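(* Let $D\subset\mathbb C$ be a domain whose Bergman kernel is denoted by $K(z)$. Assume that no boundary point $q\in\partial D$ satisfies $$\limsup_{z\to q}K(z)=\infty>\liminf_{z\to q}K(z).$$ Then the Gaussian curvature of the Bergman metric on $D$ is identically $-2$ if and only if $D$ admits a Green's function and the following conditions hold true for $X=D$ (at every $z_0\in D$): (i) $\pi K(z_0)=c_\beta^2(z_0)$; (ii) $D$ is biholomorphic to a disc possibly less a relatively closed polar set; (iii) the minimal $L^2$ norm of holomorphic 1-forms $F$ on $D$ such that $F|_{z_0}=c_\beta(z_0)\,dz|_{z_0}$ and $\|F\|_{L^2}\le\sqrt{\pi}$ is $\sqrt{\pi}$; (iv) $\log K_\tau(z_0)$ is harmonic in $\tau$ (where $\operatorname{Re}\tau\le 0$), and equivalently, linear in $\operatorname{Re}\tau$.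
   Context: $K(z)$ is the Bergman kernel of $D$ on the diagonal: $K(z)=\sum_j|a_j(z)|^2$ for a complete orthonormal basis $\{a_j\}$ of the space of holomorphic functions on $D$ that are square integrable with respect to Lebesgue measure. The form $g(z)|dz|^2$ with $g:=\frac{\partial^2\log K}{\partial z\,\partial\bar z}$ is called the Bergman metric if it is positive everywhere (in particular $K>0$ everywhere); the assertion about its curvature includes that it exists in this sense. Its Gaussian curvature is $-2g^{-1}\frac{\partial^2\log g}{\partial z\,\partial\bar z}$. For a holomorphic 1-form $F$ on $D$, $\|F\|_{L^2}^2=\frac{\sqrt{-1}}{2}\int_D F\wedge\bar F$. The Green's function $G(\cdot,z_0)$ is negative, harmonic off $z_0$, with $G(z,z_0)-\log|z-z_0|$ harmonic near $z_0$, and is the largest negative subharmonic function with such a pole. The logarithmic capacity is $c_\beta(z_0):=\exp\lim_{z\to z_0}\{G(z,z_0)-\log|z-z_0|\}$. For $\tau\in\mathbb C$ with $\operatorname{Re}\tau\le 0$, $D_\tau:=\{z\in D:G(z,z_0)<\operatorname{Re}\tau\}$ and $K_\tau$ is the Bergman kernel on the diagonal of $D_\tau$. "Linear in $\operatorname{Re}\tau$" means of the form $C\operatorname{Re}\tau+\text{const}$. A polar set is one that is locally contained in the $-\infty$ set of a subharmonic function not identically $-\infty$. "Biholomorphic to a disc possibly less a relatively closed polar set" means biholomorphic to $\mathbb D\setminus P$ with $\mathbb D$ the unit disc and $P\subset\mathbb D$ a (possibly empty) relatively closed polar subset. *)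

theory Defs
  imports "HOL-Complex_Analysis.Complex_Analysis"
begin

section \<open>Bergman kernel\<close>

definition bergman_space :: "complex set \<Rightarrow> (complex \<Rightarrow> complex) set" where
  "bergman_space D =
     {f. f holomorphic_on D \<and> set_integrable lborel D (\<lambda>z. (cmod (f z))\<^sup>2)}"

definition L2_inner :: "complex set \<Rightarrow> (complex \<Rightarrow> complex) \<Rightarrow> (complex \<Rightarrow> complex) \<Rightarrow> complex" where
  "L2_inner D f g = (LINT z:D|lborel. f z * cnj (g z))"

definition L2_norm :: "complex set \<Rightarrow> (complex \<Rightarrow> complex) \<Rightarrow> real" where
  "L2_norm D f = sqrt (LINT z:D|lborel. (cmod (f z))\<^sup>2)"

text \<open>Functions are total, so an element of the space is only determined by its values on \<open>D\<close>.
  An orthonormal set still contains no two functions that agree on \<open>D\<close>, since those would have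
  inner product 1.\<close>

definition orthonormal_basis :: "complex set \<Rightarrow> (complex \<Rightarrow> complex) set \<Rightarrow> bool" where
  "orthonormal_basis D B \<longleftrightarrow>
     B \<subseteq> bergman_space D \<and>
     (\<forall>a\<in>B. \<forall>b\<in>B. L2_inner D a b = (if a = b then 1 else 0)) \<and>
     (\<forall>f\<in>bergman_space D. (\<forall>a\<in>B. L2_inner D f a = 0) \<longrightarrow> (\<forall>z\<in>D. f z = 0))"

text \<open>For open \<open>D\<close> and \<open>z \<in> D\<close> the sum converges and does not depend on the chosen basis.\<close>

definition bergman_kernel :: "complex set \<Rightarrow> complex \<Rightarrow> real" where
  "bergman_kernel D z = (\<Sum>\<^sub>\<infinity>a\<in>(SOME B. orthonormal_basis D B). (cmod (a z))\<^sup>2)"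


section \<open>Bergman metric and its curvature\<close>

definition d_dz :: "(complex \<Rightarrow> complex) \<Rightarrow> complex \<Rightarrow> complex" where
  "d_dz f z = (frechet_derivative f (at z) 1 - \<i> * frechet_derivative f (at z) \<i>) / 2"

definition d_dzbar :: "(complex \<Rightarrow> complex) \<Rightarrow> complex \<Rightarrow> complex" where
  "d_dzbar f z = (frechet_derivative f (at z) 1 + \<i> * frechet_derivative f (at z) \<i>) / 2"

text \<open>The mixed derivative of a smooth real function is real, so \<open>Re\<close> only changes the type.\<close>

definition ddbar :: "(complex \<Rightarrow> real) \<Rightarrow> complex \<Rightarrow> real" where
  "ddbar u z = Re (d_dz (d_dzbar (\<lambda>w. complex_of_real (u w))) z)"

definition bergman_metric :: "complex set \<Rightarrow> complex \<Rightarrow> real" where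
  "bergman_metric D = ddbar (\<lambda>z. ln (bergman_kernel D z))"

definition bergman_metric_exists :: "complex set \<Rightarrow> bool" where
  "bergman_metric_exists D \<longleftrightarrow> (\<forall>z\<in>D. bergman_kernel D z > 0 \<and> bergman_metric D z > 0)"

definition bergman_curvature :: "complex set \<Rightarrow> complex \<Rightarrow> real" where
  "bergman_curvature D z =
     - 2 * inverse (bergman_metric D z) * ddbar (\<lambda>w. ln (bergman_metric D w)) z"


section \<open>Harmonic and subharmonic functions, polar sets\<close>

definition partial :: "complex \<Rightarrow> (complex \<Rightarrow> real) \<Rightarrow> complex \<Rightarrow> real" where
  "partial e u z = frechet_derivative u (at z) e"

text \<open>On open sets these are the usual classes of once and twice continuously differentiable
  functions: \<open>partial 1\<close> and \<open>partial \<i>\<close> are the derivatives with respect to \<open>x\<close> and \<open>y\<close>.\<close>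

definition C1_on :: "(complex \<Rightarrow> real) \<Rightarrow> complex set \<Rightarrow> bool" where
  "C1_on u S \<longleftrightarrow> u differentiable_on S \<and> (\<forall>e\<in>{1, \<i>}. continuous_on S (partial e u))"

definition C2_on :: "(complex \<Rightarrow> real) \<Rightarrow> complex set \<Rightarrow> bool" where
  "C2_on u S \<longleftrightarrow> C1_on u S \<and> (\<forall>e\<in>{1, \<i>}. C1_on (partial e u) S)"

definition harmonic_on :: "(complex \<Rightarrow> real) \<Rightarrow> complex set \<Rightarrow> bool" where
  "harmonic_on u S \<longleftrightarrow>
     C2_on u S \<and> (\<forall>z\<in>S. partial 1 (partial 1 u) z + partial \<i> (partial \<i> u) z = 0)"

text \<open>Subharmonic functions on an open set \<open>S\<close>, in the sense of Hormander: upper semicontinuous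
  with values in \<open>[-\<infinity>, \<infinity>)\<close> and dominated on compact sets by harmonic functions that dominate
  them on the boundary. The function that is constantly \<open>-\<infinity>\<close> is included.\<close>

definition subharmonic_on :: "(complex \<Rightarrow> ereal) \<Rightarrow> complex set \<Rightarrow> bool" where
  "subharmonic_on u S \<longleftrightarrow>
     (\<forall>z\<in>S. u z < \<infinity>) \<and>
     (\<forall>c. openin (top_of_set S) {z\<in>S. u z < c}) \<and>
     (\<forall>K h. compact K \<and> K \<subseteq> S \<and> continuous_on K h \<and> harmonic_on h (interior K) \<and>
            (\<forall>z\<in>frontier K. u z \<le> ereal (h z))
        \<longrightarrow> (\<forall>z\<in>K. u z \<le> ereal (h z)))"

text \<open>\<open>U\<close> is connected so that ``not identically \<open>-\<infinity>\<close>'' is not satisfied through another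
  component of \<open>U\<close>.\<close>

definition polar :: "complex set \<Rightarrow> bool" where
  "polar P \<longleftrightarrow>
     (\<forall>a\<in>P. \<exists>U u. open U \<and> connected U \<and> a \<in> U \<and> subharmonic_on u U \<and>
        (\<exists>z\<in>U. u z \<noteq> -\<infinity>) \<and> P \<inter> U \<subseteq> {z\<in>U. u z = -\<infinity>})"


section \<open>Green's function and logarithmic capacity\<close>

definition has_log_pole :: "(complex \<Rightarrow> ereal) \<Rightarrow> complex \<Rightarrow> bool" where
  "has_log_pole u z0 \<longleftrightarrow>
     u z0 = -\<infinity> \<and>
     (\<exists>r>0. \<exists>h. harmonic_on h (ball z0 r) \<and>
        (\<forall>z\<in>ball z0 r - {z0}. u z = ereal (ln (cmod (z - z0)) + h z)))"

definition neg_subharmonic_with_pole ::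
    "complex set \<Rightarrow> complex \<Rightarrow> (complex \<Rightarrow> ereal) \<Rightarrow> bool" where
  "neg_subharmonic_with_pole D z0 u \<longleftrightarrow>
     subharmonic_on u D \<and> (\<forall>z\<in>D. u z < 0) \<and> has_log_pole u z0"

definition is_green :: "complex set \<Rightarrow> complex \<Rightarrow> (complex \<Rightarrow> ereal) \<Rightarrow> bool" where
  "is_green D z0 G \<longleftrightarrow>
     neg_subharmonic_with_pole D z0 G \<and>
     (\<forall>z\<in>D - {z0}. \<bar>G z\<bar> \<noteq> \<infinity>) \<and>
     harmonic_on (\<lambda>z. real_of_ereal (G z)) (D - {z0}) \<and>
     (\<forall>u. neg_subharmonic_with_pole D z0 u \<longrightarrow> (\<forall>z\<in>D. u z \<le> G z))"

definition admits_green :: "complex set \<Rightarrow> bool" where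
  "admits_green D \<longleftrightarrow> (\<forall>z0\<in>D. \<exists>G. is_green D z0 G)"

text \<open>\<open>green D z0 z\<close> is \<open>G(z, z0)\<close>; by maximality its values on \<open>D\<close> do not depend on the choice.\<close>

definition green :: "complex set \<Rightarrow> complex \<Rightarrow> complex \<Rightarrow> ereal" where
  "green D z0 = (SOME G. is_green D z0 G)"

definition log_capacity :: "complex set \<Rightarrow> complex \<Rightarrow> real" where
  "log_capacity D z0 =
     exp (Lim (at z0) (\<lambda>z. real_of_ereal (green D z0 z) - ln (cmod (z - z0))))"

definition green_sublevel :: "complex set \<Rightarrow> complex \<Rightarrow> complex \<Rightarrow> complex set" where
  "green_sublevel D z0 \<tau> = {z\<in>D. green D z0 z < ereal (Re \<tau>)}"


section \<open>The conditions\<close>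

definition biholomorphic :: "complex set \<Rightarrow> complex set \<Rightarrow> bool" where
  "biholomorphic A B \<longleftrightarrow>
     (\<exists>f g. f holomorphic_on A \<and> g holomorphic_on B \<and>
        (\<forall>z\<in>A. f z \<in> B \<and> g (f z) = z) \<and> (\<forall>w\<in>B. g w \<in> A \<and> f (g w) = w))"

definition biholomorphic_to_disc_less_polar :: "complex set \<Rightarrow> bool" where
  "biholomorphic_to_disc_less_polar D \<longleftrightarrow>
     (\<exists>P. closedin (top_of_set (ball 0 1)) P \<and> polar P \<and> biholomorphic D (ball 0 1 - P))"

text \<open>A holomorphic 1-form \<open>F = f dz\<close> on a plane domain is given by its coefficient \<open>f\<close>. As
  \<open>(\<i>/2) dz \<and> d(cnj z)\<close> is Lebesgue measure, the norm of \<open>F\<close> is \<open>L2_norm D f\<close>; membership in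
  \<^const>\<open>bergman_space\<close> says that \<open>f\<close> is holomorphic and that this norm is finite.\<close>

definition admissible_form :: "complex set \<Rightarrow> complex \<Rightarrow> (complex \<Rightarrow> complex) \<Rightarrow> bool" where
  "admissible_form D z0 f \<longleftrightarrow>
     f \<in> bergman_space D \<and> f z0 = complex_of_real (log_capacity D z0) \<and> L2_norm D f \<le> sqrt pi"

definition log_kernel_sublevel :: "complex set \<Rightarrow> complex \<Rightarrow> complex \<Rightarrow> real" where
  "log_kernel_sublevel D z0 \<tau> = ln (bergman_kernel (green_sublevel D z0 \<tau>) z0)"

end

theory Submission imports Defs begin

text \<open>If the curvature is \<open>-2\<close>, then \<open>log g\<close> and \<open>log K\<close> have the same mixed derivative \<open>g\<close>, a Liouville
  equation. Polarized, it shows that \<open>K(z,w) K(z\<^sub>0) (1 - f(z) cnj f(w))\<^sup>2 = K(z,z\<^sub>0) cnj K(w,z\<^sub>0)\<close> for a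
  holomorphic \<open>f\<close> on \<open>D\<close>. Such an \<open>f\<close> embeds \<open>D\<close> into the unit disc and carries \<open>K\<close> to the kernel of the
  disc. Comparing the moments of \<open>f(D)\<close> and of the disc, the complement of \<open>f(D)\<close> is a null set, every function in the
  Bergman space of \<open>f(D)\<close> extends to the disc, and therefore compact parts of the complement have capacity zero:
  otherwise Cauchy transforms of near-Fekete points would converge to a square integrable function that does not extend.
  Hence the complement is polar, \<open>log |f|\<close> is Green's function, and the kernel of a sublevel set is found by
  splitting its functions along circles avoiding the complement.

  Conversely, the difference between Green's function and the logarithm of the biholomorphic map (normalized
  by a Moebius transformation) is bounded, harmonic off a polar set and vanishes at the unit circle, hence is
  zero. So (i) determines \<open>K\<close>, and its curvature is computed directly.\<close>

section \<open>Change of variables and mean values\<close>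

text \<open>The model is the disc, where K(z,w) = 1 / (pi (1 - z cnj w)^2): after normalization at a
  base point, K^(-1/2) is 1 minus a product of coordinates, and this is the quantity for which the
  Liouville equation is solved. The map f is therefore explicit: a multiple of the derivative in cnj
  w of log K(z,w) - log K(z0,w) at w = z0, the Bergman representative coordinate. What has to be
  excluded are poles of f at zeros of K(.,z0). The moments enter because the inner products of the
  functions f^m K(.,z0) can be read off from a power series identity near 0. They say that
  |K(.,z0)|^2 dA, pushed forward by f, and a multiple of area on the disc have the same moments, so
  that they coincide. This one comparison yields both the null complement and K(.,z0) = c f'.
  Capacity zero is phrased through products of distances to finitely many points. Such products give
  explicit harmonic functions with finitely many poles, which take the place of equilibrium
  potentials in the polar potential, in the choice of circles and in the maximality of log
  |f|.\<close>

unbundle no fps_syntax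

lemmas hol_cont = holomorphic_on_imp_continuous_on
lemmas hol_subset = holomorphic_on_subset
lemmas hol_compose = holomorphic_on_compose_gen
lemmas p2eq = power2_eq_square
lemmas A2_def = bergman_space_def

abbreviation "A2 \<equiv> bergman_space"
abbreviation "intg \<equiv> set_integrable lborel"
abbreviation "smeas \<equiv> set_borel_measurable lborel"
abbreviation "cor \<equiv> complex_of_real"

text \<open>The area formula \<open>has_measure_differentiable_image\<close> speaks of
  \<open>real^'n\<close> and Jacobian determinants; this identification carries it to the complex
  plane.\<close>

definition vec2 :: "complex => real^2" where
 "vec2 z = vector [Re z, Im z]"

definition unvec2 :: "real^2 => complex" where
 "unvec2 v = Complex (v $ 1) (v $ 2)"

lemma vec2_nth [simp]: "vec2 z $ 1 = Re z" "vec2 z $ 2 = Im z"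
 by (simp_all add: vec2_def)

lemma vec2_inverse [simp]: "unvec2 (vec2 z) = z" "vec2 (unvec2 v) = v"
 by (simp_all add: unvec2_def vec_eq_iff forall_2)

lemma linear_vec2: "linear vec2" and linear_unvec2: "linear unvec2"
 by (auto simp: linear_iff vec_eq_iff forall_2 unvec2_def complex_eq_iff)

lemma measurable_vec2 [measurable]: "vec2 : borel_measurable borel" "unvec2 : borel_measurable borel"
 by (simp_all add: borel_measurable_continuous_onI linear_continuous_on linear_vec2 linear_unvec2 linear_linear)

lemma Basis_real2: "(Basis :: (real^2) set) = {axis 1 1, axis 2 1}"
 by (auto simp: Basis_vec_def UNIV_2)

lemma distr_lborel_vec2: "distr lborel borel vec2 = (lborel :: (real^2) measure)"
proof (rule sym, rule lborel_eqI)
 fix l u :: "real^2" assume le: "!!b. b : Basis ==> l \<bullet> b <= u \<bullet> b"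
 have le': "l $ 1 <= u $ 1" "l $ 2 <= u $ 2"
  using le[of "axis 1 1"] le[of "axis 2 1"] by (auto simp: Basis_real2 inner_axis)
 have ne: "axis 1 (1::real) ~= (axis 2 1 :: real^2)"
  by (simp add: axis_eq_axis)
 have "vec2 -` box l u = box (unvec2 l) (unvec2 u)"
  by (auto simp: mem_box Basis_real2 inner_axis Basis_complex_def unvec2_def)
 then have "emeasure (distr lborel borel vec2) (box l u) = emeasure lborel (box (unvec2 l) (unvec2 u))"
  by (simp add: emeasure_distr)
 also have "... = ennreal (\<Prod>b\<in>Basis. (unvec2 u - unvec2 l) \<bullet> b)"
  using le' by (subst emeasure_lborel_box) (auto simp: Basis_complex_def unvec2_def)
 also have "(\<Prod>b\<in>Basis. (unvec2 u - unvec2 l) \<bullet> b) = (\<Prod>b\<in>Basis. (u - l) \<bullet> b)"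
  using ne by (simp add: Basis_real2 inner_axis Basis_complex_def unvec2_def)
 finally show "emeasure (distr lborel borel vec2) (box l u) = ennreal (\<Prod>b\<in>Basis. (u - l) \<bullet> b)" .
qed simp

text \<open>In these coordinates multiplication by \<open>c\<close> has the rows (Re c, - Im c) and
  (Im c, Re c). By the Cauchy-Riemann equations this is the Jacobian of a holomorphic map with
  derivative \<open>c\<close>.\<close>

lemma det_vec2_conj: "det (matrix (%h. vec2 (c * unvec2 h))) = (cmod c)\<^sup>2"
 unfolding cmod_power2 by (simp add: det_2 matrix_def unvec2_def axis_def p2eq)

text \<open>The area formula relates finite measure of the image to integrability of the Jacobian.
  Infinite measure is a separate case: a finite integral would by the same equivalence make the
  measure of the image finite.\<close>

lemma emeasure_holomorphic_image:
 assumes S: "open S" and F: "F holomorphic_on S" and inj: "inj_on F S"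
  and B: "B : sets borel" "B <= S" and FB: "F ` B : sets borel"
 shows "emeasure lborel (F ` B) = (\<integral>\<^sup>+z\<in>B. ennreal ((cmod (deriv F z))\<^sup>2) \<partial>lborel)"
proof -
 let ?G = "%v. vec2 (F (unvec2 v))"
 let ?B = "vec2 ` B"
 have eqB: "?B = unvec2 -` B" by (force simp: image_iff)
 have Bm: "?B : sets borel"
  unfolding eqB by (rule measurable_sets_borel[OF measurable_vec2(2) B(1)])
 have eqF: "?G ` ?B = unvec2 -` (F ` B)"
  by (auto simp: image_iff) (metis vec2_inverse)+
 have Fm: "?G ` ?B : sets borel"
  unfolding eqF by (rule measurable_sets_borel[OF measurable_vec2(2) FB])
 have em: "emeasure lborel (unvec2 -` A) = emeasure lborel A" if "A : sets borel" for A
 proof -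
  have "emeasure lborel (unvec2 -` A) = emeasure (distr lborel borel vec2) (unvec2 -` A)"
  by (simp add: distr_lborel_vec2)
  also have "... = emeasure lborel (vec2 -` (unvec2 -` A))"
  using that measurable_sets_borel[OF measurable_vec2(2) that] by (subst emeasure_distr) auto
  also have "vec2 -` (unvec2 -` A) = A" by auto
  finally show ?thesis .
 qed
 have der: "(?G has_derivative (%h. vec2 (deriv F (unvec2 x) * unvec2 h))) (at x within ?B)" if "x : ?B" for x
 proof -
  have x: "unvec2 x : S" using that B by auto
  have 1: "(F has_derivative (*) (deriv F (unvec2 x))) (at (unvec2 x))"
  using F S x holomorphic_derivI has_field_derivative_def by blast
  have 2: "(unvec2 has_derivative unvec2) (at x)"
  using linear_unvec2 by (simp add: bounded_linear_imp_has_derivative linear_linear)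
  have 3: "(vec2 has_derivative vec2) (at y)" for y
  using linear_vec2 by (simp add: bounded_linear_imp_has_derivative linear_linear)
  show ?thesis
  using diff_chain_at[OF diff_chain_at[OF 2 1] 3] has_derivative_at_withinI
  by (fastforce simp: o_def)
 qed
 have inj': "inj_on ?G ?B"
  using inj B by (auto simp: inj_on_def) (metis subsetD vec2_inverse(1))
 have key: "?G ` ?B : lmeasurable & measure lebesgue (?G ` ?B) = m \<longleftrightarrow>
  ((%x. (cmod (deriv F (unvec2 x)))\<^sup>2) has_integral m) ?B" for m
  using has_measure_differentiable_image[OF _ der inj', of m] Bm
  by (simp add: det_vec2_conj)
 have dm: "set_borel_measurable borel S (%z. (cmod (deriv F z))\<^sup>2)"
 proof -
  have "continuous_on S (deriv F)"
  using S F holomorphic_deriv hol_cont by blast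
  then have "continuous_on S (%z. (cmod (deriv F z))\<^sup>2)" by (intro continuous_intros)
  from borel_measurable_continuous_on_indicator[OF _ this] show ?thesis
  using S by (simp add: set_borel_measurable_def)
 qed
 have dmB: "set_borel_measurable borel B (%z. (cmod (deriv F z))\<^sup>2)"
  using set_borel_measurable_subset[OF dm] B by simp
 have mI: "(%z. indicator B z * (cmod (deriv F z))\<^sup>2) : borel_measurable borel"
  using dmB by (simp add: set_borel_measurable_def)
 have nn: "(\<integral>\<^sup>+z\<in>B. ennreal ((cmod (deriv F z))\<^sup>2) \<partial>lborel) =
  (\<integral>\<^sup>+x. ennreal (indicator ?B x * (cmod (deriv F (unvec2 x)))\<^sup>2) \<partial>lborel)"
 proof -
  have "(\<integral>\<^sup>+x. ennreal (indicator ?B x * (cmod (deriv F (unvec2 x)))\<^sup>2) \<partial>lborel)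
  = (\<integral>\<^sup>+x. ennreal (indicator B (unvec2 x) * (cmod (deriv F (unvec2 x)))\<^sup>2) \<partial>distr lborel borel vec2)"
  by (simp add: distr_lborel_vec2 eqB indicator_def)
  also have "... = (\<integral>\<^sup>+z. ennreal (indicator B (unvec2 (vec2 z)) * (cmod (deriv F (unvec2 (vec2 z))))\<^sup>2) \<partial>lborel)"
  proof -
  have "(%z. indicator B z * (cmod (deriv F z))\<^sup>2) \<circ> unvec2 : borel_measurable borel"
  using measurable_vec2(2) mI by (rule measurable_comp)
  then show ?thesis
  by (intro nn_integral_distr) (simp_all add: o_def)
  qed
  also have "... = (\<integral>\<^sup>+z\<in>B. ennreal ((cmod (deriv F z))\<^sup>2) \<partial>lborel)"
  by (intro nn_integral_cong) (auto simp: indicator_def)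
  finally show ?thesis ..
 qed
 show ?thesis
 proof (cases "emeasure lborel (F ` B) < \<infinity>")
  case True
  then have L: "?G ` ?B : lmeasurable"
  using em[OF FB] Fm eqF by (simp add: fmeasurable_def)
  have "((%x. (cmod (deriv F (unvec2 x)))\<^sup>2) has_integral measure lebesgue (?G ` ?B)) ?B"
  using key L by blast
  from nn_integral_has_integral_lebesgue[OF _ this]
  have "(\<integral>\<^sup>+x. ennreal (indicator ?B x * (cmod (deriv F (unvec2 x)))\<^sup>2) \<partial>lborel) = ennreal (measure lebesgue (?G ` ?B))"
  by simp
  also have "... = emeasure lebesgue (?G ` ?B)"
  using L by (simp add: emeasure_eq_measure2)
  also have "... = emeasure lborel (F ` B)"
  using em[OF FB] Fm eqF by simp
  finally show ?thesis unfolding nn ..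
 next
  case False
  have "~ (\<integral>\<^sup>+z\<in>B. ennreal ((cmod (deriv F z))\<^sup>2) \<partial>lborel) < \<infinity>"
  proof
  assume "(\<integral>\<^sup>+z\<in>B. ennreal ((cmod (deriv F z))\<^sup>2) \<partial>lborel) < \<infinity>"
  then have fin: "(\<integral>\<^sup>+x. ennreal (indicator ?B x * (cmod (deriv F (unvec2 x)))\<^sup>2) \<partial>lborel) < \<infinity>"
  unfolding nn .
  then obtain r where r: "(\<integral>\<^sup>+x. ennreal (indicator ?B x * (cmod (deriv F (unvec2 x)))\<^sup>2) \<partial>lborel) = ennreal r" "0 <= r"
  by (cases "\<integral>\<^sup>+x. ennreal (indicator ?B x * (cmod (deriv F (unvec2 x)))\<^sup>2) \<partial>lborel" rule: ennreal_cases) auto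
  have "(%z. indicator B z * (cmod (deriv F z))\<^sup>2) \<circ> unvec2 : borel_measurable borel"
  using measurable_vec2(2) mI by (rule measurable_comp)
  then have m2: "(%x. indicat_real ?B x * (cmod (deriv F (unvec2 x)))\<^sup>2) : borel_measurable borel"
  by (simp add: o_def eqB indicator_def)
  have "((%x. indicat_real ?B x * (cmod (deriv F (unvec2 x)))\<^sup>2) has_integral r) UNIV"
  by (rule nn_integral_has_integral[OF m2 _ r]) simp
  also have "(%x. indicat_real ?B x * (cmod (deriv F (unvec2 x)))\<^sup>2) =
  (%x. if x : ?B then (cmod (deriv F (unvec2 x)))\<^sup>2 else 0)" by (auto simp: indicator_def)
  finally have "((%x. (cmod (deriv F (unvec2 x)))\<^sup>2) has_integral r) ?B"
  by (simp add: has_integral_restrict_UNIV)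
  then have "?G ` ?B : lmeasurable" using key by blast
  then have "emeasure lborel (F ` B) < \<infinity>"
  using em[OF FB] Fm eqF by (simp add: fmeasurable_def)
  then show False using False by simp
  qed
  then show ?thesis using False by (metis infinity_ennreal_def less_top)
 qed
qed

lemma inj_holomorphic_inverse:
 assumes "open S" "F holomorphic_on S" "inj_on F S"
 obtains g where "g holomorphic_on F ` S" "!!z. z : S ==> g (F z) = z"
  "!!w. w : F ` S ==> g w : S & F (g w) = w" "open (F ` S)"
proof -
 obtain g where g: "g holomorphic_on F ` S" "!!z. z : S ==> deriv F z * deriv g (F z) = 1 & g (F z) = z"
  using holomorphic_has_inverse[OF assms(2,1,3)] by metis
 have "open (F ` S)"
  using open_mapping_thm3[OF assms(2,1,3)] .
 with g that show thesis by force
qed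

lemma borel_holomorphic_image:
 assumes S: "open S" and F: "F holomorphic_on S" and inj: "inj_on F S"
  and B: "B : sets borel" "B <= S"
 shows "F ` B : sets borel"
proof -
 obtain g where g: "g holomorphic_on F ` S" "!!z. z : S ==> g (F z) = z"
  "!!w. w : F ` S ==> g w : S & F (g w) = w" "open (F ` S)"
  using inj_holomorphic_inverse[OF S F inj] by metis
 have "g : borel_measurable (restrict_space borel (F ` S))"
  using g(1) hol_cont borel_measurable_continuous_on_restrict by blast
 then have "g -` B Int (F ` S) : sets (restrict_space borel (F ` S))"
  using B(1) measurable_sets[of g "restrict_space borel (F ` S)" borel B] by (simp add: space_restrict_space)
 then have "g -` B Int (F ` S) : sets borel"
  using g(4) by (simp add: sets_restrict_space_iff)
 moreover have "F ` B = g -` B Int (F ` S)"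
  using g B by (auto simp: image_iff)
 ultimately show ?thesis by simp
qed

text \<open>The measure |F'|^2 dA on \<open>S\<close>. Its image under an injective \<open>F\<close>
  is area on F(S), so that integrals of Banach space valued functions transform by
  \<open>integral_distr\<close> and \<open>integral_density\<close>.\<close>

definition pullback_measure :: "(complex => complex) => complex set => complex measure" where
 "pullback_measure F S = density (restrict_space lborel S) (%z. ennreal ((cmod (deriv F z))\<^sup>2))"

lemma deriv_measurable:
 assumes S: "open S" and F: "F holomorphic_on S"
 shows "deriv F : borel_measurable (restrict_space lborel S)"
proof -
 have "continuous_on S (deriv F)"
  using assms holomorphic_deriv hol_cont by blast
 then show ?thesis
  by (metis borel_measurable_continuous_on_restrict measurable_cong_sets restrict_space_sets_cong sets_lborel)
qed

lemma holomorphic_measurable: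
 assumes S: "open S" and F: "F holomorphic_on S"
 shows "F : measurable (restrict_space lborel S) (restrict_space borel (F ` S))"
proof -
 have "F : borel_measurable (restrict_space borel S)"
  using F hol_cont borel_measurable_continuous_on_restrict by blast
 then have "F : borel_measurable (restrict_space lborel S)"
  by (metis measurable_cong_sets restrict_space_sets_cong sets_lborel)
 then show ?thesis by (auto intro!: measurable_restrict_space2 simp: space_restrict_space)
qed

lemma holomorphic_change_of_variables_measure:
 assumes S: "open S" and F: "F holomorphic_on S" and inj: "inj_on F S"
 shows "restrict_space lborel (F ` S) = distr (pullback_measure F S) (restrict_space borel (F ` S)) F"
proof (rule measure_eqI)
 have oF: "open (F ` S)" using open_mapping_thm3[OF F S inj] .
 show "sets (restrict_space lborel (F ` S)) = sets (distr (pullback_measure F S) (restrict_space borel (F ` S)) F)"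
  by (simp add: sets_restrict_space)
 fix A assume "A : sets (restrict_space lborel (F ` S))"
 then have A: "A : sets borel" "A <= F ` S"
  using oF by (auto simp: sets_restrict_space_iff)
 have Am: "A : sets (restrict_space borel (F ` S))"
  using A oF by (simp add: sets_restrict_space_iff)
 let ?B = "F -` A Int S"
 have Fm: "F : measurable (restrict_space lborel S) (restrict_space borel (F ` S))"
  by (rule holomorphic_measurable[OF S F])
 then have Fm': "F : measurable (pullback_measure F S) (restrict_space borel (F ` S))"
  unfolding pullback_measure_def by simp
 have "?B : sets (restrict_space lborel S)"
  using measurable_sets[OF Fm Am] by (simp add: space_restrict_space)
 moreover then have B: "?B : sets borel" "?B <= S"
  using S by (auto simp: sets_restrict_space_iff)
 ultimately have "emeasure (distr (pullback_measure F S) (restrict_space borel (F ` S)) F) A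
  = (\<integral>\<^sup>+z. ennreal ((cmod (deriv F z))\<^sup>2) * indicator ?B z \<partial>restrict_space lborel S)"
  using deriv_measurable[OF S F] Am Fm'
  by (subst emeasure_distr) (auto simp: pullback_measure_def emeasure_density space_restrict_space)
 also have "... = (\<integral>\<^sup>+z. ennreal ((cmod (deriv F z))\<^sup>2) * indicator ?B z \<partial>lborel)"
  using S by (subst nn_integral_restrict_space) (auto intro!: nn_integral_cong simp: indicator_def)
 also have "... = emeasure lborel (F ` ?B)"
  using emeasure_holomorphic_image[OF S F inj B borel_holomorphic_image[OF S F inj B]] by simp
 also have "F ` ?B = A" using A by auto
 also have "emeasure lborel A = emeasure (restrict_space lborel (F ` S)) A"
  using A oF by (simp add: emeasure_restrict_space)
 finally show "emeasure (restrict_space lborel (F ` S)) A = emeasure (distr (pullback_measure F S) (restrict_space borel (F ` S)) F) A" ..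
qed

lemma holomorphic_change_of_variables_aux:
 fixes fi :: "complex => 'a :: {banach, second_countable_topology}"
 assumes S: "open S" and F: "F holomorphic_on S" and inj: "inj_on F S"
  and fi: "smeas (F ` S) fi"
 shows "intg (F ` S) fi \<longleftrightarrow> intg S (%z. (cmod (deriv F z))\<^sup>2 *\<^sub>R fi (F z))"
  and "(LINT w:F ` S|lborel. fi w) = (LINT z:S|lborel. (cmod (deriv F z))\<^sup>2 *\<^sub>R fi (F z))"
proof -
 have oF: "open (F ` S)" using open_mapping_thm3[OF F S inj] .
 have fim: "fi : borel_measurable (restrict_space lborel (F ` S))"
  using fi oF by (simp add: borel_measurable_restrict_space_iff set_borel_measurable_def)
 have eq: "sets (restrict_space lborel (F ` S)) = sets (restrict_space borel (F ` S))"
  by (rule restrict_space_sets_cong) auto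
 have fim': "fi : borel_measurable (restrict_space borel (F ` S))"
  using fim measurable_cong_sets[OF eq refl] by blast
 have Fm: "F : measurable (restrict_space lborel S) (restrict_space borel (F ` S))"
  by (rule holomorphic_measurable[OF S F])
 have Fm': "F : measurable (pullback_measure F S) (restrict_space borel (F ` S))"
  using Fm unfolding pullback_measure_def by simp
 have comp: "(%z. fi (F z)) : borel_measurable (restrict_space lborel S)"
  using measurable_compose[OF Fm fim'] .
 note dm = deriv_measurable[OF S F]
 have "intg (F ` S) fi \<longleftrightarrow> integrable (restrict_space lborel (F ` S)) fi"
  using oF by (simp add: set_integrable_def integrable_restrict_space)
 also have "... \<longleftrightarrow> integrable (pullback_measure F S) (%z. fi (F z))"
  by (subst holomorphic_change_of_variables_measure[OF S F inj]) (rule integrable_distr_eq[OF Fm' fim'])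
 also have "... \<longleftrightarrow> integrable (restrict_space lborel S) (%z. (cmod (deriv F z))\<^sup>2 *\<^sub>R fi (F z))"
  unfolding pullback_measure_def using dm comp by (subst integrable_density) auto
 also have "... \<longleftrightarrow> intg S (%z. (cmod (deriv F z))\<^sup>2 *\<^sub>R fi (F z))"
  using S by (simp add: set_integrable_def integrable_restrict_space)
 finally show "intg (F ` S) fi \<longleftrightarrow> intg S (%z. (cmod (deriv F z))\<^sup>2 *\<^sub>R fi (F z))" .
 have "(LINT w:F ` S|lborel. fi w) = integral\<^sup>L (restrict_space lborel (F ` S)) fi"
  using oF by (simp add: set_lebesgue_integral_def integral_restrict_space)
 also have "... = integral\<^sup>L (pullback_measure F S) (%z. fi (F z))"
  by (subst holomorphic_change_of_variables_measure[OF S F inj]) (rule integral_distr[OF Fm' fim'])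
 also have "... = integral\<^sup>L (restrict_space lborel S) (%z. (cmod (deriv F z))\<^sup>2 *\<^sub>R fi (F z))"
  unfolding pullback_measure_def using dm comp by (subst integral_density) auto
 also have "... = (LINT z:S|lborel. (cmod (deriv F z))\<^sup>2 *\<^sub>R fi (F z))"
  using S by (simp add: set_lebesgue_integral_def integral_restrict_space)
 finally show "(LINT w:F ` S|lborel. fi w) = (LINT z:S|lborel. (cmod (deriv F z))\<^sup>2 *\<^sub>R fi (F z))" .
qed

lemmas holomorphic_change_of_variables_integrable = holomorphic_change_of_variables_aux(1)
lemmas holomorphic_change_of_variables = holomorphic_change_of_variables_aux(2)

lemma meas_cont:
 fixes f :: "complex => 'a :: real_normed_vector"
 assumes "S : sets borel" "continuous_on S f"
 shows "smeas S f"
 using borel_measurable_continuous_on_indicator[OF assms] by (simp add: set_borel_measurable_def)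

lemma set_integrable_bounded:
 fixes f :: "complex => 'a :: {banach, second_countable_topology}"
 assumes S: "S : sets borel" "emeasure lborel S < \<infinity>" and m: "smeas S f"
  and b: "!!z. z : S ==> norm (f z) <= B"
 shows "intg S f"
proof (rule set_integrable_bound[OF _ m])
 show "intg S (%_. B)"
  using S by (simp add: set_integrable_def integrable_mult_left)
 show "AE z in lborel. z : S --> norm (f z) <= norm B"
  using b by (intro AE_I2) force
qed

section \<open>Integrals over discs: rotations, monomials and the mean value property\<close>

lemma emeasure_ball_complex: "r >= 0 ==> emeasure lborel (ball (c::complex) r) = ennreal (pi * r\<^sup>2)"
 by (simp add: emeasure_ball unit_ball_vol_2)

lemma measure_ball_complex: "r >= 0 ==> measure lborel (ball (c::complex) r) = pi * r\<^sup>2"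
 by (simp add: measure_def emeasure_ball_complex)

lemma emeasure_bounded_finite: "bounded (S::complex set) ==> emeasure lborel S < \<infinity>"
 by (rule emeasure_bounded_finite)

lemma set_integral_rotate:
 fixes f :: "complex => 'a :: {banach, second_countable_topology}"
 assumes f: "smeas (ball 0 r) f" and w: "cmod w = 1"
 shows "(LINT z:ball 0 r|lborel. f (w * z)) = (LINT z:ball 0 r|lborel. f z)"
  and "intg (ball 0 r) (%z. f (w * z)) \<longleftrightarrow> intg (ball 0 r) f"
proof -
 have w0: "w ~= 0" using w by auto
 have im: "(%z. w * z) ` ball 0 r = ball 0 r"
 proof -
  have "x : (%z. w * z) ` ball 0 r" if "cmod x < r" for x
  by (rule image_eqI[of _ _ "x / w"]) (use that w w0 in \<open>auto simp: norm_divide\<close>)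
  then show ?thesis using w by (auto simp: norm_mult)
 qed
 have "inj_on (%z. w * z) (ball 0 r)" using w0 by (auto simp: inj_on_def)
 moreover have "(%z. w * z) holomorphic_on ball 0 r" by (intro holomorphic_intros)
 moreover have "deriv (%z. w * z) z = w" for z
  by (rule DERIV_imp_deriv) (auto intro!: derivative_eq_intros)
 ultimately show "(LINT z:ball 0 r|lborel. f (w * z)) = (LINT z:ball 0 r|lborel. f z)"
  "intg (ball 0 r) (%z. f (w * z)) \<longleftrightarrow> intg (ball 0 r) f"
  using holomorphic_change_of_variables_aux[of "ball 0 r" "%z. w * z" f] f w by (simp_all add: im)
qed

lemma set_integrable_continuous_cball:
 fixes f :: "complex => 'a :: {banach, second_countable_topology}"
 assumes "continuous_on (cball c r) f"
 shows "intg (ball c r) f"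
proof -
 obtain B where B: "!!z. z : cball c r ==> norm (f z) <= B"
  using compact_continuous_image[OF assms compact_cball] compact_imp_bounded bounded_iff
  by (metis imageI)
 show ?thesis
 proof (rule set_integrable_bounded[where B=B])
  show "smeas (ball c r) f"
  using assms by (intro meas_cont) (auto intro: continuous_on_subset)
 qed (use B emeasure_bounded_finite[of "ball c r"] in auto)
qed

lemma set_integral_ball_translate:
 fixes f :: "complex => 'a :: {banach, second_countable_topology}"
 assumes f: "smeas (ball c r) f"
 shows "(LINT z:ball 0 r|lborel. f (c + z)) = (LINT z:ball c r|lborel. f z)"
  and "intg (ball 0 r) (%z. f (c + z)) \<longleftrightarrow> intg (ball c r) f"
proof -
 have im: "(%z. c + z) ` ball 0 r = ball c r"
  by (simp add: image_add_ball)
 have "inj_on (%z. c + z) (ball 0 r)" by (auto simp: inj_on_def)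
 moreover have "(%z. c + z) holomorphic_on ball 0 r" by (intro holomorphic_intros)
 moreover have "deriv (%z. c + z) z = 1" for z
  by (rule DERIV_imp_deriv) (auto intro!: derivative_eq_intros)
 ultimately show "(LINT z:ball 0 r|lborel. f (c + z)) = (LINT z:ball c r|lborel. f z)"
  "intg (ball 0 r) (%z. f (c + z)) \<longleftrightarrow> intg (ball c r) f"
  using holomorphic_change_of_variables_aux[of "ball 0 r" "%z. c + z" f] f by (simp_all add: im)
qed

text \<open>The angle pi / (m + n + 1) is so small that its product with m - n is nonzero and lies
  strictly between -pi and pi, so it is no multiple of 2 pi.\<close>

lemma rotation_exists:
 fixes m n :: nat assumes "m ~= n"
 obtains w :: complex where "cmod w = 1" "w ^ m * cnj w ^ n ~= 1"
proof -
 define t where "t = pi / (real m + real n + 1)"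
 have "cis t ^ m * cnj (cis t) ^ n ~= 1"
 proof
  assume "cis t ^ m * cnj (cis t) ^ n = 1"
  then have "cis (real m * t - real n * t) = 1"
  using Complex.DeMoivre[of t m] Complex.DeMoivre[of "-t" n] by (simp add: cis_cnj cis_mult)
  then have "cos (real m * t - real n * t) = 1"
  by (metis cis.sel(1) one_complex.sel(1))
  then obtain k :: int where k: "real m * t - real n * t = of_int k * 2 * pi"
  using cos_one_2pi_int by blast
  then have "(real m - real n) * t = of_int (2 * k) * pi" by (simp add: algebra_simps)
  then have "pi * (real m - real n) = pi * (of_int (2 * k) * (real m + real n + 1))"
  by (simp add: t_def field_simps)
  then have "real m - real n = of_int (2 * k) * (real m + real n + 1)"
  using pi_neq_zero mult_left_cancel by blast
  then have "real_of_int (int m - int n) = real_of_int (2 * k * (int m + int n + 1))" by simp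
  then have e: "int m - int n = 2 * k * (int m + int n + 1)" by (simp only: of_int_eq_iff)
  have "k ~= 0" using e assms by auto
  then have "\<bar>2 * k * (int m + int n + 1)\<bar> >= 1 * (int m + int n + 1)"
  unfolding abs_mult by (intro mult_mono) auto
  then have "\<bar>int m - int n\<bar> >= int m + int n + 1" by (simp only: e[symmetric] mult_1)
  then show False by linarith
 qed
 then show thesis using that[of "cis t"] by simp
qed

text \<open>The rotation by \<open>w\<close> preserves the integral and multiplies the integrand by
  a constant different from 1.\<close>

lemma set_integral_monomial_zero:
 fixes m n :: nat assumes "m ~= n"
 shows "(LINT z:ball 0 r|lborel. z ^ m * cnj z ^ n) = 0"
proof -
 obtain w where w: "cmod w = 1" "w ^ m * cnj w ^ n ~= 1" using rotation_exists[OF assms] by blast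
 have "(LINT z:ball 0 r|lborel. z ^ m * cnj z ^ n) = (LINT z:ball 0 r|lborel. (w * z) ^ m * cnj (w * z) ^ n)"
  using w by (subst set_integral_rotate) (auto intro!: meas_cont continuous_intros)
 also have "... = (LINT z:ball 0 r|lborel. (w ^ m * cnj w ^ n) * (z ^ m * cnj z ^ n))"
  by (simp add: power_mult_distrib algebra_simps)
 also have "... = (w ^ m * cnj w ^ n) * (LINT z:ball 0 r|lborel. z ^ m * cnj z ^ n)"
  by simp
 finally show ?thesis using w by (simp add: algebra_simps)
qed

text \<open>The power series is integrated term by term and only its constant term survives. On the
  smaller radius \<open>rh\<close> the series converges absolutely and uniformly, which justifies
  the exchange.\<close>

lemma mean_value_ball_aux:
 assumes U: "U holomorphic_on ball 0 r" and rho: "0 < rh" "rh < r"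
 shows "(LINT z:ball 0 rh|lborel. U z) = of_real (pi * rh\<^sup>2) * U 0"
proof -
 define a where "a n = (deriv ^^ n) U 0 / fact n" for n
 have S: "(%n. a n * z ^ n) sums U z" if "cmod z < r" for z
  using holomorphic_power_series[OF U, of z] that by (simp add: a_def)
 have sumab: "summable (%n. cmod (a n) * rh ^ n)"
 proof -
  obtain t where t: "rh < t" "t < r" using rho dense by blast
  have "summable (%n. a n * of_real t ^ n)" using S[of "of_real t"] t rho sums_summable by auto
  then have "summable (%n. norm (a n * of_real rh ^ n))"
  by (rule powser_insidea) (use t rho in auto)
  then show ?thesis using rho by (simp add: norm_mult norm_power)
 qed
 let ?f = "%n z. indicator (ball 0 rh) z *\<^sub>R (a n * z ^ n)"
 have bd: "norm (?f n z) <= indicator (ball 0 rh) z * (cmod (a n) * rh ^ n)" for n z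
  by (auto simp: indicator_def norm_mult norm_power intro!: mult_left_mono power_mono)
 have "(%n. integral\<^sup>L lborel (?f n)) sums (\<integral>z. (\<Sum>n. ?f n z) \<partial>lborel)"
 proof (rule sums_integral)
  show I: "integrable lborel (?f n)" for n
  using set_integrable_continuous_cball[of 0 rh "%z. a n * z ^ n"]
  by (simp add: set_integrable_def continuous_intros)
  show "AE z in lborel. summable (%n. norm (?f n z))"
  by (rule AE_I2, rule summable_comparison_test'[OF summable_mult[OF sumab]]) (use bd in auto)
  show "summable (%n. \<integral>z. norm (?f n z) \<partial>lborel)"
  proof (rule summable_comparison_test'[where N=0])
  show "summable (%n. measure lborel (ball (0::complex) rh) * (cmod (a n) * rh ^ n))"
  by (rule summable_mult[OF sumab])
  fix n
  have "(\<integral>z. norm (?f n z) \<partial>lborel) <= (\<integral>z. indicator (ball (0::complex) rh) z * (cmod (a n) * rh ^ n) \<partial>lborel)"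
  proof (rule integral_mono)
  show "integrable lborel (%z. norm (?f n z))" by (rule integrable_norm[OF I])
  show "integrable lborel (%z. indicator (ball (0::complex) rh) z * (cmod (a n) * rh ^ n))"
  using emeasure_bounded_finite[of "ball (0::complex) rh"] by (auto intro!: integrable_mult_left)
  qed (rule bd)
  also have "... = measure lborel (ball (0::complex) rh) * (cmod (a n) * rh ^ n)" by simp
  finally show "norm (\<integral>z. norm (?f n z) \<partial>lborel) <= measure lborel (ball (0::complex) rh) * (cmod (a n) * rh ^ n)"
  by simp
  qed
 qed
 moreover have "(\<integral>z. (\<Sum>n. ?f n z) \<partial>lborel) = (LINT z:ball 0 rh|lborel. U z)"
  unfolding set_lebesgue_integral_def
 proof (rule Bochner_Integration.integral_cong)
  fix z
  show "(\<Sum>n. ?f n z) = indicat_real (ball 0 rh) z *\<^sub>R U z"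
  using S[of z] rho by (auto simp: indicator_def sums_iff)
 qed simp
 moreover have "integral\<^sup>L lborel (?f n) = (if n = 0 then of_real (pi * rh\<^sup>2) * U 0 else 0)" for n
 proof -
  have "integral\<^sup>L lborel (?f n) = a n * (LINT z:ball 0 rh|lborel. z ^ n)"
  proof -
  have "integral\<^sup>L lborel (?f n) = (\<integral>z. a n * (indicat_real (ball 0 rh) z *\<^sub>R z ^ n) \<partial>lborel)"
  by (simp only: mult_scaleR_right)
  then show ?thesis unfolding set_lebesgue_integral_def by (simp only: integral_mult_right_zero)
  qed
  then show ?thesis
  using set_integral_monomial_zero[of n 0 rh] rho measure_ball_complex[of rh 0]
  by (cases "n = 0") (auto simp: a_def set_lebesgue_integral_def scaleR_conv_of_real emeasure_ball_complex)
 qed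
 ultimately have "(%n. (if n = 0 then of_real (pi * rh\<^sup>2) * U 0 else 0)) sums (LINT z:ball 0 rh|lborel. U z)"
  by simp
 moreover have "(%n::nat. (if n = 0 then of_real (pi * rh\<^sup>2) * U 0 else 0)) sums (of_real (pi * rh\<^sup>2) * U 0)"
  using sums_single[of 0 "%_. of_real (pi * rh\<^sup>2) * U 0"] by simp
 ultimately show ?thesis by (rule sums_unique2)
qed

lemma mean_value_ball:
 assumes U: "U holomorphic_on ball c r" and i: "intg (ball c r) U" and r: "r > 0"
 shows "(LINT z:ball c r|lborel. U z) = of_real (pi * r\<^sup>2) * U c"
proof -
 have m: "smeas (ball c r) U"
  using U by (intro meas_cont) (auto intro: hol_cont)
 define V where "V z = U (c + z)" for z
 have V: "V holomorphic_on ball 0 r"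
  unfolding V_def by (rule hol_compose[OF _ U, unfolded o_def]) (auto intro!: holomorphic_intros simp: dist_norm)
 have iV: "intg (ball 0 r) V"
  using set_integral_ball_translate(2)[OF m] i by (simp add: V_def[abs_def])
 \<comment> \<open>Radii increasing to \<open>r\<close>; the shift by 2 keeps the first one
   positive.\<close>
 define q where "q n = r * (1 - 1 / real (n + 2))" for n
 have q: "0 < q n" "q n < r" for n
 proof -
  have "0 < 1 / real (n + 2)" "1 / real (n + 2) < 1" by auto
  then have "0 < 1 - 1 / real (n + 2)" "1 - 1 / real (n + 2) < 1" by linarith+
  then show "0 < q n" "q n < r" using r by (auto simp: q_def)
 qed
 have mono: "incseq q" unfolding q_def using r by (intro incseq_SucI) (auto simp: field_simps)
 have lim: "q \<longlonglongrightarrow> r"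
 proof -
  have "(%n. r * (1 - 1 / real (n + 2))) \<longlonglongrightarrow> r * (1 - 0)"
  by (intro tendsto_intros LIMSEQ_ignore_initial_segment[OF lim_1_over_n])
  then show ?thesis by (simp add: q_def[abs_def])
 qed
 have un: "(\<Union>n. ball 0 (q n)) = ball (0::complex) r"
 proof (auto)
  fix z :: complex and n assume "cmod z < q n" then show "cmod z < r" using q[of n] by simp
 next
  fix z :: complex assume "cmod z < r"
  then have "eventually (%n. cmod z < q n) sequentially" using lim order_tendstoD(1) by blast
  then show "EX n. cmod z < q n" by (meson eventually_sequentially order_refl)
 qed
 have "(%n. LINT z:ball 0 (q n)|lborel. V z) \<longlonglongrightarrow> (LINT z:(\<Union>n. ball 0 (q n))|lborel. V z)"
  by (rule set_integral_cont_up) (use mono iV in \<open>auto simp: un incseq_def intro!: subset_ball\<close>)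
 moreover have "(LINT z:ball 0 (q n)|lborel. V z) = of_real (pi * (q n)\<^sup>2) * V 0" for n
  by (rule mean_value_ball_aux[OF V q])
 moreover have "(%n. of_real (pi * (q n)\<^sup>2) * V 0) \<longlonglongrightarrow> of_real (pi * r\<^sup>2) * V 0"
  by (intro tendsto_intros lim)
 ultimately have "(LINT z:ball 0 r|lborel. V z) = of_real (pi * r\<^sup>2) * V 0"
  using LIMSEQ_unique un by simp
 then show ?thesis
  using set_integral_ball_translate(1)[OF m] by (simp add: V_def[abs_def])
qed

text \<open>Dilation shows that the integral over radius \<open>rh\<close> is rh^(2 n + 2) times the
  one over radius 1, and on the thin annulus between them the integrand lies between rh^(2 n) and 1.
  Dividing by 1 - rh^2 and letting \<open>rh\<close> tend to 1 determines the value.\<close>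

lemma set_integral_monomial_diag:
 "(LINT z:ball 0 1|lborel. (cmod z) ^ (2 * n)) = pi / (real n + 1)"
proof -
 define G where "G rh = (LINT z:ball 0 rh|lborel. (cmod z) ^ (2 * n))" for rh
 have int: "intg (ball (0::complex) rh) (%z. (cmod z) ^ (2 * n))" for rh
  by (intro set_integrable_continuous_cball continuous_intros)
 have scal: "G rh = rh ^ (2 * n + 2) * G 1" if "rh > 0" for rh
 proof -
  have im: "(%z. cor rh * z) ` ball 0 1 = ball 0 rh"
  proof -
  have "x : (%z. cor rh * z) ` ball 0 1" if "cmod x < rh" for x
  by (rule image_eqI[of _ _ "x / of_real rh"]) (use that \<open>rh > 0\<close> in \<open>auto simp: norm_divide\<close>)
  then show ?thesis using that by (auto simp: norm_mult)
  qed
  have d: "deriv (%z. cor rh * z) z = of_real rh" for z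
  by (rule DERIV_imp_deriv) (auto intro!: derivative_eq_intros)
  have "G rh = (LINT z:ball 0 1|lborel. (cmod (deriv (%z. cor rh * z) z))\<^sup>2 *\<^sub>R (cmod (cor rh * z)) ^ (2 * n))"
  unfolding G_def im[symmetric]
  by (rule holomorphic_change_of_variables)
  (use that in \<open>auto simp: inj_on_def im intro!: holomorphic_intros meas_cont continuous_intros\<close>)
  also have "... = (LINT z:ball 0 1|lborel. rh ^ (2 * n + 2) * (cmod z) ^ (2 * n))"
  using that by (simp add: d norm_mult power_mult_distrib power_add algebra_simps p2eq)
  also have "... = rh ^ (2 * n + 2) * G 1" by (simp add: G_def)
  finally show ?thesis .
 qed
 have step: "rh ^ (2 * n) * (pi * (1 - rh\<^sup>2)) <= G 1 - G rh & G 1 - G rh <= pi * (1 - rh\<^sup>2)" if "0 < rh" "rh < 1" for rh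
 proof -
  let ?A = "ball 0 1 - ball (0::complex) rh"
  have un: "ball 0 1 = ball (0::complex) rh \<union> ?A" using that by auto
  have iA: "intg ?A (%z. (cmod z) ^ (2 * n))"
  by (rule set_integrable_subset[OF int[of 1]]) auto
  have "G 1 = G rh + (LINT z:?A|lborel. (cmod z) ^ (2 * n))"
  unfolding G_def by (subst un, subst set_integral_Un) (use int iA in auto)
  then have e: "G 1 - G rh = (LINT z:?A|lborel. (cmod z) ^ (2 * n))" by simp
  have fin: "emeasure lborel ?A < \<infinity>"
  by (rule emeasure_bounded_finite) (auto intro: bounded_subset[of "ball 0 1"])
  have mA: "measure lborel ?A = pi * (1 - rh\<^sup>2)"
  using that by (subst measure_Diff) (auto simp: measure_ball_complex emeasure_ball_complex algebra_simps)
  have c: "intg ?A (%z. k)" for k :: real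
  using fin by (simp add: set_integrable_def integrable_mult_left)
  have ic: "(LINT z:?A|lborel. k) = pi * (1 - rh\<^sup>2) * k" for k :: real
  using mA by (simp add: set_lebesgue_integral_def)
  have "(LINT z:?A|lborel. rh ^ (2 * n)) <= (LINT z:?A|lborel. (cmod z) ^ (2 * n))"
  by (rule set_integral_mono[OF c iA]) (use that in \<open>auto intro!: power_mono\<close>)
  moreover have "(LINT z:?A|lborel. (cmod z) ^ (2 * n)) <= (LINT z:?A|lborel. 1)"
  by (rule set_integral_mono[OF iA c]) (use that in \<open>auto intro!: power_le_one\<close>)
  ultimately show ?thesis using e ic by (simp add: mult.commute)
 qed
 define p where "p rh = (\<Sum>i<n+1. (rh\<^sup>2) ^ i)" for rh :: real
 have geo: "1 - rh ^ (2 * n + 2) = (1 - rh\<^sup>2) * p rh" for rh :: real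
 proof -
  have e: "2 * n + 2 = 2 * (n + 1)" by simp
  show ?thesis unfolding e power_mult p_def by (rule one_diff_power_eq)
 qed
 have b: "rh ^ (2 * n) * pi <= G 1 * p rh & G 1 * p rh <= pi" if "0 < rh" "rh < 1" for rh
 proof -
  have pos: "1 - rh\<^sup>2 > 0" using that by (simp add: power_less_one_iff abs_square_less_1)
  have "G 1 - G rh = (1 - rh\<^sup>2) * (G 1 * p rh)"
  proof -
  have "G 1 - G rh = (1 - rh ^ (2 * n + 2)) * G 1"
  unfolding left_diff_distrib scal[OF that(1)] by simp
  then show ?thesis unfolding geo by (simp only: mult_ac)
  qed
  then have "(1 - rh\<^sup>2) * (rh ^ (2 * n) * pi) <= (1 - rh\<^sup>2) * (G 1 * p rh)" "(1 - rh\<^sup>2) * (G 1 * p rh) <= (1 - rh\<^sup>2) * pi"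
  using step[OF that] by (simp_all add: algebra_simps)
  then show ?thesis using pos by simp
 qed
 have ev: "eventually (%rh::real. 0 < rh & rh < 1) (at_left 1)"
  using eventually_at_left_real[of 0 1] by (auto elim!: eventually_mono)
 have l1: "((%rh. G 1 * p rh) \<longlongrightarrow> G 1 * p 1) (at_left 1)"
  unfolding p_def by (intro tendsto_intros)
 have l2: "((%rh::real. rh ^ (2 * n) * pi) \<longlongrightarrow> 1 ^ (2 * n) * pi) (at_left 1)"
  by (intro tendsto_intros)
 have "1 ^ (2 * n) * pi <= G 1 * p 1"
  by (rule tendsto_le[OF _ l1 l2]) (use ev b in \<open>auto elim!: eventually_mono\<close>)
 moreover have "G 1 * p 1 <= pi"
  by (rule tendsto_upperbound[OF l1]) (use ev b in \<open>auto elim!: eventually_mono\<close>)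
 ultimately have "G 1 * p 1 = pi" by simp
 then show ?thesis by (simp add: G_def p_def field_simps)
qed

lemma set_integral_monomial:
 "(LINT z:ball 0 1|lborel. z ^ m * cnj z ^ n) = (if m = n then of_real (pi / (real n + 1)) else 0)"
proof (cases "m = n")
 case True
 have "z ^ n * cnj z ^ n = of_real ((cmod z) ^ (2 * n))" for z
 proof -
  have "z ^ n * cnj z ^ n = (z * cnj z) ^ n" by (simp add: power_mult_distrib)
  also have "... = of_real ((cmod z) ^ (2 * n))"
  by (metis complex_norm_square of_real_power power_mult)
  finally show ?thesis .
 qed
 then have "(LINT z:ball 0 1|lborel. z ^ m * cnj z ^ n) = (LINT z:ball 0 1|lborel. of_real ((cmod z) ^ (2 * n)))"
  using True by simp
 also have "... = of_real (LINT z:ball 0 1|lborel. (cmod z) ^ (2 * n))"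
  by (rule set_integral_complex_of_real)
 finally show ?thesis
  using True by (simp add: set_integral_monomial_diag)
qed (simp add: set_integral_monomial_zero)

section \<open>Bergman spaces\<close>

lemma A2D:
 assumes "f : A2 S"
 shows "f holomorphic_on S" "intg S (%z. (cmod (f z))\<^sup>2)"
 using assms by (auto simp: A2_def)

lemma holomorphic_set_measurable:
 "open S ==> f holomorphic_on S ==> smeas S f"
 by (intro meas_cont hol_cont) auto

abbreviation nsq :: "complex set => (complex => complex) => real" where
 "nsq S f \<equiv> (LINT z:S|lborel. (cmod (f z))\<^sup>2)"

lemma nsq_nonneg [simp]: "nsq S f >= 0"
 by (auto simp: set_lebesgue_integral_def intro!: integral_nonneg)

lemma nsq_cong: "(!!z. z : S ==> f z = g z) ==> nsq S f = nsq S g"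
 unfolding set_lebesgue_integral_def by (intro Bochner_Integration.integral_cong) (auto simp: indicator_def)

lemma L2_inner_cong: "(!!z. z : S ==> f z = f' z) ==> (!!z. z : S ==> g z = g' z) ==> L2_inner S f g = L2_inner S f' g'"
 unfolding L2_inner_def set_lebesgue_integral_def by (intro Bochner_Integration.integral_cong) (auto simp: indicator_def)

lemma A2_cong:
 assumes "f : A2 S" "!!z. z : S ==> f z = g z"
 shows "g : A2 S"
proof -
 have "g holomorphic_on S" using assms holomorphic_transform[of f S g] by (auto simp: A2_def)
 moreover have "intg S (%z. (cmod (g z))\<^sup>2) = intg S (%z. (cmod (f z))\<^sup>2)"
  unfolding set_integrable_def by (intro Bochner_Integration.integrable_cong) (use assms in \<open>auto simp: indicator_def\<close>)
 ultimately show ?thesis using assms by (auto simp: A2_def)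
qed

lemma bergman_mult_integrable:
 assumes S: "open S" and f: "f : A2 S" and g: "g : A2 S"
 shows "intg S (%z. f z * cnj (g z))"
proof (rule set_integrable_bound)
 show "intg S (%z. (cmod (f z))\<^sup>2 + (cmod (g z))\<^sup>2)"
  using f g by (auto simp: A2_def)
 have "continuous_on S (%z. f z * cnj (g z))"
  using f g by (intro continuous_intros) (auto simp: A2_def hol_cont)
 then show "smeas S (%z. f z * cnj (g z))"
  using S by (intro meas_cont) auto
 show "AE z in lborel. z : S --> norm (f z * cnj (g z)) <= norm ((cmod (f z))\<^sup>2 + (cmod (g z))\<^sup>2)"
 proof (rule AE_I2, rule impI)
  fix z
  have "2 * cmod (f z) * cmod (g z) <= (cmod (f z))\<^sup>2 + (cmod (g z))\<^sup>2" by (rule sum_squares_bound)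
  moreover have "0 <= cmod (f z) * cmod (g z)" by simp
  ultimately have "cmod (f z) * cmod (g z) <= (cmod (f z))\<^sup>2 + (cmod (g z))\<^sup>2" by linarith
  then show "norm (f z * cnj (g z)) <= norm ((cmod (f z))\<^sup>2 + (cmod (g z))\<^sup>2)"
  by (simp add: norm_mult)
 qed
qed

lemma A2_mult_bounded:
 assumes S: "open S" and f: "f : A2 S" and g: "g holomorphic_on S" "!!z. z : S ==> cmod (g z) <= B"
 shows "(%z. g z * f z) : A2 S"
proof -
 have "(%z. g z * f z) holomorphic_on S" using f g by (auto simp: A2_def intro: holomorphic_intros)
 moreover have "intg S (%z. (cmod (g z * f z))\<^sup>2)"
 proof (rule set_integrable_bound)
  show "intg S (%z. B\<^sup>2 * (cmod (f z))\<^sup>2)" using f by (auto simp: A2_def)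
  have "continuous_on S (%z. (cmod (g z * f z))\<^sup>2)"
  using f g by (intro continuous_intros) (auto simp: A2_def hol_cont)
  then show "smeas S (%z. (cmod (g z * f z))\<^sup>2)"
  using S by (intro meas_cont) auto
  show "AE z in lborel. z : S --> norm ((cmod (g z * f z))\<^sup>2) <= norm (B\<^sup>2 * (cmod (f z))\<^sup>2)"
  using g(2) by (intro AE_I2) (auto simp: norm_mult power_mult_distrib intro!: mult_right_mono power_mono)
 qed
 ultimately show ?thesis by (simp add: A2_def)
qed

lemma A2_scale:
 assumes "open S" "f : A2 S" shows "(%z. c * f z) : A2 S"
 by (rule A2_mult_bounded[OF assms, of "%_. c" "cmod c"]) auto

lemma A2_add:
 assumes S: "open S" and f: "f : A2 S" and g: "g : A2 S"
 shows "(%z. f z + g z) : A2 S"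
proof -
 have h: "(%z. f z + g z) holomorphic_on S" using f g by (auto simp: A2_def intro: holomorphic_intros)
 moreover have "intg S (%z. (cmod (f z + g z))\<^sup>2)"
 proof (rule set_integrable_bound)
  show "intg S (%z. 2 * (cmod (f z))\<^sup>2 + 2 * (cmod (g z))\<^sup>2)"
  using f g by (auto simp: A2_def)
  have "continuous_on S (%z. (cmod (f z + g z))\<^sup>2)"
  using f g by (intro continuous_intros) (auto simp: A2_def hol_cont)
  then show "smeas S (%z. (cmod (f z + g z))\<^sup>2)"
  using S by (intro meas_cont) auto
  show "AE z in lborel. z : S --> norm ((cmod (f z + g z))\<^sup>2) <= norm (2 * (cmod (f z))\<^sup>2 + 2 * (cmod (g z))\<^sup>2)"
  proof (rule AE_I2, rule impI)
  fix z
  have "(cmod (f z + g z))\<^sup>2 <= (cmod (f z) + cmod (g z))\<^sup>2"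
  by (intro power_mono norm_triangle_ineq) auto
  also have "... = 2 * (cmod (f z))\<^sup>2 + 2 * (cmod (g z))\<^sup>2 - (cmod (f z) - cmod (g z))\<^sup>2"
  by (simp add: p2eq algebra_simps)
  also have "... <= 2 * (cmod (f z))\<^sup>2 + 2 * (cmod (g z))\<^sup>2" by simp
  finally show "norm ((cmod (f z + g z))\<^sup>2) <= norm (2 * (cmod (f z))\<^sup>2 + 2 * (cmod (g z))\<^sup>2)" by simp
  qed
 qed
 ultimately show ?thesis by (simp add: A2_def)
qed

lemma A2_diff:
 assumes "open S" "f : A2 S" "g : A2 S"
 shows "(%z. f z - g z) : A2 S"
 using A2_add[OF assms(1,2) A2_scale[OF assms(1,3), of "-1"]] by simp

lemma A2_zero: "(%_. 0) : A2 S"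
 by (simp add: A2_def set_integrable_def)

lemma A2_sum:
 assumes "open S" "finite F" "!!a. a : F ==> g a : A2 S"
 shows "(%z. \<Sum>a\<in>F. g a z) : A2 S"
 using assms(2,3)
proof (induction F rule: finite_induct)
 case empty then show ?case by (simp add: A2_zero)
next
 case (insert x F) then show ?case by (simp add: A2_add[OF assms(1)])
qed

lemma A2_subset:
 assumes "f : A2 S" "T <= S" "open T"
 shows "f : A2 T"
 using assms by (auto simp: A2_def intro: hol_subset set_integrable_subset)

lemma L2_inner_self: "L2_inner S f f = of_real (nsq S f)"
proof -
 have "L2_inner S f f = (LINT z:S|lborel. of_real ((cmod (f z))\<^sup>2))"
  by (simp only: L2_inner_def complex_norm_square)
 also have "... = of_real (nsq S f)" by (rule set_integral_complex_of_real)
 finally show ?thesis .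
qed

lemma L2_inner_commute: "L2_inner S g f = cnj (L2_inner S f g)"
proof -
 have "cnj (L2_inner S f g) = (\<integral>z. cnj (indicator S z *\<^sub>R (f z * cnj (g z))) \<partial>lborel)"
  unfolding L2_inner_def set_lebesgue_integral_def by (rule Bochner_Integration.integral_cnj[symmetric])
 also have "... = L2_inner S g f"
  unfolding L2_inner_def set_lebesgue_integral_def by (simp add: mult.commute)
 finally show ?thesis ..
qed

lemma L2_inner_scale_left: "L2_inner S (%z. c * f z) g = c * L2_inner S f g"
 unfolding L2_inner_def by (simp add: mult.assoc)

lemma L2_inner_scale_right: "L2_inner S f (%z. c * g z) = cnj c * L2_inner S f g"
 using L2_inner_scale_left[of S c g f] L2_inner_commute[of S f "%z. c * g z"] L2_inner_commute[of S f g]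
 by simp

lemma nsq_scale: "nsq S (%z. c * f z) = (cmod c)\<^sup>2 * nsq S f"
 by (simp add: norm_mult power_mult_distrib)

text \<open>Discriminant argument with the step 1 / b or, for b = 0, (a + 1) / c. With c = |<f,g>|^2
  it gives the Cauchy-Schwarz inequality, and with a = 0 the orthogonality of a minimizer.\<close>

lemma quadratic_nonneg_imp:
 fixes a b c :: real
 assumes key: "!!s. 0 <= a - 2 * s * c + s\<^sup>2 * c * b" and "a >= 0" "b >= 0" "c >= 0"
 shows "c <= a * b"
proof (cases "b = 0")
 case True
 have "c = 0"
 proof (rule ccontr)
  assume "c ~= 0"
  then have "0 <= a - 2 * (a + 1)"
  using key[of "(a + 1) / c"] True by simp
  then have "a <= - 2" by simp
  then show False using \<open>a \<ge> 0\<close> by simp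
 qed
 then show ?thesis using True by simp
next
 case False
 then have pos: "b > 0" using \<open>b \<ge> 0\<close> by linarith
 have "0 <= a - c / b"
  using key[of "1 / b"] pos by (simp add: p2eq)
 then show ?thesis using pos by (simp add: field_simps)
qed

section \<open>The Bergman space as a Hilbert space with bounded point evaluations\<close>

context
 fixes S :: "complex set"
 assumes S: "open S"
begin

lemma L2_inner_add_left:
 assumes "f : A2 S" "g : A2 S" "h : A2 S"
 shows "L2_inner S (%z. f z + g z) h = L2_inner S f h + L2_inner S g h"
 unfolding L2_inner_def distrib_right
 using assms bergman_mult_integrable[OF S] by (intro set_integral_add) auto

lemma L2_inner_diff_left:
 assumes "f : A2 S" "g : A2 S" "h : A2 S"
 shows "L2_inner S (%z. f z - g z) h = L2_inner S f h - L2_inner S g h"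
 unfolding L2_inner_def left_diff_distrib
 using assms bergman_mult_integrable[OF S] by (intro set_integral_diff) auto

lemma L2_inner_diff_right:
 assumes "f : A2 S" "g : A2 S" "h : A2 S"
 shows "L2_inner S h (%z. f z - g z) = L2_inner S h f - L2_inner S h g"
 using L2_inner_diff_left[OF assms]
 by (metis (no_types, lifting) L2_inner_commute complex_cnj_diff)

lemma L2_inner_sum_left:
 assumes "finite F" "!!a. a : F ==> g a : A2 S" "h : A2 S"
 shows "L2_inner S (%z. \<Sum>a\<in>F. g a z) h = (\<Sum>a\<in>F. L2_inner S (g a) h)"
 using assms(1,2)
proof (induction F rule: finite_induct)
 case empty then show ?case by (simp add: L2_inner_def)
next
 case (insert x F)
 then have "(%z. \<Sum>a\<in>F. g a z) : A2 S" by (intro A2_sum S) auto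
 then show ?case using insert assms(3) by (simp add: L2_inner_add_left)
qed

lemma nsq_diff:
 assumes f: "f : A2 S" and g: "g : A2 S"
 shows "nsq S (%z. f z - t * g z) = nsq S f - 2 * Re (cnj t * L2_inner S f g) + (cmod t)\<^sup>2 * nsq S g"
proof -
 note tg = A2_scale[OF S g, of t]
 note d = A2_diff[OF S f tg]
 have "cor (nsq S (%z. f z - t * g z)) = L2_inner S (%z. f z - t * g z) (%z. f z - t * g z)"
  by (simp add: L2_inner_self)
 also have "... = L2_inner S f f - t * L2_inner S g f - cnj t * L2_inner S f g + t * cnj t * L2_inner S g g"
  by (simp add: L2_inner_diff_left[OF f tg d] L2_inner_diff_right[OF f tg f] L2_inner_diff_right[OF f tg g]
  L2_inner_scale_left L2_inner_scale_right algebra_simps)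
 also have "... = of_real (nsq S f) - (cnj t * L2_inner S f g + cnj (cnj t * L2_inner S f g)) + of_real ((cmod t)\<^sup>2) * of_real (nsq S g)"
  unfolding complex_norm_square L2_inner_self using L2_inner_commute[of S g f] by (simp add: algebra_simps)
 also have "... = of_real (nsq S f - 2 * Re (cnj t * L2_inner S f g) + (cmod t)\<^sup>2 * nsq S g)"
  unfolding complex_add_cnj by simp
 finally show ?thesis using of_real_eq_iff by blast
qed

lemma Cauchy_Schwarz_L2:
 assumes f: "f : A2 S" and g: "g : A2 S"
 shows "(cmod (L2_inner S f g))\<^sup>2 <= nsq S f * nsq S g"
proof -
 define I where "I = L2_inner S f g"
 have key: "0 <= nsq S f - 2 * s * (cmod I)\<^sup>2 + s\<^sup>2 * (cmod I)\<^sup>2 * nsq S g" for s :: real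
 proof -
  have "Re (cnj (of_real s * I) * I) = s * (cmod I)\<^sup>2"
  unfolding cmod_power2 by (simp add: p2eq algebra_simps)
  then show ?thesis
  using nsq_diff[OF f g, of "of_real s * I"] nsq_nonneg[of S "%z. f z - of_real s * I * g z"]
  by (simp add: I_def[symmetric] norm_mult power_mult_distrib)
 qed
 show ?thesis
  unfolding I_def[symmetric] by (rule quadratic_nonneg_imp[OF key]) auto
qed

text \<open>The mean value property is applied to the holomorphic function f^2, whose modulus is the
  integrand of the norm.\<close>

lemma bergman_point_eval:
 assumes f: "f : A2 S" and b: "ball c r <= S" "r > 0"
 shows "(cmod (f c))\<^sup>2 <= nsq S f / (pi * r\<^sup>2)"
proof -
 have h: "f holomorphic_on ball c r" using f b by (auto simp: A2_def intro: hol_subset)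
 have i: "intg (ball c r) (%z. (cmod (f z))\<^sup>2)"
  using f b by (auto simp: A2_def intro: set_integrable_subset)
 have h2: "(%z. (f z)\<^sup>2) holomorphic_on ball c r" using h by (intro holomorphic_intros)
 have i2: "intg (ball c r) (%z. (f z)\<^sup>2)"
  by (rule set_integrable_bound[OF i]) (use h2 in \<open>auto simp: norm_power intro: holomorphic_set_measurable\<close>)
 have "pi * r\<^sup>2 * (cmod (f c))\<^sup>2 = cmod (LINT z:ball c r|lborel. (f z)\<^sup>2)"
  using mean_value_ball[OF h2 i2 b(2)] by (simp add: norm_mult norm_power)
 also have "... <= (LINT z:ball c r|lborel. (cmod (f z))\<^sup>2)"
  using set_integral_norm_bound[OF i2] by (simp add: norm_power)
 also have "... <= nsq S f"
  unfolding set_lebesgue_integral_def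
 proof (rule integral_mono)
  show "integrable lborel (%z. indicat_real (ball c r) z *\<^sub>R (cmod (f z))\<^sup>2)" using i by (simp add: set_integrable_def)
  show "integrable lborel (%z. indicat_real S z *\<^sub>R (cmod (f z))\<^sup>2)" using f by (simp add: set_integrable_def A2_def)
  show "indicat_real (ball c r) z *\<^sub>R (cmod (f z))\<^sup>2 <= indicat_real S z *\<^sub>R (cmod (f z))\<^sup>2" for z
  using b by (auto simp: indicator_def)
 qed
 finally show ?thesis using b(2) by (simp add: field_simps)
qed

lemma bergman_compact_eval:
 assumes K: "compact K" "K <= S"
 shows "EX C>0. ALL f:A2 S. ALL z:K. (cmod (f z))\<^sup>2 <= C * nsq S f"
proof -
 obtain e where e: "e > 0" "(\<Union>z\<in>K. ball z e) <= S"
  using compact_subset_open_imp_ball_epsilon_subset[OF K(1) S K(2)] by metis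
 have "1 / (pi * e\<^sup>2) > 0" using e by simp
 moreover have "(cmod (f z))\<^sup>2 <= 1 / (pi * e\<^sup>2) * nsq S f" if "f : A2 S" "z : K" for f z
  using bergman_point_eval[of f z e] e that by auto
 ultimately show ?thesis by blast
qed

lemma nsq_eq_0:
 assumes f: "f : A2 S" and 0: "nsq S f = 0" and z: "z : S"
 shows "f z = 0"
proof -
 have K: "compact {z}" "{z} <= S" using z by auto
 obtain C where "(cmod (f z))\<^sup>2 <= C * nsq S f"
  using bergman_compact_eval[OF K] f by blast
 then show ?thesis using 0 by simp
qed

lemma nn_integral_nsq:
 assumes "f : A2 S"
 shows "(\<integral>\<^sup>+z. ennreal (indicat_real S z * (cmod (f z))\<^sup>2) \<partial>lborel) = ennreal (nsq S f)"
 using assms by (subst nn_integral_eq_integral)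
  (auto simp: A2_def set_integrable_def set_lebesgue_integral_def)

text \<open>Lower semicontinuity of the norm under pointwise convergence, by Fatou's lemma. It
  serves for completeness, applied to differences, and for the minimizer in
  \<open>brepresenter_exists\<close>.\<close>

lemma bergman_fatou:
 assumes h: "!!m. h m : A2 S" and g: "g holomorphic_on S"
  and lim: "!!z. z : S ==> (%m. h m z) \<longlonglongrightarrow> g z"
  and e: "eventually (%m. nsq S (h m) <= e) sequentially"
 shows "g : A2 S" "nsq S g <= e"
proof -
 have e0: "e >= 0" using eventually_happens'[OF sequentially_bot e] nsq_nonneg order_trans by blast
 have meas: "(%z. indicat_real S z * (cmod (f z))\<^sup>2) : borel_measurable lborel" if "f holomorphic_on S" for f
 proof -
  have "continuous_on S (%z. (cmod (f z))\<^sup>2)"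
  using that by (intro continuous_intros) (auto intro: hol_cont)
  from meas_cont[OF _ this] show ?thesis
  using S by (simp add: set_borel_measurable_def)
 qed
 have "(\<integral>\<^sup>+z. ennreal (indicat_real S z * (cmod (g z))\<^sup>2) \<partial>lborel)
  = (\<integral>\<^sup>+z. liminf (%m. ennreal (indicat_real S z * (cmod (h m z))\<^sup>2)) \<partial>lborel)"
 proof (rule nn_integral_cong)
  fix z
  have "(%m. ennreal (indicat_real S z * (cmod (h m z))\<^sup>2)) \<longlonglongrightarrow> ennreal (indicat_real S z * (cmod (g z))\<^sup>2)"
  proof (cases "z : S")
  case True then show ?thesis by (intro tendsto_intros lim)
  qed simp
  then show "ennreal (indicat_real S z * (cmod (g z))\<^sup>2) = liminf (%m. ennreal (indicat_real S z * (cmod (h m z))\<^sup>2))"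
  by (rule lim_imp_Liminf[OF sequentially_bot, symmetric])
 qed
 also have "... <= liminf (%m. \<integral>\<^sup>+z. ennreal (indicat_real S z * (cmod (h m z))\<^sup>2) \<partial>lborel)"
  by (rule nn_integral_liminf) (use meas h in \<open>auto simp: A2_def\<close>)
 also have "... <= ennreal e"
 proof -
  have "liminf (%m. ennreal (nsq S (h m))) <= liminf (%m. ennreal e)"
  by (rule Liminf_mono) (use e in \<open>auto elim!: eventually_mono intro: ennreal_leI\<close>)
  then show ?thesis using h by (simp add: nn_integral_nsq Liminf_const)
 qed
 finally have le: "(\<integral>\<^sup>+z. ennreal (indicat_real S z * (cmod (g z))\<^sup>2) \<partial>lborel) <= ennreal e" .
 then have "integrable lborel (%z. indicat_real S z * (cmod (g z))\<^sup>2)"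
  by (intro integrableI_bounded meas g) (auto simp: order.strict_trans1)
 then show gb: "g : A2 S" using g by (simp add: A2_def set_integrable_def)
 then show "nsq S g <= e" using le e0 by (simp add: nn_integral_nsq)
qed

text \<open>Bounded point evaluations turn a Cauchy sequence in norm into a locally uniformly Cauchy
  one, whose limit is holomorphic; \<open>bergman_fatou\<close> then gives convergence in
  norm.\<close>

lemma bergman_complete:
 assumes f: "!!n. f n : A2 S"
  and cau: "!!e. e > 0 ==> EX N. ALL m>=N. ALL n>=N. nsq S (%z. f m z - f n z) <= e"
 obtains g where "g : A2 S" "(%n. nsq S (%z. f n z - g z)) \<longlonglongrightarrow> 0"
  "!!z. z : S ==> (%n. f n z) \<longlonglongrightarrow> g z"
proof -
 have d: "(%z. f m z - f n z) : A2 S" for m n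
  using A2_diff[OF S f f] .
 have unif: "uniformly_Cauchy_on K f" if K: "compact K" "K <= S" for K
 proof -
  obtain C where C: "C > 0" "!!f z. f : A2 S ==> z : K ==> (cmod (f z))\<^sup>2 <= C * nsq S f"
  using bergman_compact_eval[OF K] by blast
  show ?thesis
  proof (rule uniformly_Cauchy_onI)
  fix e :: real assume e: "e > 0"
  obtain N where N: "ALL m>=N. ALL n>=N. nsq S (%z. f m z - f n z) <= e\<^sup>2 / (2 * C)"
  using cau[of "e\<^sup>2 / (2 * C)"] e C by auto
  have "dist (f m z) (f n z) < e" if "z : K" "m >= N" "n >= N" for z m n
  proof -
  have "(cmod (f m z - f n z))\<^sup>2 <= C * nsq S (%z. f m z - f n z)" using C(2)[OF d] that by blast
  also have "... <= C * (e\<^sup>2 / (2 * C))" using N that C by (intro mult_left_mono) auto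
  also have "... < e\<^sup>2" using C e by simp
  finally show ?thesis using e power_less_imp_less_base[of _ 2 e] by (auto simp: dist_norm)
  qed
  then show "EX M. ALL x:K. ALL m>=M. ALL n>=M. dist (f m x) (f n x) < e" by blast
  qed
 qed
 define g where "g z = lim (%n. f n z)" for z
 have lim: "(%n. f n z) \<longlonglongrightarrow> g z" if "z : S" for z
 proof -
  have "uniformly_convergent_on {z} f"
  by (rule Cauchy_uniformly_convergent) (use unif that in auto)
  then have "convergent (%n. f n z)"
  using uniformly_convergent_imp_convergent by fastforce
  then show ?thesis by (simp add: g_def convergent_LIMSEQ_iff)
 qed
 have ul: "uniform_limit K f g sequentially" if K: "compact K" "K <= S" for K
  using Cauchy_uniformly_convergent[OF unif[OF K]] unfolding uniformly_convergent_uniform_limit_iff g_def .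
 have g: "g holomorphic_on S"
 proof (rule holomorphic_uniform_sequence[OF S])
  show "f n holomorphic_on S" for n using f by (auto simp: A2_def)
  fix x assume "x : S"
  then obtain e where "e > 0" "cball x e <= S" using S open_contains_cball by blast
  then show "EX d>0. cball x d <= S & uniform_limit (cball x d) f g sequentially"
  using ul[of "cball x e"] by auto
 qed
 have le: "nsq S (%z. f n z - g z) <= e & (%z. f n z - g z) : A2 S" if N: "ALL m>=N. ALL n>=N. nsq S (%z. f m z - f n z) <= e" "n >= N" for e N n
 proof -
  have hg: "(%z. f n z - g z) holomorphic_on S" using f g by (intro holomorphic_intros) (auto simp: A2_def)
  have "eventually (%m. nsq S (%z. f n z - f m z) <= e) sequentially"
  using N eventually_sequentially by auto
  moreover have "(%m. f n z - f m z) \<longlonglongrightarrow> f n z - g z" if "z : S" for z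
  using that by (intro tendsto_intros lim)
  ultimately show ?thesis
  using bergman_fatou[of "%m z. f n z - f m z", OF d hg] by blast
 qed
 have gb: "g : A2 S"
 proof -
  obtain N where "ALL m>=N. ALL n>=N. nsq S (%z. f m z - f n z) <= 1" using cau[of 1] by auto
  then have "(%z. f N z - g z) : A2 S" using le by blast
  from A2_diff[OF S f[of N] this] show ?thesis by simp
 qed
 have "(%n. nsq S (%z. f n z - g z)) \<longlonglongrightarrow> 0"
 proof (rule LIMSEQ_I)
  fix e :: real assume "e > 0"
  then obtain N where "ALL m>=N. ALL n>=N. nsq S (%z. f m z - f n z) <= e / 2" using cau[of "e / 2"] by auto
  then have "norm (nsq S (%z. f n z - g z) - 0) < e" if "n >= N" for n
  using le[of N "e / 2" n] that \<open>e > 0\<close> nsq_nonneg[of S "%z. f n z - g z"] by auto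
  then show "EX no. ALL n>=no. norm (nsq S (%z. f n z - g z) - 0) < e" by blast
 qed
 then show thesis using that gb lim by blast
qed

lemma L2_inner_tendsto:
 assumes f: "!!n. f n : A2 S" and g: "g : A2 S" and a: "a : A2 S"
  and lim: "(%n. nsq S (%z. f n z - g z)) \<longlonglongrightarrow> 0"
 shows "(%n. L2_inner S (f n) a) \<longlonglongrightarrow> L2_inner S g a"
proof (rule LIM_zero_cancel, rule Lim_null_comparison)
 have "(%n. sqrt (nsq S (%z. f n z - g z) * nsq S a)) \<longlonglongrightarrow> sqrt (0 * nsq S a)"
  by (intro tendsto_intros lim)
 then show "(%n. sqrt (nsq S (%z. f n z - g z) * nsq S a)) \<longlonglongrightarrow> 0" by simp
 show "eventually (%n. norm (L2_inner S (f n) a - L2_inner S g a) <= sqrt (nsq S (%z. f n z - g z) * nsq S a)) sequentially"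
 proof (rule always_eventually, rule allI, rule real_le_rsqrt)
  fix n
  have "(%z. f n z - g z) : A2 S" by (rule A2_diff[OF S f g])
  from Cauchy_Schwarz_L2[OF this a]
  show "(norm (L2_inner S (f n) a - L2_inner S g a))\<^sup>2 <= nsq S (%z. f n z - g z) * nsq S a"
  by (simp add: L2_inner_diff_left[OF f g a])
 qed
qed

end

section \<open>Orthonormal bases and the reproducing kernel\<close>

context
 fixes S :: "complex set"
 assumes S: "open S"
begin

text \<open>A maximal orthonormal set is total, because a function orthogonal to it that is nonzero
  somewhere could be normalized and adjoined.\<close>

lemma orthonormal_basis_exists: "EX B. orthonormal_basis S B"
proof -
 define ON where "ON B \<longleftrightarrow> B <= A2 S & (ALL a:B. ALL b:B. L2_inner S a b = (if a = b then 1 else 0))" for B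
 have "EX M:{B. ON B}. ALL X:{B. ON B}. M <= X --> X = M"
 proof (rule subset_Zorn')
  fix C assume C: "subset.chain {B. ON B} C"
  have "ON (\<Union>C)"
  unfolding ON_def
  proof (intro conjI ballI)
  show "\<Union>C <= A2 S" using C by (auto simp: subset.chain_def ON_def)
  fix a b assume "a : \<Union>C" "b : \<Union>C"
  then obtain X Y where XY: "X : C" "Y : C" "a : X" "b : Y" by blast
  then have "X <= Y \<or> Y <= X" using C by (auto simp: subset.chain_def)
  then obtain Z where "Z : C" "a : Z" "b : Z" using XY by blast
  then show "L2_inner S a b = (if a = b then 1 else 0)" using C by (auto simp: subset.chain_def ON_def)
  qed
  then show "\<Union>C \<in> {B. ON B}" by simp
 qed
 then obtain B where B: "ON B" "!!X. ON X ==> B <= X ==> X = B" by auto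
 have zero: "f z = 0" if f: "f : A2 S" "ALL a:B. L2_inner S f a = 0" and z: "z : S" for f z
 proof (rule ccontr)
  assume "f z ~= 0"
  then have n0: "nsq S f ~= 0" using nsq_eq_0[OF S f(1) _ z] by blast
  then have pos: "nsq S f > 0" using nsq_nonneg[of S f] by linarith
  define g where "g = (%z. of_real (1 / sqrt (nsq S f)) * f z)"
  have gb: "g : A2 S" unfolding g_def by (rule A2_scale[OF S f(1)])
  have gg: "L2_inner S g g = 1"
  proof -
  have "nsq S g = (cmod (of_real (1 / sqrt (nsq S f))))\<^sup>2 * nsq S f" unfolding g_def by (rule nsq_scale)
  also have "... = 1" using pos n0 by (simp add: power_divide norm_divide)
  finally show ?thesis by (simp add: L2_inner_self)
  qed
  have ga: "L2_inner S g a = 0" if "a : B" for a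
  using f(2) that unfolding g_def L2_inner_scale_left by simp
  have ag: "L2_inner S a g = 0" if "a : B" for a
  using ga[OF that] L2_inner_commute[of S a g] by simp
  have "ON (insert g B)" using B(1) gb gg ga ag by (auto simp: ON_def)
  then have "g : B" using B(2)[of "insert g B"] by blast
  then have "L2_inner S g g = 0" by (rule ga)
  then show False using gg by simp
 qed
 have "orthonormal_basis S B"
  unfolding orthonormal_basis_def using B(1) zero unfolding ON_def by blast
 then show ?thesis ..
qed

text \<open>The basis carries no enumeration. Finite subsets whose coefficient sums approach their
  supremum are merged into an increasing sequence \<open>H\<close>; the partial sums along it
  converge to some \<open>g\<close>, the coefficients outside the union vanish, and \<open>g\<close>
  agrees with \<open>f\<close> by totality.\<close>

lemma Parseval:
 assumes B: "orthonormal_basis S B" and f: "f : A2 S"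
 shows "((%a. (cmod (L2_inner S f a))\<^sup>2) has_sum nsq S f) B"
proof -
 define c where "c a = L2_inner S f a" for a
 define P where "P F z = (\<Sum>a\<in>F. c a * a z)" for F z
 have Bb: "a : A2 S" if "a : B" for a using B that by (auto simp: orthonormal_basis_def)
 have ON: "L2_inner S a b = (if a = b then 1 else 0)" if "a : B" "b : B" for a b
  using B that by (auto simp: orthonormal_basis_def)
 have Pb: "P F : A2 S" if "finite F" "F <= B" for F
  unfolding P_def using that Bb by (intro A2_sum A2_scale S) auto
 have Pin: "L2_inner S (P F) h = (\<Sum>a\<in>F. c a * L2_inner S a h)" if "finite F" "F <= B" "h : A2 S" for F h
  unfolding P_def using that Bb
  by (subst L2_inner_sum_left[OF S]) (auto intro: A2_scale[OF S] simp: L2_inner_scale_left)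
 have Pa: "L2_inner S (P F) a = (if a : F then c a else 0)" if "finite F" "F <= B" "a : B" for F a
 proof -
  have "L2_inner S (P F) a = (\<Sum>b\<in>F. if b = a then c b else 0)"
  unfolding Pin[OF that(1,2) Bb[OF that(3)]] by (rule sum.cong) (use that ON in auto)
  then show ?thesis using that by simp
 qed
 have nsqP: "nsq S (P F) = (\<Sum>a\<in>F. (cmod (c a))\<^sup>2)" if F: "finite F" "F <= B" for F
 proof -
  have "cor (nsq S (P F)) = (\<Sum>a\<in>F. c a * cnj (L2_inner S (P F) a))"
  unfolding L2_inner_self[symmetric] Pin[OF F Pb[OF F]]
  by (rule sum.cong) (auto simp: L2_inner_commute[of S _ "P F"])
  also have "... = (\<Sum>a\<in>F. of_real ((cmod (c a))\<^sup>2))"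
  proof (rule sum.cong[OF refl])
  fix a assume "a : F"
  then have "L2_inner S (P F) a = c a" using Pa[OF F, of a] F by auto
  then show "c a * cnj (L2_inner S (P F) a) = of_real ((cmod (c a))\<^sup>2)" unfolding complex_norm_square by simp
  qed
  finally have "cor (nsq S (P F)) = of_real (\<Sum>a\<in>F. (cmod (c a))\<^sup>2)" by simp
  then show ?thesis unfolding of_real_eq_iff .
 qed
 have fP: "L2_inner S f (P F) = of_real (\<Sum>a\<in>F. (cmod (c a))\<^sup>2)" if F: "finite F" "F <= B" for F
 proof -
  have "L2_inner S f (P F) = cnj (\<Sum>a\<in>F. c a * L2_inner S a f)"
  unfolding Pin[OF F f, symmetric] by (rule L2_inner_commute)
  also have "... = (\<Sum>a\<in>F. of_real ((cmod (c a))\<^sup>2))"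
  unfolding complex_norm_square cnj_sum
  by (rule sum.cong) (auto simp: c_def L2_inner_commute[of S f] mult.commute)
  finally show ?thesis by simp
 qed
 have dist: "nsq S (%z. f z - P F z) = nsq S f - (\<Sum>a\<in>F. (cmod (c a))\<^sup>2)" if F: "finite F" "F <= B" for F
  using nsq_diff[OF S f Pb[OF F], of 1] nsqP[OF F] fP[OF F] by simp
 have le: "(\<Sum>a\<in>F. (cmod (c a))\<^sup>2) <= nsq S f" if F: "finite F" "F <= B" for F
  using dist[OF F] nsq_nonneg[of S "%z. f z - P F z"] by linarith
 have hs: "((%a. (cmod (c a))\<^sup>2) has_sum (SUP F\<in>{F. finite F & F <= B}. \<Sum>a\<in>F. (cmod (c a))\<^sup>2)) B"
  by (rule nonneg_bdd_above_has_sum) (use le in \<open>auto intro!: bdd_aboveI\<close>)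
 define s where "s = (SUP F\<in>{F. finite F & F <= B}. \<Sum>a\<in>F. (cmod (c a))\<^sup>2)"
 have bdd: "bdd_above ((%F. \<Sum>a\<in>F. (cmod (c a))\<^sup>2) ` {F. finite F & F <= B})"
  using le by (auto intro!: bdd_aboveI)
 have les: "(\<Sum>a\<in>F. (cmod (c a))\<^sup>2) <= s" if "finite F" "F <= B" for F
  unfolding s_def by (rule cSUP_upper[OF _ bdd]) (use that in auto)
 have "EX F. finite F & F <= B & s - 1 / real (Suc n) < (\<Sum>a\<in>F. (cmod (c a))\<^sup>2)" for n
 proof -
  have "s - 1 / real (Suc n) < s" by simp
  then show ?thesis
  using less_cSUP_iff[OF _ bdd, of "s - 1 / real (Suc n)"] unfolding s_def by auto
 qed
 then obtain G where G: "!!n. finite (G n) & G n <= B & s - 1 / real (Suc n) < (\<Sum>a\<in>G n. (cmod (c a))\<^sup>2)" by metis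
 define H where "H n = (\<Union>i\<le>n. G i)" for n
 have H: "finite (H n)" "H n <= B" for n using G by (auto simp: H_def)
 have Hm: "H m <= H n" if "m <= n" for m n using that by (force simp: H_def)
 have Hs: "s - 1 / real (Suc n) < (\<Sum>a\<in>H n. (cmod (c a))\<^sup>2)" for n
 proof -
  have "(\<Sum>a\<in>G n. (cmod (c a))\<^sup>2) <= (\<Sum>a\<in>H n. (cmod (c a))\<^sup>2)"
  by (rule sum_mono2) (use H in \<open>auto simp: H_def\<close>)
  then show ?thesis using G[of n] by linarith
 qed
 have nd: "nsq S (%z. P (H n) z - P (H m) z) <= 1 / real (Suc m)" if "m <= n" for m n
 proof -
  have "nsq S (%z. P (H n) z - P (H m) z) = nsq S (P (H n - H m))"
  unfolding P_def using H Hm[OF that] by (simp add: sum_diff)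
  also have "... = (\<Sum>a\<in>H n. (cmod (c a))\<^sup>2) - (\<Sum>a\<in>H m. (cmod (c a))\<^sup>2)"
  using H Hm[OF that] by (subst nsqP) (auto simp: sum_diff)
  also have "... <= 1 / real (Suc m)" using les[OF H(1,2), of n] Hs[of m] by linarith
  finally show ?thesis .
 qed
 have cau: "EX N. ALL m>=N. ALL n>=N. nsq S (%z. P (H m) z - P (H n) z) <= e" if e: "e > 0" for e
 proof -
  obtain N where N: "1 / real (Suc N) < e" using e nat_approx_posE by blast
  have "nsq S (%z. P (H m) z - P (H n) z) <= e" if mn: "m >= N" "n >= N" for m n
  proof -
  have sym: "nsq S (%z. P (H m) z - P (H n) z) = nsq S (%z. P (H n) z - P (H m) z)"
  by (simp add: norm_minus_commute)
  have le': "1 / real (Suc k) <= 1 / real (Suc N)" if "k >= N" for k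
  using that by (simp add: frac_le)
  show ?thesis
  proof (cases "m <= n")
  case True then show ?thesis using nd[OF True] sym le'[OF mn(1)] N by linarith
  next
  case False then show ?thesis using nd[of n m] le'[OF mn(2)] N by linarith
  qed
  qed
  then show ?thesis by blast
 qed
 obtain g where g: "g : A2 S" "(%n. nsq S (%z. P (H n) z - g z)) \<longlonglongrightarrow> 0"
  using bergman_complete[OF S, of "%n. P (H n)", OF Pb[OF H] cau] by blast
 have eq: "L2_inner S g a = c a" if a: "a : B" for a
 proof -
  have l: "(%n. L2_inner S (P (H n)) a) \<longlonglongrightarrow> L2_inner S g a"
  by (rule L2_inner_tendsto[OF S Pb[OF H] g(1) Bb[OF a] g(2)])
  show ?thesis
  proof (cases "EX n. a : H n")
  case True
  then obtain n0 where "a : H n0" by blast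
  then have "eventually (%n. L2_inner S (P (H n)) a = c a) sequentially"
  by (intro eventually_mono[OF eventually_ge_at_top[of n0]]) (use Pa[OF H a] Hm in auto)
  then have "(%n. L2_inner S (P (H n)) a) \<longlonglongrightarrow> c a" by (rule tendsto_eventually)
  then show ?thesis using l LIMSEQ_unique by blast
  next
  case False
  \<comment> \<open>Adjoining \<open>a\<close> to \<open>H n\<close> cannot raise the sum above
    \<open>s\<close>, while \<open>H n\<close> already comes within 1 / (n + 1).\<close>
  have "(cmod (c a))\<^sup>2 <= 1 / real (Suc n)" for n
  proof -
  have "(\<Sum>b\<in>insert a (H n). (cmod (c b))\<^sup>2) <= s" by (rule les) (use H a in auto)
  then show ?thesis using False H Hs[of n] by simp
  qed
  note small = this
  have "(cmod (c a))\<^sup>2 <= 0"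
  proof (rule field_le_epsilon)
  fix e :: real assume "e > 0"
  then obtain n where "1 / real (Suc n) < e" using nat_approx_posE by blast
  then show "(cmod (c a))\<^sup>2 <= 0 + e" using small[of n] by linarith
  qed
  then have "c a = 0" by simp
  then have "(%n. L2_inner S (P (H n)) a) \<longlonglongrightarrow> 0" using Pa[OF H a] False by simp
  then show ?thesis using l LIMSEQ_unique \<open>c a = 0\<close> by metis
  qed
 qed
 have fg: "f z = g z" if "z : S" for z
 proof -
  have "(%z. f z - g z) : A2 S" by (rule A2_diff[OF S f g(1)])
  moreover have "ALL a:B. L2_inner S (%z. f z - g z) a = 0"
  using L2_inner_diff_left[OF S f g(1)] eq Bb by (simp add: c_def)
  ultimately have "f z - g z = 0" using B that unfolding orthonormal_basis_def by blast
  then show ?thesis by simp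
 qed
 have "nsq S (%z. P (H n) z - g z) = nsq S (%z. f z - P (H n) z)" for n
 proof -
  have "nsq S (%z. P (H n) z - g z) = nsq S (%z. - (f z - P (H n) z))"
  by (rule nsq_cong) (simp add: fg)
  then show ?thesis by (simp only: norm_minus_cancel)
 qed
 then have "(%n. nsq S f - (\<Sum>a\<in>H n. (cmod (c a))\<^sup>2)) \<longlonglongrightarrow> 0" using g(2) dist[OF H] by simp
 moreover have "nsq S f - s <= nsq S f - (\<Sum>a\<in>H n. (cmod (c a))\<^sup>2)" for n using les[OF H] by simp
 ultimately have "nsq S f - s <= 0" by (meson LIMSEQ_le_const)
 moreover have "s <= nsq S f"
  unfolding s_def by (rule cSUP_least) (use le in auto)
 ultimately have "s = nsq S f" by simp
 then show ?thesis using hs s_def c_def by simp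
qed

text \<open>Each basis function satisfies a(w) = <a,k>, so the defining series is the Parseval sum
  of \<open>k\<close>. This frees \<open>bergman_kernel\<close> from the basis picked by
  \<open>SOME\<close>.\<close>

lemma bergman_kernel_eqI:
 assumes k: "k : A2 S" and rep: "!!f. f : A2 S ==> f w = L2_inner S f k"
 shows "bergman_kernel S w = nsq S k"
proof -
 let ?B = "SOME B. orthonormal_basis S B"
 have B: "orthonormal_basis S ?B" using orthonormal_basis_exists by (rule someI_ex)
 have "(cmod (a w))\<^sup>2 = (cmod (L2_inner S k a))\<^sup>2" if "a : ?B" for a
 proof -
  have "a : A2 S" using B that unfolding orthonormal_basis_def by blast
  then show ?thesis using rep[of a] L2_inner_commute[of S k a] by simp
 qed
 then have "bergman_kernel S w = (\<Sum>\<^sub>\<infinity>a\<in>?B. (cmod (L2_inner S k a))\<^sup>2)"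
  unfolding bergman_kernel_def by (rule infsum_cong)
 also have "... = nsq S k" using Parseval[OF B k] by (rule infsumI)
 finally show ?thesis .
qed

text \<open>Riesz representation of point evaluation, by minimizing the norm among functions with
  value 1 at \<open>w\<close>. The parallelogram law makes a minimizing sequence Cauchy, and the
  minimizer is orthogonal to all functions vanishing at \<open>w\<close>; a multiple of it
  represents the evaluation.\<close>

lemma brepresenter_exists:
 assumes w: "w : S"
 shows "EX k:A2 S. ALL f:A2 S. f w = L2_inner S f k"
proof (cases "ALL f:A2 S. f w = 0")
 case True
 show ?thesis
 proof (rule bexI[of _ "%_. 0"])
  show "ALL f:A2 S. f w = L2_inner S f (%_. 0)" using True by (simp add: L2_inner_def)
 qed (rule A2_zero)
next
 case False
 define A where "A = {f : A2 S. f w = 1}"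
 obtain f0 where f0: "f0 : A2 S" "f0 w ~= 0" using False by blast
 have "(%z. inverse (f0 w) * f0 z) : A"
  using A2_scale[OF S f0(1)] f0 by (simp add: A_def)
 then have ne: "A ~= {}" by blast
 define d where "d = (INF f\<in>A. nsq S f)"
 have bdd: "bdd_below (nsq S ` A)" by (auto intro!: bdd_belowI[of _ 0])
 have dle: "d <= nsq S f" if "f : A" for f
  unfolding d_def using that by (intro cINF_lower[OF bdd])
 have "EX f:A. nsq S f < d + 1 / real (Suc n)" for n
 proof -
  have "d < d + 1 / real (Suc n)" by simp
  then show ?thesis using cINF_less_iff[OF ne bdd, of "d + 1 / real (Suc n)"] unfolding d_def by blast
 qed
 then obtain f where f: "!!n. f n : A" "!!n. nsq S (f n) < d + 1 / real (Suc n)" by metis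
 have fb: "f n : A2 S" "f n w = 1" for n using f(1) by (auto simp: A_def)
 have par: "nsq S (%z. f m z - f n z) <= 2 / real (Suc m) + 2 / real (Suc n)" for m n
 proof -
  have mid: "(%z. (1/2) * (f m z + f n z)) : A"
  using A2_scale[OF S A2_add[OF S fb(1)[of m] fb(1)[of n]], of "1/2"] fb(2) by (simp add: A_def)
  have "d <= (cmod (1/2))\<^sup>2 * nsq S (%z. f m z + f n z)"
  using dle[OF mid] unfolding nsq_scale .
  then have d4: "4 * d <= nsq S (%z. f m z + f n z)" by (simp add: p2eq)
  have "nsq S (%z. f m z + f n z) + nsq S (%z. f m z - f n z) = 2 * nsq S (f m) + 2 * nsq S (f n)"
  using nsq_diff[OF S fb(1)[of m] fb(1)[of n], of "-1"] nsq_diff[OF S fb(1)[of m] fb(1)[of n], of 1] by simp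
  moreover have "2 * nsq S (f m) <= 2 * d + 2 / real (Suc m)" "2 * nsq S (f n) <= 2 * d + 2 / real (Suc n)"
  using f(2)[of m] f(2)[of n] by (simp_all add: field_simps)
  ultimately show ?thesis using d4 by linarith
 qed
 have cau: "EX N. ALL m>=N. ALL n>=N. nsq S (%z. f m z - f n z) <= e" if e: "e > 0" for e
 proof -
  obtain N where N: "1 / real (Suc N) < e / 4" using e nat_approx_posE[of "e / 4"] by auto
  have "2 / real (Suc k) <= e / 2" if "k >= N" for k
  proof -
  have "2 / real (Suc k) <= 2 / real (Suc N)" using that by (simp add: frac_le)
  then show ?thesis using N by simp
  qed
  then have "nsq S (%z. f m z - f n z) <= e" if "m >= N" "n >= N" for m n
  using par[of m n] that by (smt (verit) field_sum_of_halves)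
  then show ?thesis by blast
 qed
 obtain g where g: "g : A2 S" "(%n. nsq S (%z. f n z - g z)) \<longlonglongrightarrow> 0"
  "!!z. z : S ==> (%n. f n z) \<longlonglongrightarrow> g z"
  using bergman_complete[OF S fb(1) cau] by blast
 have "(%n. f n w) \<longlonglongrightarrow> 1" by (simp add: fb(2))
 then have gw: "g w = 1" using LIMSEQ_unique[OF g(3)[OF w]] by simp
 then have gA: "g : A" using g by (simp add: A_def)
 have gd: "nsq S g <= d"
 proof (rule field_le_epsilon)
  fix e :: real assume "e > 0"
  then obtain N where N: "1 / real (Suc N) < e" using nat_approx_posE by blast
  have "nsq S (f n) <= d + e" if "n >= N" for n
  proof -
  have "1 / real (Suc n) <= 1 / real (Suc N)" using that by (simp add: frac_le)
  then show ?thesis using f(2)[of n] N by linarith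
  qed
  then have "eventually (%n. nsq S (f n) <= d + e) sequentially" using eventually_sequentially by blast
  then show "nsq S g <= d + e"
  using bergman_fatou(2)[OF S fb(1) A2D(1)[OF g(1)] g(3)] by blast
 qed
 have orth: "L2_inner S h g = 0" if h: "h : A2 S" "h w = 0" for h
 proof -
  define I where "I = L2_inner S g h"
  have key: "0 <= 0 - 2 * s * (cmod I)\<^sup>2 + s\<^sup>2 * (cmod I)\<^sup>2 * nsq S h" for s :: real
  proof -
  have "(%z. g z - (of_real s * I) * h z) : A"
  using A2_diff[OF S g(1) A2_scale[OF S h(1)]] gw h(2) by (simp add: A_def)
  from dle[OF this] have "nsq S g <= nsq S (%z. g z - (of_real s * I) * h z)" using gd by linarith
  moreover have "Re (cnj (of_real s * I) * I) = s * (cmod I)\<^sup>2"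
  unfolding cmod_power2 by (simp add: p2eq algebra_simps)
  ultimately show ?thesis
  using nsq_diff[OF S g(1) h(1), of "of_real s * I"] by (simp add: I_def[symmetric] norm_mult power_mult_distrib)
  qed
  have "(cmod I)\<^sup>2 <= 0 * nsq S h" by (rule quadratic_nonneg_imp[OF key]) auto
  then have "I = 0" by simp
  then show ?thesis using L2_inner_commute[of S h g] by (simp add: I_def)
 qed
 have pos: "nsq S g ~= 0" using nsq_eq_0[OF S g(1) _ w] gw by auto
 let ?k = "%z. of_real (1 / nsq S g) * g z"
 show ?thesis
 proof (rule bexI[of _ ?k], rule ballI)
  show "?k : A2 S" by (rule A2_scale[OF S g(1)])
  fix h assume h: "h : A2 S"
  note sg = A2_scale[OF S g(1), of "h w"]
  have "L2_inner S (%z. h z - h w * g z) g = 0"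
  by (rule orth) (use A2_diff[OF S h sg] gw in auto)
  then have "L2_inner S h g = h w * of_real (nsq S g)"
  using L2_inner_diff_left[OF S h sg g(1)] by (simp add: L2_inner_scale_left L2_inner_self)
  then show "h w = L2_inner S h ?k"
  using pos unfolding L2_inner_scale_right by simp
 qed
qed

end

text \<open>\<open>brep S w z\<close> is the off-diagonal Bergman kernel K(z,w), holomorphic in
  \<open>z\<close> and antiholomorphic in \<open>w\<close>.\<close>

definition brep :: "complex set => complex => complex => complex" where
 "brep S w = (SOME k. k : A2 S & (ALL f:A2 S. f w = L2_inner S f k))"

context
 fixes S :: "complex set"
 assumes S: "open S"
begin

lemma brep:
 assumes "w : S"
 shows "brep S w : A2 S"
  and "f : A2 S ==> L2_inner S f (brep S w) = f w"
proof -
 have "EX k. k : A2 S & (ALL f:A2 S. f w = L2_inner S f k)"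
  using brepresenter_exists[OF S assms] by blast
 then have "brep S w : A2 S & (ALL f:A2 S. f w = L2_inner S f (brep S w))"
  unfolding brep_def by (rule someI_ex)
 then show "brep S w : A2 S"
  "f : A2 S ==> L2_inner S f (brep S w) = f w" by auto
qed

lemma brep_sym:
 assumes "w : S" "z : S"
 shows "brep S w z = cnj (brep S z w)"
 using brep(2)[OF assms(2) brep(1)[OF assms(1)]]
  brep(2)[OF assms(1) brep(1)[OF assms(2)]] L2_inner_commute
 by metis

lemma bergman_kernel_rep:
 assumes w: "w : S"
 shows "brep S w w = of_real (bergman_kernel S w)" "bergman_kernel S w = nsq S (brep S w)"
proof -
 show 1: "bergman_kernel S w = nsq S (brep S w)"
  by (rule bergman_kernel_eqI[OF S]) (use brep[OF w] in auto)
 show "brep S w w = of_real (bergman_kernel S w)"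
  unfolding 1 using brep(2)[OF w brep(1)[OF w]] by (simp add: L2_inner_self)
qed

text \<open>Applying the evaluation bound to K(.,w) itself gives K(w,w)^2 <= C K(w,w), hence a bound
  for the norm of K(.,w) uniform in \<open>w\<close>; a second evaluation bounds the kernel.\<close>

lemma bergman_kernel_bounded:
 assumes "compact K" "K <= S"
 obtains M where "!!w z. w : K ==> z : K ==> cmod (brep S w z) <= M"
proof -
 obtain C where C: "C > 0" "!!f z. f : A2 S ==> z : K ==> (cmod (f z))\<^sup>2 <= C * nsq S f"
  using bergman_compact_eval[OF S assms] by blast
 have n: "nsq S (brep S w) <= C" if w: "w : K" for w
 proof -
  have wS: "w : S" using w assms by auto
  have k: "bergman_kernel S w >= 0" using bergman_kernel_rep(2)[OF wS] by simp
  have "(bergman_kernel S w)\<^sup>2 <= C * bergman_kernel S w"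
  using C(2)[OF brep(1)[OF wS] w] k
  unfolding bergman_kernel_rep(1)[OF wS] bergman_kernel_rep(2)[OF wS, symmetric] by simp
  then have "bergman_kernel S w <= C"
  using k C(1) by (cases "bergman_kernel S w = 0") (auto simp: p2eq)
  then show ?thesis using bergman_kernel_rep(2)[OF wS] by simp
 qed
 have "cmod (brep S w z) <= C" if "w : K" "z : K" for w z
 proof -
  have wS: "w : S" using that assms by auto
  have "(cmod (brep S w z))\<^sup>2 <= C * C"
  using C(2)[OF brep(1)[OF wS] that(2)] n[OF that(1)] C(1)
  by (meson less_imp_le mult_left_mono order_trans)
  then show ?thesis using C(1) power2_le_imp_le[of _ C] by (simp add: p2eq)
 qed
 then show thesis by (rule that)
qed

end

section \<open>Polarization\<close>

text \<open>Separate holomorphy together with local boundedness: enough for Cauchy estimates in one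
  variable that are uniform in the other, and directly checked for the Bergman kernel.\<close>

definition hol2 :: "(complex => complex => complex) => complex set => complex set => bool" where
 "hol2 F A B \<longleftrightarrow> open A & open B & (ALL b:B. (%a. F a b) holomorphic_on A) & (ALL a:A. F a holomorphic_on B) &
  (ALL a:A. ALL b:B. EX r>0. EX M. ALL x:ball a r. ALL y:ball b r. cmod (F x y) <= M)"

definition D1 :: "(complex => complex => complex) => complex => complex => complex" where
 "D1 F a b = deriv (%x. F x b) a"

definition D2 :: "(complex => complex => complex) => complex => complex => complex" where
 "D2 F a b = deriv (F a) b"

lemma hol2_swap: "hol2 F A B \<longleftrightarrow> hol2 (%b a. F a b) B A"
 unfolding hol2_def by blast

lemma D1_swap: "D1 (%b a. F a b) = (%b a. D2 F a b)"
 by (simp add: D1_def D2_def fun_eq_iff)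

lemma hol2_box:
 assumes "hol2 F A B" "a : A" "b : B"
 shows "EX r>0. EX M>0. cball a r <= A & cball b r <= B & (ALL x:cball a r. ALL y:cball b r. cmod (F x y) <= M)"
proof -
 obtain r1 where r1: "r1 > 0" "cball a r1 <= A" using assms open_contains_cball unfolding hol2_def by meson
 obtain r2 where r2: "r2 > 0" "cball b r2 <= B" using assms open_contains_cball unfolding hol2_def by meson
 obtain r3 M where r3: "r3 > 0" "ALL x:ball a r3. ALL y:ball b r3. cmod (F x y) <= M" using assms unfolding hol2_def by meson
 define r where "r = Min {r1, r2, r3 / 2}"
 have r: "r > 0" "r <= r1" "r <= r2" "r < r3" using r1 r2 r3 by (auto simp: r_def)
 have "cball a r <= ball a r3" "cball b r <= ball b r3" using r by auto
 then have "cmod (F x y) <= max M 1" if "x : cball a r" "y : cball b r" for x y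
  using r3(2) that by (meson max.coboundedI1 subsetD)
 moreover have "cball a r <= A" "cball b r <= B" using r r1 r2 by auto
 ultimately show ?thesis using r(1) by (intro exI[of _ r] conjI exI[of _ "max M 1"]) auto
qed

lemma hol2_D1_deriv:
 assumes "hol2 F A B" "a : A" "b : B"
 shows "((%x. F x b) has_field_derivative D1 F a b) (at a)"
 using assms holomorphic_derivI unfolding hol2_def D1_def by blast

lemma hol2_D2_deriv:
 assumes "hol2 F A B" "a : A" "b : B"
 shows "(F a has_field_derivative D2 F a b) (at b)"
 using assms holomorphic_derivI unfolding hol2_def D2_def by blast

text \<open>Cauchy's inequality on discs of radius r / 4 centred in the half disc gives |f'| <= 4 M
  / r and |f''| <= 2 M (4 / r)^2 = 32 M / r^2; Taylor's formula does the rest.\<close>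

lemma hol2_lipschitz_aux:
 assumes f: "f holomorphic_on ball a r" and M: "!!x. x : ball a r ==> cmod (f x) <= M" and r: "r > 0"
  and x: "x : ball a (r/2)"
 shows "cmod (deriv f x) <= 4 * M / r" "cmod (f x - f a) <= 4 * M / r * cmod (x - a)"
  "cmod (f x - f a - deriv f a * (x - a)) <= 32 * M / r\<^sup>2 * (cmod (x - a))\<^sup>2"
proof -
 have M0: "M >= 0" using M[of a] r by (smt (verit) centre_in_ball norm_ge_zero)
 have hd: "cmod ((deriv ^^ n) f y) <= fact n * M / (r/4) ^ n" if y: "y : ball a (r/2)" for y n
 proof (rule Cauchy_inequality)
  have sub: "cball y (r/4) <= ball a r"
  proof
  fix u assume "u : cball y (r/4)"
  then show "u : ball a r" using y r dist_triangle[of a u y] by simp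
  qed
  show "f holomorphic_on ball y (r/4)" using f sub hol_subset ball_subset_cball by blast
  show "continuous_on (cball y (r/4)) f"
  using f sub hol_cont continuous_on_subset by blast
  show "0 < r/4" using r by simp
  show "norm (f x) <= M" if "norm (y - x) = r/4" for x
  using M[of x] sub that by (auto simp: dist_norm)
 qed
 have d1: "cmod (deriv f y) <= 4 * M / r" if "y : ball a (r/2)" for y
  using hd[OF that, of 1] by (simp add: mult.commute)
 then show "cmod (deriv f x) <= 4 * M / r" using x by blast
 have fd: "(f has_field_derivative deriv f y) (at y within ball a (r/2))" if "y : ball a (r/2)" for y
 proof -
  have "y : ball a r" using that r by simp
  then show ?thesis using holomorphic_derivI[OF f open_ball] has_field_derivative_at_within by blast
 qed
 show "cmod (f x - f a) <= 4 * M / r * cmod (x - a)"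
  by (rule field_differentiable_bound[of "ball a (r/2)" f "deriv f"]) (use fd d1 x r in auto)
 have f2: "(deriv f has_field_derivative deriv (deriv f) y) (at y within ball a (r/2))" if "y : ball a (r/2)" for y
 proof -
  have "y : ball a r" using that r by simp
  moreover have "deriv f holomorphic_on ball a r" using f by (simp add: holomorphic_deriv)
  ultimately show ?thesis using holomorphic_derivI[OF _ open_ball] has_field_derivative_at_within by blast
 qed
 have d2: "cmod (deriv (deriv f) y) <= 32 * M / r\<^sup>2" if "y : ball a (r/2)" for y
  using hd[OF that, of 2] by (simp add: numeral_2_eq_2 p2eq)
 define G where "G i = (if i = 0 then f else if i = 1 then deriv f else deriv (deriv f))" for i :: nat
 have "cmod (G 0 x - (\<Sum>i\<le>1. G i a * (x - a) ^ i / fact i)) <= 32 * M / r\<^sup>2 * cmod (x - a) ^ Suc 1 / fact 1"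
 proof (rule complex_Taylor[of "ball a (r/2)"])
  show "convex (ball a (r/2))" by simp
  show "(G i has_field_derivative G (Suc i) x) (at x within ball a (r / 2))" if "x : ball a (r/2)" "i <= 1" for i x
  proof (cases "i = 0")
  case True then show ?thesis using fd[OF that(1)] by (simp add: G_def)
  next
  case False then have "i = 1" using that by simp
  then show ?thesis using f2[OF that(1)] by (simp add: G_def)
  qed
  show "cmod (G (Suc 1) x) <= 32 * M / r\<^sup>2" if "x : ball a (r/2)" for x using d2[OF that] by (simp add: G_def)
 qed (use x r in auto)
 then show "cmod (f x - f a - deriv f a * (x - a)) <= 32 * M / r\<^sup>2 * (cmod (x - a))\<^sup>2"
  by (simp add: G_def p2eq algebra_simps)
qed

lemma hol2_subset: "hol2 F A B ==> A' <= A ==> B' <= B ==> open A' ==> open B' ==> hol2 F A' B'"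
 unfolding hol2_def by (meson hol_subset subsetD)

lemma hol2_section: "hol2 F A B ==> b : B ==> (%x. F x b) holomorphic_on A" "hol2 F A B ==> a : A ==> F a holomorphic_on B"
 unfolding hol2_def by auto

lemma hol2_section_ball:
 assumes "hol2 F A B" "cball a r <= A" "cball b r <= B" "y : cball b r"
 shows "(%x. F x y) holomorphic_on ball a r"
proof (rule hol_subset)
 show "(%x. F x y) holomorphic_on A" by (rule hol2_section(1)[OF assms(1)]) (use assms in auto)
 show "ball a r <= A" using assms(2) ball_subset_cball by (rule order_trans[rotated])
qed

text \<open>The quadratic Taylor error is bounded independently of the second variable, so
  difference quotients along a fixed null sequence converge uniformly in it. Holomorphy of
  \<open>D1 F\<close> in the second variable and the interchange of derivatives both come from
  this.\<close>

lemma hol2_D1_limit: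
 assumes F: "hol2 F A B" and a: "a : A" and b: "b : B"
 shows "EX r>0. EX t::nat => complex. ball b r <= B & (ALL n. t n ~= 0) & (ALL n. a + t n : A) & t \<longlonglongrightarrow> 0 &
  uniform_limit (ball b r) (%n y. (F (a + t n) y - F a y) / t n) (D1 F a) sequentially"
proof -
 obtain r M where rM: "r > 0" "M > 0" "cball a r <= A" "cball b r <= B"
  "ALL x:cball a r. ALL y:cball b r. cmod (F x y) <= M"
  using hol2_box[OF F a b] by blast
 define t where "t n = cor (r / 2 * (1 / real (n + 2)))" for n
 have tn: "cmod (t n) = r / 2 * (1 / real (n + 2))" for n unfolding t_def norm_of_real using rM(1) by simp
 have lt1: "1 / real (n + 2) < 1" for n by simp
 have tlt: "cmod (t n) < r / 2" for n unfolding tn using mult_strict_left_mono[OF lt1[of n], of "r / 2"] rM(1) by simp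
 have t0: "t \<longlonglongrightarrow> 0"
 proof -
  have "(%n. cor (r / 2 * (1 / real (n + 2)))) \<longlonglongrightarrow> cor (r / 2 * 0)"
  by (intro tendsto_intros LIMSEQ_ignore_initial_segment[OF lim_1_over_n])
  then show ?thesis by (simp add: t_def[abs_def])
 qed
 have tnz: "t n ~= 0" for n
 proof -
  have "cmod (t n) > 0" unfolding tn using rM(1) by simp
  then show ?thesis by auto
 qed
 have tA: "a + t n : A" for n
 proof -
  have "a + t n : cball a r" using tlt[of n] rM(1) by (simp add: dist_norm)
  then show ?thesis using rM(3) by blast
 qed
 have est: "cmod ((F (a + t n) y - F a y) / t n - D1 F a y) <= 32 * M / r\<^sup>2 * cmod (t n)" if y: "y : ball b r" for n y
 proof -
  have yB: "y : cball b r" using y by simp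
  have h: "(%x. F x y) holomorphic_on ball a r"
  by (rule hol2_section_ball[OF F rM(3,4) yB])
  have "cmod (F (a + t n) y - F a y - deriv (%x. F x y) a * (a + t n - a)) <= 32 * M / r\<^sup>2 * (cmod (a + t n - a))\<^sup>2"
  by (rule hol2_lipschitz_aux(3)[OF h]) (use rM yB tlt[of n] in \<open>auto simp: dist_norm\<close>)
  then have "cmod (F (a + t n) y - F a y - D1 F a y * t n) <= 32 * M / r\<^sup>2 * (cmod (t n))\<^sup>2"
  by (simp add: D1_def)
  moreover have "(F (a + t n) y - F a y) / t n - D1 F a y = (F (a + t n) y - F a y - D1 F a y * t n) / t n"
  using tnz[of n] by (simp add: field_simps)
  ultimately show ?thesis
  using tnz[of n] by (simp add: norm_divide divide_le_eq p2eq mult.assoc)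
 qed
 have "uniform_limit (ball b r) (%n y. (F (a + t n) y - F a y) / t n) (D1 F a) sequentially"
 proof (rule uniform_limitI)
  fix e :: real assume e: "e > 0"
  have "(%n. 32 * M / r\<^sup>2 * cmod (t n)) \<longlonglongrightarrow> 32 * M / r\<^sup>2 * cmod 0"
  by (intro tendsto_intros t0)
  then have "eventually (%n. 32 * M / r\<^sup>2 * cmod (t n) < e) sequentially"
  by (rule order_tendstoD(2)) (use e in simp)
  then show "eventually (%n. ALL y:ball b r. dist ((F (a + t n) y - F a y) / t n) (D1 F a y) < e) sequentially"
  proof (rule eventually_mono)
  fix n assume n: "32 * M / r\<^sup>2 * cmod (t n) < e"
  show "ALL y:ball b r. dist ((F (a + t n) y - F a y) / t n) (D1 F a y) < e"
  proof
  fix y assume "y : ball b r"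
  from est[OF this, of n] n show "dist ((F (a + t n) y - F a y) / t n) (D1 F a y) < e"
  unfolding dist_norm by linarith
  qed
  qed
 qed
 moreover have "ball b r <= B" using rM(4) by auto
 ultimately show ?thesis using rM(1) tnz tA t0 by blast
qed

lemma hol2_D1:
 assumes F: "hol2 F A B"
 shows "hol2 (D1 F) A B"
 unfolding hol2_def
proof (intro conjI ballI)
 show o: "open A" "open B" using F by (auto simp: hol2_def)
 show "(%a. D1 F a b) holomorphic_on A" if "b : B" for b
  unfolding D1_def by (rule holomorphic_deriv[OF hol2_section(1)[OF F that] o(1)])
 show "D1 F a holomorphic_on B" if a: "a : A" for a
  unfolding holomorphic_on_def
 proof
  fix b assume b: "b : B"
  obtain r t where rt: "r > 0" "ball b r <= B" "ALL n::nat. t n ~= 0" "ALL n. a + t n : A" "t \<longlonglongrightarrow> 0"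
  "uniform_limit (ball b r) (%n y. (F (a + t n) y - F a y) / t n) (D1 F a) sequentially"
  using hol2_D1_limit[OF F a b] by blast
  have "D1 F a holomorphic_on ball b r"
  proof (rule holomorphic_uniform_sequence[OF open_ball])
  show "(%y. (F (a + t n) y - F a y) / t n) holomorphic_on ball b r" for n
  by (intro holomorphic_intros hol_subset[OF hol2_section(2)[OF F] rt(2)]) (use rt a in auto)
  fix x assume "x : ball b r"
  then obtain d where "d > 0" "cball x d <= ball b r" using open_contains_cball open_ball by metis
  then show "EX d>0. cball x d <= ball b r & uniform_limit (cball x d) (%n y. (F (a + t n) y - F a y) / t n) (D1 F a) sequentially"
  using uniform_limit_on_subset[OF rt(6)] by blast
  qed
  then have "D1 F a field_differentiable at b"
  using rt(1) holomorphic_on_imp_differentiable_at[OF _ open_ball] by auto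
  then show "D1 F a field_differentiable at b within B" using field_differentiable_at_within by blast
 qed
 fix a b assume ab: "a : A" "b : B"
 obtain r M where rM: "r > 0" "M > 0" "cball a r <= A" "cball b r <= B"
  "ALL x:cball a r. ALL y:cball b r. cmod (F x y) <= M"
  using hol2_box[OF F ab] by blast
 have "cmod (D1 F x y) <= 4 * M / r" if xy: "x : ball a (r/2)" "y : ball b (r/2)" for x y
 proof -
  have yB: "y : cball b r" using xy rM(1) by simp
  have h: "(%x. F x y) holomorphic_on ball a r"
  by (rule hol2_section_ball[OF F rM(3,4) yB])
  show ?thesis unfolding D1_def
  by (rule hol2_lipschitz_aux(1)[OF h]) (use rM yB xy in auto)
 qed
 then show "EX r>0. EX M. ALL x:ball a r. ALL y:ball b r. cmod (D1 F x y) <= M"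
  using rM(1) half_gt_zero by blast
qed

lemma hol2_D2:
 assumes "hol2 F A B" shows "hol2 (D2 F) A B"
proof -
 have "hol2 (%b a. F a b) B A" by (rule hol2_swap[THEN iffD1, OF assms])
 from hol2_D1[OF this] have "hol2 (%b a. D2 F a b) B A" unfolding D1_swap .
 then show ?thesis by (rule hol2_swap[THEN iffD2])
qed

text \<open>The derivative in the second variable passes through the locally uniform limit of the
  difference quotients.\<close>

lemma hol2_D1_D2_commute:
 assumes F: "hol2 F A B" and a: "a : A" and b: "b : B"
 shows "D2 (D1 F) a b = D1 (D2 F) a b"
proof -
 obtain r t where rt: "r > 0" "ball b r <= B" "ALL n::nat. t n ~= 0" "ALL n. a + t n : A" "t \<longlonglongrightarrow> 0"
  "uniform_limit (ball b r) (%n y. (F (a + t n) y - F a y) / t n) (D1 F a) sequentially"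
  using hol2_D1_limit[OF F a b] by blast
 have "(%n. (deriv ^^ 1) (%y. (F (a + t n) y - F a y) / t n) b) \<longlonglongrightarrow> (deriv ^^ 1) (D1 F a) b"
 proof (rule higher_deriv_complex_uniform_limit[OF rt(6)])
  show "\<forall>\<^sub>F n in sequentially. (%y. (F (a + t n) y - F a y) / t n) holomorphic_on ball b r"
  by (intro always_eventually allI holomorphic_intros hol_subset[OF hol2_section(2)[OF F] rt(2)])
  (use rt a in auto)
 qed (use rt(1) in auto)
 moreover have "deriv (%y. (F (a + t n) y - F a y) / t n) b = (D2 F (a + t n) b - D2 F a b) / t n" for n
  by (rule DERIV_imp_deriv)
  (auto intro!: derivative_eq_intros hol2_D2_deriv[OF F] simp: rt a b)
 ultimately have "(%n. (D2 F (a + t n) b - D2 F a b) / t n) \<longlonglongrightarrow> D2 (D1 F) a b"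
  by (simp add: D2_def)
 moreover have "(%n. (D2 F (a + t n) b - D2 F a b) / t n) \<longlonglongrightarrow> D1 (D2 F) a b"
 proof -
  have "((%h. (D2 F (a + h) b - D2 F a b) / h) \<longlongrightarrow> D1 (D2 F) a b) (at 0)"
  using hol2_D1_deriv[OF hol2_D2[OF F] a b] by (simp add: DERIV_def)
  moreover have "filterlim t (at 0) sequentially"
  using rt(3,5) by (simp add: filterlim_at)
  ultimately show ?thesis by (rule filterlim_compose)
 qed
 ultimately show ?thesis by (rule LIMSEQ_unique)
qed

lemma hol2_isCont:
 assumes F: "hol2 F A B" and a: "a : A" and b: "b : B"
 shows "isCont (%p. F (fst p) (snd p)) (a, b)"
proof -
 obtain r M where rM: "r > 0" "M > 0" "cball a r <= A" "cball b r <= B"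
  "ALL x:cball a r. ALL y:cball b r. cmod (F x y) <= M"
  using hol2_box[OF F a b] by blast
 have est: "cmod (F x y - F a b) <= 4 * M / r * cmod (x - a) + cmod (F a y - F a b)"
  if "x : ball a (r/2)" "y : ball b r" for x y
 proof -
  have h: "(%x. F x y) holomorphic_on ball a r"
  by (rule hol2_section_ball[OF F rM(3,4)]) (use that in auto)
  have "cmod (F x y - F a y) <= 4 * M / r * cmod (x - a)"
  by (rule hol2_lipschitz_aux(2)[OF h]) (use rM that in auto)
  then show ?thesis using norm_triangle_ineq[of "F x y - F a y" "F a y - F a b"] by simp
 qed
 have cF: "isCont (F a) b" using hol2_D2_deriv[OF F a b] DERIV_isCont by blast
 have lim: "((%p. 4 * M / r * cmod (fst p - a) + cmod (F a (snd p) - F a b)) \<longlongrightarrow> 4 * M / r * cmod (a - a) + cmod (F a b - F a b)) (at (a, b))"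
 proof -
  have "isCont snd (a, b)" "isCont fst (a, b)"
  unfolding isCont_def by (intro tendsto_snd[OF tendsto_ident_at] tendsto_fst[OF tendsto_ident_at])+
  moreover then have "isCont (%p. F a (snd p)) (a, b)"
  by (intro isCont_o2[of "(a, b)" snd "F a"]) (use cF in auto)
  ultimately have "isCont (%p. 4 * M / r * cmod (fst p - a) + cmod (F a (snd p) - F a b)) (a, b)"
  by (intro continuous_intros)
  then show ?thesis unfolding isCont_def by simp
 qed
 have "((%p. F (fst p) (snd p) - F a b) \<longlongrightarrow> 0) (at (a, b))"
 proof (rule Lim_null_comparison)
  show "((%p. 4 * M / r * cmod (fst p - a) + cmod (F a (snd p) - F a b)) \<longlongrightarrow> 0) (at (a, b))" using lim by simp
  have "open (ball a (r/2) \<times> ball b r)" by (intro open_Times open_ball)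
  then have "eventually (%p. p : ball a (r/2) \<times> ball b r) (nhds (a, b))"
  using rM(1) by (intro eventually_nhds_in_open) auto
  then have "eventually (%p. p : ball a (r/2) \<times> ball b r) (at (a, b))"
  using eventually_nhds_conv_at by blast
  then show "eventually (%p. norm (F (fst p) (snd p) - F a b) <= 4 * M / r * cmod (fst p - a) + cmod (F a (snd p) - F a b)) (at (a, b))"
  by (rule eventually_mono) (use est in auto)
 qed
 then have "((%p. F (fst p) (snd p)) \<longlongrightarrow> F a b) (at (a, b))" by (rule LIM_zero_cancel)
 then show ?thesis by (simp add: isCont_def)
qed

lemma hol2_nonzero_nbhd:
 assumes F: "hol2 F A B" and a: "a : A" and b: "b : B" and P: "open V" "F a b : V"
 shows "EX r>0. ball a r <= A & ball b r <= B & (ALL x:ball a r. ALL y:ball b r. F x y : V)"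
proof -
 define g where "g p = F (fst p) (snd p)" for p
 have "isCont g (a, b)" using hol2_isCont[OF F a b] by (simp add: g_def[abs_def])
 then have "(g \<longlongrightarrow> g (a, b)) (nhds (a, b))" unfolding isCont_def tendsto_at_iff_tendsto_nhds .
 then have "((%p. F (fst p) (snd p)) \<longlongrightarrow> F a b) (nhds (a, b))" by (simp add: g_def[abs_def])
 then have "eventually (%p. F (fst p) (snd p) : V) (nhds (a, b))"
  using P topological_tendstoD by blast
 then obtain U where U: "open U" "(a, b) : U" "ALL p:U. F (fst p) (snd p) : V"
  unfolding eventually_nhds by blast
 then obtain U1 U2 where U12: "open U1" "open U2" "a : U1" "b : U2" "U1 \<times> U2 <= U"
  unfolding open_prod_def by (metis SigmaE2 mem_Sigma_iff)
 have "open (U1 Int A)" "open (U2 Int B)" using U12 F by (auto simp: hol2_def)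
 then obtain r1 r2 where r: "r1 > 0" "ball a r1 <= U1 Int A" "r2 > 0" "ball b r2 <= U2 Int B"
  using U12 a b unfolding open_contains_ball by (metis IntI)
 have "F x y : V" if "x : ball a (min r1 r2)" "y : ball b (min r1 r2)" for x y
 proof -
  have "x : ball a r1" "y : ball b r2" using that by auto
  then have "x : U1" "y : U2" using r by blast+
  then have "(x, y) : U" using U12(5) by blast
  then show ?thesis using U(3) by force
 qed
 then show ?thesis using r by (intro exI[of _ "min r1 r2"]) auto
qed

lemma hol2_left: "f holomorphic_on A ==> open A ==> open B ==> hol2 (%a b. f a) A B"
proof -
 assume f: "f holomorphic_on A" "open A" "open B"
 have "EX r>0. EX M. ALL x:ball a r. cmod (f x) <= M" if a: "a : A" for a
 proof -
  obtain r where r: "r > 0" "cball a r <= A" using f a open_contains_cball by meson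
  then have "continuous_on (cball a r) f"
  using f hol_cont continuous_on_subset by blast
  then have "bounded (f ` cball a r)" using compact_cball compact_continuous_image compact_imp_bounded by blast
  then obtain M where "ALL x:cball a r. cmod (f x) <= M" unfolding bounded_iff by blast
  then show ?thesis using r(1) ball_subset_cball by blast
 qed
 then show ?thesis using f unfolding hol2_def by (intro conjI ballI holomorphic_intros) blast+
qed

lemma hol2_right: "f holomorphic_on B ==> open A ==> open B ==> hol2 (%a b. f b) A B"
 using hol2_left[of f B A] hol2_swap[of "%a b. f b" A B] by simp

lemma hol2_mult:
 assumes F: "hol2 F A B" and G: "hol2 G A B"
 shows "hol2 (%a b. F a b * G a b) A B"
 unfolding hol2_def
proof (intro conjI ballI)
 show "open A" "open B" using F by (auto simp: hol2_def)
 fix a b assume ab: "a : A" "b : B"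
 obtain r M where 1: "r > 0" "ALL x:cball a r. ALL y:cball b r. cmod (F x y) <= M"
  using hol2_box[OF F ab] by blast
 obtain s N where 2: "s > 0" "ALL x:cball a s. ALL y:cball b s. cmod (G x y) <= N"
  using hol2_box[OF G ab] by blast
 have "cmod (F x y * G x y) <= M * N" if "x : ball a (min r s)" "y : ball b (min r s)" for x y
 proof -
  have "cmod (F x y) <= M" "cmod (G x y) <= N" using 1(2) 2(2) that by auto
  then show ?thesis unfolding norm_mult by (intro mult_mono) (auto intro: order_trans[OF norm_ge_zero])
 qed
 then show "EX r>0. EX M. ALL x:ball a r. ALL y:ball b r. cmod (F x y * G x y) <= M"
  using 1(1) 2(1) by (intro exI[of _ "min r s"] conjI exI[of _ "M * N"]) auto
qed (use F G in \<open>auto simp: hol2_def intro!: holomorphic_intros\<close>)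

lemma hol2_add:
 assumes F: "hol2 F A B" and G: "hol2 G A B"
 shows "hol2 (%a b. F a b + G a b) A B"
 unfolding hol2_def
proof (intro conjI ballI)
 show "open A" "open B" using F by (auto simp: hol2_def)
 fix a b assume ab: "a : A" "b : B"
 obtain r M where 1: "r > 0" "ALL x:cball a r. ALL y:cball b r. cmod (F x y) <= M"
  using hol2_box[OF F ab] by blast
 obtain s N where 2: "s > 0" "ALL x:cball a s. ALL y:cball b s. cmod (G x y) <= N"
  using hol2_box[OF G ab] by blast
 have "cmod (F x y + G x y) <= M + N" if "x : ball a (min r s)" "y : ball b (min r s)" for x y
  using 1(2) 2(2) that by (intro norm_triangle_mono) auto
 then show "EX r>0. EX M. ALL x:ball a r. ALL y:ball b r. cmod (F x y + G x y) <= M"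
  using 1(1) 2(1) by (intro exI[of _ "min r s"] conjI exI[of _ "M + N"]) auto
qed (use F G in \<open>auto simp: hol2_def intro!: holomorphic_intros\<close>)

lemma hol2_const: "open A ==> open B ==> hol2 (%a b. c) A B"
 by (rule hol2_left) auto

lemma hol2_cmult: "hol2 F A B ==> hol2 (%a b. c * F a b) A B"
 by (rule hol2_mult[OF hol2_const]) (auto simp: hol2_def)

lemma hol2_diff: "hol2 F A B ==> hol2 G A B ==> hol2 (%a b. F a b - G a b) A B"
 using hol2_add[of F A B "%a b. -1 * G a b"] hol2_cmult[of G A B "-1"] by simp

lemma hol2_power: "hol2 F A B ==> hol2 (%a b. F a b ^ n) A B"
proof (induction n)
 case 0 then show ?case using hol2_const[of A B 1] by (simp add: hol2_def)
next
 case (Suc n) then show ?case using hol2_mult by auto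
qed

lemma hol2_compose:
 assumes F: "hol2 F A B" and g: "g holomorphic_on V" "open V" and V: "!!a b. a : A ==> b : B ==> F a b : V"
 shows "hol2 (%a b. g (F a b)) A B"
 unfolding hol2_def
proof (intro conjI ballI)
 show "open A" "open B" using F by (auto simp: hol2_def)
 show "(%a. g (F a b)) holomorphic_on A" if "b : B" for b
  using hol_compose[OF hol2_section(1)[OF F that] g(1)] V that by (auto simp: o_def)
 show "(%b. g (F a b)) holomorphic_on B" if "a : A" for a
  using hol_compose[OF hol2_section(2)[OF F that] g(1)] V that by (auto simp: o_def)
 fix a b assume ab: "a : A" "b : B"
 have "isCont g (F a b)"
  using g V[OF ab] hol_cont continuous_on_eq_continuous_at by blast
 then have "eventually (%w. g w : ball (g (F a b)) 1) (nhds (F a b))"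
  unfolding isCont_def tendsto_at_iff_tendsto_nhds by (rule topological_tendstoD) auto
 then obtain W where W: "open W" "F a b : W" "ALL w:W. g w : ball (g (F a b)) 1"
  unfolding eventually_nhds by blast
 obtain r where r: "r > 0" "ALL x:ball a r. ALL y:ball b r. F x y : W"
  using hol2_nonzero_nbhd[OF F ab W(1,2)] by blast
 have "cmod (g (F x y)) <= cmod (g (F a b)) + 1" if "x : ball a r" "y : ball b r" for x y
 proof -
  have "dist (g (F a b)) (g (F x y)) < 1" using W(3) r(2) that by auto
  then show ?thesis using norm_triangle_sub[of "g (F x y)" "g (F a b)"] by (simp add: dist_norm norm_minus_commute)
 qed
 then show "EX r>0. EX M. ALL x:ball a r. ALL y:ball b r. cmod (g (F x y)) <= M" using r(1) by blast
qed

lemma hol2_divide: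
 assumes F: "hol2 F A B" and G: "hol2 G A B" and nz: "!!a b. a : A ==> b : B ==> G a b ~= 0"
 shows "hol2 (%a b. F a b / G a b) A B"
proof -
 have "hol2 (%a b. inverse (G a b)) A B"
  by (rule hol2_compose[OF G, of inverse "- {0}"]) (use nz in \<open>auto intro!: holomorphic_intros\<close>)
 from hol2_mult[OF F this] show ?thesis by (simp add: divide_inverse)
qed

section \<open>Wirtinger derivatives of functions restricted to the pairs (z, cnj z)\<close>

definition has_wirt :: "(complex => complex) => complex => complex => complex => bool" where
 "has_wirt f A B z \<longleftrightarrow> (f has_derivative (%h. A * h + B * cnj h)) (at z)"

lemma
 assumes "has_wirt f A B z"
 shows has_wirt_d_dz: "d_dz f z = A" and has_wirt_d_dzbar: "d_dzbar f z = B"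
proof -
 have fd: "frechet_derivative f (at z) = (%h. A * h + B * cnj h)"
  using frechet_derivative_at[OF assms[unfolded has_wirt_def]] by (rule sym)
 show "d_dz f z = A" "d_dzbar f z = B"
  unfolding d_dz_def d_dzbar_def fd by (simp_all add: algebra_simps)
qed

lemma has_wirt_transform:
 assumes "has_wirt f A B z" "open U" "z : U" "!!w. w : U ==> f w = g w"
 shows "has_wirt g A B z"
 using assms has_derivative_transform_within_open unfolding has_wirt_def by blast

lemma has_wirt_unique:
 assumes "has_wirt f A B z" "has_wirt f A' B' z" shows "A = A'" "B = B'"
 using has_wirt_d_dz has_wirt_d_dzbar assms by metis+

lemma has_wirt_zero: "has_wirt (%_. 0) 0 0 z"
 by (simp add: has_wirt_def)

lemma hol2_has_wirt:
 assumes F: "hol2 F A B" and z: "z : A" "cnj z : B"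
 shows "has_wirt (%z. F z (cnj z)) (D1 F z (cnj z)) (D2 F z (cnj z)) z"
proof -
 let ?b = "cnj z"
 obtain r M where rM: "r > 0" "M > 0" "cball z r <= A" "cball ?b r <= B"
  "ALL x:cball z r. ALL y:cball ?b r. cmod (F x y) <= M"
  using hol2_box[OF F z] by blast
 have c1: "isCont (%y. D1 F z y) ?b"
  using hol2_section(2)[OF hol2_D1[OF F] z(1)] F z(2) hol_cont continuous_on_eq_continuous_at
  unfolding hol2_def by blast
 define e where "e h = 32 * M / r\<^sup>2 * cmod h + cmod (D1 F z (cnj (z + h)) - D1 F z ?b) + 32 * M / r\<^sup>2 * cmod h" for h :: complex
 have est: "cmod (F (z + h) (cnj (z + h)) - F z ?b - (D1 F z ?b * h + D2 F z ?b * cnj h)) <= e h * cmod h"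
  if h: "cmod h < r / 2" for h :: complex
 proof -
  let ?y = "cnj (z + h)"
  have y: "?y : cball ?b r" using h rM(1) by (simp add: dist_norm)
  have h1: "(%x. F x ?y) holomorphic_on ball z r"
  by (rule hol2_section_ball[OF F rM(3,4) y])
  have e1: "cmod (F (z + h) ?y - F z ?y - D1 F z ?y * h) <= 32 * M / r\<^sup>2 * (cmod h)\<^sup>2"
  using hol2_lipschitz_aux(3)[OF h1, of M "z + h"] rM y h by (auto simp: dist_norm D1_def)
  have h2: "F z holomorphic_on ball ?b r"
  using hol2_section(2)[OF F z(1)] rM(4) hol_subset ball_subset_cball by blast
  have e2: "cmod (F z ?y - F z ?b - D2 F z ?b * cnj h) <= 32 * M / r\<^sup>2 * (cmod h)\<^sup>2"
  using hol2_lipschitz_aux(3)[OF h2, of M ?y] rM h by (auto simp: dist_norm D2_def)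
  have tri: "cmod (X + Y + W) <= x + cmod Y + w" if "cmod X <= x" "cmod W <= w" for X Y W :: complex and x w
  using norm_triangle_ineq[of "X + Y" W] norm_triangle_ineq[of X Y] that by linarith
  \<comment> \<open>The increment is taken in the second variable at fixed \<open>z\<close> and in
    the first at the moved second argument; the middle term corrects \<open>D1\<close> and is small
    by continuity.\<close>
  have eq: "F (z + h) ?y - F z ?b - (D1 F z ?b * h + D2 F z ?b * cnj h)
  = (F (z + h) ?y - F z ?y - D1 F z ?y * h) + (D1 F z ?y - D1 F z ?b) * h + (F z ?y - F z ?b - D2 F z ?b * cnj h)"
  by (simp add: left_diff_distrib)
  have "cmod (F (z + h) ?y - F z ?b - (D1 F z ?b * h + D2 F z ?b * cnj h))
  <= 32 * M / r\<^sup>2 * (cmod h)\<^sup>2 + cmod (D1 F z ?y - D1 F z ?b) * cmod h + 32 * M / r\<^sup>2 * (cmod h)\<^sup>2"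
  unfolding eq using tri[OF e1 e2, of "(D1 F z ?y - D1 F z ?b) * h"] by (simp only: norm_mult)
  also have "... = e h * cmod h" by (simp add: e_def algebra_simps p2eq)
  finally show ?thesis .
 qed
 have e0: "(e \<longlongrightarrow> 0) (at 0)"
 proof -
  have "((%h. D1 F z (cnj (z + h))) \<longlongrightarrow> D1 F z ?b) (at 0)"
  proof (rule isCont_tendsto_compose[OF c1])
  have "((%h. cnj (z + h)) \<longlongrightarrow> cnj (z + 0)) (at 0)" by (intro tendsto_intros)
  then show "((%h. cnj (z + h)) \<longlongrightarrow> ?b) (at 0)" by simp
  qed
  then have "(e \<longlongrightarrow> 32 * M / r\<^sup>2 * cmod 0 + cmod (D1 F z ?b - D1 F z ?b) + 32 * M / r\<^sup>2 * cmod 0) (at 0)"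
  unfolding e_def by (intro tendsto_intros)
  then show ?thesis by simp
 qed
 show ?thesis
  unfolding has_wirt_def has_derivative_at
 proof
  show "bounded_linear (%h. D1 F z ?b * h + D2 F z ?b * cnj h)"
  by (intro bounded_linear_add bounded_linear_mult_right bounded_linear_compose[OF bounded_linear_mult_right bounded_linear_cnj])
  show "(%h. norm (F (z + h) (cnj (z + h)) - F z ?b - (D1 F z ?b * h + D2 F z ?b * cnj h)) / norm h) \<midarrow>0\<rightarrow> 0"
  proof (rule Lim_null_comparison[OF _ e0])
  have "eventually (%h. h : ball 0 (r/2) & h ~= 0) (at (0::complex))"
  unfolding eventually_at using rM(1) by (intro exI[of _ "r/2"]) (auto simp: dist_norm)
  then show "eventually (%h. norm (norm (F (z + h) (cnj (z + h)) - F z ?b - (D1 F z ?b * h + D2 F z ?b * cnj h)) / norm h) <= e h) (at 0)"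
  proof (rule eventually_mono)
  fix h :: complex assume h: "h : ball 0 (r/2) & h ~= 0"
  then have "cmod h < r/2" by (simp add: dist_norm)
  from est[OF this] h show "norm (norm (F (z + h) (cnj (z + h)) - F z ?b - (D1 F z ?b * h + D2 F z ?b * cnj h)) / norm h) <= e h"
  by (simp add: divide_le_eq)
  qed
  qed
 qed
qed

lemma hol2_funpow_D1:
 assumes F: "hol2 F A B"
 shows "hol2 ((D1 ^^ n) F) A B" "(D1 ^^ n) F a b = (deriv ^^ n) (%x. F x b) a"
proof -
 show "hol2 ((D1 ^^ n) F) A B" by (induction n) (auto simp: F hol2_D1)
 show "(D1 ^^ n) F a b = (deriv ^^ n) (%x. F x b) a"
 proof (induction n arbitrary: a)
  case (Suc n)
  have "(%x. (D1 ^^ n) F x b) = (deriv ^^ n) (%x. F x b)" using Suc by (simp add: fun_eq_iff)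
  then show ?case by (simp add: D1_def[of "(D1 ^^ n) F"])
 qed simp
qed

text \<open>Polarization: a function that is holomorphic in the first and (through the conjugated
  argument) antiholomorphic in the second variable is determined by its values on the diagonal.\<close>

lemma hol2_polarization:
 assumes F: "hol2 F A B" and conn: "connected A" and AB: "!!b. b : B ==> cnj b : A" "!!a. a : A ==> cnj a : B"
  and zero: "!!z. z : A ==> F z (cnj z) = 0" and a: "a : A" and b: "b : B"
 shows "F a b = 0"
proof -
 have oA: "open A" using F by (simp add: hol2_def)
 have diag: "(D1 ^^ n) F z (cnj z) = 0" if "z : A" for n z
  using that
 proof (induction n arbitrary: z)
  case 0 then show ?case using zero by simp
 next
  case (Suc n)
  let ?G = "(D1 ^^ n) F"
  have "has_wirt (%z. ?G z (cnj z)) (D1 ?G z (cnj z)) (D2 ?G z (cnj z)) z"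
  by (rule hol2_has_wirt[OF hol2_funpow_D1(1)[OF F]]) (use Suc.prems AB in auto)
  moreover have "has_wirt (%z. ?G z (cnj z)) 0 0 z"
  by (rule has_wirt_transform[OF has_wirt_zero oA Suc.prems]) (use Suc.IH in auto)
  ultimately have "D1 ?G z (cnj z) = 0" by (rule has_wirt_unique(1))
  then show ?case by simp
 qed
 show ?thesis
 proof (rule holomorphic_fun_eq_0_on_connected[of "%x. F x b" A "cnj b" a])
  show "(%x. F x b) holomorphic_on A" by (rule hol2_section(1)[OF F b])
  show "(deriv ^^ n) (%x. F x b) (cnj b) = 0" for n
  using diag[OF AB(1)[OF b], of n] unfolding hol2_funpow_D1(2)[OF F] by simp
 qed (use oA conn a AB b in auto)
qed

text \<open>This is F^2 times the mixed derivative of log F. Clearing the denominator makes it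
  holomorphic also at zeros of \<open>F\<close> and avoids choosing a logarithm.\<close>

definition wronsk :: "(complex => complex => complex) => complex => complex => complex" where
 "wronsk F a b = F a b * D1 (D2 F) a b - D1 F a b * D2 F a b"

lemma hol2_wronsk: "hol2 F A B ==> hol2 (wronsk F) A B"
 unfolding wronsk_def[abs_def] by (intro hol2_diff hol2_mult hol2_D1 hol2_D2)

lemma D1_log_D2:
 assumes F: "hol2 F A B" and ab: "a : A" "b : B" and nz: "F a b ~= 0"
 shows "((%x. D2 F x b / F x b) has_field_derivative wronsk F a b / (F a b)\<^sup>2) (at a)"
 by (auto intro!: derivative_eq_intros hol2_D1_deriv[OF F] hol2_D1_deriv[OF hol2_D2[OF F]]
  simp: ab nz wronsk_def p2eq field_simps)

text \<open>The derivative of ln u with respect to cnj z is D2 F / F at (z, cnj z). This quotient is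
  again holomorphic in two variables near the point, so the second derivative is its
  \<open>D1\<close>.\<close>

lemma ddbar_ln_hol2:
 assumes F: "hol2 F A B" and z: "z : U" and U: "open U" "!!w. w : U ==> w : A & cnj w : B"
  and u: "!!w. w : U ==> F w (cnj w) = of_real (u w)" "!!w. w : U ==> u w > 0"
 shows "ddbar (%w. ln (u w)) z = Re (wronsk F z (cnj z) / (F z (cnj z))\<^sup>2)"
proof -
 have w1: "has_wirt (%w. cor (ln (u w))) (D1 F w (cnj w) / F w (cnj w)) (D2 F w (cnj w) / F w (cnj w)) w"
  if w: "w : U" for w
 proof -
  let ?A = "D1 F w (cnj w)" and ?B = "D2 F w (cnj w)"
  have d: "((%w. F w (cnj w)) has_derivative (%h. ?A * h + ?B * cnj h)) (at w)"
  using hol2_has_wirt[OF F] U(2)[OF w] by (simp add: has_wirt_def)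
  have "((%w. Re (F w (cnj w))) has_derivative (%h. Re (?A * h + ?B * cnj h))) (at w)"
  by (rule bounded_linear.has_derivative[OF bounded_linear_Re d])
  then have du: "(u has_derivative (%h. Re (?A * h + ?B * cnj h))) (at w)"
  by (rule has_derivative_transform_within_open[OF _ U(1) w]) (use u in auto)
  have "((%w. cor (u w)) has_derivative (%h. of_real (Re (?A * h + ?B * cnj h)))) (at w)"
  by (rule bounded_linear.has_derivative[OF bounded_linear_of_real du])
  moreover have "((%w. cor (u w)) has_derivative (%h. ?A * h + ?B * cnj h)) (at w)"
  by (rule has_derivative_transform_within_open[OF d U(1) w]) (use u in auto)
  \<comment> \<open>The derivative of the real function \<open>u\<close> is real valued, so the
    Wirtinger expression equals its own real part.\<close>
  ultimately have "(%h. cor (Re (?A * h + ?B * cnj h))) = (%h. ?A * h + ?B * cnj h)"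
  by (rule has_derivative_unique)
  then have re: "cor (Re (?A * h + ?B * cnj h)) = ?A * h + ?B * cnj h" for h
  by (rule fun_cong)
  have "((%w. ln (u w)) has_derivative (%h. Re (?A * h + ?B * cnj h) / u w)) (at w)"
  using has_derivative_ln[OF u(2)[OF w] du] by (simp add: divide_inverse mult.commute)
  from bounded_linear.has_derivative[OF bounded_linear_of_real this]
  have "((%w. cor (ln (u w))) has_derivative (%h. of_real (Re (?A * h + ?B * cnj h) / u w))) (at w)" .
  also have "(%h. cor (Re (?A * h + ?B * cnj h) / u w)) = (%h. ?A / F w (cnj w) * h + ?B / F w (cnj w) * cnj h)"
  unfolding of_real_divide re u(1)[OF w] by (simp add: add_divide_distrib)
  finally show ?thesis by (simp add: has_wirt_def)
 qed
 have nz: "F z (cnj z) ~= 0" using u[OF z] by simp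
 have zAB: "z : A" "cnj z : B" using U(2)[OF z] by auto
 have op: "open (- {0::complex})" by (rule open_Compl) simp
 obtain r where r: "r > 0" "ball z r <= A" "ball (cnj z) r <= B" "ALL x:ball z r. ALL y:ball (cnj z) r. F x y : - {0}"
  using hol2_nonzero_nbhd[OF F zAB op] nz by blast
 have F': "hol2 F (ball z r) (ball (cnj z) r)" by (rule hol2_subset[OF F r(2,3)]) auto
 let ?Q = "%a b. D2 F a b / F a b"
 have Q: "hol2 ?Q (ball z r) (ball (cnj z) r)"
  by (rule hol2_divide[OF hol2_D2[OF F'] F']) (use r(4) in auto)
 have zi: "z : ball z r" "cnj z : ball (cnj z) r" using r(1) by auto
 have "has_wirt (%w. ?Q w (cnj w)) (D1 ?Q z (cnj z)) (D2 ?Q z (cnj z)) z"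
  by (rule hol2_has_wirt[OF Q zi])
 then have "has_wirt (d_dzbar (%w. cor (ln (u w)))) (D1 ?Q z (cnj z)) (D2 ?Q z (cnj z)) z"
  by (rule has_wirt_transform[OF _ U(1) z]) (use has_wirt_d_dzbar[OF w1] in auto)
 then have "d_dz (d_dzbar (%w. cor (ln (u w)))) z = D1 ?Q z (cnj z)"
  by (rule has_wirt_d_dz)
 also have "... = wronsk F z (cnj z) / (F z (cnj z))\<^sup>2"
  unfolding D1_def[of ?Q] by (rule DERIV_imp_deriv[OF D1_log_D2[OF F' zi nz]])
 finally show ?thesis by (simp add: ddbar_def)
qed

lemma hol2_D1_mult:
 assumes "hol2 F A B" "hol2 G A B" "a : A" "b : B"
 shows "D1 (%a b. F a b * G a b) a b = D1 F a b * G a b + F a b * D1 G a b"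
 unfolding D1_def[of "%a b. F a b * G a b"]
 by (rule DERIV_imp_deriv) (auto intro!: derivative_eq_intros hol2_D1_deriv[OF assms(1)] hol2_D1_deriv[OF assms(2)] simp: assms)

lemma hol2_D2_mult:
 assumes "hol2 F A B" "hol2 G A B" "a : A" "b : B"
 shows "D2 (%a b. F a b * G a b) a b = D2 F a b * G a b + F a b * D2 G a b"
 unfolding D2_def[of "%a b. F a b * G a b"]
 by (rule DERIV_imp_deriv) (auto intro!: derivative_eq_intros hol2_D2_deriv[OF assms(1)] hol2_D2_deriv[OF assms(2)] simp: assms)

lemma D1_cong:
 assumes "open A" "a : A" "!!x. x : A ==> F x b = G x b"
 shows "D1 F a b = D1 G a b"
 unfolding D1_def
 by (rule deriv_cong_ev[OF _ refl]) (use assms in \<open>auto intro!: eventually_mono[OF eventually_nhds_in_open[of A a]]\<close>)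

lemma D2_cong:
 assumes "open B" "b : B" "!!y. y : B ==> F a y = G a y"
 shows "D2 F a b = D2 G a b"
 unfolding D2_def
 by (rule deriv_cong_ev[OF _ refl]) (use assms in \<open>auto intro!: eventually_mono[OF eventually_nhds_in_open[of B b]]\<close>)

lemma wronsk_cong:
 assumes "open A" "open B" "a : A" "b : B" and eq: "!!x y. x : A ==> y : B ==> F x y = G x y"
 shows "wronsk F a b = wronsk G a b"
proof -
 have "D2 F x b = D2 G x b" if "x : A" for x
  by (rule D2_cong[OF assms(2,4)]) (use eq that in auto)
 then have "D1 (D2 F) a b = D1 (D2 G) a b" "D2 F a b = D2 G a b"
  using D1_cong[OF assms(1,3)] assms(3) by blast+
 moreover have "D1 F a b = D1 G a b" by (rule D1_cong[OF assms(1,3)]) (use eq assms in auto)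
 ultimately show ?thesis using eq assms by (simp add: wronsk_def)
qed

text \<open>The rule log (F G) = log F + log G for the mixed derivative, multiplied by (F G)^2, so
  that it holds at zeros as well.\<close>

lemma wronsk_mult:
 assumes F: "hol2 F A B" and G: "hol2 G A B" and ab: "a : A" "b : B"
 shows "wronsk (%a b. F a b * G a b) a b = wronsk F a b * (G a b)\<^sup>2 + (F a b)\<^sup>2 * wronsk G a b"
proof -
 have oA: "open A" using F by (simp add: hol2_def)
 have "D1 (D2 (%a b. F a b * G a b)) a b = D1 (%a b. D2 F a b * G a b + F a b * D2 G a b) a b"
  by (rule D1_cong[OF oA ab(1)]) (rule hol2_D2_mult[OF F G _ ab(2)])
 also have "... = D1 (D2 F) a b * G a b + D2 F a b * D1 G a b + (D1 F a b * D2 G a b + F a b * D1 (D2 G) a b)"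
  unfolding D1_def[of "%a b. D2 F a b * G a b + F a b * D2 G a b"]
  by (rule DERIV_imp_deriv)
  (auto intro!: derivative_eq_intros hol2_D1_deriv[OF F] hol2_D1_deriv[OF G] hol2_D1_deriv[OF hol2_D2[OF F]]
  hol2_D1_deriv[OF hol2_D2[OF G]] simp: ab)
 finally show ?thesis
  unfolding wronsk_def hol2_D2_mult[OF F G ab] hol2_D1_mult[OF F G ab]
  by (simp add: algebra_simps p2eq)
qed

lemma wronsk_left [simp]: "wronsk (%a b. f a) a b = 0"
 by (simp add: wronsk_def D1_def D2_def)

lemma wronsk_right [simp]: "wronsk (%a b. f b) a b = 0"
 by (simp add: wronsk_def D1_def D2_def)

text \<open>Hermitian symmetry K(w,z) = cnj K(z,w) for a kernel whose second variable has been
  conjugated; the two domains are therefore mirror images.\<close>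

definition herm2 :: "(complex => complex => complex) => complex set => complex set => bool" where
 "herm2 F A B \<longleftrightarrow> hol2 F A B & (ALL a:A. cnj a : B) & (ALL b:B. cnj b : A) & (ALL a:A. ALL b:B. F (cnj b) (cnj a) = cnj (F a b))"

lemma herm2_D:
 assumes F: "herm2 F A B" and ab: "a : A" "b : B"
 shows "D1 F (cnj b) (cnj a) = cnj (D2 F a b)" "D2 F (cnj b) (cnj a) = cnj (D1 F a b)"
proof -
 have H: "hol2 F A B" and o: "open A" "open B" and c: "ALL a:A. cnj a : B" "ALL b:B. cnj b : A"
  and s: "ALL a:A. ALL b:B. F (cnj b) (cnj a) = cnj (F a b)"
  using F by (auto simp: herm2_def hol2_def)
 have "((cnj \<circ> F a \<circ> cnj) has_field_derivative cnj (D2 F a b)) (at (cnj b))"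
  using has_field_derivative_cnj_cnj[of "F a" "D2 F a b" "cnj b"] hol2_D2_deriv[OF H ab] by simp
 then have "((%x. F x (cnj a)) has_field_derivative cnj (D2 F a b)) (at (cnj b))"
 proof (rule has_field_derivative_transform_within_open[OF _ o(1)])
  show "cnj b : A" using c ab by blast
  fix x assume "x : A" then show "(cnj \<circ> F a \<circ> cnj) x = F x (cnj a)"
  using s c ab by (metis comp_apply complex_cnj_cnj)
 qed
 then show "D1 F (cnj b) (cnj a) = cnj (D2 F a b)" unfolding D1_def by (rule DERIV_imp_deriv)
 have "((cnj \<circ> (%x. F x b) \<circ> cnj) has_field_derivative cnj (D1 F a b)) (at (cnj a))"
  using has_field_derivative_cnj_cnj[of "%x. F x b" "D1 F a b" "cnj a"] hol2_D1_deriv[OF H ab] by simp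
 then have "((%y. F (cnj b) y) has_field_derivative cnj (D1 F a b)) (at (cnj a))"
 proof (rule has_field_derivative_transform_within_open[OF _ o(2)])
  show "cnj a : B" using c ab by blast
  fix x assume "x : B" then show "(cnj \<circ> (%x. F x b) \<circ> cnj) x = F (cnj b) x"
  using s c ab by (metis comp_apply complex_cnj_cnj)
 qed
 then show "D2 F (cnj b) (cnj a) = cnj (D1 F a b)" unfolding D2_def by (rule DERIV_imp_deriv)
qed

text \<open>The reflection exchanges the two orders of the mixed derivative, so that their equality
  enters.\<close>

lemma herm2_wronsk:
 assumes F: "herm2 F A B"
 shows "herm2 (wronsk F) A B"
 unfolding herm2_def
proof (intro conjI ballI)
 have H: "hol2 F A B" and o: "open A" "open B" and c: "ALL a:A. cnj a : B" "ALL b:B. cnj b : A"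
  and s: "ALL a:A. ALL b:B. F (cnj b) (cnj a) = cnj (F a b)"
  using F by (auto simp: herm2_def hol2_def)
 show "hol2 (wronsk F) A B" by (rule hol2_wronsk[OF H])
 show "cnj a : B" if "a : A" for a using c that by blast
 show "cnj b : A" if "b : B" for b using c that by blast
 fix a b assume ab: "a : A" "b : B"
 have "((cnj \<circ> (%y. D1 F a y) \<circ> cnj) has_field_derivative cnj (D2 (D1 F) a b)) (at (cnj b))"
  using has_field_derivative_cnj_cnj[of "D1 F a" "D2 (D1 F) a b" "cnj b"] hol2_D2_deriv[OF hol2_D1[OF H] ab] by simp
 then have "((%x. D2 F x (cnj a)) has_field_derivative cnj (D2 (D1 F) a b)) (at (cnj b))"
 proof (rule has_field_derivative_transform_within_open[OF _ o(1)])
  show "cnj b : A" using c ab by blast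
  fix x assume x: "x : A"
  then have "cnj x : B" using c by blast
  from herm2_D(2)[OF F ab(1) this] show "(cnj \<circ> (%y. D1 F a y) \<circ> cnj) x = D2 F x (cnj a)" by simp
 qed
 then have "D1 (D2 F) (cnj b) (cnj a) = cnj (D2 (D1 F) a b)" unfolding D1_def[of "D2 F"] by (rule DERIV_imp_deriv)
 then have "D1 (D2 F) (cnj b) (cnj a) = cnj (D1 (D2 F) a b)" using hol2_D1_D2_commute[OF H ab] by simp
 then show "wronsk F (cnj b) (cnj a) = cnj (wronsk F a b)"
  using s ab herm2_D[OF F ab] by (simp add: wronsk_def mult.commute)
qed

lemma herm2_diag_real:
 assumes "herm2 F A B" "z : A"
 shows "F z (cnj z) = of_real (Re (F z (cnj z)))"
proof -
 have "F (cnj (cnj z)) (cnj z) = cnj (F z (cnj z))"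
  using assms unfolding herm2_def by blast
 then have "F z (cnj z) : \<real>" by (simp add: Reals_cnj_iff)
 then show ?thesis by (simp add: of_real_Re)
qed

lemma hol2_zero_extend:
 assumes F: "hol2 F A B" and conn: "connected A" "connected B"
  and U: "open U" "U <= A" "u : U" and V: "open V" "V <= B" "v : V"
  and zero: "!!a b. a : U ==> b : V ==> F a b = 0" and a: "a : A" and b: "b : B"
 shows "F a b = 0"
proof -
 have o: "open A" "open B" using F by (auto simp: hol2_def)
 have 1: "F x y = 0" if x: "x : A" and y: "y : V" for x y
 proof (rule analytic_continuation_open[of U A "%x. F x y" "%_. 0"])
  show "(%x. F x y) holomorphic_on A" by (rule hol2_section(1)[OF F]) (use y V in auto)
 qed (use U o conn zero x y in auto)
 show ?thesis
 proof (rule analytic_continuation_open[of V B "F a" "%_. 0"])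
  show "F a holomorphic_on B" by (rule hol2_section(2)[OF F a])
 qed (use V o conn 1 a b in auto)
qed

lemma zero_deriv_constant:
 assumes "connected A" "open A" "!!x. x : A ==> (f has_field_derivative 0) (at x)" "x : A" "y : A"
 shows "f x = (f y :: complex)"
 using DERIV_zero_connected_constant[of A "{}" f] assms
 by (metis (no_types, lifting) Diff_empty DERIV_isCont continuous_at_imp_continuous_on finite.emptyI)

lemma hol2_D1_zero_const:
 assumes F: "hol2 F A B" "connected A" and z: "!!a. a : A ==> D1 F a b = 0" and ab: "a : A" "a' : A" "b : B"
 shows "F a b = F a' b"
proof (rule zero_deriv_constant[of A "%x. F x b", OF F(2) _ _ ab(1,2)])
 show "open A" using F(1) by (simp add: hol2_def)
 show "((%x. F x b) has_field_derivative 0) (at x)" if "x : A" for x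
  using hol2_D1_deriv[OF F(1) that ab(3)] z[OF that] by simp
qed

text \<open>If \<open>\<partial>\<^sub>1\<partial>\<^sub>2 log F = 0\<close> then \<open>F\<close> is a product of functions of one variable.\<close>

lemma wronsk_zero_separates:
 assumes F: "hol2 F A B" and conn: "connected A" "connected B"
  and nz: "!!a b. a : A ==> b : B ==> F a b ~= 0" and w: "!!a b. a : A ==> b : B ==> wronsk F a b = 0"
  and a: "a : A" "a0 : A" and b: "b : B" "b0 : B"
 shows "F a b * F a0 b0 = F a b0 * F a0 b"
proof -
 have o: "open A" "open B" using F by (auto simp: hol2_def)
 have q: "D2 F a y / F a y = D2 F a0 y / F a0 y" if y: "y : B" for y
 proof (rule zero_deriv_constant[of A "%x. D2 F x y / F x y", OF conn(1) o(1) _ a])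
  fix x assume x: "x : A"
  show "((%x. D2 F x y / F x y) has_field_derivative 0) (at x)"
  using D1_log_D2[OF F x y nz[OF x y]] w[OF x y] by simp
 qed
 have "F a b / F a0 b = F a b0 / F a0 b0"
 proof (rule zero_deriv_constant[of B "%y. F a y / F a0 y", OF conn(2) o(2) _ b])
  fix y assume y: "y : B"
  have "((%y. F a y / F a0 y) has_field_derivative (D2 F a y * F a0 y - F a y * D2 F a0 y) / (F a0 y * F a0 y)) (at y)"
  by (rule DERIV_divide[OF hol2_D2_deriv[OF F a(1) y] hol2_D2_deriv[OF F a(2) y] nz[OF a(2) y]])
  moreover have "D2 F a y * F a0 y - F a y * D2 F a0 y = 0"
  using q[OF y] nz[OF a(1) y] nz[OF a(2) y] by (simp add: field_simps)
  ultimately show "((%y. F a y / F a0 y) has_field_derivative 0) (at y)" by simp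
 qed
 then show ?thesis using nz a b by (simp add: field_simps)
qed

text \<open>The polarized Liouville equation \<open>\<partial>\<^sub>1\<partial>\<^sub>2 log m = - c/2 \<phi>'\<^sub>1 \<phi>'\<^sub>2 m\<^sup>-\<^sup>2\<close> for \<open>m = L\<^sup>-\<^sup>1\<^sup>/\<^sup>2\<close>, with
  \<open>m = 1\<close> on both axes. Differentiating along the first variable shows that \<open>\<delta>\<^sup>2 m / m\<close> with
  \<open>\<delta> = (\<phi>'\<^sub>1)\<^sup>-\<^sup>1 \<partial>\<^sub>1\<close> does not depend on the second variable, so that it vanishes and \<open>m\<close> is affine in
  \<open>\<phi>\<^sub>1\<close>.\<close>

lemma liouville_affine:
 assumes m: "hol2 m A B" and conn: "connected A" "connected B"
  and nz: "!!a b. a : A ==> b : B ==> m a b ~= 0"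
  and p1: "fi1 holomorphic_on A" "!!a. a : A ==> deriv fi1 a ~= 0" and p2: "fi2 holomorphic_on B"
  and w: "!!a b. a : A ==> b : B ==> wronsk m a b = gq * deriv fi1 a * deriv fi2 b"
  and a0: "a0 : A" and b0: "b0 : B"
  and ax: "!!a. a : A ==> m a b0 = 1" "!!b. b : B ==> m a0 b = 1"
  and a: "a : A" and b: "b : B"
 shows "m a b = 1 + gq * (fi1 a - fi1 a0) * (fi2 b - fi2 b0)"
proof -
 have o: "open A" "open B" using m by (auto simp: hol2_def)
 define d where "d = deriv fi1"
 have dh: "d holomorphic_on A" using p1(1) o by (simp add: d_def holomorphic_deriv)
 have dnz: "d a ~= 0" if "a : A" for a using p1(2) that by (simp add: d_def)
 \<comment> \<open>\<open>p\<close> is the derivative of \<open>m\<close> with respect to the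
   coordinate \<open>fi1\<close>. With \<open>q\<close> below, the derivative of \<open>p\<close>,
   the equation q = 0 says that \<open>m\<close> is affine in \<open>fi1\<close>.\<close>
 define p where "p = (%a b. D1 m a b / d a)"
 have hp: "hol2 p A B"
  unfolding p_def by (rule hol2_divide[OF hol2_D1[OF m] hol2_left[OF dh o]]) (rule dnz)
 have D1m: "D1 m x y = p x y * d x" if "x : A" for x y using dnz[OF that] by (simp add: p_def)
 have D2p: "D2 p x y = D1 (D2 m) x y / d x" if "x : A" "y : B" for x y
 proof -
  have "(p x has_field_derivative D2 (D1 m) x y / d x) (at y)"
  unfolding p_def by (rule DERIV_cdivide[OF hol2_D2_deriv[OF hol2_D1[OF m] that]])
  then show ?thesis unfolding hol2_D1_D2_commute[OF m that] by (simp add: D2_def[of p] DERIV_imp_deriv)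
 qed
 have eq: "m x y * D2 p x y - p x y * D2 m x y = gq * deriv fi2 y" if "x : A" "y : B" for x y
 proof -
  have "m x y * (D2 p x y * d x) - p x y * d x * D2 m x y = gq * d x * deriv fi2 y"
  using w[OF that] D2p[OF that] dnz[OF that(1)] D1m[OF that(1)] by (simp add: wronsk_def d_def)
  then have "d x * (m x y * D2 p x y - p x y * D2 m x y) = d x * (gq * deriv fi2 y)"
  by (simp add: algebra_simps)
  then show ?thesis using dnz[OF that(1)] by simp
 qed
 define q where "q = D1 p"
 have hq: "hol2 q A B" unfolding q_def by (rule hol2_D1[OF hp])
 have qm: "m x y * D2 q x y = q x y * D2 m x y" if xy: "x : A" "y : B" for x y
 proof -
  have "((%x. m x y * D2 p x y - p x y * D2 m x y) has_field_derivative
  (D1 m x y * D2 p x y + D1 (D2 p) x y * m x y) - (D1 p x y * D2 m x y + D1 (D2 m) x y * p x y)) (at x)"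
  by (intro DERIV_diff DERIV_mult hol2_D1_deriv[OF m xy] hol2_D1_deriv[OF hol2_D2[OF hp] xy]
  hol2_D1_deriv[OF hp xy] hol2_D1_deriv[OF hol2_D2[OF m] xy])
  moreover have "((%x. m x y * D2 p x y - p x y * D2 m x y) has_field_derivative 0) (at x)"
  by (rule has_field_derivative_transform_within_open[OF DERIV_const[of "gq * deriv fi2 y"] o(1) xy(1)])
  (use eq xy in auto)
  ultimately have "(D1 m x y * D2 p x y + D1 (D2 p) x y * m x y) - (D1 p x y * D2 m x y + D1 (D2 m) x y * p x y) = 0"
  by (rule DERIV_unique)
  moreover have "D1 (D2 m) x y * p x y = D1 m x y * D2 p x y"
  using D2p[OF xy] D1m[OF xy(1)] dnz[OF xy(1)] by simp
  moreover have "D1 (D2 p) x y = D2 q x y"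
  unfolding q_def using hol2_D1_D2_commute[OF hp xy] by simp
  ultimately show ?thesis unfolding q_def by (simp add: algebra_simps)
 qed
 have D1m0: "D1 m x b0 = 0" if "x : A" for x
 proof -
  have "D1 m x b0 = D1 (%_ _. 1) x b0" by (rule D1_cong[OF o(1) that]) (use ax in auto)
  then show ?thesis by (simp add: D1_def)
 qed
 have p0: "p x b0 = 0" if "x : A" for x using D1m0[OF that] by (simp add: p_def)
 have q0: "q x b0 = 0" if "x : A" for x
 proof -
  have "q x b0 = D1 (%_ _. 0) x b0" unfolding q_def by (rule D1_cong[OF o(1) that]) (use p0 in auto)
  then show ?thesis by (simp add: D1_def)
 qed
 have qz: "q x y = 0" if xy: "x : A" "y : B" for x y
 proof -
  have "q x y / m x y = q x b0 / m x b0"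
  proof (rule zero_deriv_constant[of B "%y. q x y / m x y", OF conn(2) o(2) _ xy(2) b0])
  fix y assume y: "y : B"
  have "((%y. q x y / m x y) has_field_derivative (D2 q x y * m x y - q x y * D2 m x y) / (m x y * m x y)) (at y)"
  by (rule DERIV_divide[OF hol2_D2_deriv[OF hq xy(1) y] hol2_D2_deriv[OF m xy(1) y] nz[OF xy(1) y]])
  then show "((%y. q x y / m x y) has_field_derivative 0) (at y)"
  using qm[OF xy(1) y] by (simp add: mult.commute)
  qed
  then show ?thesis using q0[OF xy(1)] nz[OF xy] by simp
 qed
 have pc: "p x y = p a0 y" if "x : A" "y : B" for x y
  by (rule hol2_D1_zero_const[OF hp conn(1) _ that(1) a0 that(2)]) (use qz that in \<open>auto simp: q_def\<close>)
 have mm: "m x y - p a0 y * fi1 x = m a0 y - p a0 y * fi1 a0" if xy: "x : A" "y : B" for x y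
 proof (rule zero_deriv_constant[of A "%x. m x y - p a0 y * fi1 x", OF conn(1) o(1) _ xy(1) a0])
  fix x assume x: "x : A"
  have "((%x. m x y - p a0 y * fi1 x) has_field_derivative D1 m x y - p a0 y * d x) (at x)"
  unfolding d_def
  by (intro DERIV_diff DERIV_cmult hol2_D1_deriv[OF m x xy(2)] holomorphic_derivI[OF p1(1) o(1) x])
  then show "((%x. m x y - p a0 y * fi1 x) has_field_derivative 0) (at x)"
  using D1m[OF x] pc[OF x xy(2)] by simp
 qed
 have D2m0: "D2 m a0 y = 0" if "y : B" for y
 proof -
  have "D2 m a0 y = D2 (%_ _. 1) a0 y" by (rule D2_cong[OF o(2) that]) (use ax in auto)
  then show ?thesis by (simp add: D2_def)
 qed
 have D2p0: "D2 p a0 y = gq * deriv fi2 y" if y: "y : B" for y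
  using eq[OF a0 y] D2m0[OF y] ax(2)[OF y] by simp
 have "p a0 b - gq * fi2 b = p a0 b0 - gq * fi2 b0"
 proof (rule zero_deriv_constant[of B "%y. p a0 y - gq * fi2 y", OF conn(2) o(2) _ b b0])
  fix y assume y: "y : B"
  have "((%y. p a0 y - gq * fi2 y) has_field_derivative D2 p a0 y - gq * deriv fi2 y) (at y)"
  by (intro DERIV_diff DERIV_cmult hol2_D2_deriv[OF hp a0 y] holomorphic_derivI[OF p2 o(2) y])
  then show "((%y. p a0 y - gq * fi2 y) has_field_derivative 0) (at y)" using D2p0[OF y] by simp
 qed
 then have pab: "p a0 b = gq * (fi2 b - fi2 b0)" using p0[OF a0] by (simp add: algebra_simps)
 have "m a b = 1 + p a0 b * (fi1 a - fi1 a0)" using mm[OF a b] ax(2)[OF b] by (simp add: algebra_simps)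
 then show ?thesis unfolding pab by (simp only: mult_ac)
qed

text \<open>With N = \<open>wronsk K\<close> the equation says that log N - 3 log K has mixed
  derivative 0, so that N / K^3 separates. Dividing \<open>K\<close> by its restrictions to the two
  axes through (a0,b0) gives \<open>L\<close>, and L^(-1/2) satisfies the equation of
  \<open>liouville_affine\<close> in the coordinates \<open>fi1\<close> and \<open>fi2\<close>, the
  transversal logarithmic derivatives of \<open>K\<close> on the axes.\<close>

lemma liouville_kernel_local:
 assumes K: "hol2 K A B" and conn: "connected A" "connected B" and a0: "a0 : A" and b0: "b0 : B"
  and Knz: "!!a b. a : A ==> b : B ==> K a b ~= 0"
  and Nnz: "!!a b. a : A ==> b : B ==> wronsk K a b ~= 0"
  and eq: "!!a b. a : A ==> b : B ==> wronsk (wronsk K) a b * (K a b)\<^sup>2 = 3 * (wronsk K a b) ^ 3"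
  and re: "!!a b. a : A ==> b : B ==> Re (K a b * K a0 b0 / (K a b0 * K a0 b)) > 0"
  and a: "a : A" and b: "b : B"
 shows "K a b * K a0 b0 * (1 - (K a0 b0)\<^sup>2 / (2 * wronsk K a0 b0) * (D2 K a b0 / K a b0 - D2 K a0 b0 / K a0 b0)
  * (D1 K a0 b / K a0 b - D1 K a0 b0 / K a0 b0))\<^sup>2 = K a b0 * K a0 b"
proof -
 have o: "open A" "open B" using K by (auto simp: hol2_def)
 define N where "N = wronsk K"
 have hN: "hol2 N A B" unfolding N_def by (rule hol2_wronsk[OF K])
 define R where "R = (%a b. N a b / (K a b)^3)"
 have hR: "hol2 R A B" unfolding R_def by (rule hol2_divide[OF hN hol2_power[OF K]]) (use Knz in auto)
 have Rnz: "R x y ~= 0" if "x : A" "y : B" for x y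
  using Knz[OF that] Nnz[OF that] by (simp add: R_def N_def)
 have hK2: "hol2 (%a b. K a b * K a b) A B" by (rule hol2_mult[OF K K])
 have hK3: "hol2 (%a b. K a b * (K a b * K a b)) A B" by (rule hol2_mult[OF K hK2])
 have wR: "wronsk R x y = 0" if xy: "x : A" "y : B" for x y
 proof -
  have wK2: "wronsk (%a b. K a b * K a b) x y = 2 * N x y * (K x y)\<^sup>2"
  using wronsk_mult[OF K K xy] by (simp add: N_def)
  have wK3: "wronsk (%a b. K a b * (K a b * K a b)) x y = 3 * N x y * (K x y) ^ 4"
  using wronsk_mult[OF K hK2 xy] wK2 by (simp add: N_def p2eq power4_eq_xxxx)
  have "wronsk N x y = wronsk (%a b. R a b * (K a b * (K a b * K a b))) x y"
  by (rule wronsk_cong[OF o xy]) (use Knz in \<open>simp add: R_def power3_eq_cube\<close>)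
  also have "... = wronsk R x y * (K x y) ^ 6 + (R x y)\<^sup>2 * (3 * N x y * (K x y) ^ 4)"
  using wronsk_mult[OF hR hK3 xy] wK3 by (simp add: p2eq power4_eq_xxxx power_def numeral_eq_Suc)
  finally have "wronsk N x y * (K x y)\<^sup>2 = wronsk R x y * (K x y) ^ 8 + (R x y)\<^sup>2 * (3 * N x y * (K x y) ^ 6)"
  by (simp add: algebra_simps p2eq power_def numeral_eq_Suc)
  moreover have "(R x y)\<^sup>2 * (3 * N x y * (K x y) ^ 6) = 3 * (N x y)^3"
  using Knz[OF xy] by (simp add: R_def field_simps p2eq power3_eq_cube power_def numeral_eq_Suc)
  ultimately have "wronsk R x y * (K x y) ^ 8 = 0" using eq[OF xy] by (simp add: N_def)
  then show ?thesis using Knz[OF xy] by simp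
 qed
 have sep: "R x y * R a0 b0 = R x b0 * R a0 y" if "x : A" "y : B" for x y
  by (rule wronsk_zero_separates[OF hR conn Rnz wR that(1) a0 that(2) b0])
 define k1 where "k1 = (%x. K x b0)"
 define k2 where "k2 = (%y. K a0 y)"
 define k0 where "k0 = K a0 b0"
 have k1h: "k1 holomorphic_on A" unfolding k1_def by (rule hol2_section(1)[OF K b0])
 have k2h: "k2 holomorphic_on B" using hol2_section(2)[OF K a0] by (simp add: k2_def)
 have k1nz: "k1 x ~= 0" if "x : A" for x using Knz[OF that b0] by (simp add: k1_def)
 have k2nz: "k2 y ~= 0" if "y : B" for y using Knz[OF a0 that] by (simp add: k2_def)
 have k0nz: "k0 ~= 0" using Knz[OF a0 b0] by (simp add: k0_def)
 \<comment> \<open>Equal to 1 on both axes, with the same mixed logarithmic derivative as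
   \<open>K\<close>; the hypothesis on the real part keeps it in the domain of the principal square
   root.\<close>
 define L where "L = (%a b. K a b * k0 / (k1 a * k2 b))"
 have hk12: "hol2 (%a b. k1 a * k2 b) A B" by (intro hol2_mult hol2_left hol2_right k1h k2h o)
 have hL: "hol2 L A B"
  unfolding L_def by (intro hol2_divide hol2_mult K hol2_const o hk12) (use k1nz k2nz in auto)
 have Lre: "Re (L x y) > 0" if "x : A" "y : B" for x y
  using re[OF that] by (simp add: L_def k1_def k2_def k0_def)
 have Lnz: "L x y ~= 0" if "x : A" "y : B" for x y using Lre[OF that] by auto
 define m where "m = (%a b. 1 / csqrt (L a b))"
 have hsq: "hol2 (%a b. csqrt (L a b)) A B"
 proof (rule hol2_compose[OF hL, of csqrt "{z. Re z > 0}"])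
  show "csqrt holomorphic_on {z. 0 < Re z}"
  by (intro holomorphic_intros) (auto simp: complex_nonpos_Reals_iff)
  show "open {z. 0 < Re z}" by (rule open_halfspace_Re_gt)
 qed (use Lre in auto)
 have hm: "hol2 m A B"
  unfolding m_def by (rule hol2_divide[OF hol2_const[OF o] hsq]) (use Lnz in auto)
 have m2L: "m x y * m x y * L x y = 1" if "x : A" "y : B" for x y
 proof -
  have "m x y * m x y * L x y = L x y / (csqrt (L x y))\<^sup>2" by (simp add: m_def p2eq)
  then show ?thesis using Lnz[OF that] by simp
 qed
 have mnz: "m x y ~= 0" if "x : A" "y : B" for x y using m2L[OF that] by auto
 define fi1 where "fi1 = (%x. D2 K x b0 / k1 x)"
 define fi2 where "fi2 = (%y. D1 K a0 y / k2 y)"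
 have dphi1: "(fi1 has_field_derivative N x b0 / (k1 x)\<^sup>2) (at x)" if "x : A" for x
  using D1_log_D2[OF K that b0 Knz[OF that b0]] by (simp add: fi1_def k1_def N_def)
 have dphi2: "(fi2 has_field_derivative N a0 y / (k2 y)\<^sup>2) (at y)" if y: "y : B" for y
 proof -
  have "((%y. D1 K a0 y / K a0 y) has_field_derivative
  (D2 (D1 K) a0 y * K a0 y - D1 K a0 y * D2 K a0 y) / (K a0 y * K a0 y)) (at y)"
  by (rule DERIV_divide[OF hol2_D2_deriv[OF hol2_D1[OF K] a0 y] hol2_D2_deriv[OF K a0 y] Knz[OF a0 y]])
  then show ?thesis
  unfolding hol2_D1_D2_commute[OF K a0 y] by (simp add: fi2_def k2_def N_def wronsk_def p2eq mult.commute)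
 qed
 have ph1: "fi1 holomorphic_on A" using dphi1 by (meson DERIV_subset holomorphic_on_def field_differentiable_def top_greatest)
 have ph2: "fi2 holomorphic_on B" using dphi2 by (meson DERIV_subset holomorphic_on_def field_differentiable_def top_greatest)
 \<comment> \<open>Since log m = - log L / 2, the mixed logarithmic derivative is halved and changes
   sign. The rest of the constant comes from the separation of N / K^3 together with fi1' = N / k1^2
   and fi2' = N / k2^2.\<close>
 define gq where "gq = - (k0\<^sup>2 / (2 * N a0 b0))"
 have n0nz: "N a0 b0 ~= 0" using Nnz[OF a0 b0] by (simp add: N_def)
 have wm: "wronsk m x y = gq * deriv fi1 x * deriv fi2 y" if xy: "x : A" "y : B" for x y
 proof -
  have hmm: "hol2 (%a b. m a b * m a b) A B" by (rule hol2_mult[OF hm hm])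
  have "0 = wronsk (%a b. m a b * m a b * L a b) x y"
  using wronsk_cong[OF o xy, of "%a b. m a b * m a b * L a b" "%_ _. 1"] m2L by simp
  also have "... = 2 * wronsk m x y * (m x y)\<^sup>2 * (L x y)\<^sup>2 + (m x y)^4 * wronsk L x y"
  using wronsk_mult[OF hmm hL xy] wronsk_mult[OF hm hm xy] by (simp add: p2eq power4_eq_xxxx algebra_simps)
  finally have 1: "2 * wronsk m x y * (m x y)\<^sup>2 * (L x y)\<^sup>2 = - ((m x y)^4 * wronsk L x y)"
  by (simp add: add_eq_0_iff)
  have "wronsk K x y * k0\<^sup>2 = wronsk (%a b. K a b * k0) x y"
  using wronsk_mult[OF K hol2_const[OF o] xy, of k0] by simp
  also have "... = wronsk (%a b. L a b * (k1 a * k2 b)) x y"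
  by (rule wronsk_cong[OF o xy]) (use k1nz k2nz in \<open>simp add: L_def\<close>)
  also have "... = wronsk L x y * (k1 x * k2 y)\<^sup>2"
  using wronsk_mult[OF hL hk12 xy] wronsk_mult[OF hol2_left[OF k1h o] hol2_right[OF k2h o] xy] by simp
  finally have 2: "N x y * k0\<^sup>2 = wronsk L x y * (k1 x * k2 y)\<^sup>2" by (simp add: N_def)
  have Nxy: "N x y * N a0 b0 * (k1 x)^3 * (k2 y)^3 = N x b0 * N a0 y * (K x y)^3 * k0^3"
  using sep[OF xy] Knz[OF xy] k1nz[OF xy(1)] k2nz[OF xy(2)] k0nz
  by (simp add: R_def k1_def k2_def k0_def field_simps)
  have Kxy: "K x y * k0 = L x y * (k1 x * k2 y)" using k1nz[OF xy(1)] k2nz[OF xy(2)] by (simp add: L_def)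
  have L3: "wronsk L x y * N a0 b0 * (k1 x)\<^sup>2 * (k2 y)\<^sup>2 = k0\<^sup>2 * N x b0 * N a0 y * (L x y)^3"
  proof -
  have "(wronsk L x y * N a0 b0 * (k1 x)\<^sup>2 * (k2 y)\<^sup>2) * ((k1 x)^3 * (k2 y)^3)
  = (wronsk L x y * (k1 x * k2 y)\<^sup>2) * N a0 b0 * (k1 x)^3 * (k2 y)^3"
  by (simp add: power_mult_distrib)
  also have "... = k0\<^sup>2 * (N x y * N a0 b0 * (k1 x)^3 * (k2 y)^3)" by (simp only: 2[symmetric] mult_ac)
  also have "... = k0\<^sup>2 * N x b0 * N a0 y * (K x y * k0)^3" unfolding Nxy by (simp only: power_mult_distrib mult_ac)
  also have "... = (k0\<^sup>2 * N x b0 * N a0 y * (L x y)^3) * ((k1 x)^3 * (k2 y)^3)"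
  unfolding Kxy by (simp only: power_mult_distrib mult_ac)
  finally show ?thesis using k1nz[OF xy(1)] k2nz[OF xy(2)] by simp
  qed
  have "2 * wronsk m x y * N a0 b0 * (k1 x)\<^sup>2 * (k2 y)\<^sup>2 * ((m x y)\<^sup>2 * (L x y)\<^sup>2)
  = (2 * wronsk m x y * (m x y)\<^sup>2 * (L x y)\<^sup>2) * (N a0 b0 * (k1 x)\<^sup>2 * (k2 y)\<^sup>2)" by (simp only: mult_ac)
  also have "... = - ((m x y)^4 * (wronsk L x y * N a0 b0 * (k1 x)\<^sup>2 * (k2 y)\<^sup>2))" unfolding 1 by (simp add: mult_ac)
  also have "... = - (k0\<^sup>2 * N x b0 * N a0 y) * ((m x y * m x y * L x y) * ((m x y)\<^sup>2 * (L x y)\<^sup>2))"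
  unfolding L3 by (simp add: p2eq power3_eq_cube power4_eq_xxxx)
  finally have "2 * wronsk m x y * N a0 b0 * (k1 x)\<^sup>2 * (k2 y)\<^sup>2 * ((m x y)\<^sup>2 * (L x y)\<^sup>2)
  = - (k0\<^sup>2 * N x b0 * N a0 y) * ((m x y)\<^sup>2 * (L x y)\<^sup>2)"
  unfolding m2L[OF xy] mult_1 .
  moreover have "(m x y)\<^sup>2 * (L x y)\<^sup>2 ~= 0" using mnz[OF xy] Lnz[OF xy] by simp
  ultimately have fin: "2 * wronsk m x y * N a0 b0 * (k1 x)\<^sup>2 * (k2 y)\<^sup>2 = - (k0\<^sup>2 * N x b0 * N a0 y)"
  using mult_right_cancel by blast
  have de: "deriv fi1 x = N x b0 / (k1 x)\<^sup>2" "deriv fi2 y = N a0 y / (k2 y)\<^sup>2"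
  using dphi1[OF xy(1)] dphi2[OF xy(2)] DERIV_imp_deriv by auto
  have "gq * deriv fi1 x * deriv fi2 y = - (k0\<^sup>2 * N x b0 * N a0 y) / (2 * N a0 b0 * (k1 x)\<^sup>2 * (k2 y)\<^sup>2)"
  unfolding de gq_def by simp
  also have "... = wronsk m x y"
  unfolding fin[symmetric] using n0nz k1nz[OF xy(1)] k2nz[OF xy(2)] by simp
  finally show ?thesis ..
 qed
 have "m a b = 1 + gq * (fi1 a - fi1 a0) * (fi2 b - fi2 b0)"
 proof (rule liouville_affine[OF hm conn mnz ph1 _ ph2 wm a0 b0 _ _ a b])
  show "deriv fi1 x ~= 0" if "x : A" for x
  using DERIV_imp_deriv[OF dphi1[OF that]] Nnz[OF that b0] k1nz[OF that] by (simp add: N_def)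
  have "L x b0 = 1" if "x : A" for x using k1nz[OF that] k0nz by (simp add: L_def k1_def k2_def k0_def)
  then show "m x b0 = 1" if "x : A" for x using that by (simp add: m_def)
  have "L a0 y = 1" if "y : B" for y using k2nz[OF that] k0nz by (simp add: L_def k1_def k2_def k0_def)
  then show "m a0 y = 1" if "y : B" for y using that by (simp add: m_def)
 qed
 then have m': "m a b = 1 - (K a0 b0)\<^sup>2 / (2 * wronsk K a0 b0) * (D2 K a b0 / K a b0 - D2 K a0 b0 / K a0 b0)
  * (D1 K a0 b / K a0 b - D1 K a0 b0 / K a0 b0)"
  by (simp add: gq_def fi1_def fi2_def k1_def k2_def k0_def N_def)
 have "K a b * K a0 b0 * (m a b)\<^sup>2 = L a b * (k1 a * k2 b) * (m a b)\<^sup>2"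
  using k1nz[OF a] k2nz[OF b] by (simp add: L_def k0_def)
 also have "... = (m a b * m a b * L a b) * (k1 a * k2 b)" by (simp add: p2eq)
 also have "... = K a b0 * K a0 b" using m2L[OF a b] by (simp add: k1_def k2_def)
 finally show ?thesis unfolding m' .
qed

text \<open>K(a, cnj b): conjugating the second argument makes the kernel holomorphic in both
  variables, over \<open>D\<close> and its mirror image.\<close>

definition bker2 :: "complex set => complex => complex => complex" where
 "bker2 D a b = brep D (cnj b) a"

lemma cnj_image_iff: "b : cnj ` D \<longleftrightarrow> cnj b : D"
 by (metis complex_cnj_cnj image_iff)

lemma open_cnj_image: "open D ==> open (cnj ` D)"
 unfolding image_cnj_conv_vimage_cnj by (intro open_vimage) auto

lemma connected_cnj_image: "connected D ==> connected (cnj ` D)"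
 by (intro connected_continuous_image continuous_intros)

section \<open>The polarized Bergman kernel and the curvature equation\<close>

context
 fixes D :: "complex set"
 assumes D: "open D"
begin

lemma bker2_herm: "herm2 (bker2 D) D (cnj ` D)"
proof -
 have s: "bker2 D (cnj b) (cnj a) = cnj (bker2 D a b)" if "a : D" "b : cnj ` D" for a b
  using brep_sym[OF D, of a "cnj b"] that by (simp add: bker2_def cnj_image_iff)
 have "hol2 (bker2 D) D (cnj ` D)"
  unfolding hol2_def
 proof (intro conjI ballI)
  show "open D" "open (cnj ` D)" using D open_cnj_image by auto
  show "(%a. bker2 D a b) holomorphic_on D" if "b : cnj ` D" for b
  using A2D(1)[OF brep(1)[OF D, of "cnj b"]] that by (simp add: bker2_def cnj_image_iff)
  show "bker2 D a holomorphic_on cnj ` D" if a: "a : D" for a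
  proof -
  have "brep D a holomorphic_on cnj ` (cnj ` D)"
  using A2D(1)[OF brep(1)[OF D a]] by (simp add: image_comp o_def)
  from holomorphic_on_compose_cnj_cnj[OF this open_cnj_image[OF D]]
  show ?thesis
  by (rule holomorphic_transform) (use brep_sym[OF D _ a] in \<open>auto simp: bker2_def\<close>)
  qed
  fix a b assume a: "a : D" and b: "b : cnj ` D"
  then have b': "cnj b : D" by (simp add: cnj_image_iff)
  obtain r1 where r1: "r1 > 0" "cball a r1 <= D" using D a open_contains_cball by meson
  obtain r2 where r2: "r2 > 0" "cball (cnj b) r2 <= D" using D b' open_contains_cball by meson
  have K: "compact (cball a r1 \<union> cball (cnj b) r2)" "cball a r1 \<union> cball (cnj b) r2 <= D"
  using r1 r2 by (auto intro: compact_Un)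
  obtain M where M: "!!w z. w : cball a r1 \<union> cball (cnj b) r2 ==> z : cball a r1 \<union> cball (cnj b) r2 ==> cmod (brep D w z) <= M"
  using bergman_kernel_bounded[OF D K] by auto
  have "cmod (bker2 D x y) <= M" if "x : ball a (min r1 r2)" "y : ball b (min r1 r2)" for x y
  proof -
  have "dist (cnj b) (cnj y) < r2"
  using that by (simp add: dist_norm flip: complex_cnj_diff)
  then show ?thesis unfolding bker2_def by (intro M) (use that in auto)
  qed
  then show "EX r>0. EX M. ALL x:ball a r. ALL y:ball b r. cmod (bker2 D x y) <= M"
  using r1(1) r2(1) by (intro exI[of _ "min r1 r2"] conjI exI[of _ M]) auto
 qed
 then show ?thesis using s by (auto simp: herm2_def cnj_image_iff)
qed

lemma bker2_diag: "z : D ==> bker2 D z (cnj z) = of_real (bergman_kernel D z)"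
 by (simp add: bker2_def bergman_kernel_rep(1)[OF D])

end

text \<open>Curvature -2 means that log g has mixed derivative g, as has log K. With N the
  \<open>wronsk\<close> of the kernel, N = K^2 g on the diagonal, so log N = log g + 2 log K has
  mixed derivative 3 g = 3 N / K^2; this is the source of the factor 3. Polarization carries the
  identity off the diagonal.\<close>

lemma curvature_equation:
 assumes D: "open D" "connected D"
  and ex: "bergman_metric_exists D" and curv: "ALL z:D. bergman_curvature D z = -2"
  and ab: "a : D" "b : cnj ` D"
 shows "wronsk (wronsk (bker2 D)) a b * (bker2 D a b)\<^sup>2 = 3 * (wronsk (bker2 D) a b) ^ 3"
  and "z : D ==> Re (wronsk (bker2 D) z (cnj z)) > 0"
proof -
 define K where "K = bker2 D"
 define N where "N = wronsk K"
 let ?B = "cnj ` D"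
 have hK: "herm2 K D ?B" unfolding K_def by (rule bker2_herm[OF D(1)])
 have hN: "herm2 N D ?B" unfolding N_def by (rule herm2_wronsk[OF hK])
 have hW: "herm2 (wronsk N) D ?B" by (rule herm2_wronsk[OF hN])
 have K2: "hol2 K D ?B" and N2: "hol2 N D ?B" and W2: "hol2 (wronsk N) D ?B"
  using hK hN hW by (auto simp: herm2_def)
 have c: "cnj z : ?B" if "z : D" for z using that by simp
 have kpos: "bergman_kernel D z > 0" and gpos: "bergman_metric D z > 0" if "z : D" for z
  using ex that by (auto simp: bergman_metric_exists_def)
 define n where "n z = Re (N z (cnj z))" for z
 have Nr: "N z (cnj z) = of_real (n z)" if "z : D" for z
  using herm2_diag_real[OF hN that] by (simp add: n_def)
 have Kr: "K z (cnj z) = of_real (bergman_kernel D z)" if "z : D" for z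
  using bker2_diag[OF D(1) that] by (simp add: K_def)
 have g: "bergman_metric D z = n z / (bergman_kernel D z)\<^sup>2" if z: "z : D" for z
 proof -
  have "bergman_metric D z = Re (N z (cnj z) / (K z (cnj z))\<^sup>2)"
  unfolding bergman_metric_def N_def
  by (rule ddbar_ln_hol2[OF K2 z D(1)]) (use Kr kpos in auto)
  then show ?thesis unfolding Nr[OF z] Kr[OF z] by (simp flip: of_real_power of_real_divide)
 qed
 have npos: "n z > 0" if "z : D" for z
  using gpos[OF that] kpos[OF that] g[OF that] by (simp add: zero_less_divide_iff)
 have diag: "wronsk N z (cnj z) * (K z (cnj z))\<^sup>2 = 3 * (N z (cnj z)) ^ 3" if z: "z : D" for z
 proof -
  define w where "w = Re (wronsk N z (cnj z))"
  have Wr: "wronsk N z (cnj z) = of_real w"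
  using herm2_diag_real[OF hW z] by (simp add: w_def)
  define ka where "ka = bergman_kernel D z"
  have ka: "ka > 0" using kpos[OF z] by (simp add: ka_def)
  have nz: "K z (cnj z) : - {0}" using Kr[OF z] kpos[OF z] by simp
  have op: "open (- {0::complex})" by (rule open_Compl) simp
  obtain r where r: "r > 0" "ball z r <= D" "ball (cnj z) r <= ?B" "ALL x:ball z r. ALL y:ball (cnj z) r. K x y : - {0}"
  using hol2_nonzero_nbhd[OF K2 z c[OF z] op nz] by blast
  have K': "hol2 K (ball z r) (ball (cnj z) r)" by (rule hol2_subset[OF K2 r(2,3)]) auto
  have N': "hol2 N (ball z r) (ball (cnj z) r)" by (rule hol2_subset[OF N2 r(2,3)]) auto
  have KK': "hol2 (%a b. K a b * K a b) (ball z r) (ball (cnj z) r)" by (rule hol2_mult[OF K' K'])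
  \<comment> \<open>The polarized metric, available only near (z, cnj z) where \<open>K\<close> has
    no zeros; hence the restriction to balls.\<close>
  define F where "F = (%a b. N a b / (K a b * K a b))"
  have F: "hol2 F (ball z r) (ball (cnj z) r)"
  unfolding F_def by (rule hol2_divide[OF N' KK']) (use r(4) in auto)
  have zi: "z : ball z r" "cnj z : ball (cnj z) r" using r(1) by auto
  have ci: "cnj w : ball (cnj z) r" if "w : ball z r" for w
  using that by (simp add: dist_norm flip: complex_cnj_diff)
  have Fr: "F w (cnj w) = of_real (bergman_metric D w)" if "w : ball z r" for w
  proof -
  have wD: "w : D" using that r(2) by blast
  show ?thesis unfolding F_def Nr[OF wD] Kr[OF wD] g[OF wD] by (simp add: p2eq)
  qed
  have dd: "ddbar (%w. ln (bergman_metric D w)) z = Re (wronsk F z (cnj z) / (F z (cnj z))\<^sup>2)"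
  by (rule ddbar_ln_hol2[OF F zi(1) open_ball]) (use Fr gpos r(2) ci in auto)
  have "wronsk N z (cnj z) = wronsk (%a b. F a b * (K a b * K a b)) z (cnj z)"
  by (rule wronsk_cong[OF open_ball open_ball zi]) (use r(4) in \<open>auto simp: F_def\<close>)
  also have "... = wronsk F z (cnj z) * (K z (cnj z)) ^ 4 + (F z (cnj z))\<^sup>2 * (2 * N z (cnj z) * (K z (cnj z))\<^sup>2)"
  using wronsk_mult[OF F KK' zi] wronsk_mult[OF K' K' zi]
  by (simp add: N_def p2eq power4_eq_xxxx)
  finally have e: "of_real w = wronsk F z (cnj z) * of_real (ka ^ 4) + of_real ((n z / ka\<^sup>2)\<^sup>2 * (2 * n z * ka\<^sup>2))"
  unfolding Wr Kr[OF z] Nr[OF z] Fr[OF zi(1)] g[OF z] by (simp add: ka_def)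
  have "wronsk F z (cnj z) = of_real ((w - (n z / ka\<^sup>2)\<^sup>2 * (2 * n z * ka\<^sup>2)) / ka ^ 4)"
  proof -
  have "wronsk F z (cnj z) * of_real (ka ^ 4) = of_real (w - (n z / ka\<^sup>2)\<^sup>2 * (2 * n z * ka\<^sup>2))"
  using e by (simp add: of_real_diff)
  then show ?thesis using ka by (simp add: field_simps)
  qed
  then have "Re (wronsk F z (cnj z) / (F z (cnj z))\<^sup>2)
  = ((w - (n z / ka\<^sup>2)\<^sup>2 * (2 * n z * ka\<^sup>2)) / ka ^ 4) / (n z / ka\<^sup>2)\<^sup>2"
  unfolding Fr[OF zi(1)] g[OF z] ka_def by (simp only: of_real_power[symmetric] of_real_divide[symmetric] Re_complex_of_real)
  moreover have "ddbar (%w. ln (bergman_metric D w)) z = bergman_metric D z"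
  using curv z gpos[OF z] by (auto simp: bergman_curvature_def field_simps)
  ultimately have f: "((w - (n z / ka\<^sup>2)\<^sup>2 * (2 * n z * ka\<^sup>2)) / ka ^ 4) / (n z / ka\<^sup>2)\<^sup>2 = n z / ka\<^sup>2"
  using dd g[OF z] by (simp add: ka_def)
  have "(n z / ka\<^sup>2)\<^sup>2 ~= 0" "ka ^ 4 ~= 0" using npos[OF z] ka by auto
  with f have "w - (n z / ka\<^sup>2)\<^sup>2 * (2 * n z * ka\<^sup>2) = n z / ka\<^sup>2 * (n z / ka\<^sup>2)\<^sup>2 * ka ^ 4"
  by (simp add: divide_eq_eq)
  then have "w * ka\<^sup>2 = 3 * n z ^ 3"
  using ka by (simp add: field_simps p2eq power3_eq_cube power4_eq_xxxx)
  then show ?thesis unfolding Wr Kr[OF z] Nr[OF z] ka_def by (metis of_real_mult of_real_numeral of_real_power)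
 qed
 define H where "H = (%a b. wronsk N a b * (K a b)\<^sup>2 - 3 * (N a b) ^ 3)"
 have "hol2 H D ?B"
  unfolding H_def by (intro hol2_diff hol2_mult hol2_cmult hol2_power W2 K2 N2)
 then have "H a b = 0"
  by (rule hol2_polarization[OF _ D(2) _ _ _ ab]) (use diag in \<open>auto simp: H_def\<close>)
 then show "wronsk (wronsk (bker2 D)) a b * (bker2 D a b)\<^sup>2 = 3 * (wronsk (bker2 D) a b) ^ 3"
  by (simp add: H_def N_def K_def)
 show "z : D ==> Re (wronsk (bker2 D) z (cnj z)) > 0"
  using npos by (simp add: n_def N_def K_def)
qed

text \<open>The local solution has the denominators K(z,z0) and cnj K(w,z0), which may vanish
  elsewhere in \<open>D\<close>. Multiplied by their squares the identity is holomorphic on the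
  whole product and extends by the identity theorem; up to a constant, \<open>ps\<close> is the
  numerator of the developing map.\<close>

lemma curvature_global_identity:
 assumes D: "open D" "connected D"
  and ex: "bergman_metric_exists D" and curv: "ALL z:D. bergman_curvature D z = -2"
  and z0: "z0 : D"
 obtains ps s where "ps holomorphic_on D" "s > 0" "ps z0 = 0" "~ (ALL z:D. ps z = 0)"
  "!!z w. z : D ==> w : D ==> brep D w z * of_real (bergman_kernel D z0) *
  (brep D z0 z * cnj (brep D z0 w) - of_real s * ps z * cnj (ps w))\<^sup>2
  = (brep D z0 z * cnj (brep D z0 w)) ^ 3"
proof -
 define K where "K = bker2 D"
 let ?B = "cnj ` D"
 define b0 where "b0 = cnj z0"
 have hK: "herm2 K D ?B" unfolding K_def by (rule bker2_herm[OF D(1)])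
 then have K2: "hol2 K D ?B" by (simp add: herm2_def)
 have b0B: "b0 : ?B" using z0 by (simp add: b0_def)
 have oB: "open ?B" "connected ?B" using D open_cnj_image connected_cnj_image by auto
 have kpos: "bergman_kernel D z0 > 0" using ex z0 by (auto simp: bergman_metric_exists_def)
 have k0: "K z0 b0 = of_real (bergman_kernel D z0)" using bker2_diag[OF D(1) z0] by (simp add: K_def b0_def)
 define n where "n = Re (wronsk K z0 b0)"
 have npos: "n > 0" using curvature_equation(2)[OF D ex curv z0 b0B z0] by (simp add: n_def K_def b0_def)
 have n0: "wronsk K z0 b0 = of_real n"
  using herm2_diag_real[OF herm2_wronsk[OF hK] z0] by (simp add: n_def b0_def)
 define p1 where "p1 = D2 K z0 b0 / K z0 b0"
 define p2 where "p2 = D1 K z0 b0 / K z0 b0"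
 \<comment> \<open>K(.,z0) times the representative coordinate, normalized to vanish at
   \<open>z0\<close>.\<close>
 define ps where "ps a = D2 K a b0 - p1 * K a b0" for a
 define ps' where "ps' b = D1 K z0 b - p2 * K z0 b" for b
 have ph: "ps holomorphic_on D"
  unfolding ps_def using hol2_section(1)[OF hol2_D2[OF K2] b0B] hol2_section(1)[OF K2 b0B] by (intro holomorphic_intros)
 have ph': "ps' holomorphic_on ?B"
  unfolding ps'_def using hol2_section(2)[OF hol2_D1[OF K2] z0] hol2_section(2)[OF K2 z0] by (intro holomorphic_intros)
 define s where "s = (bergman_kernel D z0)\<^sup>2 / (2 * n)"
 have spos: "s > 0" using npos kpos by (simp add: s_def)
 have sc: "(K z0 b0)\<^sup>2 / (2 * wronsk K z0 b0) = of_real s" unfolding k0 n0 s_def by simp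
 define H where "H = (%a b. K a b * K z0 b0 * (K a b0 * K z0 b - of_real s * ps a * ps' b)\<^sup>2 - (K a b0 * K z0 b) ^ 3)"
 have l1: "hol2 (%a b. K a b0) D ?B" by (rule hol2_left[OF hol2_section(1)[OF K2 b0B] D(1) oB(1)])
 have l2: "hol2 (%a b. K z0 b) D ?B" by (rule hol2_right[OF hol2_section(2)[OF K2 z0] D(1) oB(1)])
 have l3: "hol2 (%a b. ps a) D ?B" by (rule hol2_left[OF ph D(1) oB(1)])
 have l4: "hol2 (%a b. ps' b) D ?B" by (rule hol2_right[OF ph' D(1) oB(1)])
 have hH: "hol2 H D ?B"
  unfolding H_def by (intro hol2_diff hol2_mult hol2_power K2 l1 l2 l3 l4 hol2_const D(1) oB(1))
 have Knz: "K z0 b0 : - {0}" using k0 kpos by simp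
 have Nnz: "wronsk K z0 b0 : - {0}" using n0 npos by simp
 have op: "open (- {0::complex})" by (rule open_Compl) simp
 obtain r1 where r1: "r1 > 0" "ball z0 r1 <= D" "ball b0 r1 <= ?B" "ALL x:ball z0 r1. ALL y:ball b0 r1. K x y : - {0}"
  using hol2_nonzero_nbhd[OF K2 z0 b0B op Knz] by blast
 obtain r2 where r2: "r2 > 0" "ball z0 r2 <= D" "ball b0 r2 <= ?B" "ALL x:ball z0 r2. ALL y:ball b0 r2. wronsk K x y : - {0}"
  using hol2_nonzero_nbhd[OF hol2_wronsk[OF K2] z0 b0B op Nnz] by blast
 let ?A1 = "ball z0 r1" and ?B1 = "ball b0 r1"
 have zi: "z0 : ?A1" "b0 : ?B1" using r1(1) by auto
 have hL: "hol2 (%a b. K a b * K z0 b0 / (K a b0 * K z0 b)) ?A1 ?B1"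
 proof (rule hol2_divide)
  show "hol2 (%a b. K a b * K z0 b0) ?A1 ?B1"
  by (rule hol2_subset[OF hol2_mult[OF K2 hol2_const[OF D(1) oB(1)]] r1(2,3)]) auto
  show "hol2 (%a b. K a b0 * K z0 b) ?A1 ?B1"
  by (rule hol2_subset[OF hol2_mult[OF l1 l2] r1(2,3)]) auto
 qed (use r1(4) zi in auto)
 have "K z0 b0 * K z0 b0 / (K z0 b0 * K z0 b0) : {z. Re z > 0}" using Knz by simp
 from hol2_nonzero_nbhd[OF hL zi open_halfspace_Re_gt this]
 obtain r3 where r3: "r3 > 0" "ALL x:ball z0 r3. ALL y:ball b0 r3. Re (K x y * K z0 b0 / (K x b0 * K z0 y)) > 0"
  by auto
 define r where "r = min r1 (min r2 r3)"
 have r: "r > 0" "r <= r1" "r <= r2" "r <= r3" using r1(1) r2(1) r3(1) by (auto simp: r_def)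
 have sub: "ball z0 r <= D" "ball b0 r <= ?B" using r1(2,3) subset_ball[OF r(2)] by blast+
 have in1: "x : ball z0 r1" "x : ball z0 r2" "x : ball z0 r3" if "x : ball z0 r" for x using that r by auto
 have in2: "y : ball b0 r1" "y : ball b0 r2" "y : ball b0 r3" if "y : ball b0 r" for y using that r by auto
 have Kr: "hol2 K (ball z0 r) (ball b0 r)" by (rule hol2_subset[OF K2 sub]) auto
 have Hloc: "H a b = 0" if ab: "a : ball z0 r" "b : ball b0 r" for a b
 proof -
  have zi': "z0 : ball z0 r" "b0 : ball b0 r" using r(1) by auto
  have nz: "K a b0 ~= 0" "K z0 b ~= 0" using r1(4) in1(1) in2(1) ab zi by auto
  have "K a b * K z0 b0 * (1 - (K z0 b0)\<^sup>2 / (2 * wronsk K z0 b0) * (D2 K a b0 / K a b0 - D2 K z0 b0 / K z0 b0)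
  * (D1 K z0 b / K z0 b - D1 K z0 b0 / K z0 b0))\<^sup>2 = K a b0 * K z0 b"
  proof (rule liouville_kernel_local[OF Kr _ _ zi' _ _ _ _ ab])
  show "wronsk (wronsk K) x y * (K x y)\<^sup>2 = 3 * (wronsk K x y) ^ 3" if "x : ball z0 r" "y : ball b0 r" for x y
  using curvature_equation(1)[OF D ex curv, of x y] that sub unfolding K_def by blast
  show "K x y ~= 0" if "x : ball z0 r" "y : ball b0 r" for x y
  using r1(4) in1(1) in2(1) that by blast
  show "wronsk K x y ~= 0" if "x : ball z0 r" "y : ball b0 r" for x y
  using r2(4) in1(2) in2(2) that by blast
  show "0 < Re (K x y * K z0 b0 / (K x b0 * K z0 y))" if "x : ball z0 r" "y : ball b0 r" for x y
  using r3(2) in1(3) in2(3) that by blast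
  qed auto
  moreover have "D2 K a b0 / K a b0 - D2 K z0 b0 / K z0 b0 = ps a / K a b0"
  using nz by (simp add: ps_def p1_def diff_divide_distrib)
  moreover have "D1 K z0 b / K z0 b - D1 K z0 b0 / K z0 b0 = ps' b / K z0 b"
  using nz by (simp add: ps'_def p2_def diff_divide_distrib)
  ultimately have e: "K a b * K z0 b0 * (1 - of_real s * (ps a / K a b0) * (ps' b / K z0 b))\<^sup>2 = K a b0 * K z0 b"
  unfolding sc by simp
  have "K a b0 * K z0 b - of_real s * ps a * ps' b = (1 - of_real s * (ps a / K a b0) * (ps' b / K z0 b)) * (K a b0 * K z0 b)"
  using nz by (simp add: left_diff_distrib)
  then have "K a b * K z0 b0 * (K a b0 * K z0 b - of_real s * ps a * ps' b)\<^sup>2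
  = (K a b * K z0 b0 * (1 - of_real s * (ps a / K a b0) * (ps' b / K z0 b))\<^sup>2) * (K a b0 * K z0 b)\<^sup>2"
  by (simp only: power_mult_distrib mult_ac)
  also have "... = (K a b0 * K z0 b) ^ 3" unfolding e by (simp add: p2eq power3_eq_cube)
  finally show ?thesis by (simp add: H_def)
 qed
 have Hz: "H a b = 0" if "a : D" "b : ?B" for a b
  by (rule hol2_zero_extend[where U = "ball z0 r" and V = "ball b0 r" and u = z0 and v = b0, OF hH D(2) oB(2)])
  (use r(1) sub Hloc that in auto)
 \<comment> \<open>Hermitian symmetry turns the factor in the second variable into the conjugate of
   \<open>ps\<close>, so that a single holomorphic function remains.\<close>
 have cp: "ps' (cnj w) = cnj (ps w)" if w: "w : D" for w
 proof -
  have 1: "D1 K z0 (cnj w) = cnj (D2 K w b0)" using herm2_D(1)[OF hK w b0B] by (simp add: b0_def)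
  have 2: "K z0 (cnj w) = cnj (K w b0)" if "w : D" for w using hK that b0B unfolding herm2_def b0_def by (metis complex_cnj_cnj)
  have 3: "D1 K z0 b0 = cnj (D2 K z0 b0)" using herm2_D(1)[OF hK z0 b0B] by (simp add: b0_def)
  show ?thesis unfolding ps'_def ps_def p1_def p2_def 1 2[OF w] 3 using 2[OF z0] by (simp add: b0_def)
 qed
 \<comment> \<open>If \<open>ps\<close> vanished, \<open>D2 K\<close> would be a multiple of
   \<open>K\<close> along b = b0 and the Wronskian at the base point would be 0, against the
   positivity of the metric.\<close>
 have nonzero: "~ (ALL z:D. ps z = 0)"
 proof
  assume "ALL z:D. ps z = 0"
  then have "D2 K x b0 = p1 * K x b0" if "x : D" for x using that by (simp add: ps_def)
  then have "D1 (D2 K) z0 b0 = D1 (%a b. p1 * K a b) z0 b0" "D2 K z0 b0 = p1 * K z0 b0"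
  using D1_cong[OF D(1) z0, of "D2 K" b0 "%a b. p1 * K a b"] z0 by auto
  moreover have "D1 (%a b. p1 * K a b) z0 b0 = p1 * D1 K z0 b0"
  unfolding D1_def[of "%a b. p1 * K a b"] by (rule DERIV_imp_deriv) (rule DERIV_cmult[OF hol2_D1_deriv[OF K2 z0 b0B]])
  ultimately have "wronsk K z0 b0 = 0" by (simp add: wronsk_def)
  then show False using n0 npos by simp
 qed
 show thesis
 proof (rule that[OF ph spos _ nonzero])
  show "ps z0 = 0" using Knz by (simp add: ps_def p1_def)
  fix z w assume zw: "z : D" "w : D"
  have "H z (cnj w) = 0" by (rule Hz) (use zw in auto)
  moreover have "K z0 (cnj w) = cnj (K w b0)" using hK zw b0B unfolding herm2_def b0_def by (metis complex_cnj_cnj)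
  ultimately show "brep D w z * of_real (bergman_kernel D z0) *
  (brep D z0 z * cnj (brep D z0 w) - of_real s * ps z * cnj (ps w))\<^sup>2
  = (brep D z0 z * cnj (brep D z0 w)) ^ 3"
  using k0 cp[OF zw(2)] by (simp add: H_def) (simp add: K_def bker2_def b0_def)
 qed
qed

text \<open>The developing map of the hyperbolic metric is single valued because the polarized kernel is.\<close>

lemma curvature_developing_map:
 assumes D: "open D" "connected D"
  and ex: "bergman_metric_exists D" and curv: "ALL z:D. bergman_curvature D z = -2"
  and z0: "z0 : D"
 obtains f where "f holomorphic_on D" "f ` D <= ball 0 1" "f z0 = 0" "~ (ALL z:D. f z = 0)"
  "!!z. z : D ==> brep D z0 z ~= 0"
  "!!z w. z : D ==> w : D ==> brep D w z * of_real (bergman_kernel D z0) * (1 - f z * cnj (f w))\<^sup>2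
  = brep D z0 z * cnj (brep D z0 w)"
proof -
 define k where "k = brep D z0"
 define ka where "ka = bergman_kernel D z0"
 obtain ps s where ps: "ps holomorphic_on D" "s > 0" "ps z0 = 0" "~ (ALL z:D. ps z = 0)"
  and id: "!!z w. z : D ==> w : D ==> brep D w z * of_real ka *
  (k z * cnj (k w) - of_real s * ps z * cnj (ps w))\<^sup>2 = (k z * cnj (k w)) ^ 3"
  using curvature_global_identity[OF D ex curv z0] unfolding k_def ka_def by metis
 have kpos: "bergman_kernel D z > 0" if "z : D" for z using ex that by (auto simp: bergman_metric_exists_def)
 have ka: "ka > 0" using kpos[OF z0] by (simp add: ka_def)
 have kz0: "k z0 = of_real ka" using bergman_kernel_rep(1)[OF D(1) z0] by (simp add: k_def ka_def)
 have kh: "k holomorphic_on D" unfolding k_def by (rule A2D(1)[OF brep(1)[OF D(1) z0]])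
 \<comment> \<open>This is |k|^2 (1 - |q|^2) for the quotient \<open>q\<close> below, written
   without a denominator. The identity on the diagonal forbids u = 0 wherever \<open>k\<close> is
   nonzero.\<close>
 define u where "u z = (cmod (k z))\<^sup>2 - s * (cmod (ps z))\<^sup>2" for z
 have diag: "bergman_kernel D z * ka * (u z)\<^sup>2 = (cmod (k z)) ^ 6" if z: "z : D" for z
 proof -
  have 1: "k z * cnj (k z) - of_real s * ps z * cnj (ps z) = of_real (u z)"
  unfolding u_def of_real_diff of_real_mult complex_norm_square by (simp add: mult.assoc)
  have 2: "k z * cnj (k z) = of_real ((cmod (k z))\<^sup>2)" by (simp only: complex_norm_square)
  have "cor (bergman_kernel D z * ka * (u z)\<^sup>2) = of_real (((cmod (k z))\<^sup>2) ^ 3)"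
  using id[OF z z] unfolding 1 unfolding 2 bergman_kernel_rep(1)[OF D(1) z] by simp
  then have "bergman_kernel D z * ka * (u z)\<^sup>2 = ((cmod (k z))\<^sup>2) ^ 3" unfolding of_real_eq_iff .
  then show ?thesis by (simp flip: power_mult)
 qed
 define Z where "Z = {z\<in>D. k z = 0}"
 have contu: "continuous_on D u"
  unfolding u_def using kh ps(1) by (intro continuous_intros hol_cont)
 have upos: "u z > 0" if z: "z : D - Z" for z
 proof (rule ccontr)
  assume "~ u z > 0"
  obtain C :: "nat => complex set" where C: "!!n. compact (C n)" "\<Union>(range C) = D"
  using open_Union_compact_subsets[OF D(1)] by metis
  have "fsigma (\<Union>(range C))" by (rule fsigma.intros) (use C compact_imp_closed in auto)
  then have "fsigma D" unfolding C(2) .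
  then have "countable Z \<or> k constant_on D"
  using holomorphic_countable_zeros[OF kh D] by (auto simp: Z_def)
  then have cz: "countable Z"
  proof
  assume "k constant_on D"
  then have "k z = of_real ka" if "z : D" for z using that z0 kz0 unfolding constant_on_def by metis
  then have "Z = {}" using ka by (auto simp: Z_def)
  then show ?thesis by simp
  qed
  \<comment> \<open>Removing a countable set keeps \<open>D\<close> connected, so positivity of
    \<open>u\<close> at \<open>z0\<close> spreads over the complement of the zeros of
    \<open>k\<close>.\<close>
  have conn: "connected (D - Z)" by (rule connected_open_diff_countable[OF _ D cz]) simp
  have "connected (u ` (D - Z))"
  by (rule connected_continuous_image[OF continuous_on_subset[OF contu] conn]) auto
  moreover have "z0 : D - Z" using z0 kz0 ka by (auto simp: Z_def)
  moreover have "u z0 > 0" using kz0 ka ps(3) by (simp add: u_def)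
  ultimately have "0 : u ` (D - Z)"
  using \<open>\<not> u z > 0\<close> z unfolding connected_iff_interval by (meson imageI less_imp_le not_less)
  then obtain y where "y : D - Z" "u y = 0" by (metis image_iff)
  then have y: "y : D" "k y ~= 0" "u y = 0" by (simp_all add: Z_def)
  then show False using diag[OF y(1)] by simp
 qed
 define q where "q z = of_real (sqrt s) * ps z / k z" for z
 have usq: "u z = (cmod (k z))\<^sup>2 * (1 - (cmod (q z))\<^sup>2)" if "k z ~= 0" for z
  using that ps(2) by (simp add: u_def q_def norm_divide norm_mult power_divide power_mult_distrib right_diff_distrib)
 have qlt: "cmod (q z) < 1" if z: "z : D - Z" for z
 proof -
  have kz: "k z ~= 0" using z by (simp add: Z_def)
  then have "(cmod (q z))\<^sup>2 < 1" using upos[OF z] usq[OF kz] by (simp add: zero_less_mult_iff)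
  then show ?thesis by (simp add: abs_square_less_1)
 qed
 have dq: "bergman_kernel D z * ka * (1 - (cmod (q z))\<^sup>2)\<^sup>2 = (cmod (k z))\<^sup>2" if z: "z : D - Z" for z
 proof -
  have kz: "k z ~= 0" using z by (simp add: Z_def)
  have "(bergman_kernel D z * ka * (1 - (cmod (q z))\<^sup>2)\<^sup>2) * (cmod (k z)) ^ 4 = (cmod (k z))\<^sup>2 * (cmod (k z)) ^ 4"
  using diag[of z] z unfolding usq[OF kz] by (simp add: power_mult_distrib p2eq power4_eq_xxxx power_def numeral_eq_Suc mult_ac)
  moreover have "(cmod (k z)) ^ 4 ~= 0" using kz by simp
  ultimately show ?thesis using mult_right_cancel by blast
 qed
 have contk: "isCont (bergman_kernel D) z" if z: "z : D" for z
 proof -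
  have "has_wirt (%z. bker2 D z (cnj z)) (D1 (bker2 D) z (cnj z)) (D2 (bker2 D) z (cnj z)) z"
  by (rule hol2_has_wirt[of _ D "cnj ` D"]) (use bker2_herm[OF D(1)] z in \<open>auto simp: herm2_def\<close>)
  then have "isCont (%z. bker2 D z (cnj z)) z" unfolding has_wirt_def by (rule has_derivative_continuous)
  then have c: "isCont (%z. Re (bker2 D z (cnj z))) z" unfolding isCont_def by (rule tendsto_Re)
  have "eventually (%w. w : D) (nhds z)" using D(1) z eventually_nhds_in_open by blast
  then have "eventually (%w. Re (bker2 D w (cnj w)) = bergman_kernel D w) (nhds z)"
  by (rule eventually_mono) (simp add: bker2_diag[OF D(1)])
  from isCont_cong[OF this] c show ?thesis by blast
 qed
 \<comment> \<open>A zero of \<open>k\<close> would be a removable singularity of the bounded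
   quotient \<open>q\<close>, and the extension would have modulus 1 there because K(z1,z1) > 0. The
   maximum principle makes the extension constant, although |q| < 1 nearby.\<close>
 have knz: "k z1 ~= 0" if z1: "z1 : D" for z1
 proof
  assume k0: "k z1 = 0"
  have kz0n: "k z0 ~= 0" using kz0 ka by simp
  obtain r where r: "0 < r" "ball z1 r <= D" "!!z. z : ball z1 r - {z1} ==> k z ~= 0"
  using isolated_zeros[OF kh D z1 k0 z0 kz0n] by metis
  have pun: "z : D - Z" if "z : ball z1 r - {z1}" for z using r(2) r(3)[OF that] that by (auto simp: Z_def)
  have qh: "q holomorphic_on ball z1 r - {z1}"
  unfolding q_def using r kh ps(1) by (intro holomorphic_intros) (auto intro: hol_subset)
  have bd: "EX B. eventually (%z. cmod (q z) <= B) (at z1)"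
  proof (intro exI[of _ 1])
  have "eventually (%z. z : ball z1 r - {z1}) (at z1)"
  using eventually_at_in_open[of "ball z1 r" z1] r(1) by auto
  then show "eventually (%z. cmod (q z) <= 1) (at z1)"
  by (rule eventually_mono) (use qlt pun in \<open>auto intro: less_imp_le\<close>)
  qed
  then obtain g where g: "g holomorphic_on ball z1 r" "ALL z:ball z1 r - {z1}. g z = q z"
  using holomorphic_on_extend_bounded[OF qh] r(1) by auto
  have gc: "isCont g z1"
  using g(1) r(1) hol_cont continuous_on_eq_continuous_at[OF open_ball] by (metis centre_in_ball)
  have lim1: "((%z. bergman_kernel D z * ka * (1 - (cmod (g z))\<^sup>2)\<^sup>2) \<longlongrightarrow> bergman_kernel D z1 * ka * (1 - (cmod (g z1))\<^sup>2)\<^sup>2) (at z1)"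
  using gc contk[OF z1] unfolding isCont_def by (intro tendsto_intros)
  have "isCont k z1" using kh z1 hol_cont continuous_on_eq_continuous_at[OF D(1)] by blast
  then have lim2: "((%z. (cmod (k z))\<^sup>2) \<longlongrightarrow> (cmod (k z1))\<^sup>2) (at z1)" unfolding isCont_def by (intro tendsto_intros)
  have "eventually (%z. z : ball z1 r - {z1}) (at z1)"
  using eventually_at_in_open[of "ball z1 r" z1] r(1) by auto
  then have "eventually (%z. bergman_kernel D z * ka * (1 - (cmod (g z))\<^sup>2)\<^sup>2 = (cmod (k z))\<^sup>2) (at z1)"
  by (rule eventually_mono) (use dq pun g(2) in auto)
  then have "((%z. (cmod (k z))\<^sup>2) \<longlongrightarrow> bergman_kernel D z1 * ka * (1 - (cmod (g z1))\<^sup>2)\<^sup>2) (at z1)"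
  using lim1 by (rule Lim_transform_eventually[rotated])
  then have "bergman_kernel D z1 * ka * (1 - (cmod (g z1))\<^sup>2)\<^sup>2 = (cmod (k z1))\<^sup>2"
  using lim2 tendsto_unique at_neq_bot by blast
  then have "(cmod (g z1))\<^sup>2 = 1" using k0 kpos[OF z1] ka by simp
  then have g1: "cmod (g z1) = 1" using power2_eq_iff_nonneg[of "cmod (g z1)" 1] by simp
  have "g constant_on ball z1 r"
  proof (rule maximum_modulus_principle[OF g(1) open_ball connected_ball open_ball order_refl])
  show "z1 : ball z1 r" using r(1) by simp
  show "cmod (g z) <= cmod (g z1)" if "z : ball z1 r" for z
  using g1 g(2) qlt pun that by (cases "z = z1") (auto intro: less_imp_le)
  qed
  then obtain c where c: "!!z. z : ball z1 r ==> g z = c" unfolding constant_on_def by blast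
  define z2 where "z2 = z1 + of_real (r / 2)"
  have z2: "z2 : ball z1 r - {z1}" using r(1) by (auto simp: z2_def dist_norm)
  have "cmod (g z2) < 1" using g(2) qlt[OF pun[OF z2]] z2 by simp
  moreover have "g z2 = g z1" using c z2 r(1) by simp
  ultimately show False using g1 by simp
 qed
 then have Ze: "Z = {}" by (auto simp: Z_def)
 show thesis
 proof (rule that[of q])
  show "q holomorphic_on D" unfolding q_def using kh ps(1) knz by (intro holomorphic_intros)
  show "q ` D <= ball 0 1" using qlt Ze by auto
  show "q z0 = 0" using ps(3) by (simp add: q_def)
  show "~ (ALL z:D. q z = 0)" using ps(2,4) knz by (auto simp: q_def)
  show "brep D z0 z ~= 0" if "z : D" for z using knz[OF that] by (simp add: k_def)
  fix z w assume zw: "z : D" "w : D"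
  let ?c = "k z * cnj (k w)"
  have nz: "?c ~= 0" using knz zw by simp
  have ss: "cor (sqrt s) * cor (sqrt s) = of_real s"
  using ps(2) by (simp flip: of_real_mult)
  have "q z * cnj (q w) = of_real s * ps z * cnj (ps w) / ?c"
  unfolding q_def ss[symmetric] by (simp add: mult_ac)
  then have "?c - of_real s * ps z * cnj (ps w) = ?c * (1 - q z * cnj (q w))"
  using nz by (simp add: right_diff_distrib)
  then have "(brep D w z * of_real ka * (1 - q z * cnj (q w))\<^sup>2) * ?c\<^sup>2 = ?c * ?c\<^sup>2"
  using id[OF zw] by (simp add: power_mult_distrib mult_ac p2eq power3_eq_cube)
  moreover have "?c\<^sup>2 ~= 0" using nz by simp
  ultimately have "brep D w z * of_real ka * (1 - q z * cnj (q w))\<^sup>2 = ?c" using mult_right_cancel by blast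
  then show "brep D w z * of_real (bergman_kernel D z0) * (1 - q z * cnj (q w))\<^sup>2
  = brep D z0 z * cnj (brep D z0 w)" by (simp add: k_def ka_def)
 qed
qed

section \<open>The developing map\<close>

lemma compact_continuous_bound:
 assumes "compact K" "continuous_on K f"
 shows "EX M. ALL z:K. norm (f z) <= M"
proof -
 have "bounded (f ` K)" by (rule compact_imp_bounded[OF compact_continuous_image[OF assms(2,1)]])
 then obtain M where "ALL x:f ` K. norm x <= M" unfolding bounded_iff by blast
 then show ?thesis by blast
qed

text \<open>Dividing by the exact power of z - z1 keeps square integrability: near \<open>z1\<close>
  the quotient is bounded, elsewhere the denominator is bounded below. The result tells
  \<open>z1\<close> from \<open>z2\<close>, as the injectivity of \<open>f\<close> requires.\<close>

lemma bergman_divide_zero: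
 assumes D: "open D" "connected D" and u: "u : A2 D" and z1: "z1 : D" and nz: "~ (ALL z:D. u z = 0)"
  and z2: "z2 : D" "z2 ~= z1" "u z2 = 0" and u1: "u z1 = 0"
 obtains v where "v : A2 D" "v z1 ~= 0" "v z2 = 0"
proof -
 have uh: "u holomorphic_on D" using u by (simp add: A2_def)
 obtain zz where zz: "zz : D" "u zz ~= 0" using nz by blast
 have nc: "~ u constant_on D" using zz u1 z1 unfolding constant_on_def by metis
 obtain g r n where g: "0 < (n::nat)" "0 < r" "ball z1 r <= D" "g holomorphic_on ball z1 r"
  "!!w. w : ball z1 r ==> u w = (w - z1) ^ n * g w" "!!w. w : ball z1 r ==> g w ~= 0"
  by (rule holomorphic_factor_zero_nonconstant[OF uh D z1 u1 nc]) (rule that)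
 define v where "v z = (if z = z1 then g z1 else u z / (z - z1) ^ n)" for z
 have vg: "v w = g w" if "w : ball z1 r" for w using g(5)[OF that] by (simp add: v_def)
 have vh: "v holomorphic_on D"
  unfolding holomorphic_on_def
 proof
  fix z assume z: "z : D"
  show "v field_differentiable at z within D"
  proof (cases "z = z1")
  case True
  have "v holomorphic_on ball z1 r" by (rule holomorphic_transform[OF g(4)]) (simp add: vg)
  then have "v field_differentiable at z1" using holomorphic_on_imp_differentiable_at[OF _ open_ball] g(2) by simp
  then show ?thesis using True field_differentiable_at_within by blast
  next
  case False
  have "(%z. u z / (z - z1) ^ n) holomorphic_on D - {z1}"
  using uh by (intro holomorphic_intros) (auto intro: hol_subset)
  then have "v holomorphic_on D - {z1}" by (rule holomorphic_transform) (simp add: v_def)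
  moreover have "open (D - {z1})" using D(1) by (simp add: open_delete)
  ultimately have "v field_differentiable at z" using holomorphic_on_imp_differentiable_at False z by blast
  then show ?thesis using field_differentiable_at_within by blast
  qed
 qed
 have cg: "continuous_on (cball z1 (r/2)) v"
  using vh g(2,3) by (intro hol_cont) (auto intro!: hol_subset[OF vh] simp: subset_iff)
 obtain M where M: "!!z. z : cball z1 (r/2) ==> cmod (v z) <= M"
  using compact_continuous_bound[OF compact_cball cg] by blast
 let ?b = "%z. ((2 / r) ^ n)\<^sup>2 * (cmod (u z))\<^sup>2 + indicat_real (cball z1 (r/2)) z * M\<^sup>2"
 have "v : A2 D"
  unfolding A2_def
 proof (intro CollectI conjI vh)
  show "intg D (%z. (cmod (v z))\<^sup>2)"
  proof (rule set_integrable_bound)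
  have "intg D (%z. indicat_real (cball z1 (r/2)) z * M\<^sup>2)"
  unfolding set_integrable_def
  proof (rule Bochner_Integration.integrable_bound)
  show "integrable lborel (%z. indicat_real (cball z1 (r/2)) z * M\<^sup>2)"
  using emeasure_bounded_finite[of "cball z1 (r/2)"] by (intro integrable_mult_left) auto
  show "(%z. indicat_real D z *\<^sub>R (indicat_real (cball z1 (r / 2)) z * M\<^sup>2)) : borel_measurable lborel"
  by (intro borel_measurable_scaleR borel_measurable_times borel_measurable_indicator) (use D(1) in auto)
  qed (auto simp: indicator_def)
  then show "intg D ?b"
  using A2D(2)[OF u] by (intro set_integral_add) auto
  have "continuous_on D (%z. (cmod (v z))\<^sup>2)"
  using vh by (intro continuous_intros hol_cont)
  then show "smeas D (%z. (cmod (v z))\<^sup>2)"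
  using D(1) by (intro meas_cont) auto
  show "AE z in lborel. z : D --> norm ((cmod (v z))\<^sup>2) <= norm (?b z)"
  proof (rule AE_I2, rule impI)
  fix z assume "z : D"
  show "norm ((cmod (v z))\<^sup>2) <= norm (?b z)"
  proof (cases "z : cball z1 (r/2)")
  case True
  then have "(cmod (v z))\<^sup>2 <= M\<^sup>2" by (intro power_mono M) auto
  then show ?thesis using True by (simp add: add_increasing)
  next
  case False
  then have "cmod (z - z1) >= r/2" by (simp add: dist_norm norm_minus_commute)
  then have "(r/2) ^ n <= cmod ((z - z1) ^ n)" unfolding norm_power using g(2) by (intro power_mono) auto
  moreover have "(r/2) ^ n > 0" using g(2) by simp
  ultimately have "cmod (u z) / cmod ((z - z1) ^ n) <= cmod (u z) / (r/2) ^ n"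
  by (intro divide_left_mono[OF _ norm_ge_zero] mult_pos_pos) linarith+
  also have "... = (2 / r) ^ n * cmod (u z)" by (simp add: power_divide)
  finally have "cmod (v z) <= (2 / r) ^ n * cmod (u z)" using False g(2) by (auto simp: v_def norm_divide)
  then have "(cmod (v z))\<^sup>2 <= ((2 / r) ^ n * cmod (u z))\<^sup>2" by (intro power_mono) auto
  then show ?thesis using False by (simp add: power_mult_distrib)
  qed
  qed
  qed
 qed
 moreover have "v z1 ~= 0" using g(6)[of z1] g(2) by (simp add: v_def)
 moreover have "v z2 = 0" using z2 by (simp add: v_def)
 ultimately show thesis by (rule that)
qed

text \<open>The output of \<open>curvature_developing_map\<close> at one base point: up to a
  constant and the factors K(.,z0), the kernel is that of the disc pulled back by
  \<open>f\<close>.\<close>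

locale hyperbolic_kernel =
 fixes D :: "complex set" and z0 :: complex and f :: "complex => complex"
 assumes D: "open D" "connected D" and z0: "z0 : D"
  and f: "f holomorphic_on D" and fD: "f ` D <= ball 0 1" and f0: "f z0 = 0" and fn: "~ (ALL z:D. f z = 0)"
  and knz: "z : D ==> brep D z0 z ~= 0"
  and ker: "z : D ==> w : D ==> brep D w z * of_real (bergman_kernel D z0) * (1 - f z * cnj (f w))\<^sup>2
  = brep D z0 z * cnj (brep D z0 w)"
begin

definition "k = brep D z0"
definition "ka = bergman_kernel D z0"

lemma kb: "k : A2 D" unfolding k_def by (rule brep(1)[OF D(1) z0])

lemma k_nonzero: "z : D ==> k z ~= 0" using knz by (simp add: k_def)

lemma f_lt: "z : D ==> cmod (f z) < 1" using fD by auto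

lemma kappa_pos: "ka > 0"
proof -
 have "ka >= 0" using bergman_kernel_rep(2)[OF D(1) z0] by (simp add: ka_def)
 moreover have "ka ~= 0" using bergman_kernel_rep(1)[OF D(1) z0] k_nonzero[OF z0] by (simp add: k_def ka_def)
 ultimately show ?thesis by simp
qed

lemma one_minus_nz: "z : D ==> w : D ==> 1 - f z * cnj (f w) ~= 0"
proof
 assume zw: "z : D" "w : D" and "1 - f z * cnj (f w) = 0"
 then have "cmod (f z) * cmod (f w) = 1" by (metis complex_mod_cnj eq_iff_diff_eq_0 norm_mult norm_one)
 moreover have "cmod (f z) * cmod (f w) < 1 * 1" using f_lt zw by (intro mult_strict_mono) auto
 ultimately show False by simp
qed

lemma rep_eq: "z : D ==> w : D ==> brep D w z = cnj (k w) / of_real ka * (k z / (1 - f z * cnj (f w))\<^sup>2)"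
 using ker[of z w] one_minus_nz[of z w] kappa_pos by (simp add: k_def ka_def field_simps)

text \<open>If f(z1) = f(z2), then K(.,z1) and K(.,z2) are proportional by the kernel identity, so
  all functions in the space have values in a fixed ratio at the two points. A function vanishing at
  \<open>z2\<close> but not at \<open>z1\<close> contradicts this.\<close>

lemma f_inj: "inj_on f D"
proof (rule inj_onI, rule ccontr)
 fix z1 z2 assume z: "z1 : D" "z2 : D" and e: "f z1 = f z2" and ne: "z1 ~= z2"
 have fib: "u z1 * k z2 = u z2 * k z1" if u: "u : A2 D" for u
 proof -
  have "k z2 * u z1 = L2_inner D u (%z. cnj (k z2) * brep D z1 z)"
  using brep(2)[OF D(1) z(1) u] L2_inner_scale_right[of D u "cnj (k z2)"] by simp
  also have "... = L2_inner D u (%z. cnj (k z1) * brep D z2 z)"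
  by (rule L2_inner_cong) (use z e in \<open>auto simp: rep_eq\<close>)
  also have "... = k z1 * u z2"
  using brep(2)[OF D(1) z(2) u] L2_inner_scale_right[of D u "cnj (k z1)"] by simp
  finally show ?thesis by (simp add: mult.commute)
 qed
 define u where "u = (%z. (f z - f z1) * k z)"
 have ub: "u : A2 D"
  unfolding u_def
 proof (rule A2_mult_bounded[OF D(1) kb])
  show "(%z. f z - f z1) holomorphic_on D" using f by (intro holomorphic_intros)
  show "cmod (f z - f z1) <= 2" if "z : D" for z
  using norm_triangle_ineq4[of "f z" "f z1"] f_lt[OF that] f_lt[OF z(1)] by linarith
 qed
 obtain v where v: "v : A2 D" "v z1 ~= 0" "v z2 = 0"
 proof (rule bergman_divide_zero[OF D ub z(1) _ z(2)])
  show "~ (ALL z:D. u z = 0)"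
  proof
  assume "ALL z:D. u z = 0"
  then have "f z = f z1" if "z : D" for z using k_nonzero[OF that] that by (auto simp: u_def)
  then show False using fn f0 z0 by metis
  qed
 qed (use ne e in \<open>auto simp: u_def\<close>)
 show False using fib[OF v(1)] v k_nonzero[OF z(2)] by simp
qed

lemma open_image: "open (f ` D)"
 by (rule open_mapping_thm3[OF f D(1) f_inj])

lemma deriv_f_nonzero: "z : D ==> deriv f z ~= 0"
 by (rule holomorphic_injective_imp_regular[OF f D(1) f_inj])

text \<open>The functions that correspond to the monomials on the disc.\<close>

definition "em m = (%z. f z ^ m * k z)"

lemma em_bs: "em m : A2 D"
 unfolding em_def
proof (rule A2_mult_bounded[OF D(1) kb])
 show "(%z. f z ^ m) holomorphic_on D" using f by (intro holomorphic_intros)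
 show "cmod (f z ^ m) <= 1" if "z : D" for z
  using f_lt[OF that] by (simp add: norm_power power_le_one)
qed

lemma geometric_square_sums:
 fixes x :: complex assumes "cmod x < 1"
 shows "(%n. of_nat (n + 1) * x ^ n) sums (1 / (1 - x)\<^sup>2)"
 using geometric_deriv_sums[of x] assms by simp

text \<open>The reproducing property paired with the power series of the kernel.\<close>

lemma inner_rep_sums:
 assumes u: "u : A2 D" and w: "w : D"
 shows "(%n. of_nat (n + 1) * f w ^ n * L2_inner D u (em n)) sums (of_real ka * u w / k w)"
proof -
 let ?t = "cnj (f w)"
 have t: "cmod ?t < 1" using f_lt[OF w] by simp
 define h where "h N z = (\<Sum>n<N. of_nat (n + 1) * ?t ^ n * em n z)" for N z
 define H where "H z = k z / (1 - f z * ?t)\<^sup>2" for z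
 \<comment> \<open>Tail of the dominating series at |f w|. As |f| < 1 on \<open>D\<close>, it bounds
   the error uniformly up to the square integrable factor |k|.\<close>
 define ta where "ta N = (\<Sum>n. real (n + N + 1) * cmod ?t ^ (n + N))" for N
 have sn: "summable (%n. real (n + 1) * cmod ?t ^ n)"
  using geometric_deriv_sums[of "cmod ?t"] t by (simp add: sums_iff)
 have ta0: "ta \<longlonglongrightarrow> 0"
  using suminf_exist_split2[OF sn] unfolding ta_def by simp
 have est: "cmod (h N z - H z) <= ta N * cmod (k z)" if z: "z : D" for N z
 proof -
  let ?x = "f z * ?t"
  have x: "cmod ?x <= cmod ?t" unfolding norm_mult using f_lt[OF z] by (intro mult_left_le_one_le) auto
  then have "cmod ?x < 1" using t by linarith
  from geometric_square_sums[OF this] have s: "(%n. of_nat (n + 1) * ?x ^ n) sums (1 / (1 - ?x)\<^sup>2)" .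
  have tail: "(\<Sum>n. of_nat (n + N + 1) * ?x ^ (n + N)) = 1 / (1 - ?x)\<^sup>2 - (\<Sum>n<N. of_nat (n + 1) * ?x ^ n)"
  using sums_split_initial_segment[OF s, of N] by (simp add: sums_iff)
  have hz: "h N z = k z * (\<Sum>n<N. of_nat (n + 1) * ?x ^ n)"
  unfolding h_def em_def sum_distrib_left by (rule sum.cong) (auto simp: power_mult_distrib)
  have "H z - h N z = k z * (\<Sum>n. of_nat (n + N + 1) * ?x ^ (n + N))"
  unfolding tail hz H_def by (simp add: right_diff_distrib)
  moreover have "cmod (\<Sum>n. of_nat (n + N + 1) * ?x ^ (n + N)) <= ta N"
  unfolding ta_def
  proof (rule norm_suminf_le)
  show "norm (of_nat (n + N + 1) * ?x ^ (n + N)) <= real (n + N + 1) * cmod ?t ^ (n + N)" for n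
  unfolding norm_mult[of "of_nat _"] norm_power norm_of_nat by (intro mult_left_mono power_mono x) auto
  show "summable (%n. real (n + N + 1) * cmod ?t ^ (n + N))"
  using summable_ignore_initial_segment[OF sn, of N] by simp
  qed
  ultimately show ?thesis
  by (metis (no_types, lifting) mult.commute mult_left_mono norm_ge_zero norm_minus_commute norm_mult)
 qed
 have hb: "h N : A2 D" for N
  unfolding h_def by (intro A2_sum A2_scale D(1) em_bs) auto
 have Hrep: "H z = of_real ka / cnj (k w) * brep D w z" if "z : D" for z
  using rep_eq[OF that w] k_nonzero[OF w] kappa_pos by (simp add: H_def)
 have Hb: "H : A2 D"
  by (rule A2_cong[OF A2_scale[OF D(1) brep(1)[OF D(1) w], of "of_real ka / cnj (k w)"]])
  (simp add: Hrep)
 have "(%N. nsq D (%z. h N z - H z)) \<longlonglongrightarrow> 0"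
 proof (rule Lim_null_comparison)
  have "(%N. (ta N)\<^sup>2 * nsq D k) \<longlonglongrightarrow> 0\<^sup>2 * nsq D k" by (intro tendsto_intros ta0)
  then show "(%N. (ta N)\<^sup>2 * nsq D k) \<longlonglongrightarrow> 0" by simp
  show "eventually (%N. norm (nsq D (%z. h N z - H z)) <= (ta N)\<^sup>2 * nsq D k) sequentially"
  proof (rule always_eventually, rule allI)
  fix N
  have "nsq D (%z. h N z - H z) <= (LINT z:D|lborel. (ta N)\<^sup>2 * (cmod (k z))\<^sup>2)"
  proof (rule set_integral_mono)
  show "intg D (%z. (cmod (h N z - H z))\<^sup>2)"
  by (rule A2D(2)[OF A2_diff[OF D(1) hb Hb]])
  show "intg D (%z. (ta N)\<^sup>2 * (cmod (k z))\<^sup>2)"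
  using A2D(2)[OF kb] by simp
  show "(cmod (h N z - H z))\<^sup>2 <= (ta N)\<^sup>2 * (cmod (k z))\<^sup>2" if "z : D" for z
  using power_mono[OF est[OF that, of N] norm_ge_zero, of 2] by (simp add: power_mult_distrib)
  qed
  then show "norm (nsq D (%z. h N z - H z)) <= (ta N)\<^sup>2 * nsq D k" by simp
  qed
 qed
 from L2_inner_tendsto[OF D(1) hb Hb u this]
 have "(%N. cnj (L2_inner D (h N) u)) \<longlonglongrightarrow> cnj (L2_inner D H u)" by (intro tendsto_intros)
 moreover have "cnj (L2_inner D (h N) u) = (\<Sum>n<N. of_nat (n + 1) * f w ^ n * L2_inner D u (em n))" for N
 proof -
  have "L2_inner D (h N) u = (\<Sum>n<N. of_nat (n + 1) * ?t ^ n * L2_inner D (em n) u)"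
  unfolding h_def
  by (subst L2_inner_sum_left[OF D(1)]) (auto intro!: A2_scale D(1) em_bs u simp: L2_inner_scale_left)
  then show ?thesis unfolding L2_inner_commute[of D u] by (simp only: cnj_sum complex_cnj_mult complex_cnj_power complex_cnj_cnj complex_cnj_of_nat)
 qed
 moreover have "cnj (L2_inner D H u) = of_real ka * u w / k w"
 proof -
  have "cnj (L2_inner D H u) = L2_inner D u H" by (rule L2_inner_commute[symmetric])
  also have "... = L2_inner D u (%z. of_real ka / cnj (k w) * brep D w z)"
  by (rule L2_inner_cong) (auto simp: Hrep)
  also have "... = of_real ka * u w / k w"
  unfolding L2_inner_scale_right brep(2)[OF D(1) w u] by simp
  finally show ?thesis .
 qed
 ultimately show ?thesis by (simp add: sums_def)
qed

text \<open>For \<open>u = em m\<close> the sum in \<open>inner_rep_sums\<close> is ka x^m with x =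
  f(w). Since 0 lies in the open image, \<open>x\<close> fills a disc and coefficients can be
  compared.\<close>

lemma em_orthogonal: "L2_inner D (em m) (em n) = (if m = n then of_real (ka / (real n + 1)) else 0)"
proof -
 define d where "d n = of_nat (n + 1) * L2_inner D (em m) (em n) - (if n = m then of_real ka else 0)" for n
 have "0 : f ` D" using f0 z0 by force
 then obtain r where r: "r > 0" "ball 0 r <= f ` D" using open_image open_contains_ball by blast
 have s: "(%n. d n * (x - 0) ^ n) sums 0" if x: "cmod (x - 0) < r" for x
 proof -
  have "x : f ` D" using r(2) x by auto
  then obtain w where w: "w : D" "f w = x" by auto
  have "em m w / k w = x ^ m" using k_nonzero[OF w(1)] w(2) by (simp add: em_def)
  then have "(%n. of_nat (n + 1) * x ^ n * L2_inner D (em m) (em n)) sums (of_real ka * x ^ m)"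
  using inner_rep_sums[OF em_bs w(1), of m] w(2) by (metis times_divide_eq_right)
  moreover have "(%n. if n = m then of_real ka * x ^ n else 0) sums (of_real ka * x ^ m)"
  using sums_single[of m "%n. of_real ka * x ^ n"] by simp
  ultimately have "(%n. of_nat (n + 1) * x ^ n * L2_inner D (em m) (em n) - (if n = m then of_real ka * x ^ n else 0)) sums (of_real ka * x ^ m - of_real ka * x ^ m)"
  by (rule sums_diff)
  moreover have "of_nat (n + 1) * x ^ n * L2_inner D (em m) (em n) - (if n = m then of_real ka * x ^ n else 0) = d n * (x - 0) ^ n" for n
  by (simp add: d_def algebra_simps)
  ultimately show ?thesis by simp
 qed
 have "d i = 0" for i
 proof (rule ccontr)
  assume di: "d i ~= 0"
  have d0: "d 0 = 0" using s[of 0] r(1) by (simp add: sums_iff)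
  then have "i > 0" using di by (cases i) auto
  \<comment> \<open>By \<open>powser_0_nonzero\<close> the sum would have no zeros on some punctured
    disc, but it is the constant 0.\<close>
  show False
  proof (rule powser_0_nonzero[OF r(1) s _ di \<open>i > 0\<close>])
  fix t :: real assume "0 < t" "!!z::complex. z : cball 0 t - {0} ==> (0::complex) ~= 0"
  from this(2)[of "of_real t"] this(1) show False by simp
  qed (assumption | rule refl)+
 qed
 from this[of n] have "of_nat (n + 1) * L2_inner D (em m) (em n) = (if n = m then of_real ka else 0)" by (simp add: d_def)
 moreover have "(of_nat (n + 1) :: complex) ~= 0" by (simp only: of_nat_eq_0_iff)
 ultimately have "L2_inner D (em m) (em n) = (if n = m then of_real ka else 0) / of_nat (n + 1)"
  by (metis nonzero_mult_div_cancel_left)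
 then show ?thesis by (auto simp: add.commute)
qed

end

text \<open>Stone--Weierstrass: a finite signed measure on the closed disc is determined by its
  moments.\<close>

lemma moments_zero_continuous:
 fixes q :: "complex => real"
 assumes q: "intg (ball 0 1) q"
  and mom: "!!m n. (LINT z:ball 0 1|lborel. cor (q z) * (z ^ m * cnj z ^ n)) = 0"
  and fi: "continuous_on (cball 0 1) fi"
 shows "(LINT z:ball 0 1|lborel. q z * fi z) = (0::real)"
proof -
 have qm: "smeas (ball 0 1) (%z. cor (q z))"
 proof -
  have "(%z. cor (indicator (ball 0 1) z *\<^sub>R q z)) : borel_measurable lborel"
  by (rule measurable_compose[OF borel_measurable_integrable[OF q[unfolded set_integrable_def]]])
  (intro borel_measurable_continuous_onI continuous_intros)
  then show ?thesis by (simp add: set_borel_measurable_def scaleR_conv_of_real)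
 qed
 have qi: "intg (ball 0 1) (%z. cor (q z) * ps z)"
  if c: "continuous_on (cball 0 1) ps" for ps
 proof -
  obtain M where M: "!!z. z : cball 0 1 ==> cmod (ps z) <= M"
  using compact_continuous_bound[OF compact_cball c] by blast
  have "smeas (ball 0 1) ps"
  by (intro meas_cont continuous_on_subset[OF c]) auto
  then have "(%z. (indicator (ball 0 1) z *\<^sub>R cor (q z)) * (indicator (ball 0 1) z *\<^sub>R ps z)) : borel_measurable lborel"
  using qm unfolding set_borel_measurable_def by (intro borel_measurable_times)
  also have "(%z. (indicator (ball 0 1) z *\<^sub>R cor (q z)) * (indicator (ball 0 1) z *\<^sub>R ps z)) = (%z. indicator (ball 0 1) z *\<^sub>R (cor (q z) * ps z))"
  by (auto simp: indicator_def)
  finally have m: "smeas (ball 0 1) (%z. cor (q z) * ps z)"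
  by (simp add: set_borel_measurable_def)
  have "intg (ball 0 1) (%z. M * q z)" using q by simp
  then show ?thesis
  proof (rule set_integrable_bound[OF _ m])
  have "cmod (cor (q z) * ps z) <= \<bar>M\<bar> * \<bar>q z\<bar>" if "z : ball 0 1" for z
  using mult_right_mono[of "cmod (ps z)" "\<bar>M\<bar>" "\<bar>q z\<bar>"] M[of z] that by (simp add: norm_mult mult.commute)
  then show "AE z in lborel. z : ball 0 1 --> norm (cor (q z) * ps z) <= norm (M * q z)"
  by (intro AE_I2) (simp add: abs_mult)
  qed
 qed
 \<comment> \<open>Weights whose product with \<open>q\<close> has vanishing moments. They are
   closed under multiplication by combinations of z, cnj z and constants, hence by every real
   polynomial.\<close>
 define I where "I ps \<longleftrightarrow> continuous_on (cball 0 1) ps &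
  (ALL m n. (LINT z:ball 0 1|lborel. cor (q z) * (ps z * (z ^ m * cnj z ^ n))) = 0)" for ps
 have Iz: "I (%z. (\<alpha> * z + \<beta> * cnj z + dl) * ps z)" if "I ps" for ps \<alpha> \<beta> dl
 proof -
  have c: "continuous_on (cball 0 1) ps"
  and z: "(LINT z:ball 0 1|lborel. cor (q z) * (ps z * (z ^ m * cnj z ^ n))) = 0" for m n
  using that by (auto simp: I_def)
  have "(LINT z:ball 0 1|lborel. cor (q z) * ((\<alpha> * z + \<beta> * cnj z + dl) * ps z * (z ^ m * cnj z ^ n))) = 0" for m n
  proof -
  define F where "F m n z = cor (q z) * (ps z * (z ^ m * cnj z ^ n))" for m n z
  have Fi: "intg (ball 0 1) (F m n)" for m n
  unfolding F_def by (intro qi continuous_intros c)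
  have F0: "(LINT z:ball 0 1|lborel. F m n z) = 0" for m n using z by (simp add: F_def)
  have "(LINT z:ball 0 1|lborel. cor (q z) * ((\<alpha> * z + \<beta> * cnj z + dl) * ps z * (z ^ m * cnj z ^ n)))
  = (LINT z:ball 0 1|lborel. (\<alpha> * F (Suc m) n z + \<beta> * F m (Suc n) z) + dl * F m n z)"
  by (simp add: F_def algebra_simps)
  also have "... = (LINT z:ball 0 1|lborel. \<alpha> * F (Suc m) n z + \<beta> * F m (Suc n) z) + (LINT z:ball 0 1|lborel. dl * F m n z)"
  by (rule set_integral_add(2)) (intro set_integral_add set_integrable_mult_right Fi; simp)+
  also have "(LINT z:ball 0 1|lborel. \<alpha> * F (Suc m) n z + \<beta> * F m (Suc n) z)
  = (LINT z:ball 0 1|lborel. \<alpha> * F (Suc m) n z) + (LINT z:ball 0 1|lborel. \<beta> * F m (Suc n) z)"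
  by (rule set_integral_add(2)) (intro set_integrable_mult_right Fi; simp)+
  finally show ?thesis by (simp add: F0)
  qed
  then show ?thesis unfolding I_def by (intro conjI allI continuous_intros c) auto
 qed
 have poly: "real_polynomial_function p ==> ALL ps. I ps --> I (%z. cor (p z) * ps z)" for p :: "complex => real"
 proof (induction rule: real_polynomial_function.induct)
  case (linear p)
  \<comment> \<open>A real linear functional of z is a complex combination of z and cnj z.\<close>
  have pe: "cor (p z) = (p 1 - \<i> * p \<i>) / 2 * z + (p 1 + \<i> * p \<i>) / 2 * cnj z + 0" for z
  proof -
  have "z = Re z *\<^sub>R 1 + Im z *\<^sub>R \<i>" by (simp add: complex_eq_iff)
  then have "p z = p (Re z *\<^sub>R 1 + Im z *\<^sub>R \<i>)" by simp
  also have "... = Re z * p 1 + Im z * p \<i>"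
  using linear bounded_linear.linear[OF linear] by (simp add: linear_add linear_scale)
  finally show ?thesis by (simp add: complex_eq_iff field_simps)
  qed
  show ?case
  proof (intro allI impI)
  fix ps assume "I ps"
  from Iz[OF this, of "(p 1 - \<i> * p \<i>) / 2" "(p 1 + \<i> * p \<i>) / 2" 0]
  show "I (%z. cor (p z) * ps z)"
  by (rule back_subst[of I]) (rule ext, rule arg_cong2[of _ _ _ _ "(*)"], rule pe[symmetric], rule refl)
  qed
 next
  case (const c)
  then show ?case using Iz[of _ 0 0 "of_real c"] by simp
 next
  case (add f g)
  show ?case
  proof (intro allI impI)
  fix ps assume "I ps"
  then have fg: "I (%z. cor (f z) * ps z)" "I (%z. cor (g z) * ps z)" using add by auto
  then have c: "continuous_on (cball 0 1) (%z. cor (f z) * ps z)" "continuous_on (cball 0 1) (%z. cor (g z) * ps z)"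
  by (auto simp: I_def)
  have "(LINT z:ball 0 1|lborel. cor (q z) * (cor (f z) * ps z * (z ^ m * cnj z ^ n)) + cor (q z) * (cor (g z) * ps z * (z ^ m * cnj z ^ n))) = 0" for m n
  using fg by (subst set_integral_add(2)) (auto simp: I_def intro!: qi continuous_intros c)
  moreover have "continuous_on (cball 0 1) (%z. cor (f z) * ps z + cor (g z) * ps z)"
  by (intro continuous_intros c)
  ultimately show "I (%z. cor (f z + g z) * ps z)" by (simp add: I_def algebra_simps)
  qed
 next
  case (mult f g)
  then show ?case by (simp add: mult.assoc)
 qed
 have I1: "I (%_. 1)" using mom by (simp add: I_def)
 have pz: "(LINT z:ball 0 1|lborel. cor (q z) * cor (p z)) = 0" if "real_polynomial_function p" for p
 proof -
  have "I (%z. cor (p z) * 1)" using poly[OF that] I1 by blast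
  then have "(LINT z:ball 0 1|lborel. cor (q z) * (cor (p z) * 1 * (z ^ 0 * cnj z ^ 0))) = 0"
  unfolding I_def by blast
  then show ?thesis by simp
 qed
 define Q where "Q = (LINT z:ball 0 1|lborel. \<bar>q z\<bar>)"
 have Qi: "intg (ball 0 1) (%z. \<bar>q z\<bar>)" using set_integrable_norm[OF q] by simp
 have "Q >= 0" unfolding Q_def set_lebesgue_integral_def by (intro Bochner_Integration.integral_nonneg) auto
 have cpl: "(LINT z:ball 0 1|lborel. cor (q z) * cor (h z)) = of_real (LINT z:ball 0 1|lborel. q z * h z)" for h
  using set_integral_complex_of_real[of lborel "ball 0 1" "%z. q z * h z"] by simp
 have ri: "intg (ball 0 1) (%z. q z * h z)" if "continuous_on (cball 0 1) h" for h :: "complex => real"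
 proof -
  have "intg (ball 0 1) (%z. cor (q z) * cor (h z))"
  by (intro qi continuous_intros that)
  then have "complex_integrable lborel (%z. cor (indicator (ball 0 1) z *\<^sub>R (q z * h z)))"
  by (simp add: set_integrable_def scaleR_conv_of_real)
  then show ?thesis unfolding complex_of_real_integrable_eq set_integrable_def .
 qed
 have "\<bar>LINT z:ball 0 1|lborel. q z * fi z\<bar> <= e" if e: "e > 0" for e
 proof -
  define e' where "e' = e / (Q + 1)"
  have e': "e' > 0" using e \<open>Q \<ge> 0\<close> by (simp add: e'_def)
  obtain p where p: "real_polynomial_function p" "!!z. z : cball 0 1 ==> \<bar>fi z - p z\<bar> < e'"
  using Stone_Weierstrass_real_polynomial_function[OF compact_cball fi e'] by metis
  have pc: "continuous_on (cball 0 1) p"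
  using p(1) by (intro continuous_at_imp_continuous_on ballI continuous_real_polymonial_function)
  have "(LINT z:ball 0 1|lborel. q z * p z) = 0" using pz[OF p(1)] unfolding cpl by simp
  then have "(LINT z:ball 0 1|lborel. q z * fi z) = (LINT z:ball 0 1|lborel. q z * fi z) - (LINT z:ball 0 1|lborel. q z * p z)" by simp
  also have "... = (LINT z:ball 0 1|lborel. q z * fi z - q z * p z)"
  by (rule set_integral_diff(2)[symmetric]) (intro ri fi pc)+
  finally have "\<bar>LINT z:ball 0 1|lborel. q z * fi z\<bar> = \<bar>LINT z:ball 0 1|lborel. q z * (fi z - p z)\<bar>"
  by (simp add: right_diff_distrib)
  also have "... <= (LINT z:ball 0 1|lborel. \<bar>q z * (fi z - p z)\<bar>)"
  using set_integral_norm_bound[OF ri[OF continuous_on_diff[OF fi pc]]] by simp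
  also have "... <= (LINT z:ball 0 1|lborel. e' * \<bar>q z\<bar>)"
  proof (rule set_integral_mono)
  show "intg (ball 0 1) (%z. \<bar>q z * (fi z - p z)\<bar>)"
  using set_integrable_norm[OF ri[OF continuous_on_diff[OF fi pc]]] by simp
  show "intg (ball 0 1) (%z. e' * \<bar>q z\<bar>)" using Qi by simp
  show "\<bar>q z * (fi z - p z)\<bar> <= e' * \<bar>q z\<bar>" if "z : ball 0 1" for z
  proof -
  have "\<bar>fi z - p z\<bar> <= e'" using p(2)[of z] that by simp
  then show ?thesis using mult_right_mono[of "\<bar>fi z - p z\<bar>" e' "\<bar>q z\<bar>"] by (simp add: abs_mult mult.commute)
  qed
  qed
  also have "... = e' * Q" by (simp add: Q_def)
  also have "... <= e" using e \<open>Q \<ge> 0\<close> by (simp add: e'_def divide_le_eq)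
  finally show ?thesis .
 qed
 then have "\<bar>LINT z:ball 0 1|lborel. q z * fi z\<bar> <= 0" by (rule field_le_epsilon) simp
 then show ?thesis by simp
qed

text \<open>At a point with h(z) nonzero, a tent function supported where \<open>h\<close> keeps its
  sign, multiplied by that sign, would give a strictly positive integral.\<close>

lemma test_functions_zero:
 fixes q h :: "complex => real"
 assumes V: "open V" "V <= ball 0 1" and h: "continuous_on V h" "!!z. z : V ==> q z = h z"
  and qi: "intg (ball 0 1) q"
  and test: "!!fi. continuous_on (cball 0 1) fi ==> (LINT z:ball 0 1|lborel. q z * fi z) = (0::real)"
  and z: "z : V"
 shows "h z = 0"
proof (rule ccontr)
 assume nz: "h z ~= 0"
 define \<sigma> where "\<sigma> = sgn (h z)"
 define dl where "dl = \<bar>h z\<bar> / 2"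
 have dl: "dl > 0" using nz by (simp add: dl_def)
 have "isCont (%w. \<sigma> * h w) z" using h(1) V(1) z continuous_on_eq_continuous_at by (intro continuous_intros) blast
 moreover have hz: "\<sigma> * h z > dl" using nz by (simp add: \<sigma>_def dl_def sgn_if)
 ultimately have "eventually (%w. \<sigma> * h w > dl) (at z)"
  unfolding isCont_def by (rule order_tendstoD(1))
 then have "eventually (%w. \<sigma> * h w > dl) (nhds z)" using hz by (simp add: eventually_nhds_conv_at)
 moreover have "eventually (%w. w : V) (nhds z)" using V z by (intro eventually_nhds_in_open)
 ultimately have "eventually (%w. \<sigma> * h w > dl & w : V) (nhds z)" by (rule eventually_conj)
 then obtain rh where rh: "rh > 0" "!!w. dist w z < rh ==> \<sigma> * h w > dl & w : V" unfolding eventually_nhds_metric by auto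
 define fi where "fi w = max 0 (rh - dist w z)" for w
 have fic: "continuous_on (cball 0 1) fi" unfolding fi_def by (intro continuous_intros)
 have fic': "continuous_on (cball 0 1) (%w. \<sigma> * fi w)" by (intro continuous_intros fic)
 have sub: "ball z (rh/2) <= ball 0 1" using rh V(2) by (force simp: dist_commute)
 have pt: "indicator (ball z (rh/2)) w * (dl * (rh/2)) <= indicator (ball 0 1) w *\<^sub>R (q w * (\<sigma> * fi w))" for w
 proof (cases "dist w z < rh")
  case True
  then have w: "\<sigma> * h w > dl" "w : V" using rh(2) by auto
  then have q: "\<sigma> * q w > dl" and wb: "w : ball 0 1" using h(2) V(2) by auto
  have p0: "fi w >= 0" by (simp add: fi_def)
  have "0 <= (\<sigma> * q w) * fi w" by (rule mult_nonneg_nonneg) (use q dl p0 in auto)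
  moreover have "dl * (rh/2) <= (\<sigma> * q w) * fi w" if "w : ball z (rh/2)"
  by (rule mult_mono) (use that q dl rh(1) in \<open>auto simp: fi_def dist_commute\<close>)
  ultimately show ?thesis using wb by (auto simp: indicator_def mult_ac)
 next
  case False
  then have "fi w = 0" "w ~: ball z (rh/2)" using rh(1) by (auto simp: fi_def dist_commute)
  then show ?thesis by simp
 qed
 have int: "integrable lborel (%w. indicator (ball 0 1) w *\<^sub>R (q w * (\<sigma> * fi w)))"
 proof (rule Bochner_Integration.integrable_bound[of _ "%w. rh * (indicator (ball 0 1) w *\<^sub>R q w)"])
  show "integrable lborel (%w. rh * (indicator (ball 0 1) w *\<^sub>R q w))" using qi by (simp add: set_integrable_def)
  have "(%w. \<sigma> * fi w) : borel_measurable borel"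
  unfolding fi_def by (intro borel_measurable_continuous_onI continuous_intros)
  then have "(%w. \<sigma> * fi w) : borel_measurable lborel" by simp
  then have "(%w. (indicator (ball 0 1) w *\<^sub>R q w) * (\<sigma> * fi w)) : borel_measurable lborel"
  by (rule borel_measurable_times[OF borel_measurable_integrable[OF qi[unfolded set_integrable_def]]])
  then show "(%w. indicator (ball 0 1) w *\<^sub>R (q w * (\<sigma> * fi w))) : borel_measurable lborel" by (simp add: mult.assoc)
  have "\<bar>\<sigma> * fi w\<bar> <= rh" for w using rh(1) by (auto simp: \<sigma>_def fi_def sgn_if)
  then show "AE w in lborel. norm (indicator (ball 0 1) w *\<^sub>R (q w * (\<sigma> * fi w))) <= norm (rh * (indicator (ball 0 1) w *\<^sub>R q w))"
  using rh(1) by (intro AE_I2) (auto simp: indicator_def abs_mult mult.commute[of rh] intro!: mult_left_mono)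
 qed
 have "(\<integral>w. indicator (ball z (rh/2)) w * (dl * (rh/2)) \<partial>lborel) <= (LINT w:ball 0 1|lborel. q w * (\<sigma> * fi w))"
  unfolding set_lebesgue_integral_def
  by (rule integral_mono[OF _ int pt]) (use emeasure_bounded_finite[of "ball z (rh/2)"] in \<open>auto intro!: integrable_mult_left\<close>)
 also have "... = 0" by (rule test[OF fic'])
 finally have "pi * (rh/2)\<^sup>2 * (dl * (rh/2)) <= 0" using rh(1) by (simp add: measure_ball_complex)
 moreover have "pi * (rh/2)\<^sup>2 * (dl * (rh/2)) > 0" using rh(1) dl by (intro mult_pos_pos) auto
 ultimately show False by linarith
qed

section \<open>Area of the image and extension of its Bergman functions\<close>

context hyperbolic_kernel
begin

text \<open>The image of |k|^2 dA under \<open>f\<close> has density \<open>W\<close> on f(D) and,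
  by \<open>em_orthogonal\<close>, the moments of the constant ka / pi on the disc. Hence
  \<open>W\<close> extended by 0 and ka / pi define the same measure: on f(D) this determines |k|,
  and off f(D) it says that the complement has area 0.\<close>

lemma kernel_measure:
 shows "!!z. z : D ==> (cmod (k z))\<^sup>2 = ka / pi * (cmod (deriv f z))\<^sup>2"
  and "emeasure lborel (ball 0 1 - f ` D) = 0"
proof -
 let ?Om = "f ` D"
 have oOm: "open ?Om" by (rule open_image)
 obtain g where g: "g holomorphic_on ?Om" "!!z. z : D ==> g (f z) = z"
  "!!w. w : ?Om ==> g w : D & f (g w) = w"
  using inj_holomorphic_inverse[OF D(1) f f_inj] by metis
 have kh: "k holomorphic_on D" by (rule A2D(1)[OF kb])
 have dh: "deriv f holomorphic_on D" by (rule holomorphic_deriv[OF f D(1)])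
 define W where "W w = (cmod (k (g w) / deriv f (g w)))\<^sup>2" for w
 have comp: "(%w. F (g w)) holomorphic_on ?Om" if "F holomorphic_on D" for F
  using hol_compose[OF g(1) that] g(3) by (auto simp: o_def)
 have Wc: "continuous_on ?Om W"
  unfolding W_def using comp[OF kh] comp[OF dh] g(3) deriv_f_nonzero
  by (intro continuous_intros) (auto intro: hol_cont)
 have Wf: "(cmod (deriv f z))\<^sup>2 * W (f z) = (cmod (k z))\<^sup>2" if "z : D" for z
  using g(2)[OF that] deriv_f_nonzero[OF that] by (simp add: W_def norm_divide power_divide)
 have Wi: "intg ?Om W"
 proof (subst holomorphic_change_of_variables_integrable[OF D(1) f f_inj])
  show "smeas ?Om W" using oOm Wc by (intro meas_cont) auto
  have "intg D (%z. (cmod (k z))\<^sup>2)" by (rule A2D(2)[OF kb])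
  also have "intg D (%z. (cmod (k z))\<^sup>2) = intg D (%z. (cmod (deriv f z))\<^sup>2 *\<^sub>R W (f z))"
  unfolding set_integrable_def by (intro Bochner_Integration.integrable_cong) (auto simp: indicator_def Wf)
  finally show "intg D (%z. (cmod (deriv f z))\<^sup>2 *\<^sub>R W (f z))" .
 qed
 have Wmom: "(LINT w:?Om|lborel. cor (W w) * (w ^ m * cnj w ^ n)) = (if m = n then of_real (ka / (real n + 1)) else 0)" for m n
 proof -
  have "(LINT w:?Om|lborel. cor (W w) * (w ^ m * cnj w ^ n))
  = (LINT z:D|lborel. (cmod (deriv f z))\<^sup>2 *\<^sub>R (cor (W (f z)) * (f z ^ m * cnj (f z) ^ n)))"
  proof (rule holomorphic_change_of_variables[OF D(1) f f_inj])
  show "smeas ?Om (%w. cor (W w) * (w ^ m * cnj w ^ n))"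
  using oOm Wc by (intro meas_cont continuous_intros) auto
  qed
  also have "... = L2_inner D (em m) (em n)"
  unfolding L2_inner_def set_lebesgue_integral_def
  proof (rule Bochner_Integration.integral_cong[OF refl])
  fix z
  have "(cmod (deriv f z))\<^sup>2 *\<^sub>R (cor (W (f z)) * (f z ^ m * cnj (f z) ^ n)) = em m z * cnj (em n z)" if z: "z : D"
  proof -
  have "(cmod (deriv f z))\<^sup>2 *\<^sub>R (cor (W (f z)) * (f z ^ m * cnj (f z) ^ n))
  = cor ((cmod (deriv f z))\<^sup>2 * W (f z)) * (f z ^ m * cnj (f z) ^ n)"
  by (simp only: scaleR_conv_of_real of_real_mult mult.assoc)
  also have "... = (k z * cnj (k z)) * (f z ^ m * cnj (f z) ^ n)"
  unfolding Wf[OF z] complex_norm_square ..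
  finally show ?thesis by (simp add: em_def)
  qed
  then show "indicat_real D z *\<^sub>R ((cmod (deriv f z))\<^sup>2 *\<^sub>R (cor (W (f z)) * (f z ^ m * cnj (f z) ^ n))) =
  indicat_real D z *\<^sub>R (em m z * cnj (em n z))" by (cases "z : D") auto
  qed
  also have "... = (if m = n then of_real (ka / (real n + 1)) else 0)" by (rule em_orthogonal)
  finally show ?thesis .
 qed
 define q where "q w = indicator ?Om w * W w - ka / pi" for w
 have W1: "intg (ball 0 1) (%w. indicator ?Om w * W w)"
 proof -
  have "indicat_real (ball 0 1) w *\<^sub>R (indicator ?Om w * W w) = indicator ?Om w *\<^sub>R W w" for w
  using fD by (cases "w : ?Om") auto
  then show ?thesis using Wi unfolding set_integrable_def by presburger
 qed
 have ci: "intg (ball (0::complex) 1) (%w. c)" for c :: real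
  using emeasure_bounded_finite[of "ball (0::complex) 1"] by (simp add: set_integrable_def integrable_mult_left)
 have qi: "intg (ball 0 1) q"
  unfolding q_def by (rule set_integral_diff(1)[OF W1 ci])
 have mom: "(LINT z:ball 0 1|lborel. cor (q z) * (z ^ m * cnj z ^ n)) = 0" for m n
 proof -
  have pwi: "intg (ball 0 1) (%w. cor (ka / pi) * (w ^ m * cnj w ^ n))"
  by (intro set_integrable_continuous_cball continuous_intros)
  have Wmi: "intg (ball 0 1) (%w. cor (indicator ?Om w * W w) * (w ^ m * cnj w ^ n))"
  proof (rule set_integrable_bound[OF W1])
  have "smeas ?Om (%w. cor (W w) * (w ^ m * cnj w ^ n))"
  using oOm Wc by (intro meas_cont continuous_intros) auto
  moreover have "indicat_real (ball 0 1) w *\<^sub>R (cor (indicator ?Om w * W w) * (w ^ m * cnj w ^ n))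
  = indicator ?Om w *\<^sub>R (cor (W w) * (w ^ m * cnj w ^ n))" for w
  using fD by (cases "w : ?Om") auto
  ultimately show "smeas (ball 0 1) (%w. cor (indicator ?Om w * W w) * (w ^ m * cnj w ^ n))"
  by (simp add: set_borel_measurable_def)
  have "norm (cor (indicator ?Om w * W w) * (w ^ m * cnj w ^ n)) <= norm (indicator ?Om w * W w)" if "w : ball 0 1" for w
  proof -
  have "cmod w ^ m * cmod w ^ n <= 1"
  using that by (intro mult_le_one power_le_one) auto
  then show ?thesis
  unfolding norm_mult norm_power norm_of_real complex_mod_cnj
  using mult_left_mono[of "cmod w ^ m * cmod w ^ n" 1 "\<bar>indicator ?Om w * W w\<bar>"] by (simp add: abs_mult)
  qed
  then show "AE w in lborel. w : ball 0 1 --> norm (cor (indicator ?Om w * W w) * (w ^ m * cnj w ^ n)) <= norm (indicator ?Om w * W w)"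
  by (intro AE_I2) blast
  qed
  have "(LINT z:ball 0 1|lborel. cor (q z) * (z ^ m * cnj z ^ n)) =
  (LINT z:ball 0 1|lborel. cor (indicator ?Om z * W z) * (z ^ m * cnj z ^ n) - cor (ka / pi) * (z ^ m * cnj z ^ n))"
  unfolding q_def of_real_diff left_diff_distrib ..
  also have "... = (LINT z:ball 0 1|lborel. cor (indicator ?Om z * W z) * (z ^ m * cnj z ^ n)) - (LINT z:ball 0 1|lborel. cor (ka / pi) * (z ^ m * cnj z ^ n))"
  by (rule set_integral_diff(2)[OF Wmi pwi])
  also have "(LINT z:ball 0 1|lborel. cor (indicator ?Om z * W z) * (z ^ m * cnj z ^ n)) = (LINT w:?Om|lborel. cor (W w) * (w ^ m * cnj w ^ n))"
  unfolding set_lebesgue_integral_def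
  by (rule Bochner_Integration.integral_cong[OF refl]) (use fD in \<open>auto simp: indicator_def\<close>)
  also have "(LINT z:ball 0 1|lborel. cor (ka / pi) * (z ^ m * cnj z ^ n)) = cor (ka / pi) * (LINT z:ball 0 1|lborel. z ^ m * cnj z ^ n)"
  by (rule set_integral_mult_right)
  finally show ?thesis unfolding Wmom set_integral_monomial by simp
 qed
 note test = moments_zero_continuous[OF qi mom]
 have Wka: "W w = ka / pi" if w: "w : ?Om" for w
 proof -
  have "W w - ka / pi = 0"
  by (rule test_functions_zero[OF oOm fD _ _ qi test w, of "%w. W w - ka / pi"])
  (auto simp: q_def intro!: continuous_intros Wc)
  then show ?thesis by simp
 qed
 show "(cmod (k z))\<^sup>2 = ka / pi * (cmod (deriv f z))\<^sup>2" if z: "z : D" for z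
  using Wf[OF z] Wka[of "f z"] z by (simp add: mult.commute)
 have bm: "ball 0 1 - ?Om : sets lborel" using oOm by simp
 have bf: "emeasure lborel (ball 0 1 - ?Om) < \<infinity>"
  by (rule emeasure_bounded_finite) (auto intro: bounded_subset[of "ball 0 1"])
 have "(LINT z:ball 0 1|lborel. q z * 1) = 0" by (rule test) (intro continuous_intros)
 moreover have "(LINT z:ball 0 1|lborel. q z * 1) = (\<integral>z. indicator (ball 0 1 - ?Om) z * (- (ka / pi)) \<partial>lborel)"
  unfolding set_lebesgue_integral_def
  by (rule Bochner_Integration.integral_cong[OF refl]) (auto simp: indicator_def q_def Wka)
 ultimately have "measure lborel (ball 0 1 - ?Om) * (ka / pi) = 0" by simp
 then have "measure lborel (ball 0 1 - ?Om) = 0" using kappa_pos by simp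
 then show "emeasure lborel (ball 0 1 - ?Om) = 0"
  using bf by (simp add: emeasure_eq_ennreal_measure)
qed

text \<open>The quotient k / f' is holomorphic with constant modulus, so the maximum principle makes
  it constant.\<close>

lemma k_eq_deriv: "EX c. c ~= 0 & (ALL z:D. k z = c * deriv f z)"
proof -
 have kh: "k holomorphic_on D" by (rule A2D(1)[OF kb])
 have dh: "deriv f holomorphic_on D" by (rule holomorphic_deriv[OF f D(1)])
 have m: "cmod (k z / deriv f z) = sqrt (ka / pi)" if "z : D" for z
 proof -
  have "(cmod (k z / deriv f z))\<^sup>2 = ka / pi"
  using kernel_measure(1)[OF that] deriv_f_nonzero[OF that] by (simp add: norm_divide power_divide)
  then show ?thesis by (rule real_sqrt_unique[OF _ norm_ge_zero, symmetric])
 qed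
 have "(%z. k z / deriv f z) constant_on D"
 proof (rule maximum_modulus_principle[of _ D D z0])
  show "open D" "connected D" "open D" "D <= D" "z0 : D" using D z0 by auto
  show "(%z. k z / deriv f z) holomorphic_on D" using deriv_f_nonzero by (intro holomorphic_on_divide kh dh)
  fix z assume "z : D"
  then show "cmod (k z / deriv f z) <= cmod (k z0 / deriv f z0)" using m[of z] m[OF z0] by linarith
 qed
 then obtain c where c: "!!z. z : D ==> k z / deriv f z = c" unfolding constant_on_def by blast
 then have "k z = c * deriv f z" if "z : D" for z using c[OF that] deriv_f_nonzero[OF that] by (auto simp: field_simps)
 moreover have "c ~= 0" using c[OF z0] k_nonzero[OF z0] deriv_f_nonzero[OF z0] by auto
 ultimately show ?thesis by blast
qed

text \<open>The coefficients in \<open>inner_rep_sums\<close> grow at most linearly by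
  Cauchy-Schwarz, so the series converges on the whole disc and not only on f(D). This is the
  extension of Bergman functions of f(D) to the disc.\<close>

lemma bergman_factor:
 assumes u: "u : A2 D"
 shows "EX U. U holomorphic_on ball 0 1 & (ALL z:D. u z = deriv f z * U (f z))"
proof -
 obtain c where c: "c ~= 0" "ALL z:D. k z = c * deriv f z" using k_eq_deriv by (elim exE conjE)
 define a where "a n = c / of_real ka * (of_nat (n + 1) * L2_inner D u (em n))" for n
 define C where "C = cmod (c / of_real ka) * sqrt (nsq D u * ka)"
 have ab: "cmod (a n) <= C * real (n + 1)" for n
 proof -
  have "nsq D (em n) <= ka"
  proof -
  have "cor (nsq D (em n)) = of_real (ka / (real n + 1))"
  using em_orthogonal[of n n] unfolding L2_inner_self by simp
  then have "nsq D (em n) = ka / (real n + 1)" unfolding of_real_eq_iff .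
  also have "... <= ka / 1" using kappa_pos by (intro divide_left_mono) auto
  finally show ?thesis by simp
  qed
  have "(cmod (L2_inner D u (em n)))\<^sup>2 <= nsq D u * ka"
  by (rule order_trans[OF Cauchy_Schwarz_L2[OF D(1) u em_bs] mult_left_mono[OF \<open>nsq D (em n) \<le> ka\<close> nsq_nonneg]])
  then have "cmod (L2_inner D u (em n)) <= sqrt (nsq D u * ka)" by (rule real_le_rsqrt)
  then have "cmod (c / of_real ka) * (real (n + 1) * cmod (L2_inner D u (em n))) <= cmod (c / of_real ka) * (real (n + 1) * sqrt (nsq D u * ka))"
  by (intro mult_left_mono) auto
  then show ?thesis unfolding a_def C_def norm_mult norm_of_nat by (simp only: mult_ac)
 qed
 define U where "U x = (\<Sum>n. a n * x ^ n)" for x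
 have sU: "(%n. a n * (x - 0) ^ n) sums U x" if "x : ball 0 1" for x
 proof -
  have "summable (%n. C * (real (n + 1) * cmod x ^ n))"
  using geometric_deriv_sums[of "cmod x"] that by (intro summable_mult) (simp add: sums_iff)
  then have "summable (%n. a n * x ^ n)"
  proof (rule summable_comparison_test'[where N = 0])
  fix n :: nat
  show "norm (a n * x ^ n) <= C * (real (n + 1) * cmod x ^ n)"
  unfolding norm_mult norm_power using mult_right_mono[OF ab[of n], of "cmod x ^ n"] by (simp add: mult.assoc)
  qed
  then show ?thesis by (simp add: U_def summable_sums)
 qed
 have "U holomorphic_on ball 0 1" by (rule power_series_holomorphic[OF sU])
 moreover have "u z = deriv f z * U (f z)" if z: "z : D" for z
 proof -
  have "f z : ball 0 1" using f_lt[OF z] by simp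
  have "(%n. c / of_real ka * (of_nat (n + 1) * f z ^ n * L2_inner D u (em n))) sums (c / of_real ka * (of_real ka * u z / k z))"
  by (rule sums_mult[OF inner_rep_sums[OF u z]])
  moreover have "c / of_real ka * (of_nat (n + 1) * f z ^ n * L2_inner D u (em n)) = a n * (f z - 0) ^ n" for n
  by (simp add: a_def mult_ac)
  ultimately have "(%n. a n * (f z - 0) ^ n) sums (c / of_real ka * (of_real ka * u z / k z))" by simp
  then have "U (f z) = c / of_real ka * (of_real ka * u z / k z)"
  using sums_unique2[OF sU[OF \<open>f z \<in> ball 0 1\<close>]] by blast
  then show ?thesis using c z kappa_pos deriv_f_nonzero[OF z] by simp
 qed
 ultimately show ?thesis by blast
qed

end

section \<open>Compact sets of capacity zero\<close>

text \<open>Compact sets of logarithmic capacity zero, in terms of their Chebyshev constant.\<close>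

definition cap0 :: "complex set => bool" where
 "cap0 E \<longleftrightarrow> (ALL M::real. EX n>0. EX w::nat => complex. (ALL i<n. w i : E) &
  (ALL z:E. (\<Prod>i<n. cmod (z - w i)) <= exp (- M * real n)))"

lemma not_cap0D:
 assumes nc: "~ cap0 E"
 shows "EX M0. ALL n w. n > 0 --> (ALL i<n. w i : E) --> (EX z:E. (\<Prod>i<n. cmod (z - w i)) > exp (- M0 * real n))"
proof (rule ccontr)
 assume a: "~ ?thesis"
 have "cap0 E"
  unfolding cap0_def
 proof
  fix M :: real
  have "~ (ALL n w. n > 0 --> (ALL i<n. w i : E) --> (EX z:E. (\<Prod>i<n. cmod (z - w i)) > exp (- M * real n)))"
  using a by simp
  then show "EX n>0. EX w::nat => complex. (ALL i<n. w i : E) & (ALL z:E. (\<Prod>i<n. cmod (z - w i)) <= exp (- M * real n))"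
  unfolding not_all not_imp Set.bex_simps not_less by (elim exE conjE) (intro exI conjI; assumption)
 qed
 with nc show False by simp
qed

text \<open>Isolates the factors of a Vandermonde product that involve \<open>j\<close>, which
  occurs as first and as second index.\<close>

lemma prod_offdiag_split:
 fixes g :: "nat => nat => 'a :: comm_monoid_mult"
 assumes j: "j < n"
 shows "(\<Prod>l<n. \<Prod>i\<in>{..<n}-{l}. g l i) =
  (\<Prod>l\<in>{..<n}-{j}. \<Prod>i\<in>{..<n}-{l}-{j}. g l i) * ((\<Prod>i\<in>{..<n}-{j}. g j i) * (\<Prod>i\<in>{..<n}-{j}. g i j))"
proof -
 have "(\<Prod>l<n. \<Prod>i\<in>{..<n}-{l}. g l i) = (\<Prod>i\<in>{..<n}-{j}. g j i) * (\<Prod>l\<in>{..<n}-{j}. \<Prod>i\<in>{..<n}-{l}. g l i)"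
  using j by (subst prod.remove[of _ j]) auto
 also have "(\<Prod>l\<in>{..<n}-{j}. \<Prod>i\<in>{..<n}-{l}. g l i) = (\<Prod>l\<in>{..<n}-{j}. g l j * (\<Prod>i\<in>{..<n}-{l}-{j}. g l i))"
  by (rule prod.cong[OF refl], subst prod.remove[of _ j]) (use j in auto)
 finally show ?thesis by (simp add: prod.distrib mult_ac)
qed

text \<open>Nearly maximizing the Vandermonde product (Fekete points) bounds every factor from below.\<close>

lemma near_fekete_points:
 assumes bd: "bounded E" and ne: "E ~= {}" and nc: "~ cap0 E"
 obtains M c where "M > 0" "0 < c" "!!n. n > 0 ==> EX w::nat => complex. inj_on w {..<n} & (ALL i<n. w i : E) &
  (ALL j<n. c * exp (- M * real n) <= (\<Prod>i\<in>{..<n}-{j}. cmod (w j - w i)))"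
proof -
 obtain M0 where M0: "ALL n w. n > 0 --> (ALL i<n. w i : E) --> (EX z:E. (\<Prod>i<n. cmod (z - w i)) > exp (- M0 * real n))"
  using not_cap0D[OF nc] by (elim exE)
 define M where "M = max M0 1"
 have M: "EX z:E. (\<Prod>i<n. cmod (z - w i)) > exp (- M * real n)" if nw: "n > 0" "ALL i<n. w i : E" for n and w :: "nat => complex"
 proof -
  obtain z where z: "z : E" "(\<Prod>i<n. cmod (z - w i)) > exp (- M0 * real n)" using M0[rule_format, OF nw(1), of w] nw(2) by blast
  have "exp (- M * real n) <= exp (- M0 * real n)" by (simp add: M_def mult_right_mono)
  then show ?thesis using z by (meson le_less_trans)
 qed
 obtain B where B: "!!z. z : E ==> cmod z <= B" using bd unfolding bounded_iff by blast
 define d where "d = 2 * \<bar>B\<bar> + 1"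
 have d: "d >= 1" "cmod (x - y) <= d" if "x : E" "y : E" for x y
  using B[OF that(1)] B[OF that(2)] norm_triangle_ineq4[of x y] by (auto simp: d_def)
 have d1: "d >= 1" by (simp add: d_def)
 \<comment> \<open>A finite nonempty set has capacity zero: the product over all its points vanishes
   on it.\<close>
 have infE: "infinite E"
 proof
  assume fin: "finite E"
  define n where "n = card E"
  have n: "n > 0" using fin ne by (simp add: n_def card_gt_0_iff)
  obtain w where w: "bij_betw w {0..<n} E" using ex_bij_betw_nat_finite[OF fin] unfolding n_def by blast
  then have wE: "ALL i<n. w i : E" by (auto simp: bij_betw_def)
  obtain z where z: "z : E" "(\<Prod>i<n. cmod (z - w i)) > exp (- M * real n)" using M[OF n wE] by blast
  have "z : w ` {0..<n}" using w z(1) by (simp add: bij_betw_def)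
  then obtain i where "i < n" "z = w i" by auto
  then have "(\<Prod>i<n. cmod (z - w i)) = 0" by (intro prod_zero) auto
  then show False using z(2) exp_gt_zero[of "- M * real n"] by linarith
 qed
 have main: "EX w::nat => complex. inj_on w {..<n} & (ALL i<n. w i : E) &
  (ALL j<n. 1 / (2 * d) * exp (- M * real n) <= (\<Prod>i\<in>{..<n}-{j}. cmod (w j - w i)))" if n: "n > 0" for n
 proof -
  define W where "W = {w::nat => complex. ALL i<n. w i : E}"
  define V where "V w = (\<Prod>l<n. \<Prod>i\<in>{..<n}-{l}. cmod (w l - w i))" for w :: "nat => complex"
  have Vd: "V w <= (\<Prod>l<n. \<Prod>i\<in>{..<n}-{l}. d)" if "w : W" for w
  unfolding V_def by (intro prod_mono conjI prod_nonneg) (use that d in \<open>auto simp: W_def\<close>)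
  have bdd: "bdd_above (V ` W)" using Vd by (auto intro!: bdd_aboveI)
  obtain e :: "nat => complex" where e: "inj e" "range e <= E" using infinite_countable_subset[OF infE] by blast
  have eW: "e : W" using e(2) by (auto simp: W_def)
  have "V e > 0" unfolding V_def using e(1) by (intro prod_pos) (auto simp: inj_def)
  define s where "s = (SUP w\<in>W. V w)"
  have Vs: "V w <= s" if "w : W" for w unfolding s_def using that bdd by (rule cSUP_upper)
  have s0: "s > 0" using Vs[OF eW] \<open>V e > 0\<close> by linarith
  \<comment> \<open>The supremum need not be attained. Each pair of points enters \<open>V\<close>
    twice, so losing a factor 4 costs a factor 2 in a single row; together with the bound
    \<open>d\<close> for one distance this gives the constant 1 / (2 d).\<close>
  then have "s / 4 < s" by simp
  then obtain w where w: "w : W" "s / 4 < V w" using less_cSUP_iff[of W V "s / 4"] eW bdd unfolding s_def by blast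
  have Vw: "V w > 0" using w s0 by linarith
  have wE: "ALL i<n. w i : E" using w(1) by (simp add: W_def)
  have inj: "inj_on w {..<n}"
  proof (rule inj_onI, rule ccontr)
  fix x y assume xy: "x : {..<n}" "y : {..<n}" "w x = w y" "x ~= y"
  then have "(\<Prod>i\<in>{..<n}-{x}. cmod (w x - w i)) = 0" by (intro prod_zero) auto
  then have "V w = 0" unfolding V_def using xy(1) by (intro prod_zero) auto
  then show False using Vw by simp
  qed
  have "1 / (2 * d) * exp (- M * real n) <= (\<Prod>i\<in>{..<n}-{j}. cmod (w j - w i))" if j: "j < n" for j
  proof -
  define A where "A z = (\<Prod>i\<in>{..<n}-{j}. cmod (z - w i))" for z
  define R where "R = (\<Prod>l\<in>{..<n}-{j}. \<Prod>i\<in>{..<n}-{l}-{j}. cmod (w l - w i))"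
  have A0: "A z >= 0" for z unfolding A_def by (intro prod_nonneg) auto
  have R0: "R >= 0" unfolding R_def by (intro prod_nonneg) auto
  have VR: "V (w(j := z)) = R * (A z)\<^sup>2" for z
  proof -
  have 1: "(\<Prod>l\<in>{..<n}-{j}. \<Prod>i\<in>{..<n}-{l}-{j}. cmod ((w(j := z)) l - (w(j := z)) i)) = R"
  unfolding R_def by (intro prod.cong refl) auto
  have 2: "(\<Prod>i\<in>{..<n}-{j}. cmod ((w(j := z)) j - (w(j := z)) i)) = A z"
  unfolding A_def by (intro prod.cong refl) auto
  have 3: "(\<Prod>i\<in>{..<n}-{j}. cmod ((w(j := z)) i - (w(j := z)) j)) = A z"
  unfolding A_def by (intro prod.cong refl) (auto simp: norm_minus_commute)
  show ?thesis unfolding V_def prod_offdiag_split[OF j] 1 2 3 by (simp add: p2eq)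
  qed
  have Rw: "R * (A (w j))\<^sup>2 = V w" using VR[of "w j"] by simp
  have Rpos: "R > 0" using Rw Vw R0 by (cases "R = 0") auto
  obtain z where z: "z : E" "(\<Prod>i<n. cmod (z - w i)) > exp (- M * real n)" using M[OF n wE] by blast
  have "w(j := z) : W" using wE z(1) by (auto simp: W_def)
  then have "R * (A z)\<^sup>2 <= s" using Vs[of "w(j := z)"] unfolding VR by simp
  also have "... <= 4 * V w" using w(2) by simp
  also have "... = R * (2 * A (w j))\<^sup>2" by (simp add: Rw[symmetric] power_mult_distrib)
  finally have "(A z)\<^sup>2 <= (2 * A (w j))\<^sup>2" using Rpos by simp
  then have Az: "A z <= 2 * A (w j)" by (rule power2_le_imp_le) (use A0 in simp)
  have "(\<Prod>i<n. cmod (z - w i)) = cmod (z - w j) * A z"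
  unfolding A_def using j by (subst prod.remove[of _ j]) auto
  also have "... <= d * A z" by (rule mult_right_mono) (use d(2)[OF z(1)] wE j A0 in auto)
  also have "... <= d * (2 * A (w j))" using Az d1 by (intro mult_left_mono) auto
  finally have "exp (- M * real n) <= 2 * d * A (w j)" using z(2) by simp
  then show ?thesis using d1 by (simp add: A_def field_simps)
  qed
  then show ?thesis using inj wE by blast
 qed
 show thesis
  by (rule that[of M "1 / (2 * d)"]) (use d1 main in \<open>auto simp: M_def\<close>)
qed

section \<open>Dyadic estimates of area integrals with poles, and logarithmic energy\<close>

lemma dyadic_exists:
 assumes "0 < (x::real)" "x < r"
 obtains k :: nat where "r / 2 ^ Suc k <= x" "x < r / 2 ^ k"
proof -
 obtain N :: nat where N: "r / x < 2 ^ N" using real_arch_pow[of 2 "r / x"] by auto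
 define k where "k = (LEAST k. r / 2 ^ Suc k <= x)"
 have ex: "r / 2 ^ Suc N <= x"
 proof -
  have "r < 2 ^ N * x" using N assms by (simp add: field_simps)
  also have "... <= 2 ^ Suc N * x" using assms by simp
  finally show ?thesis by (simp add: field_simps)
 qed
 have 1: "r / 2 ^ Suc k <= x" unfolding k_def by (rule LeastI[of _ N]) (rule ex)
 have 2: "x < r / 2 ^ k"
 proof (cases k)
  case 0 then show ?thesis using assms by simp
 next
  case (Suc m)
  then have "~ r / 2 ^ Suc m <= x" unfolding k_def using not_less_Least[of m "%k. r / 2 ^ Suc k <= x"] by simp
  then show ?thesis using Suc by simp
 qed
 show thesis by (rule that[OF 1 2])
qed

lemma ennreal_le_suminf: "(f k :: ennreal) <= (\<Sum>k. f k)"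
 using sum_le_suminf[of f "{k}"] by simp

text \<open>The disc of radius r / 2^k contributes 2 pi r / 2^k, and the geometric series sums to 4
  pi r.\<close>

lemma nn_integral_inverse_dist:
 assumes r: "r > 0"
 shows "(\<integral>\<^sup>+z\<in>ball a r. ennreal (1 / cmod (z - a)) \<partial>lborel) <= ennreal (4 * pi * r)"
proof -
 let ?g = "%k z. ennreal (2 ^ Suc k / r) * indicator (ball a (r / 2 ^ k)) z"
 have "(\<integral>\<^sup>+z\<in>ball a r. ennreal (1 / cmod (z - a)) \<partial>lborel) <= (\<integral>\<^sup>+z. (\<Sum>k. ?g k z) \<partial>lborel)"
 proof (rule nn_integral_mono)
  fix z
  show "ennreal (1 / cmod (z - a)) * indicator (ball a r) z <= (\<Sum>k. ?g k z)"
  proof (cases "z : ball a r & z ~= a")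
  case True
  then have x: "0 < cmod (z - a)" "cmod (z - a) < r" by (auto simp: dist_norm norm_minus_commute)
  obtain k where k: "r / 2 ^ Suc k <= cmod (z - a)" "cmod (z - a) < r / 2 ^ k" using dyadic_exists[OF x] by blast
  have "1 / cmod (z - a) <= 1 / (r / 2 ^ Suc k)" by (rule frac_le[OF _ _ _ k(1)]) (simp_all add: assms)
  then have "ennreal (1 / cmod (z - a)) * indicator (ball a r) z <= ?g k z"
  using k(2) True by (simp add: dist_norm norm_minus_commute ennreal_leI)
  also have "... <= (\<Sum>k. ?g k z)" by (rule ennreal_le_suminf)
  finally show ?thesis .
  qed auto
 qed
 also have "... = (\<Sum>k. \<integral>\<^sup>+z. ?g k z \<partial>lborel)" by (rule nn_integral_suminf) (auto intro!: borel_measurable_times_ennreal borel_measurable_indicator)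
 also have "... <= (\<Sum>k. ennreal (2 * pi * r * (1/2) ^ k))"
 proof (rule suminf_le)
  fix k
  have "(\<integral>\<^sup>+z. ?g k z \<partial>lborel) = ennreal (2 ^ Suc k / r) * emeasure lborel (ball a (r / 2 ^ k))"
  by (rule nn_integral_cmult_indicator) simp
  also have "... = ennreal (2 ^ Suc k / r) * ennreal (pi * (r / 2 ^ k)\<^sup>2)"
  using r by (simp add: emeasure_ball_complex)
  also have "... = ennreal (2 ^ Suc k / r * (pi * (r / 2 ^ k)\<^sup>2))" using r by (subst ennreal_mult) auto
  also have "2 ^ Suc k / r * (pi * (r / 2 ^ k)\<^sup>2) = 2 * pi * r * (1/2) ^ k"
  using r by (simp add: p2eq power_divide field_simps)
  finally show "(\<integral>\<^sup>+z. ?g k z \<partial>lborel) <= ennreal (2 * pi * r * (1/2) ^ k)" by simp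
 qed auto
 also have "... = ennreal (\<Sum>k. 2 * pi * r * (1/2) ^ k)"
  by (rule suminf_ennreal2) (use r in \<open>auto intro!: summable_mult summable_geometric\<close>)
 also have "(\<Sum>k. 2 * pi * r * (1/2::real) ^ k) = 4 * pi * r"
  by (subst suminf_mult) (auto simp: suminf_geometric intro!: summable_geometric)
 finally show ?thesis .
qed

text \<open>Each of \<open>N\<close> dyadic annuli contributes at most 4 pi, so the bound is
  logarithmic in the ratio of the radii.\<close>

lemma nn_integral_inverse_dist_sq:
 assumes s: "s > 0" and R: "R <= s * 2 ^ N"
 shows "(\<integral>\<^sup>+z\<in>ball a R - ball a s. ennreal (1 / (cmod (z - a))\<^sup>2) \<partial>lborel) <= ennreal (4 * pi * real N)"
proof -
 let ?g = "%k z. ennreal (1 / (s * 2 ^ k)\<^sup>2) * indicator (ball a (s * 2 ^ Suc k)) z"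
 have "(\<integral>\<^sup>+z\<in>ball a R - ball a s. ennreal (1 / (cmod (z - a))\<^sup>2) \<partial>lborel) <= (\<integral>\<^sup>+z. (\<Sum>k<N. ?g k z) \<partial>lborel)"
 proof (rule nn_integral_mono)
  fix z
  show "ennreal (1 / (cmod (z - a))\<^sup>2) * indicator (ball a R - ball a s) z <= (\<Sum>k<N. ?g k z)"
  proof (cases "z : ball a R - ball a s")
  case True
  then have x: "s <= cmod (z - a)" "cmod (z - a) < s * 2 ^ N" using R by (auto simp: dist_norm norm_minus_commute)
  have "EX k<N. s * 2 ^ k <= cmod (z - a) & cmod (z - a) < s * 2 ^ Suc k"
  using x(2)
  proof (induction N)
  case 0 then show ?case using x(1) by simp
  next
  case (Suc N) then show ?case by (cases "cmod (z - a) < s * 2 ^ N") (auto simp: less_Suc_eq)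
  qed
  then obtain k where k: "k < N" "s * 2 ^ k <= cmod (z - a)" "cmod (z - a) < s * 2 ^ Suc k" by blast
  have "1 / (cmod (z - a))\<^sup>2 <= 1 / (s * 2 ^ k)\<^sup>2" using k(2) s x by (intro divide_left_mono power_mono mult_pos_pos zero_less_power) auto
  then have "ennreal (1 / (cmod (z - a))\<^sup>2) * indicator (ball a R - ball a s) z <= ?g k z"
  using k(3) True by (simp add: dist_norm norm_minus_commute ennreal_leI)
  also have "... <= (\<Sum>k<N. ?g k z)" using k(1) by (intro member_le_sum) auto
  finally show ?thesis .
  qed auto
 qed
 also have "... = (\<Sum>k<N. \<integral>\<^sup>+z. ?g k z \<partial>lborel)" by (rule nn_integral_sum) (auto intro!: borel_measurable_times_ennreal borel_measurable_indicator)
 also have "... <= (\<Sum>k<N. ennreal (4 * pi))"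
 proof (rule sum_mono)
  fix k
  have "(\<integral>\<^sup>+z. ?g k z \<partial>lborel) = ennreal (1 / (s * 2 ^ k)\<^sup>2) * emeasure lborel (ball a (s * 2 ^ Suc k))"
  by (rule nn_integral_cmult_indicator) simp
  also have "... = ennreal (1 / (s * 2 ^ k)\<^sup>2) * ennreal (pi * (s * 2 ^ Suc k)\<^sup>2)"
  using s by (subst emeasure_ball_complex) auto
  also have "... = ennreal (1 / (s * 2 ^ k)\<^sup>2 * (pi * (s * 2 ^ Suc k)\<^sup>2))" by (subst ennreal_mult) auto
  also have "1 / (s * 2 ^ k)\<^sup>2 * (pi * (s * 2 ^ Suc k)\<^sup>2) = 4 * pi"
  using s by (simp add: p2eq field_simps)
  finally show "(\<integral>\<^sup>+z. ?g k z \<partial>lborel) <= ennreal (4 * pi)" by simp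
 qed
 also have "... = ennreal (4 * pi * real N)"
  by (simp add: ennreal_of_nat_eq_real_of_nat ennreal_mult[symmetric] mult.commute)
 finally show ?thesis .
qed

text \<open>Each point is assigned to its nearer pole \<open>c\<close>; its distance to the other
  one is then at least d / 2, where d = |a - b|. Within d / 2 of \<open>c\<close> the integrand is
  at most 2 / (d |z - c|), beyond it at most 1 / |z - c|^2, spread over about log (4 / d) dyadic
  annuli. This turns an area integral into logarithmic energy.\<close>

lemma nn_integral_two_poles:
 assumes a: "a : ball 0 1" and b: "b : ball 0 1" and ab: "a ~= b"
 shows "(\<integral>\<^sup>+z\<in>ball 0 1. ennreal (1 / (cmod (z - a) * cmod (z - b))) \<partial>lborel)
  <= ennreal (8 * pi * (4 + log 2 (1 / cmod (a - b))))"
proof -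
 define d where "d = cmod (a - b)"
 have d: "d > 0" "d < 2" using ab norm_triangle_ineq4[of a b] a b by (auto simp: d_def)
 define N where "N = nat \<lceil>log 2 (4 / d)\<rceil>"
 have lpos: "log 2 (4 / d) > 0" using d by simp
 have N: "real N <= log 2 (4 / d) + 1" unfolding N_def using lpos by linarith
 have "log 2 (4 / d) <= real N" unfolding N_def using lpos by linarith
 then have "4 / d <= 2 powr real N" using d by (simp add: log_le_iff)
 then have N2: "2 <= (d / 2) * 2 ^ N" using d by (simp add: powr_realpow field_simps)
 let ?h = "%c z. ennreal (2 / d) * (ennreal (1 / cmod (z - c)) * indicator (ball c (d/2)) z) + ennreal (1 / (cmod (z - c))\<^sup>2) * indicator (ball c 2 - ball c (d/2)) z"
 have pt: "ennreal (1 / (x * y)) <= ennreal (2 / d) * ennreal (1 / x)" if "d / 2 <= y" "0 < x" for x y :: real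
 proof -
  have "1 / (x * y) <= 1 / (x * (d / 2))" using that d by (intro divide_left_mono mult_left_mono mult_pos_pos) auto
  then show ?thesis using that d by (subst ennreal_mult[symmetric]) (auto intro!: ennreal_leI simp: field_simps)
 qed
 have half: "ennreal (1 / (cmod (z - c) * cmod (z - e))) <= ?h c z"
  if z: "z : ball 0 1" and c: "c : ball 0 1" and ce: "cmod (c - e) = d" and le: "cmod (z - c) <= cmod (z - e)" for z c e
 proof (cases "z = c")
  case False
  have "d <= cmod (z - c) + cmod (z - e)" using norm_triangle_ineq4[of "z - e" "z - c"] ce by (simp add: norm_minus_commute)
  then have y: "d / 2 <= cmod (z - e)" using le by linarith
  have z2: "z : ball c 2" using norm_triangle_ineq4[of c z] z c by (simp add: dist_norm)
  show ?thesis
  proof (cases "z : ball c (d/2)")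
  case True
  then show ?thesis using pt[OF y, of "cmod (z - c)"] False by (auto intro: add_increasing2)
  next
  case F: False
  have "1 / (cmod (z - c) * cmod (z - e)) <= 1 / (cmod (z - c) * cmod (z - c))"
  using le False by (intro divide_left_mono mult_left_mono mult_pos_pos) auto
  then show ?thesis using F z2 by (auto simp: p2eq intro!: ennreal_leI)
  qed
 qed simp
 have "(\<integral>\<^sup>+z\<in>ball 0 1. ennreal (1 / (cmod (z - a) * cmod (z - b))) \<partial>lborel) <= (\<integral>\<^sup>+z. ?h a z + ?h b z \<partial>lborel)"
 proof (rule nn_integral_mono)
  fix z
  show "ennreal (1 / (cmod (z - a) * cmod (z - b))) * indicator (ball 0 1) z <= ?h a z + ?h b z"
  proof (cases "z : ball 0 1")
  case z: True
  show ?thesis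
  proof (cases "cmod (z - a) <= cmod (z - b)")
  case True
  have "ennreal (1 / (cmod (z - a) * cmod (z - b))) <= ?h a z" by (rule half[OF z a _ True]) (simp add: d_def)
  then show ?thesis using z by (simp add: add_increasing2)
  next
  case False
  have "ennreal (1 / (cmod (z - b) * cmod (z - a))) <= ?h b z" by (rule half[OF z b]) (use False in \<open>auto simp: d_def norm_minus_commute\<close>)
  then show ?thesis using z by (simp add: add_increasing mult.commute)
  qed
  qed simp
 qed
 also have "... = (\<integral>\<^sup>+z. ?h a z \<partial>lborel) + (\<integral>\<^sup>+z. ?h b z \<partial>lborel)" by (rule nn_integral_add) (auto intro!: borel_measurable_add borel_measurable_times_ennreal borel_measurable_indicator)
 also have "... <= ennreal (4 * pi + 4 * pi * real N) + ennreal (4 * pi + 4 * pi * real N)"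
 proof -
  have "(\<integral>\<^sup>+z. ?h c z \<partial>lborel) <= ennreal (4 * pi + 4 * pi * real N)" for c
  proof -
  have "(\<integral>\<^sup>+z. ?h c z \<partial>lborel) = ennreal (2 / d) * (\<integral>\<^sup>+z\<in>ball c (d/2). ennreal (1 / cmod (z - c)) \<partial>lborel)
  + (\<integral>\<^sup>+z\<in>ball c 2 - ball c (d/2). ennreal (1 / (cmod (z - c))\<^sup>2) \<partial>lborel)"
  by (subst nn_integral_add) (auto intro!: nn_integral_cmult borel_measurable_times_ennreal borel_measurable_indicator)
  also have "... <= ennreal (2 / d) * ennreal (4 * pi * (d/2)) + ennreal (4 * pi * real N)"
  by (intro add_mono mult_left_mono nn_integral_inverse_dist nn_integral_inverse_dist_sq N2) (use d in auto)
  also have "ennreal (2 / d) * ennreal (4 * pi * (d/2)) = ennreal (4 * pi)"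
  using d by (subst ennreal_mult[symmetric]) auto
  finally show ?thesis by (simp add: ennreal_plus[symmetric] del: ennreal_plus)
  qed
  then show ?thesis by (intro add_mono)
 qed
 also have "... = ennreal (8 * pi * (1 + real N))"
  by (simp add: ennreal_plus[symmetric] algebra_simps del: ennreal_plus)
 also have "... <= ennreal (8 * pi * (4 + log 2 (1 / d)))"
 proof (intro ennreal_leI mult_left_mono)
  have "log 2 (4 / d) = log 2 (4 * (1 / d))" by simp
  also have "... = log 2 4 + log 2 (1 / d)" using d by (intro log_mult_pos) auto
  also have "log 2 (4::real) = 2" using log_of_power_eq[of 4 2 2] by simp
  finally show "1 + real N <= 4 + log 2 (1 / d)" using N by linarith
 qed simp
 finally show ?thesis by (simp add: d_def)
qed

text \<open>The square expands into a double sum. Off the diagonal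
  \<open>nn_integral_two_poles\<close> produces log (1 / |w i - w j|), whose row sums are controlled
  by the lower bounds for the Vandermonde rows; on the diagonal the cut-off 2^(-n) costs only 4 pi
  (n + 1). Each row is O(n), which the division by n^2 compensates.\<close>

lemma near_fekete_energy:
 fixes w :: "nat => complex"
 assumes n: "n > 0" and w: "!!i. i < n ==> w i : ball 0 1" and inj: "inj_on w {..<n}" and Mc: "M > 0" "c > 0"
  and fek: "!!j. j < n ==> c * exp (- M * real n) <= (\<Prod>i\<in>{..<n}-{j}. cmod (w j - w i))"
 shows "(\<integral>\<^sup>+z\<in>{z\<in>ball 0 1. ALL i<n. (1/2)^n <= cmod (z - w i)}.
  ennreal ((cmod ((\<Sum>i<n. 1 / (z - w i)) / of_nat n))\<^sup>2) \<partial>lborel)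
  <= ennreal (40 * pi + 8 * pi * \<bar>log 2 (1 / c)\<bar> + 8 * pi * M / ln 2)"
proof -
 define A where "A = {z\<in>ball 0 1. ALL i<n. (1/2)^n <= cmod (z - w i)}"
 define C where "C = 40 * pi + 8 * pi * \<bar>log 2 (1 / c)\<bar> + 8 * pi * M / ln 2"
 define b where "b i j = (if i = j then 4 * pi * real (n + 1) else 8 * pi * (4 + log 2 (1 / cmod (w i - w j))))" for i j
 have Am: "A : sets borel"
 proof -
  have "A = ball 0 1 Int (\<Inter>i\<in>{..<n}. {z. (1/2)^n <= cmod (z - w i)})" using n by (auto simp: A_def)
  moreover have "closed {z. (1/2)^n <= cmod (z - w i)}" for i by (intro closed_Collect_le continuous_intros)
  ultimately show ?thesis using n by (auto intro!: sets.Int sets.finite_INT)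
 qed
 have bpos: "b i j >= 0" if "i < n" "j < n" for i j
 proof (cases "i = j")
  case False
  then have d: "cmod (w i - w j) > 0" "cmod (w i - w j) < 2"
  using inj that w[of i] w[of j] norm_triangle_ineq4[of "w i" "w j"] by (auto simp: inj_on_def)
  have "log 2 (1 / 2) <= log 2 (1 / cmod (w i - w j))" using d by (subst log_le_cancel_iff) (auto simp: field_simps)
  then show ?thesis using False by (simp add: b_def log_divide)
 qed (simp add: b_def)
 have pair: "(\<integral>\<^sup>+z\<in>A. ennreal (1 / (cmod (z - w i) * cmod (z - w j))) \<partial>lborel) <= ennreal (b i j)" if ij: "i < n" "j < n" for i j
 proof (cases "i = j")
  case True
  have "A <= ball (w i) 2 - ball (w i) ((1/2)^n)"
  proof
  fix z assume z: "z : A"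
  then have "cmod z < 1" "(1/2)^n <= cmod (z - w i)" using ij by (auto simp: A_def)
  then show "z : ball (w i) 2 - ball (w i) ((1/2)^n)"
  using w[OF ij(1)] norm_triangle_ineq4[of "w i" z] by (auto simp: dist_norm norm_minus_commute)
  qed
  then have "(\<integral>\<^sup>+z\<in>A. ennreal (1 / (cmod (z - w i) * cmod (z - w j))) \<partial>lborel)
  <= (\<integral>\<^sup>+z\<in>ball (w i) 2 - ball (w i) ((1/2)^n). ennreal (1 / (cmod (z - w i))\<^sup>2) \<partial>lborel)"
  using True by (intro nn_integral_mono) (auto simp: indicator_def p2eq)
  \<comment> \<open>The radii run from 2^(-n) to 2 = 2^(-n) 2^(n + 1), hence \<open>n + 1\<close>
    dyadic annuli.\<close>
  also have "... <= ennreal (4 * pi * real (n + 1))"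
  by (rule nn_integral_inverse_dist_sq) (auto simp: power_one_over field_simps)
  finally show ?thesis using True by (simp add: b_def)
 next
  case False
  have "(\<integral>\<^sup>+z\<in>A. ennreal (1 / (cmod (z - w i) * cmod (z - w j))) \<partial>lborel)
  <= (\<integral>\<^sup>+z\<in>ball 0 1. ennreal (1 / (cmod (z - w i) * cmod (z - w j))) \<partial>lborel)"
  by (intro nn_integral_mono) (auto simp: indicator_def A_def)
  also have "... <= ennreal (8 * pi * (4 + log 2 (1 / cmod (w i - w j))))"
  by (rule nn_integral_two_poles[OF w[OF ij(1)] w[OF ij(2)]]) (use False inj ij in \<open>auto simp: inj_on_def\<close>)
  finally show ?thesis using False by (simp add: b_def)
 qed
 have row: "(\<Sum>j<n. b i j) <= C * real n" if i: "i < n" for i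
 proof -
  have dpos: "cmod (w i - w j) > 0" if "j : {..<n}-{i}" for j using inj that i by (auto simp: inj_on_def)
  have "(\<Sum>j<n. b i j) = b i i + (\<Sum>j\<in>{..<n}-{i}. b i j)" using i by (subst sum.remove[of _ i]) auto
  also have "(\<Sum>j\<in>{..<n}-{i}. b i j) = (\<Sum>j\<in>{..<n}-{i}. 32 * pi - 8 * pi * log 2 (cmod (w i - w j)))"
  by (rule sum.cong[OF refl]) (use dpos in \<open>auto simp: b_def log_divide algebra_simps\<close>)
  also have "... = 32 * pi * (real n - 1) - 8 * pi * log 2 (\<Prod>j\<in>{..<n}-{i}. cmod (w i - w j))"
  proof -
  have "ln (\<Prod>j\<in>{..<n}-{i}. cmod (w i - w j)) = (\<Sum>j\<in>{..<n}-{i}. ln (cmod (w i - w j)))"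
  by (rule ln_prod) (use dpos in auto)
  then have lp: "log 2 (\<Prod>j\<in>{..<n}-{i}. cmod (w i - w j)) = (\<Sum>j\<in>{..<n}-{i}. log 2 (cmod (w i - w j)))"
  by (simp add: log_def sum_divide_distrib)
  have "card ({..<n}-{i}) = n - 1" using i by simp
  then show ?thesis unfolding lp sum_subtractf sum_distrib_left using n by (simp add: of_nat_diff)
  qed
  finally have eq: "(\<Sum>j<n. b i j) = b i i + (32 * pi * (real n - 1) - 8 * pi * log 2 (\<Prod>j\<in>{..<n}-{i}. cmod (w i - w j)))" .
  have "log 2 (\<Prod>j\<in>{..<n}-{i}. cmod (w i - w j)) >= log 2 (c * exp (- M * real n))"
  proof -
  have "0 < (\<Prod>j\<in>{..<n}-{i}. cmod (w i - w j))" by (rule prod_pos) (rule dpos)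
  then show ?thesis using fek[OF i] Mc(2) by (subst log_le_cancel_iff) simp_all
  qed
  moreover have "log 2 (c * exp (- M * real n)) = log 2 c - M * real n / ln 2"
  using Mc by (subst log_mult) (auto simp: log_def)
  ultimately have lg: "log 2 c - M * real n / ln 2 <= log 2 (\<Prod>j\<in>{..<n}-{i}. cmod (w i - w j))" by simp
  have "8 * pi * (log 2 c - M * real n / ln 2) <= 8 * pi * log 2 (\<Prod>j\<in>{..<n}-{i}. cmod (w i - w j))"
  by (rule mult_left_mono[OF lg]) simp
  then have "(\<Sum>j<n. b i j) <= b i i + 32 * pi * (real n - 1) - 8 * pi * (log 2 c - M * real n / ln 2)" unfolding eq by linarith
  also have "... <= C * real n"
  proof -
  have n1: "real n >= 1" using n by simp
  have "- log 2 c <= \<bar>log 2 (1 / c)\<bar> * real n"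
  proof -
  have "- log 2 c = log 2 (1 / c)" using Mc by (simp add: log_divide)
  also have "... <= \<bar>log 2 (1 / c)\<bar> * 1" by simp
  also have "... <= \<bar>log 2 (1 / c)\<bar> * real n" using n1 by (intro mult_left_mono) auto
  finally show ?thesis .
  qed
  then have 1: "8 * pi * (- log 2 c) <= 8 * pi * (\<bar>log 2 (1 / c)\<bar> * real n)" by (intro mult_left_mono) auto
  have "b i i + 32 * pi * (real n - 1) = 36 * pi * real n - 28 * pi" by (simp add: b_def algebra_simps)
  also have "... <= 40 * pi * real n"
  proof -
  have "0 <= pi * real n" by simp
  then show ?thesis using pi_gt_zero by linarith
  qed
  finally have 2: "b i i + 32 * pi * (real n - 1) <= 40 * pi * real n" .
  have "C * real n = 40 * pi * real n + 8 * pi * (\<bar>log 2 (1 / c)\<bar> * real n) + 8 * pi * (M * real n / ln 2)"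
  by (simp add: C_def algebra_simps)
  moreover have "8 * pi * (log 2 c - M * real n / ln 2) = - (8 * pi * (- log 2 c)) - 8 * pi * (M * real n / ln 2)"
  by (simp add: algebra_simps)
  ultimately show ?thesis using 1 2 by linarith
  qed
  finally show ?thesis .
 qed
 have pt: "ennreal ((cmod ((\<Sum>i<n. 1 / (z - w i)) / of_nat n))\<^sup>2) <=
  ennreal (1 / (real n)\<^sup>2) * (\<Sum>i<n. \<Sum>j<n. ennreal (1 / (cmod (z - w i) * cmod (z - w j))))" for z
 proof -
  have "cmod (\<Sum>i<n. 1 / (z - w i)) <= (\<Sum>i<n. 1 / cmod (z - w i))"
  by (rule order_trans[OF norm_sum]) (simp add: norm_divide)
  then have "(cmod (\<Sum>i<n. 1 / (z - w i)))\<^sup>2 <= (\<Sum>i<n. 1 / cmod (z - w i))\<^sup>2" by (intro power_mono) auto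
  also have "... = (\<Sum>i<n. \<Sum>j<n. 1 / (cmod (z - w i) * cmod (z - w j)))"
  by (simp add: p2eq sum_product)
  finally have "(cmod ((\<Sum>i<n. 1 / (z - w i)) / of_nat n))\<^sup>2 <= 1 / (real n)\<^sup>2 * (\<Sum>i<n. \<Sum>j<n. 1 / (cmod (z - w i) * cmod (z - w j)))"
  using n by (simp add: norm_divide power_divide divide_right_mono)
  then have "ennreal ((cmod ((\<Sum>i<n. 1 / (z - w i)) / of_nat n))\<^sup>2) <= ennreal (1 / (real n)\<^sup>2 * (\<Sum>i<n. \<Sum>j<n. 1 / (cmod (z - w i) * cmod (z - w j))))"
  by (rule ennreal_leI)
  also have "... = ennreal (1 / (real n)\<^sup>2) * ennreal (\<Sum>i<n. \<Sum>j<n. 1 / (cmod (z - w i) * cmod (z - w j)))"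
  by (rule ennreal_mult) (auto intro!: sum_nonneg)
  also have "ennreal (\<Sum>i<n. \<Sum>j<n. 1 / (cmod (z - w i) * cmod (z - w j))) = (\<Sum>i<n. \<Sum>j<n. ennreal (1 / (cmod (z - w i) * cmod (z - w j))))"
  by (simp add: sum_nonneg)
  finally show ?thesis .
 qed
 have "(\<integral>\<^sup>+z\<in>A. ennreal ((cmod ((\<Sum>i<n. 1 / (z - w i)) / of_nat n))\<^sup>2) \<partial>lborel)
  <= (\<integral>\<^sup>+z. ennreal (1 / (real n)\<^sup>2) * (\<Sum>i<n. \<Sum>j<n. ennreal (1 / (cmod (z - w i) * cmod (z - w j))) * indicator A z) \<partial>lborel)"
 proof (rule nn_integral_mono)
  fix z
  show "ennreal ((cmod ((\<Sum>i<n. 1 / (z - w i)) / of_nat n))\<^sup>2) * indicator A z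
  <= ennreal (1 / (real n)\<^sup>2) * (\<Sum>i<n. \<Sum>j<n. ennreal (1 / (cmod (z - w i) * cmod (z - w j))) * indicator A z)"
  using pt[of z] by (cases "z : A") auto
 qed
 also have "... = ennreal (1 / (real n)\<^sup>2) * (\<Sum>i<n. \<Sum>j<n. \<integral>\<^sup>+z\<in>A. ennreal (1 / (cmod (z - w i) * cmod (z - w j))) \<partial>lborel)"
 proof -
  have m: "(%z. ennreal (1 / (cmod (z - w i) * cmod (z - w j))) * indicator A z) : borel_measurable lborel" for i j
  using Am by (intro borel_measurable_times_ennreal borel_measurable_indicator) auto
  have "(\<integral>\<^sup>+z. (\<Sum>j<n. ennreal (1 / (cmod (z - w i) * cmod (z - w j))) * indicator A z) \<partial>lborel)
  = (\<Sum>j<n. \<integral>\<^sup>+z\<in>A. ennreal (1 / (cmod (z - w i) * cmod (z - w j))) \<partial>lborel)" for i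
  by (rule nn_integral_sum) (rule m)
  then show ?thesis
  by (subst nn_integral_cmult, intro borel_measurable_sum m, subst nn_integral_sum, intro borel_measurable_sum m) (simp only:)
 qed
 also have "... <= ennreal (1 / (real n)\<^sup>2) * (\<Sum>i<n. \<Sum>j<n. ennreal (b i j))"
  by (intro mult_left_mono sum_mono pair) auto
 also have "(\<Sum>i<n. \<Sum>j<n. ennreal (b i j)) = ennreal (\<Sum>i<n. \<Sum>j<n. b i j)"
 proof -
  have "(\<Sum>j<n. ennreal (b i j)) = ennreal (\<Sum>j<n. b i j)" if "i < n" for i
  by (rule sum_ennreal) (use bpos that in auto)
  then have "(\<Sum>i<n. \<Sum>j<n. ennreal (b i j)) = (\<Sum>i<n. ennreal (\<Sum>j<n. b i j))" by (intro sum.cong) auto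
  also have "... = ennreal (\<Sum>i<n. \<Sum>j<n. b i j)" by (rule sum_ennreal) (auto intro!: sum_nonneg bpos)
  finally show ?thesis .
 qed
 also have "... <= ennreal (real n * (C * real n))"
  using sum_mono[of "{..<n}" "%i. \<Sum>j<n. b i j" "%_. C * real n"] row by (intro ennreal_leI) simp
 also have "ennreal (1 / (real n)\<^sup>2) * ennreal (real n * (C * real n)) = ennreal C"
  using n by (subst ennreal_mult'[symmetric]) (auto simp: p2eq)
 finally show ?thesis by (simp add: A_def C_def mult_left_mono)
qed

text \<open>Cauchy transforms of near-Fekete points stay bounded in \<open>L\<^sup>2\<close> away from the points, so that a
  normal family argument gives an \<open>L\<^sup>2\<close> holomorphic function with a non-removable singularity.\<close>

lemma positive_capacity_nonremovable:
 assumes E: "compact E" "E <= ball 0 1" "E ~= {}" and nc: "~ cap0 E"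
 obtains F where "F holomorphic_on - E" "F : A2 (ball 0 1 - E)"
  "!!z. cmod z >= 3 ==> cmod (F z - 1 / z) <= 1 / (cmod z * (cmod z - 1))"
proof -
 obtain M c where Mc: "M > 0" "0 < c" and ex: "!!n. n > 0 ==> EX w::nat => complex. inj_on w {..<n} & (ALL i<n. w i : E) &
  (ALL j<n. c * exp (- M * real n) <= (\<Prod>i\<in>{..<n}-{j}. cmod (w j - w i)))"
  by (rule near_fekete_points[OF compact_imp_bounded[OF E(1)] E(3) nc]) (rule that)
 have "ALL m. EX w::nat => complex. inj_on w {..<Suc m} & (ALL i<Suc m. w i : E) &
  (ALL j<Suc m. c * exp (- M * real (Suc m)) <= (\<Prod>i\<in>{..<Suc m}-{j}. cmod (w j - w i)))"
  using ex by blast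
 then obtain w :: "nat => nat => complex" where w: "!!m. inj_on (w m) {..<Suc m}" "!!m i. i < Suc m ==> w m i : E"
  "!!m j. j < Suc m ==> c * exp (- M * real (Suc m)) <= (\<Prod>i\<in>{..<Suc m}-{j}. cmod (w m j - w m i))"
  by metis
 define f where "f m z = (\<Sum>i<Suc m. 1 / (z - w m i)) / of_nat (Suc m)" for m z
 define A where "A m = {z\<in>ball 0 1. ALL i<Suc m. (1/2)^(Suc m) <= cmod (z - w m i)}" for m
 define C where "C = 40 * pi + 8 * pi * \<bar>log 2 (1 / c)\<bar> + 8 * pi * M / ln 2"
 have en: "(\<integral>\<^sup>+z\<in>A m. ennreal ((cmod (f m z))\<^sup>2) \<partial>lborel) <= ennreal C" for m
  unfolding A_def f_def C_def
  by (rule near_fekete_energy[OF _ _ w(1) Mc w(3)]) (use subsetD[OF E(2) w(2)] in auto)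
 have avg: "cmod (\<Sum>i<Suc m. h i) / real (Suc m) <= B" if "!!i. i < Suc m ==> cmod (h i) <= B" for m B and h :: "nat => complex"
 proof -
  have "cmod (\<Sum>i<Suc m. h i) <= of_nat (card {..<Suc m}) * B" by (rule sum_norm_bound) (use that in auto)
  then show ?thesis by (simp add: field_simps)
 qed
 have fh: "f m holomorphic_on - E" for m
  unfolding f_def using w(2) by (intro holomorphic_intros) auto
 have oE: "open (- E)" using E(1) compact_imp_closed by auto
 have fb: "EX B. ALL h:range f. ALL z:K. cmod (h z) <= B" if K: "compact K" "K <= - E" for K
 proof -
  obtain d where d: "d > 0" "ALL x:K. ALL y:E. d <= dist x y"
  using separate_compact_closed[OF K(1) compact_imp_closed[OF E(1)]] K(2) by blast
  have "cmod (f m z) <= 1 / d" if "z : K" for m z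
  unfolding f_def norm_divide norm_of_nat
  proof (rule avg)
  fix i assume "i < Suc m"
  then have "d <= cmod (z - w m i)" using d(2) that w(2) by (auto simp: dist_norm)
  then show "cmod (1 / (z - w m i)) <= 1 / d" using d(1) by (simp add: norm_divide frac_le)
  qed
  then show ?thesis by blast
 qed
 \<comment> \<open>On compact sets off \<open>E\<close> the averages of 1 / (z - w) are bounded by
   the inverse distance to \<open>E\<close>, so Montel's theorem applies.\<close>
 obtain F r where F: "F holomorphic_on - E" "strict_mono (r :: nat => nat)"
  "!!x. x : - E ==> (%n. f (r n) x) \<longlonglongrightarrow> F x"
 proof (rule Montel[OF oE, of "range f" f])
  show "!!h. h : range f ==> h holomorphic_on - E" using fh by auto
  show "!!K. compact K ==> K <= - E ==> EX B. ALL h:range f. ALL z:K. cmod (h z) <= B" by (rule fb)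
 qed auto
 have Am: "A m : sets borel" for m
 proof -
  have "A m = ball 0 1 Int (\<Inter>i\<in>{..<Suc m}. {z. (1/2)^(Suc m) <= cmod (z - w m i)})" by (auto simp: A_def)
  moreover have "closed {z. (1/2)^(Suc m) <= cmod (z - w m i)}" for i by (intro closed_Collect_le continuous_intros)
  ultimately show ?thesis by (auto intro!: sets.Int sets.finite_INT)
 qed
 let ?S = "ball 0 1 - E"
 have oS: "open ?S" using E(1) compact_imp_closed by (intro open_Diff) auto
 \<comment> \<open>A fixed point off \<open>E\<close> lies in \<open>A (r m)\<close> for all large
   \<open>m\<close>, because the excluded discs shrink; so Fatou's lemma bounds \<open>F\<close> on
   the whole of the disc minus \<open>E\<close>.\<close>
 have ptl: "(%m. ennreal ((cmod (f (r m) z))\<^sup>2) * indicator (A (r m)) z) \<longlonglongrightarrow> ennreal ((cmod (F z))\<^sup>2)" if z: "z : ?S" for z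
 proof -
  obtain d where d: "d > 0" "ALL x:{z}. ALL y:E. d <= dist x y"
  proof (rule separate_compact_closed[of "{z}" E, THEN exE, OF _ compact_imp_closed[OF E(1)]])
  show "{z} Int E = {}" using z by auto
  qed auto
  have "(%m. (1/2::real) ^ Suc (r m)) \<longlonglongrightarrow> 0"
  using LIMSEQ_subseq_LIMSEQ[OF LIMSEQ_Suc[OF LIMSEQ_realpow_zero[of "1/2"]] F(2)] by (simp add: o_def)
  then have "eventually (%m. (1/2::real) ^ Suc (r m) < d) sequentially" by (rule order_tendstoD(2)[OF _ d(1)])
  then have ev: "eventually (%m. ennreal ((cmod (f (r m) z))\<^sup>2) = ennreal ((cmod (f (r m) z))\<^sup>2) * indicator (A (r m)) z) sequentially"
  proof (rule eventually_mono)
  fix m assume m: "(1/2::real) ^ Suc (r m) < d"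
  have "z : A (r m)" using z d(2) w(2)[of _ "r m"] m by (force simp: A_def dist_norm)
  then show "ennreal ((cmod (f (r m) z))\<^sup>2) = ennreal ((cmod (f (r m) z))\<^sup>2) * indicator (A (r m)) z" by simp
  qed
  have "(%m. ennreal ((cmod (f (r m) z))\<^sup>2)) \<longlonglongrightarrow> ennreal ((cmod (F z))\<^sup>2)"
  using F(3)[of z] z by (intro tendsto_ennrealI tendsto_intros) auto
  then show ?thesis using ev by (rule Lim_transform_eventually)
 qed
 have "(\<integral>\<^sup>+z\<in>?S. ennreal ((cmod (F z))\<^sup>2) \<partial>lborel) <= (\<integral>\<^sup>+z. liminf (%m. ennreal ((cmod (f (r m) z))\<^sup>2) * indicator (A (r m)) z) \<partial>lborel)"
 proof (rule nn_integral_mono)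
  fix z
  show "ennreal ((cmod (F z))\<^sup>2) * indicator ?S z <= liminf (%m. ennreal ((cmod (f (r m) z))\<^sup>2) * indicator (A (r m)) z)"
  proof (cases "z : ?S")
  case True
  have "liminf (%m. ennreal ((cmod (f (r m) z))\<^sup>2) * indicator (A (r m)) z) = ennreal ((cmod (F z))\<^sup>2)"
  by (rule lim_imp_Liminf[OF sequentially_bot ptl[OF True]])
  then show ?thesis using True by simp
  qed simp
 qed
 also have "... <= liminf (%m. \<integral>\<^sup>+z. ennreal ((cmod (f (r m) z))\<^sup>2) * indicator (A (r m)) z \<partial>lborel)"
 proof (rule nn_integral_liminf)
  fix m
  have "f (r m) : borel_measurable lborel" unfolding f_def by measurable
  then show "(%z. ennreal ((cmod (f (r m) z))\<^sup>2) * indicator (A (r m)) z) : borel_measurable lborel"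
  using Am[of "r m"] by (intro borel_measurable_times_ennreal borel_measurable_indicator) auto
 qed
 also have "... <= liminf (%m::nat. ennreal C)" by (rule Liminf_mono) (use en in auto)
 also have "... = ennreal C" by (simp add: Liminf_const)
 finally have fin: "(\<integral>\<^sup>+z\<in>?S. ennreal ((cmod (F z))\<^sup>2) \<partial>lborel) <= ennreal C" .
 have FS: "F holomorphic_on ?S" using F(1) by (rule hol_subset) auto
 have Fb: "F : A2 ?S"
  unfolding A2_def set_integrable_def
 proof (intro CollectI conjI FS integrableI_bounded)
  have "continuous_on ?S (%z. (cmod (F z))\<^sup>2)" using FS by (intro continuous_intros hol_cont)
  then show "(%z. indicat_real ?S z *\<^sub>R (cmod (F z))\<^sup>2) : borel_measurable lborel"
  using meas_cont[OF borel_open[OF oS]] unfolding set_borel_measurable_def by blast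
  have "(\<integral>\<^sup>+z. ennreal (norm (indicat_real ?S z *\<^sub>R (cmod (F z))\<^sup>2)) \<partial>lborel) = (\<integral>\<^sup>+z\<in>?S. ennreal ((cmod (F z))\<^sup>2) \<partial>lborel)"
  by (intro nn_integral_cong) (auto simp: indicator_def)
  also have "... < \<infinity>" using fin by (rule le_less_trans) simp
  finally show "(\<integral>\<^sup>+z. ennreal (norm (indicat_real ?S z *\<^sub>R (cmod (F z))\<^sup>2)) \<partial>lborel) < \<infinity>" .
 qed
 show thesis
 proof (rule that[OF F(1) Fb])
  fix z :: complex assume z: "cmod z >= 3"
  then have "z : - E" using E(2) by auto
  \<comment> \<open>The leading coefficient 1 at infinity survives in the limit; it is what prevents
    \<open>F\<close> from extending to an entire function.\<close>
  have "cmod (f m z - 1 / z) <= 1 / (cmod z * (cmod z - 1))" for m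
  proof -
  have "f m z - 1 / z = (\<Sum>i<Suc m. 1 / (z - w m i) - 1 / z) / of_nat (Suc m)"
  unfolding sum_subtractf f_def by (simp add: diff_divide_distrib del: of_nat_Suc)
  also have "cmod ... <= 1 / (cmod z * (cmod z - 1))"
  unfolding norm_divide norm_of_nat
  proof (rule avg)
  fix i assume "i < Suc m"
  then have wi: "cmod (w m i) <= 1" using w(2) E(2) by force
  then have d: "cmod (z - w m i) >= cmod z - 1" using norm_triangle_ineq2[of z "w m i"] by linarith
  then have nz: "z - w m i ~= 0" "z ~= 0" using z by auto
  have "1 / (z - w m i) - 1 / z = w m i / (z * (z - w m i))" using nz by (simp add: field_simps)
  also have "cmod ... <= 1 / (cmod z * (cmod z - 1))"
  unfolding norm_divide norm_mult by (rule frac_le) (use wi d z in \<open>auto intro!: mult_left_mono mult_pos_pos\<close>)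
  finally show "cmod (1 / (z - w m i) - 1 / z) <= 1 / (cmod z * (cmod z - 1))" .
  qed
  finally show ?thesis .
  qed
  moreover have "(%m. cmod (f (r m) z - 1 / z)) \<longlonglongrightarrow> cmod (F z - 1 / z)"
  by (intro tendsto_intros F(3) \<open>z \<in> - E\<close>)
  ultimately show "cmod (F z - 1 / z) <= 1 / (cmod z * (cmod z - 1))"
  by (intro LIMSEQ_le_const2) auto
 qed
qed

lemma null_complement_dense:
 assumes "open V" "V ~= {}" "emeasure lborel N = 0" "N : sets lborel" "V <= (N :: complex set)"
 shows False
proof -
 obtain z where "z : V" using assms(2) by auto
 then obtain r where zr: "r > 0" "ball z r <= V" by (rule openE[OF assms(1)])
 have "emeasure lborel (ball z r) <= emeasure lborel N" by (rule emeasure_mono) (use zr assms in auto)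
 then show False using assms(3) zr(1) by (simp add: emeasure_ball_complex)
qed

text \<open>If \<open>E\<close> had positive capacity, the function \<open>F\<close> of
  \<open>positive_capacity_nonremovable\<close> would restrict to the Bergman space of f(D) and so
  extend to the disc by \<open>bergman_factor\<close>. Glued with \<open>F\<close> outside it would
  be entire and vanish at infinity, hence be zero, although F(z) behaves like 1 / z.\<close>

lemma (in hyperbolic_kernel) complement_cap0:
 assumes E: "compact E" "E <= ball 0 1 - f ` D" "E ~= {}"
 shows "cap0 E"
proof (rule ccontr)
 assume nc: "~ cap0 E"
 have E1: "E <= ball 0 1" using E(2) by auto
 obtain F where F: "F holomorphic_on - E" "F : A2 (ball 0 1 - E)"
  "!!z. cmod z >= 3 ==> cmod (F z - 1 / z) <= 1 / (cmod z * (cmod z - 1))"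
  by (rule positive_capacity_nonremovable[OF E(1) E1 E(3) nc]) (rule that)
 have sub: "f ` D <= ball 0 1 - E" using fD E(2) by auto
 have FOm: "F : A2 (f ` D)" by (rule A2_subset[OF F(2) sub open_image])
 have Fh: "F holomorphic_on f ` D" using FOm by (simp add: A2_def)
 define u where "u z = deriv f z * F (f z)" for z
 have uh: "u holomorphic_on D"
  unfolding u_def using hol_compose[OF f Fh] holomorphic_deriv[OF f D(1)]
  by (intro holomorphic_on_mult) (auto simp: o_def)
 have "intg D (%z. (cmod (deriv f z))\<^sup>2 *\<^sub>R (cmod (F (f z)))\<^sup>2)"
 proof (subst holomorphic_change_of_variables_integrable[OF D(1) f f_inj, symmetric])
  show "smeas (f ` D) (%w. (cmod (F w))\<^sup>2)"
  using Fh open_image by (intro meas_cont continuous_intros hol_cont) auto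
  show "intg (f ` D) (%w. (cmod (F w))\<^sup>2)" by (rule A2D(2)[OF FOm])
 qed
 then have "u : A2 D" using uh by (simp add: A2_def u_def norm_mult power_mult_distrib)
 then obtain U where U: "U holomorphic_on ball 0 1" "ALL z:D. u z = deriv f z * U (f z)" using bergman_factor by blast
 have UF: "U w = F w" if "w : f ` D" for w
  using U(2) that deriv_f_nonzero by (auto simp: u_def)
 have oE: "open (- E)" using E(1) compact_imp_closed by auto
 \<comment> \<open>Equality on f(D) spreads to the disc minus \<open>E\<close> by continuity: a
   difference would live on a nonempty open subset of the null complement.\<close>
 have UFE: "U w = F w" if w: "w : ball 0 1 - E" for w
 proof (rule ccontr)
  assume ne: "U w ~= F w"
  define h where "h w = U w - F w" for w
  have oS: "open (ball 0 1 - E)" using E(1) compact_imp_closed by (intro open_Diff) auto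
  have "continuous_on (ball 0 1 - E) h"
  unfolding h_def using U(1) F(1)
  by (intro continuous_intros hol_cont) (auto intro: hol_subset)
  then have oV: "open (h -` (- {0}) Int (ball 0 1 - E))"
  using continuous_open_preimage[OF _ oS, of h "- {0}"] by (simp add: Int_commute open_Compl)
  have "h -` (- {0}) Int (ball 0 1 - E) <= ball 0 1 - f ` D" using UF by (auto simp: h_def)
  moreover have "w : h -` (- {0}) Int (ball 0 1 - E)" using ne w by (simp add: h_def)
  ultimately show False
  using null_complement_dense[OF oV _ kernel_measure(2)] open_image
  by (metis borel_open empty_iff open_ball sets.Diff sets_lborel)
 qed
 define G where "G w = (if w : ball 0 1 then U w else F w)" for w
 have G1: "G holomorphic_on ball 0 1" by (rule holomorphic_transform[OF U(1)]) (simp add: G_def)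
 have GF: "G w = F w" if "w : - E" for w using UFE that by (auto simp: G_def)
 have G2: "G holomorphic_on - E" by (rule holomorphic_transform[OF F(1)]) (simp add: GF)
 have "G holomorphic_on ball 0 1 \<union> - E" by (rule holomorphic_on_Un[OF G1 G2 open_ball oE])
 moreover have "ball 0 1 \<union> - E = UNIV" using E1 by auto
 ultimately have GU: "G holomorphic_on UNIV" by simp
 have big: "cmod (G z) <= 2 / cmod z" if z: "cmod z >= 3" for z
 proof -
  have "G z = F z" using GF z E1 by force
  moreover have "1 / (cmod z * (cmod z - 1)) <= 1 / cmod z"
  using z mult_left_mono[of 1 "cmod z - 1" "cmod z"] by (intro frac_le) auto
  ultimately show ?thesis
  using F(3)[OF z] norm_triangle_sub[of "F z" "1 / z"] by (simp add: norm_divide)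
 qed
 have "(G \<longlongrightarrow> 0) at_infinity"
 proof (rule Lim_null_comparison)
  show "eventually (%z. norm (G z) <= 2 * norm (1 / z)) at_infinity"
  unfolding eventually_at_infinity using big by (intro exI[of _ 3]) (auto simp: norm_divide)
  have "((%z::complex. 2 * norm (1 / z)) \<longlongrightarrow> 2 * norm (0::complex)) at_infinity"
  by (intro tendsto_intros tendsto_divide_0[OF tendsto_const] filterlim_ident)
  then show "((%z::complex. 2 * norm (1 / z)) \<longlongrightarrow> 0) at_infinity" by simp
 qed
 then have "G 3 = 0" by (rule Liouville_weak_0[OF GU])
 then have "F 3 = 0" using GF[of 3] E1 by force
 then show False using F(3)[of 3] by (simp add: norm_divide)
qed

section \<open>Harmonic and subharmonic functions\<close>

text \<open>Differentiability with gradient (a, b). Unlike \<open>partial\<close> it asserts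
  differentiability, so that calculus rules compose.\<close>

definition pd :: "(complex => real) => real => real => complex => bool" where
 "pd u a b z \<longleftrightarrow> (u has_derivative (%h. Re h * a + Im h * b)) (at z)"

lemma has_derivative_pd:
 assumes "(u has_derivative L) (at z)"
 shows "pd u (L 1) (L \<i>) z"
proof -
 interpret L: bounded_linear L using assms by (rule has_derivative_bounded_linear)
 have "L h = Re h * L 1 + Im h * L \<i>" for h
 proof -
  have "h = Re h *\<^sub>R 1 + Im h *\<^sub>R \<i>" by (simp add: complex_eq_iff)
  then have "L h = L (Re h *\<^sub>R 1 + Im h *\<^sub>R \<i>)" by simp
  then show ?thesis by (simp only: L.add L.scaleR real_scaleR_def)
 qed
 then have "L = (%h. Re h * L 1 + Im h * L \<i>)" by (rule ext)
 then show ?thesis unfolding pd_def using assms by simp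
qed

lemma partial_pd:
 assumes "pd u a b z" shows "partial 1 u z = a" "partial \<i> u z = b"
 using frechet_derivative_at[OF assms[unfolded pd_def], symmetric] by (auto simp: partial_def)

lemma pd_differentiable: "pd u a b z ==> u differentiable at z"
 unfolding pd_def differentiable_def by blast

lemma pd_partial: "u differentiable at z ==> pd u (partial 1 u z) (partial \<i> u z) z"
 unfolding partial_def by (rule has_derivative_pd) (simp add: frechet_derivative_works)

lemma pd_isCont: "pd u a b z ==> isCont u z"
 unfolding pd_def by (rule has_derivative_continuous)

lemma pd_cong:
 assumes "pd u a b z" "open S" "z : S" "!!w. w : S ==> v w = u w"
 shows "pd v a b z"
 using assms(1) unfolding pd_def
 by (rule has_derivative_transform_within_open[OF _ assms(2,3)]) (simp add: assms(4))

lemma pd_const: "pd (%_. c) 0 0 z" unfolding pd_def by simp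

lemma pd_add: "pd u a b z ==> pd v c d z ==> pd (%w. u w + v w) (a + c) (b + d) z"
 unfolding pd_def by (drule (1) has_derivative_add) (simp add: algebra_simps)

lemma pd_mult: "pd u a b z ==> pd v c d z ==> pd (%w. u w * v w) (a * v z + u z * c) (b * v z + u z * d) z"
 unfolding pd_def by (drule (1) has_derivative_mult) (simp add: algebra_simps)

lemma pd_compose:
 assumes "pd H P Q (g z)" "(g has_field_derivative c) (at z)"
 shows "pd (%w. H (g w)) (Re c * P + Im c * Q) (- Im c * P + Re c * Q) z"
proof -
 have "((%w. H (g w)) has_derivative (%h. Re (c * h) * P + Im (c * h) * Q)) (at z)"
  using diff_chain_at[OF assms(2)[unfolded has_field_derivative_def] assms(1)[unfolded pd_def]] by (simp add: o_def)
 then show ?thesis unfolding pd_def by (simp add: algebra_simps)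
qed

lemma pd_Re: "(g has_field_derivative c) (at z) ==> pd (%w. Re (g w)) (Re c) (- Im c) z"
 using pd_compose[of Re 1 0 g z c] by (simp add: pd_def bounded_linear.has_derivative[OF bounded_linear_Re])

lemma pd_Im: "(g has_field_derivative c) (at z) ==> pd (%w. Im (g w)) (Im c) (Re c) z"
 using pd_compose[of Im 0 1 g z c] by (simp add: pd_def bounded_linear.has_derivative[OF bounded_linear_Im])

lemma harmonic_on_pointwise:
 assumes "open S"
 shows "harmonic_on u S \<longleftrightarrow> (ALL z:S. u differentiable at z &
  (ALL e:{1, \<i>}. isCont (partial e u) z & partial e u differentiable at z &
  (ALL e':{1, \<i>}. isCont (partial e' (partial e u)) z)) &
  partial 1 (partial 1 u) z + partial \<i> (partial \<i> u) z = 0)"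
 unfolding harmonic_on_def C2_on_def C1_on_def continuous_on_eq_continuous_at[OF assms]
  differentiable_on_eq_differentiable_at[OF assms] by auto

lemma harmonic_on_subset: "harmonic_on u S ==> open S ==> T <= S ==> open T ==> harmonic_on u T"
 by (auto simp: harmonic_on_pointwise)

lemma harmonic_on_local:
 assumes "open S" "!!z. z : S ==> EX T. open T & z : T & harmonic_on u T"
 shows "harmonic_on u S"
 unfolding harmonic_on_pointwise[OF assms(1)]
proof
 fix z assume "z : S"
 then obtain T where T: "open T" "z : T" "harmonic_on u T" using assms(2) by blast
 then show "u differentiable at z &
  (ALL e:{1, \<i>}. isCont (partial e u) z & partial e u differentiable at z &
  (ALL e':{1, \<i>}. isCont (partial e' (partial e u)) z)) &
  partial 1 (partial 1 u) z + partial \<i> (partial \<i> u) z = 0"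
  unfolding harmonic_on_pointwise[OF T(1)] by blast
qed

text \<open>Candidates for the first and second partial derivatives as a certificate of harmonicity;
  they combine more easily than iterated \<open>partial\<close>, which depends on the function near
  each point.\<close>

definition hdata where
 "hdata u p q p1 p2 q1 q2 S \<longleftrightarrow> continuous_on S p1 & continuous_on S p2 & continuous_on S q1 & continuous_on S q2 &
  (ALL z:S. pd u (p z) (q z) z & pd p (p1 z) (p2 z) z & pd q (q1 z) (q2 z) z & p1 z + q2 z = 0)"

lemma hdataI:
 assumes S: "open S" and h: "harmonic_on u S"
 shows "hdata u (partial 1 u) (partial \<i> u) (partial 1 (partial 1 u)) (partial \<i> (partial 1 u))
  (partial 1 (partial \<i> u)) (partial \<i> (partial \<i> u)) S"
 using h unfolding harmonic_on_pointwise[OF S] hdata_def continuous_on_eq_continuous_at[OF S]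
 by (simp add: pd_partial)

lemma hdata_harmonic:
 assumes S: "open S" and h: "hdata u p q p1 p2 q1 q2 S"
 shows "harmonic_on u S"
proof -
 note hd = h[unfolded hdata_def continuous_on_eq_continuous_at[OF S]]
 have 1: "partial 1 u z = p z" "partial \<i> u z = q z" if "z : S" for z
  using partial_pd[of u "p z" "q z" z] hd that by auto
 have 2: "pd (partial 1 u) (p1 z) (p2 z) z" "pd (partial \<i> u) (q1 z) (q2 z) z" if z: "z : S" for z
  using pd_cong[OF _ S z, of p "p1 z" "p2 z" "partial 1 u"] pd_cong[OF _ S z, of q "q1 z" "q2 z" "partial \<i> u"] 1 hd z by auto
 have cc: "isCont v z" if "isCont w z" "z : S" "!!x. x : S ==> v x = w x" for v w :: "complex => real" and z
  using that(1) isCont_cong[OF eventually_mono[OF eventually_nhds_in_open[OF S that(2)] that(3)]] by simp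
 have 3: "partial 1 (partial 1 u) z = p1 z" "partial \<i> (partial 1 u) z = p2 z"
  "partial 1 (partial \<i> u) z = q1 z" "partial \<i> (partial \<i> u) z = q2 z" if "z : S" for z
  using partial_pd[OF 2(1)[OF that]] partial_pd[OF 2(2)[OF that]] by auto
 show ?thesis
  unfolding harmonic_on_pointwise[OF S]
 proof
  fix z assume z: "z : S"
  have "isCont (partial 1 (partial 1 u)) z" by (rule cc[where w = p1]) (use hd z 3 in auto)
  moreover have "isCont (partial \<i> (partial 1 u)) z" by (rule cc[where w = p2]) (use hd z 3 in auto)
  moreover have "isCont (partial 1 (partial \<i> u)) z" by (rule cc[where w = q1]) (use hd z 3 in auto)
  moreover have "isCont (partial \<i> (partial \<i> u)) z" by (rule cc[where w = q2]) (use hd z 3 in auto)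
  ultimately show "u differentiable at z &
  (ALL e:{1, \<i>}. isCont (partial e u) z & partial e u differentiable at z &
  (ALL e':{1, \<i>}. isCont (partial e' (partial e u)) z)) &
  partial 1 (partial 1 u) z + partial \<i> (partial \<i> u) z = 0"
  using hd z 3[OF z] 2[OF z] pd_isCont[OF 2(1)[OF z]] pd_isCont[OF 2(2)[OF z]]
  pd_differentiable[OF 2(1)[OF z]] pd_differentiable[OF 2(2)[OF z]] by (auto intro: pd_differentiable)
 qed
qed

lemma harmonic_on_cong:
 assumes S: "open S" and h: "harmonic_on u S" and eq: "!!z. z : S ==> v z = u z"
 shows "harmonic_on v S"
proof (rule hdata_harmonic[OF S])
 show "hdata v (partial 1 u) (partial \<i> u) (partial 1 (partial 1 u)) (partial \<i> (partial 1 u))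
  (partial 1 (partial \<i> u)) (partial \<i> (partial \<i> u)) S"
  using hdataI[OF S h] eq unfolding hdata_def by (auto intro: pd_cong[OF _ S])
qed

lemma harmonic_on_const: "open S ==> harmonic_on (%_. c) S"
 by (rule hdata_harmonic[of _ _ "%_. 0" "%_. 0" "%_. 0" "%_. 0" "%_. 0" "%_. 0"]) (simp_all add: hdata_def pd_const)

lemma harmonic_on_add:
 assumes S: "open S" and u: "harmonic_on u S" and v: "harmonic_on v S"
 shows "harmonic_on (%z. u z + v z) S"
proof (rule hdata_harmonic[OF S])
 show "hdata (%z. u z + v z) (%z. partial 1 u z + partial 1 v z) (%z. partial \<i> u z + partial \<i> v z)
  (%z. partial 1 (partial 1 u) z + partial 1 (partial 1 v) z) (%z. partial \<i> (partial 1 u) z + partial \<i> (partial 1 v) z)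
  (%z. partial 1 (partial \<i> u) z + partial 1 (partial \<i> v) z) (%z. partial \<i> (partial \<i> u) z + partial \<i> (partial \<i> v) z) S"
  using hdataI[OF S u] hdataI[OF S v] unfolding hdata_def by (auto intro!: pd_add continuous_on_add) (smt (verit))
qed

lemma harmonic_on_cmult:
 assumes S: "open S" and u: "harmonic_on u S"
 shows "harmonic_on (%z. c * u z) S"
proof (rule hdata_harmonic[OF S])
 have m: "pd (%z. c * f z) (c * a) (c * b) z" if "pd f a b z" for f a b z
  using pd_mult[OF pd_const that, of c] by simp
 show "hdata (%z. c * u z) (%z. c * partial 1 u z) (%z. c * partial \<i> u z)
  (%z. c * partial 1 (partial 1 u) z) (%z. c * partial \<i> (partial 1 u) z)
  (%z. c * partial 1 (partial \<i> u) z) (%z. c * partial \<i> (partial \<i> u) z) S"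
  using hdataI[OF S u] unfolding hdata_def
  by (auto intro!: m continuous_on_mult_left simp: distrib_left[symmetric])
qed

lemma harmonic_on_diff:
 assumes "open S" "harmonic_on u S" "harmonic_on v S"
 shows "harmonic_on (%z. u z - v z) S"
 using harmonic_on_add[OF assms(1,2) harmonic_on_cmult[OF assms(1,3), of "-1"]] by simp

lemma harmonic_on_sum:
 assumes "open S" "!!i. i : I ==> harmonic_on (u i) S"
 shows "harmonic_on (%z. \<Sum>i\<in>I. u i z) S"
 using assms(2) by (induction I rule: infinite_finite_induct) (simp_all add: harmonic_on_const[OF assms(1)] harmonic_on_add[OF assms(1)])

text \<open>The mixed second derivatives cancel in the Laplacian of the composition, so that their symmetry is not needed.\<close>

lemma harmonic_on_compose:
 assumes S: "open S" and T: "open T" and H: "harmonic_on H T" and g: "g holomorphic_on S" "g ` S <= T"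
 shows "harmonic_on (%z. H (g z)) S"
proof -
 define P Q P1 P2 Q1 Q2 where "P = partial 1 H" "Q = partial \<i> H" "P1 = partial 1 P" "P2 = partial \<i> P"
  "Q1 = partial 1 Q" "Q2 = partial \<i> Q"
 have hd: "hdata H P Q P1 P2 Q1 Q2 T" using hdataI[OF T H] unfolding P_Q_P1_P2_Q1_Q2_def .
 define a b c d where "a z = Re (deriv g z)" "b z = Im (deriv g z)" "c z = Re (deriv (deriv g) z)" "d z = Im (deriv (deriv g) z)" for z
 have gd: "(g has_field_derivative deriv g z) (at z)" "(deriv g has_field_derivative deriv (deriv g) z) (at z)" if "z : S" for z
  using holomorphic_derivI[OF g(1) S that] holomorphic_derivI[OF holomorphic_deriv[OF g(1) S] S that] by auto
 have ab: "pd a (c z) (- d z) z" "pd b (d z) (c z) z" if "z : S" for z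
  using pd_Re[OF gd(2)[OF that]] pd_Im[OF gd(2)[OF that]] unfolding a_b_c_d_def .
 have comp: "pd (%w. V (g w)) (a z * Va (g z) + b z * Vb (g z)) (- b z * Va (g z) + a z * Vb (g z)) z"
  if "z : S" "pd V (Va (g z)) (Vb (g z)) (g z)" for V Va Vb z
  using pd_compose[OF that(2) gd(1)[OF that(1)]] unfolding a_b_c_d_def .
 have cg: "continuous_on S g" "continuous_on S (deriv g)" "continuous_on S (deriv (deriv g))"
  using g(1) S by (auto intro!: hol_cont holomorphic_deriv)
 have cV: "continuous_on S (%z. V (g z))" if "continuous_on T V" for V :: "complex => real"
  using continuous_on_compose2[OF that cg(1) g(2)] .
 have Pc: "continuous_on T P" "continuous_on T Q"
  using hd unfolding hdata_def by (auto intro!: continuous_at_imp_continuous_on pd_isCont)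
 have cs: "continuous_on S a" "continuous_on S b" "continuous_on S c" "continuous_on S d"
  unfolding a_b_c_d_def by (intro continuous_intros cg)+
 show ?thesis
 proof (rule hdata_harmonic[OF S])
  let ?p = "%z. a z * P (g z) + b z * Q (g z)"
  let ?q = "%z. (-1) * b z * P (g z) + a z * Q (g z)"
  let ?p1 = "%z. (c z * P (g z) + a z * (a z * P1 (g z) + b z * P2 (g z))) + (d z * Q (g z) + b z * (a z * Q1 (g z) + b z * Q2 (g z)))"
  let ?p2 = "%z. (- d z * P (g z) + a z * (- b z * P1 (g z) + a z * P2 (g z))) + (c z * Q (g z) + b z * (- b z * Q1 (g z) + a z * Q2 (g z)))"
  let ?q1 = "%z. ((0 * b z + (-1) * d z) * P (g z) + (-1) * b z * (a z * P1 (g z) + b z * P2 (g z))) + (c z * Q (g z) + a z * (a z * Q1 (g z) + b z * Q2 (g z)))"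
  let ?q2 = "%z. ((0 * b z + (-1) * c z) * P (g z) + (-1) * b z * (- b z * P1 (g z) + a z * P2 (g z))) + (- d z * Q (g z) + a z * (- b z * Q1 (g z) + a z * Q2 (g z)))"
  show "hdata (%z. H (g z)) ?p ?q ?p1 ?p2 ?q1 ?q2 S"
  unfolding hdata_def
  proof (intro conjI ballI)
  show "continuous_on S ?p1" "continuous_on S ?p2" "continuous_on S ?q1" "continuous_on S ?q2"
  using hd Pc cs unfolding hdata_def by (auto intro!: continuous_intros cV)
  fix z assume z: "z : S"
  then have gz: "g z : T" using g(2) by auto
  have pds: "pd H (P (g z)) (Q (g z)) (g z)" "pd P (P1 (g z)) (P2 (g z)) (g z)" "pd Q (Q1 (g z)) (Q2 (g z)) (g z)" "P1 (g z) + Q2 (g z) = 0"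
  using hd gz unfolding hdata_def by auto
  show "pd (%z. H (g z)) (?p z) (?q z) z" using comp[where V = H and Va = P and Vb = Q, OF z pds(1)] by simp
  show "pd ?p (?p1 z) (?p2 z) z"
  by (rule pd_add[OF pd_mult[OF ab(1)[OF z] comp[where V = P and Va = P1 and Vb = P2, OF z pds(2)]]
  pd_mult[OF ab(2)[OF z] comp[where V = Q and Va = Q1 and Vb = Q2, OF z pds(3)]]])
  show "pd ?q (?q1 z) (?q2 z) z"
  by (rule pd_add[OF pd_mult[OF pd_mult[OF pd_const ab(2)[OF z]] comp[where V = P and Va = P1 and Vb = P2, OF z pds(2)]]
  pd_mult[OF ab(1)[OF z] comp[where V = Q and Va = Q1 and Vb = Q2, OF z pds(3)]]])
  have "?p1 z + ?q2 z = (a z * a z + b z * b z) * (P1 (g z) + Q2 (g z))" by (simp add: algebra_simps)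
  then show "?p1 z + ?q2 z = 0" unfolding pds(4) by simp
  qed
 qed
qed

lemma harmonic_on_Re_holomorphic:
 assumes "open S" "g holomorphic_on S" shows "harmonic_on (%z. Re (g z)) S"
proof (rule harmonic_on_compose[OF assms(1) open_UNIV _ assms(2)])
 show "harmonic_on Re UNIV"
  by (rule hdata_harmonic[of _ _ "%_. 1" "%_. 0" "%_. 0" "%_. 0" "%_. 0" "%_. 0"])
  (use pd_Re[of "%x. x" 1] in \<open>simp_all add: hdata_def pd_const\<close>)
qed simp

text \<open>Off the cut of the principal logarithm, ln |z| is Re (Ln z); around points of the cut it
  is Re (Ln (- z)).\<close>

lemma harmonic_on_ln_cmod: "harmonic_on (%z. ln (cmod z)) (- {0})"
proof (rule harmonic_on_local)
 have o: "open (- \<real>\<^sub>\<le>\<^sub>0 :: complex set)" by (simp add: closed_nonpos_Reals_complex open_Compl)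
 fix z :: complex assume z: "z : - {0}"
 show "EX T. open T & z : T & harmonic_on (%z. ln (cmod z)) T"
 proof (cases "z : \<real>\<^sub>\<le>\<^sub>0")
  case False
  have "harmonic_on (%z. ln (cmod z)) (- \<real>\<^sub>\<le>\<^sub>0)"
  proof (rule harmonic_on_cong[OF o harmonic_on_Re_holomorphic[OF o, of Ln]])
  show "ln (cmod z) = Re (Ln z)" if "z : - \<real>\<^sub>\<le>\<^sub>0" for z using that by (subst Re_Ln) auto
  qed (auto intro: holomorphic_intros)
  then show ?thesis using o False by blast
 next
  case True
  let ?T = "uminus ` (- \<real>\<^sub>\<le>\<^sub>0 :: complex set)"
  have T: "open ?T" using o by (rule open_negations)
  have mz: "- z ~: \<real>\<^sub>\<le>\<^sub>0" using True z by (auto simp: complex_nonpos_Reals_iff complex_eq_iff)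
  have mem: "- w ~: \<real>\<^sub>\<le>\<^sub>0" if "w : ?T" for w using that by auto
  have "harmonic_on (%z. ln (cmod z)) ?T"
  proof (rule harmonic_on_cong[OF T harmonic_on_Re_holomorphic[OF T, of "%z. Ln (- z)"]])
  show "ln (cmod z) = Re (Ln (- z))" if "z : ?T" for z using mem[OF that] by (subst Re_Ln) auto
  show "(%z. Ln (- z)) holomorphic_on ?T" using mem by (auto intro!: holomorphic_intros)
  qed
  moreover have "z : ?T" using mz by (intro image_eqI[of _ _ "- z"]) auto
  ultimately show ?thesis using T by blast
 qed
qed auto

lemma harmonic_on_ln_holomorphic:
 assumes "open S" "g holomorphic_on S" "!!z. z : S ==> g z ~= 0"
 shows "harmonic_on (%z. ln (cmod (g z))) S"
 by (rule harmonic_on_compose[OF assms(1) _ harmonic_on_ln_cmod assms(2)]) (use assms(3) in auto)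

section \<open>Maximum principles and subharmonic functions given by logarithms\<close>

lemma second_derivative_local_max:
 fixes g :: "real => real"
 assumes r: "r > 0" and g: "!!t. \<bar>t\<bar> < r ==> (g has_real_derivative g1 t) (at t)"
  and g1: "(g1 has_real_derivative m) (at 0)" and mx: "!!t. \<bar>t\<bar> < r ==> g t <= g 0"
 shows "m <= 0"
proof (rule ccontr)
 assume "~ m <= 0"
 then have m: "m > 0" by simp
 have "g1 0 = 0" by (rule DERIV_local_max[OF g r]) (use r mx in auto)
 then obtain d where d: "d > 0" "!!h. 0 < h ==> h < d ==> 0 < g1 h" using DERIV_pos_inc_right[OF g1 m] by auto
 define t where "t = min r d / 2"
 have t: "0 < t" "t < r" "t < d" using r d(1) by (auto simp: t_def)
 have "EX l z. l > 0 & l < t & (g has_real_derivative g1 z) (at l) & g t - g 0 = (t - 0) * g1 l"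
 proof -
  obtain z where "0 < z" "z < t" "g t - g 0 = (t - 0) * g1 z"
  using MVT2[OF t(1), of g g1] g t by fastforce
  then show ?thesis using g[of z] t by auto
 qed
 then obtain l where l: "0 < l" "l < t" "g t - g 0 = (t - 0) * g1 l" by blast
 have "g t - g 0 > 0" unfolding l(3) using t l d(2)[of l] by auto
 then show False using mx[of t] t by auto
qed

lemma pd_line:
 assumes "pd u a b (z + of_real t * e)"
 shows "((%s. u (z + of_real s * e)) has_real_derivative (Re e * a + Im e * b)) (at t)"
proof -
 have "((%s. z + of_real s * e) has_derivative (%s. of_real s * e)) (at t)"
  by (auto intro!: derivative_eq_intros)
 from diff_chain_at[OF this assms[unfolded pd_def]]
 have "((%s. u (z + of_real s * e)) has_derivative (%s. Re (of_real s * e) * a + Im (of_real s * e) * b)) (at t)"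
  by (simp add: o_def)
 moreover have "(%s. Re (of_real s * e) * a + Im (of_real s * e) * b) = (*) (Re e * a + Im e * b)"
  by (simp add: fun_eq_iff algebra_simps)
 ultimately show ?thesis by (simp add: has_field_derivative_def)
qed

text \<open>A term \<open>\<epsilon> |z|\<^sup>2\<close> makes the Laplacian at an interior maximum strictly positive.\<close>

lemma harmonic_local_max:
 assumes V: "open V" "z : V" and h: "harmonic_on h V" and e: "ep > 0"
  and mx: "!!w. w : V ==> h w + ep * (cmod w)\<^sup>2 <= h z + ep * (cmod z)\<^sup>2"
 shows False
proof -
 define P Q P1 P2 Q1 Q2 where "P = partial 1 h" "Q = partial \<i> h" "P1 = partial 1 P" "P2 = partial \<i> P"
  "Q1 = partial 1 Q" "Q2 = partial \<i> Q"
 have hd: "hdata h P Q P1 P2 Q1 Q2 V" using hdataI[OF V(1) h] unfolding P_Q_P1_P2_Q1_Q2_def .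
 define u where "u w = h w + ep * (cmod w)\<^sup>2" for w
 have pRe: "pd Re 1 0 w" and pIm: "pd Im 0 1 w" for w
  using pd_Re[of "%x. x" 1 w] pd_Im[of "%x. x" 1 w] by auto
 have ueq: "u = (%w. h w + ep * (Re w * Re w + Im w * Im w))" unfolding u_def cmod_power2 by (simp add: p2eq)
 have u: "pd u (P w + 2 * ep * Re w) (Q w + 2 * ep * Im w) w" if "w : V" for w
 proof -
  have "pd h (P w) (Q w) w" using hd that unfolding hdata_def by blast
  from pd_add[OF this pd_mult[OF pd_const pd_add[OF pd_mult[OF pRe pRe] pd_mult[OF pIm pIm]], of ep]]
  show ?thesis unfolding ueq by (simp add: algebra_simps)
 qed
 have u1: "pd (%w. P w + 2 * ep * Re w) (P1 z + 2 * ep) (P2 z) z"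
  using pd_add[OF _ pd_mult[OF pd_const pRe, of "2 * ep"], of P "P1 z" "P2 z" z] hd V(2) unfolding hdata_def by auto
 have u2: "pd (%w. Q w + 2 * ep * Im w) (Q1 z) (Q2 z + 2 * ep) z"
  using pd_add[OF _ pd_mult[OF pd_const pIm, of "2 * ep"], of Q "Q1 z" "Q2 z" z] hd V(2) unfolding hdata_def by auto
 obtain r where r: "r > 0" "ball z r <= V" using V by (rule openE)
 have in_V: "z + of_real t * e : V" if "\<bar>t\<bar> < r" "cmod e = 1" for t e
  using that r(2) by (auto simp: dist_norm norm_mult)
 have "P1 z + 2 * ep <= 0"
 proof (rule second_derivative_local_max[OF r(1)])
  show "((%s. u (z + of_real s * 1)) has_real_derivative (P (z + of_real t * 1) + 2 * ep * Re (z + of_real t * 1))) (at t)" if "\<bar>t\<bar> < r" for t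
  using pd_line[OF u[OF in_V[OF that, of 1]]] by simp
  show "((%t. P (z + of_real t * 1) + 2 * ep * Re (z + of_real t * 1)) has_real_derivative P1 z + 2 * ep) (at 0)"
  using pd_line[of "%w. P w + 2 * ep * Re w" "P1 z + 2 * ep" "P2 z" z 0 1] u1 by simp
  show "u (z + of_real t * 1) <= u (z + of_real 0 * 1)" if "\<bar>t\<bar> < r" for t
  using mx[OF in_V[OF that, of 1]] by (simp add: u_def)
 qed
 moreover have "Q2 z + 2 * ep <= 0"
 proof (rule second_derivative_local_max[OF r(1)])
  show "((%s. u (z + of_real s * \<i>)) has_real_derivative (Q (z + of_real t * \<i>) + 2 * ep * Im (z + of_real t * \<i>))) (at t)" if "\<bar>t\<bar> < r" for t
  using pd_line[OF u[OF in_V[OF that, of \<i>]]] by simp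
  show "((%t. Q (z + of_real t * \<i>) + 2 * ep * Im (z + of_real t * \<i>)) has_real_derivative Q2 z + 2 * ep) (at 0)"
  using pd_line[of "%w. Q w + 2 * ep * Im w" "Q1 z" "Q2 z + 2 * ep" z 0 \<i>] u2 by simp
  show "u (z + of_real t * \<i>) <= u (z + of_real 0 * \<i>)" if "\<bar>t\<bar> < r" for t
  using mx[OF in_V[OF that, of \<i>]] by (simp add: u_def)
 qed
 moreover have "P1 z + Q2 z = 0" using hd V(2) unfolding hdata_def by blast
 ultimately show False using e by linarith
qed

text \<open>The real function \<open>ln\<close> cannot take the value -\<infinity> at 0. Subharmonic
  functions are given below through their exponentials, so that poles become zeros.\<close>

definition lnE :: "real => ereal" where
 "lnE x = (if x = 0 then -\<infinity> else ereal (ln x))"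

lemma lnE_le: "x >= 0 ==> lnE x <= ereal c \<longleftrightarrow> x <= exp c"
 using exp_le_cancel_iff[of "ln x" c] by (cases "x = 0") (simp_all add: lnE_def)

lemma lnE_less: "x >= 0 ==> lnE x < ereal c \<longleftrightarrow> x < exp c"
 using exp_less_cancel_iff[of "ln x" c] by (cases "x = 0") (simp_all add: lnE_def)

text \<open>The function maximized is Fj exp(-h) exp(ep |z|^2), which is continuous even at zeros of
  \<open>Fj\<close>. A maximum inside \<open>K\<close> lies where \<open>Fj\<close> is nonzero, and
  there its logarithm contradicts \<open>harmonic_local_max\<close>.\<close>

lemma lnE_maximum_principle:
 assumes S: "open S" and c: "continuous_on S Fj" and pos: "!!z. z : S ==> Fj z >= 0"
  and harm: "harmonic_on (%z. ln (Fj z)) {z\<in>S. Fj z ~= 0}"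
  and K: "compact K" "K <= S" and h: "continuous_on K h" "harmonic_on h (interior K)"
  and fr: "!!z. z : frontier K ==> Fj z <= exp (h z)" and z0: "z0 : K"
 shows "Fj z0 <= exp (h z0)"
proof (rule ccontr)
 assume "~ Fj z0 <= exp (h z0)"
 then have big: "Fj z0 * exp (- h z0) > 1" by (simp add: exp_minus field_simps)
 define m where "m = Fj z0 * exp (- h z0)"
 obtain R where R: "!!z. z : K ==> cmod z <= R" using compact_imp_bounded[OF K(1)] unfolding bounded_iff by blast
 \<comment> \<open>Small enough that ep |z|^2 stays below ln m on \<open>K\<close>, so that the
   extra factor cannot move the maximum to the frontier.\<close>
 define ep where "ep = ln m / (2 * (R\<^sup>2 + 1))"
 have lm: "ln m > 0" using big by (simp add: m_def)
 have R1: "R\<^sup>2 + 1 > 0" by (smt (verit) zero_le_power2)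
 have e: "ep > 0" using lm R1 by (simp add: ep_def)
 have e2: "ep * (cmod z)\<^sup>2 < ln m" if "z : K" for z
 proof -
  have "(cmod z)\<^sup>2 <= R\<^sup>2" using R[OF that] by (intro power_mono) auto
  then have "ep * (cmod z)\<^sup>2 <= ep * (R\<^sup>2 + 1)" using e by (intro mult_left_mono) auto
  also have "... = ln m / 2" using R1 by (simp add: ep_def field_simps)
  finally show ?thesis using lm by simp
 qed
 define G where "G z = Fj z * exp (- h z) * exp (ep * (cmod z)\<^sup>2)" for z
 have "continuous_on K G"
  unfolding G_def by (intro continuous_intros h(1) continuous_on_subset[OF c K(2)])
 then obtain z where z: "z : K" "!!w. w : K ==> G w <= G z"
  using continuous_attains_sup[OF K(1)] z0 by (metis empty_iff)
 have "m = m * 1" by simp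
 also have "... <= G z0" unfolding G_def m_def using big e by (intro mult_left_mono) auto
 finally have Gm: "m <= G z" using z(2)[OF z0] by linarith
 have "z ~: frontier K"
 proof
  assume "z : frontier K"
  then have "Fj z * exp (- h z) <= exp (h z) * exp (- h z)" using fr by (intro mult_right_mono) auto
  then have "Fj z * exp (- h z) <= 1" by (simp add: exp_minus)
  then have "G z <= 1 * exp (ep * (cmod z)\<^sup>2)" unfolding G_def by (intro mult_right_mono) auto
  also have "... < exp (ln m)" using e2[OF z(1)] by simp
  also have "... = m" using big by (simp add: m_def)
  finally show False using Gm by simp
 qed
 then have zi: "z : interior K" using z(1) compact_imp_closed[OF K(1)] by (simp add: frontier_def)
 define T where "T = {z\<in>S. Fj z ~= 0}"
 have "T = S Int Fj -` (- {0})" by (auto simp: T_def)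
 then have T: "open T" using continuous_open_preimage[OF c S, of "- {0}"] by (simp add: open_Compl)
 have Fjz: "Fj z ~= 0" using Gm big by (auto simp: G_def m_def)
 define V where "V = interior K Int T"
 have V: "open V" "z : V" using T zi Fjz z(1) K(2) by (auto simp: V_def T_def)
 have lnG: "ln (Fj w) - h w + ep * (cmod w)\<^sup>2 = ln (G w)" if "w : V" for w
 proof -
  have "Fj w > 0" using that pos[of w] by (auto simp: V_def T_def)
  then show ?thesis by (simp add: G_def ln_mult)
 qed
 show False
 proof (rule harmonic_local_max[OF V _ e])
  show "harmonic_on (%z. ln (Fj z) - h z) V"
  by (intro harmonic_on_diff V(1) harmonic_on_subset[OF harm[folded T_def] T] harmonic_on_subset[OF h(2) open_interior])
  (auto simp: V_def T)
  fix w assume w: "w : V"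
  have "w : K" using w interior_subset by (auto simp: V_def)
  moreover have "G w > 0" using w pos[of w] by (auto simp: V_def T_def G_def)
  ultimately show "ln (Fj w) - h w + ep * (cmod w)\<^sup>2 <= ln (Fj z) - h z + ep * (cmod z)\<^sup>2"
  unfolding lnG[OF w] lnG[OF V(2)] using z(2)[of w] by (metis less_le_trans ln_le_cancel_iff)
 qed
qed

text \<open>The limit need not be continuous, so the comparison is made at a finite stage. The
  frontier points where \<open>Fj m\<close> still reaches exp(h + e) form nested compact sets with
  empty intersection; hence one of them is empty and \<open>lnE_maximum_principle\<close> applies to
  that \<open>Fj m\<close>.\<close>

lemma subharmonic_on_lnE_limit:
 fixes Fj :: "nat => complex => real"
 assumes S: "open S" and c: "!!m. continuous_on S (Fj m)" and pos: "!!m z. z : S ==> Fj m z >= 0"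
  and harm: "!!m. harmonic_on (%z. ln (Fj m z)) {z\<in>S. Fj m z ~= 0}"
  and dec: "!!m z. z : S ==> Fj (Suc m) z <= Fj m z"
  and lim: "!!z. z : S ==> (%m. Fj m z) \<longlonglongrightarrow> Ps z"
 shows "subharmonic_on (%z. lnE (Ps z)) S"
proof -
 have decm: "Fj n z <= Fj m z" if "m <= n" "z : S" for m n z
  by (rule lift_Suc_antimono_le[of "%m. Fj m z", OF dec[OF that(2)] that(1)])
 have le: "Ps z <= Fj m z" if "z : S" for m z
  by (rule LIMSEQ_le_const2[OF lim[OF that]]) (use decm that in blast)
 have Ps0: "Ps z >= 0" if "z : S" for z
  by (rule LIMSEQ_le_const[OF lim[OF that]]) (use pos that in blast)
 show ?thesis
  unfolding subharmonic_on_def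
 proof (intro conjI ballI allI impI)
  show "lnE (Ps z) < \<infinity>" for z by (simp add: lnE_def)
 next
  fix c :: ereal
  have "open {z\<in>S. lnE (Ps z) < c}"
  proof (cases c)
  case (real r)
  have "{z\<in>S. lnE (Ps z) < c} = (\<Union>m. {z\<in>S. Fj m z < exp r})"
  proof (intro set_eqI iffI)
  fix z assume "z : {z\<in>S. lnE (Ps z) < c}"
  then have z: "z : S" "Ps z < exp r" using real Ps0 by (auto simp: lnE_less)
  then show "z : (\<Union>m. {z\<in>S. Fj m z < exp r})"
  using order_tendstoD(2)[OF lim[OF z(1)] z(2)] by (auto simp: eventually_sequentially)
  next
  fix z assume "z : (\<Union>m. {z\<in>S. Fj m z < exp r})"
  then obtain m where "z : S" "Fj m z < exp r" by auto
  then show "z : {z\<in>S. lnE (Ps z) < c}" using real Ps0 le[of z m] by (auto simp: lnE_less)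
  qed
  moreover have "open {z\<in>S. Fj m z < exp r}" for m
  using continuous_open_preimage[OF \<open>\<And>m. continuous_on S (Fj m)\<close> S, of "{..<exp r}"] by (auto simp: vimage_def Int_def)
  ultimately show ?thesis by auto
  next
  case PInf
  then have "{z\<in>S. lnE (Ps z) < c} = S" by (auto simp: lnE_def)
  then show ?thesis using S by simp
  qed simp
  then show "openin (top_of_set S) {z\<in>S. lnE (Ps z) < c}" by (intro open_subset) auto
 next
  fix K h z
  assume a: "compact K & K <= S & continuous_on K h & harmonic_on h (interior K) & (ALL z:frontier K. lnE (Ps z) <= ereal (h z))"
  and z: "z : K"
  then have K: "compact K" "K <= S" and h: "continuous_on K h" "harmonic_on h (interior K)"
  and fr: "ALL z:frontier K. lnE (Ps z) <= ereal (h z)" by auto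
  have frK: "frontier K <= K" using compact_imp_closed[OF K(1)] by (simp add: frontier_subset_closed)
  have fr': "Ps w <= exp (h w)" if "w : frontier K" for w
  using fr that Ps0 frK K(2) by (metis lnE_le subsetD)
  have "Ps z <= exp (h z + e)" if e: "e > 0" for e
  proof -
  define C where "C m = {w\<in>frontier K. exp (h w + e) <= Fj m w}" for m
  have comp: "compact (C m)" for m
  proof -
  have cf: "compact (frontier K)" using K(1) by (rule compact_frontier)
  have "continuous_on (frontier K) (%w. Fj m w - exp (h w + e))"
  by (intro continuous_intros continuous_on_subset[OF h(1) frK] continuous_on_subset[OF c order_trans[OF frK K(2)]])
  then have "closed (frontier K Int (%w. Fj m w - exp (h w + e)) -` {0..})"
  by (rule continuous_closed_preimage[OF _ compact_imp_closed[OF cf]]) simp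
  then have "compact (frontier K Int (frontier K Int (%w. Fj m w - exp (h w + e)) -` {0..}))" by (rule compact_Int_closed[OF cf])
  moreover have "frontier K Int (frontier K Int (%w. Fj m w - exp (h w + e)) -` {0..}) = C m" by (auto simp: C_def)
  ultimately show ?thesis by simp
  qed
  have "EX m. C m = {}"
  proof (rule ccontr)
  assume "\<nexists>m. C m = {}"
  moreover have "C n <= C m" if "m <= n" for m n
  using decm[OF that] frK K(2) by (force simp: C_def)
  ultimately have "(\<Inter>m. C m) ~= {}" by (intro compact_nest comp) auto
  then obtain w where w: "!!m. w : C m" by auto
  then have wK: "w : frontier K" by (auto simp: C_def)
  then have "exp (h w + e) <= Ps w" using w frK K(2)
  by (intro LIMSEQ_le_const[OF lim]) (auto simp: C_def)
  also have "... <= exp (h w)" by (rule fr'[OF wK])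
  finally show False using e by simp
  qed
  then obtain m where m: "C m = {}" by blast
  have "Fj m z <= exp (h z + e)"
  proof (rule lnE_maximum_principle[OF S c pos harm K _ _ _ z])
  show "continuous_on K (%z. h z + e)" by (intro continuous_intros h(1))
  show "harmonic_on (%z. h z + e) (interior K)" by (intro harmonic_on_add harmonic_on_const h(2)) auto
  show "Fj m w <= exp (h w + e)" if "w : frontier K" for w using m that by (force simp: C_def)
  qed
  then show ?thesis using le[of z m] z K(2) by force
  qed
  then have "lnE (Ps z) <= ereal (h z) + ereal e" if "e > 0" for e
  using lnE_le[OF Ps0[OF subsetD[OF K(2) z]], of "h z + e"] that by simp
  then show "lnE (Ps z) <= ereal (h z)" by (rule ereal_le_epsilon2)
 qed
qed

lemma subharmonic_on_lnE:
 assumes "open S" "continuous_on S Fj" "!!z. z : S ==> Fj z >= 0" "harmonic_on (%z. ln (Fj z)) {z\<in>S. Fj z ~= 0}"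
 shows "subharmonic_on (%z. lnE (Fj z)) S"
 by (rule subharmonic_on_lnE_limit[where Fj = "%_. Fj", OF assms(1)]) (simp_all add: assms)

lemma subharmonic_on_open:
 assumes "subharmonic_on u S" "open S" shows "open {z\<in>S. u z < c}"
proof -
 have "ALL c. openin (top_of_set S) {z\<in>S. u z < c}" using assms(1) unfolding subharmonic_on_def by (elim conjE)
 then have "openin (top_of_set S) {z\<in>S. u z < c}" by (rule spec)
 then show ?thesis by (rule openin_open_trans) (rule assms(2))
qed

lemma subharmonic_onD:
 assumes "subharmonic_on u S" "compact K" "K <= S" "continuous_on K h" "harmonic_on h (interior K)"
  "!!z. z : frontier K ==> u z <= ereal (h z)" "z : K"
 shows "u z <= ereal (h z)"
proof -
 have "ALL K h. compact K & K <= S & continuous_on K h & harmonic_on h (interior K) & (ALL z:frontier K. u z <= ereal (h z))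
  --> (ALL z:K. u z <= ereal (h z))" using assms(1) unfolding subharmonic_on_def by (elim conjE)
 from this[rule_format, of K h z] show ?thesis using assms(2-) by simp
qed

lemma subharmonic_on_bounded_above:
 assumes u: "subharmonic_on u S" and S: "open S" and K: "compact K" "K <= S"
 shows "EX C. ALL z:K. u z <= ereal C"
proof (rule ccontr)
 assume n: "~ ?thesis"
 define C where "C n = K - {z\<in>S. u z < ereal (real n)}" for n
 have "compact (C n)" for n unfolding C_def by (rule compact_diff[OF K(1) subharmonic_on_open[OF u S]])
 moreover have "C n ~= {}" for n
 proof -
  obtain z where "z : K" "~ u z <= ereal (real n)" using n by blast
  then show ?thesis by (auto simp: C_def)
 qed
 moreover have "C n <= C m" if "m <= n" for m n
  using that by (auto simp: C_def elim!: order_less_le_trans)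
 ultimately have "(\<Inter>m. C m) ~= {}" by (rule compact_nest)
 then obtain z where z: "!!m. z : C m" by auto
 then have "ereal (real m) <= u z" for m using K(2) by (auto simp: C_def not_less)
 moreover have "u z < \<infinity>" using u z[of 0] K(2) unfolding subharmonic_on_def C_def by auto
 ultimately obtain y where y: "u z = ereal y" "!!m. real m <= y" by (cases "u z") force+
 obtain m where "y < real m" using reals_Archimedean2 by blast
 then show False using y(2)[of m] by simp
qed

text \<open>The interior of the -\<infinity> set is relatively closed, hence empty or everything.
  Near a limit point take a centre \<open>c\<close> in it; on an annulus around \<open>c\<close> the
  function is at most C + n log |(x - c) / R| for every n, as it is -\<infinity> at the inner
  boundary, and so it is -\<infinity> on the whole disc.\<close>

lemma subharmonic_on_minus_infinity_interior:
 assumes v: "subharmonic_on v U" and U: "open U" "connected U" and nt: "z1 : U" "v z1 ~= -\<infinity>"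
 shows "interior {z\<in>U. v z = -\<infinity>} = {}"
proof (rule ccontr)
 define Z where "Z = interior {z\<in>U. v z = -\<infinity>}"
 assume "interior {z\<in>U. v z = -\<infinity>} ~= {}"
 then have ne: "Z ~= {}" by (simp add: Z_def)
 have Zsub: "Z <= {z\<in>U. v z = -\<infinity>}" unfolding Z_def by (rule interior_subset)
 have "closedin (top_of_set U) Z"
  unfolding closedin_limpt
 proof (intro conjI allI impI)
  show "Z <= U" using Zsub by auto
  fix p assume p: "p islimpt Z & p : U"
  obtain r where r: "r > 0" "ball p r <= U" using p U(1) by (auto elim: openE)
  \<comment> \<open>Within r / 4 of \<open>p\<close>, so that the disc of radius r / 2 about
    \<open>c\<close> contains \<open>p\<close> and stays in \<open>U\<close>.\<close>
  obtain c where c: "c : Z" "dist c p < r / 4" using p r(1) unfolding islimpt_approachable by (meson zero_less_divide_iff zero_less_numeral)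
  define R where "R = r / 2"
  have cR: "cball c R <= U"
  proof
  fix x assume "x : cball c R"
  then have "dist p x < r" using c(2) dist_triangle[of p x c] r(1) by (auto simp: R_def dist_commute)
  then show "x : U" using r(2) by auto
  qed
  obtain C where C: "!!z. z : cball c R ==> v z <= ereal C"
  using subharmonic_on_bounded_above[OF v U(1) compact_cball cR] by blast
  obtain s where s: "s > 0" "ball c s <= Z" using c(1) unfolding Z_def by (meson open_interior openE)
  have inf: "v z = -\<infinity>" if z: "z : ball c R" for z
  proof (cases "z : Z")
  case True then show ?thesis using Zsub by auto
  next
  case False
  define s' where "s' = s / 2"
  define K where "K = cball c R - ball c s'"
  have "ball c s' <= ball c s" using s(1) by (intro subset_ball) (simp add: s'_def)
  then have zK: "z : K" using z False s(2) by (auto simp: K_def)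
  have R0: "R > 0" using r by (simp add: R_def)
  have Knz: "x - c ~= 0" if "x : K" for x using that s(1) by (auto simp: K_def s'_def)
  define h where "h n x = C + real n * ln (cmod ((x - c) / of_real R))" for n x
  have fr: "frontier K <= sphere c R \<union> ball c s"
  proof
  fix x assume x: "x : frontier K"
  have cl: "closed K" unfolding K_def by (intro closed_Diff) auto
  show "x : sphere c R \<union> ball c s"
  proof (rule ccontr)
  assume nx: "x ~: sphere c R \<union> ball c s"
  have xK: "x : K" using x cl by (simp add: frontier_def)
  then have "x : ball c R - cball c s'" using nx s(1) by (auto simp: K_def s'_def)
  moreover have "open (ball c R - cball c s')" "ball c R - cball c s' <= K" by (auto simp: K_def)
  ultimately have "x : interior K" by (auto intro: interiorI)
  then show False using x by (simp add: frontier_def)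
  qed
  qed
  have bd: "v z <= ereal (h n z)" for n
  proof (rule subharmonic_onD[OF v _ _ _ _ _ zK])
  show "compact K" unfolding K_def by (intro compact_diff) auto
  show "K <= U" using cR by (auto simp: K_def)
  show "continuous_on K (h n)" unfolding h_def using Knz R0 by (auto intro!: continuous_intros)
  show "harmonic_on (h n) (interior K)"
  unfolding h_def using Knz R0 interior_subset[of K]
  by (intro harmonic_on_add harmonic_on_const harmonic_on_cmult harmonic_on_ln_holomorphic holomorphic_intros) auto
  fix x assume "x : frontier K"
  then consider "x : sphere c R" | "x : ball c s" using fr by auto
  then show "v x <= ereal (h n x)"
  proof cases
  case 1
  then have "h n x = C" using R0 by (simp add: h_def dist_norm norm_divide norm_minus_commute)
  then show ?thesis using C[of x] 1 by simp
  next
  case 2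
  then have "v x = -\<infinity>" using s(2) Zsub by blast
  then show ?thesis by simp
  qed
  qed
  have lneg: "ln (cmod ((z - c) / of_real R)) < 0"
  using z R0 Knz[OF zK] by (subst ln_less_zero_iff) (auto simp: norm_divide dist_norm norm_minus_commute)
  show ?thesis
  proof (rule ccontr)
  assume "v z ~= -\<infinity>"
  moreover have "v z ~= \<infinity>" using bd[of 0] by auto
  ultimately obtain y where y: "v z = ereal y" by (cases "v z") auto
  obtain n where "real n * (- ln (cmod ((z - c) / of_real R))) > C - y"
  using reals_Archimedean3 lneg by (metis neg_0_less_iff_less)
  then show False using bd[of n] y by (simp add: h_def)
  qed
  qed
  have "ball c R <= Z" unfolding Z_def by (rule interior_maximal) (use inf cR in auto)
  moreover have "p : ball c R" using c(2) r(1) by (simp add: R_def)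
  ultimately show "p : Z" by auto
 qed
 moreover have "openin (top_of_set U) Z" using Zsub by (intro open_subset) (auto simp: Z_def)
 ultimately have "Z = U" using U(2) ne unfolding connected_clopen by blast
 then show False using nt Zsub by auto
qed

section \<open>Sublevel sets\<close>

text \<open>At least - ln |x - c| of the dyadic intervals around \<open>c\<close> contain
  \<open>x\<close>, because e^(-k) <= 2^(-k). Counting intervals bounds the integral of the
  logarithm by the sum of their lengths.\<close>

lemma neg_ln_le_dyadic_count:
 assumes y: "(x::real) ~= c"
 shows "ennreal (- ln \<bar>x - c\<bar>) <= (\<Sum>k. indicator (ball c ((1/2) ^ k)) x)"
proof -
 define K where "K = nat \<lceil>- ln \<bar>x - c\<bar>\<rceil>"
 have one: "(indicator (ball c ((1/2) ^ k)) x :: ennreal) = 1" if k: "k < K" for k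
 proof -
  have "int k < \<lceil>- ln \<bar>x - c\<bar>\<rceil>" using k unfolding K_def by linarith
  then have "real k < - ln \<bar>x - c\<bar>" by (simp add: less_ceiling_iff)
  then have "exp (ln \<bar>x - c\<bar>) < exp (- real k)" by simp
  then have "\<bar>x - c\<bar> < exp (real k * (-1))" using y by simp
  also have "... = exp (-1) ^ k" by (rule exp_of_nat_mult)
  also have "... <= (1/2) ^ k"
  proof (rule power_mono)
  have "2 <= exp (1::real)" using exp_ge_add_one_self[of 1] by simp
  then show "exp (-1) <= (1/2::real)" by (simp add: exp_minus field_simps)
  qed simp
  finally show ?thesis by (simp add: dist_real_def abs_minus_commute)
 qed
 have "ennreal (- ln \<bar>x - c\<bar>) <= ennreal (real K)" unfolding K_def by (intro ennreal_leI) linarith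
 also have "... = (\<Sum>k<K. indicator (ball c ((1/2) ^ k)) x)" using one by (simp add: ennreal_of_nat_eq_real_of_nat)
 also have "... <= (\<Sum>k. indicator (ball c ((1/2) ^ k)) x)" by (rule sum_le_suminf) auto
 finally show ?thesis .
qed

text \<open>Circular projection does not increase distances, so the radii that are met form a set whose
  Chebyshev constant vanishes; averaging the logarithm shows that it contains no interval.\<close>

lemma cap0_circle_avoiding:
 assumes E: "cap0 E" and st: "s < t"
 shows "EX x. s < x & x < t & (ALL z:E. cmod z ~= x)"
proof (rule ccontr)
 assume no: "~ ?thesis"
 \<comment> \<open>Integration gives M n (t - s) <= 4 n, where 4 is the total length of the dyadic
   intervals around one point; the 5 makes this false.\<close>
 define M where "M = 5 / (t - s)"
 have Mpos: "M > 0" using st by (simp add: M_def)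
 have "EX n>0. EX w::nat => complex. (ALL i<n. w i : E) & (ALL z:E. (\<Prod>i<n. cmod (z - w i)) <= exp (- M * real n))"
  using E unfolding cap0_def by (rule spec)
 then obtain n and w :: "nat => complex" where nw: "n > 0" "ALL i<n. w i : E" "ALL z:E. (\<Prod>i<n. cmod (z - w i)) <= exp (- M * real n)"
  by (elim exE conjE)
 define rh where "rh i = cmod (w i)" for i
 \<comment> \<open>The radii of the points \<open>w i\<close>, where the logarithms are singular,
   are finitely many and are removed.\<close>
 define A where "A = {s<..<t} - rh ` {..<n}"
 define g where "g i k x = (indicator (ball (rh i) ((1/2)^k)) x :: ennreal)" for i k x
 have gm: "g i k : borel_measurable lborel" for i k unfolding g_def by (intro borel_measurable_indicator) auto
 have pt: "ennreal (M * real n) * indicator A x <= (\<Sum>i<n. \<Sum>k. g i k x)" for x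
 proof (cases "x : A")
  case True
  then have x: "s < x" "x < t" and nz: "!!i. i < n ==> x ~= rh i" by (auto simp: A_def)
  have "EX z:E. cmod z = x" using no x by auto
  then obtain z where z: "z : E" "cmod z = x" by auto
  have P0: "(\<Prod>i<n. \<bar>x - rh i\<bar>) > 0" by (rule prod_pos) (use nz in auto)
  have "(\<Prod>i<n. \<bar>x - rh i\<bar>) <= (\<Prod>i<n. cmod (z - w i))"
  by (rule prod_mono) (auto simp: rh_def z(2)[symmetric] norm_triangle_ineq3)
  also have "... <= exp (- M * real n)" using nw(3) z(1) by blast
  finally have "ln (\<Prod>i<n. \<bar>x - rh i\<bar>) <= ln (exp (- M * real n))"
  using P0 by (subst ln_le_cancel_iff) auto
  also have "ln (\<Prod>i<n. \<bar>x - rh i\<bar>) = (\<Sum>i<n. ln \<bar>x - rh i\<bar>)" by (rule ln_prod) (use nz in auto)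
  finally have "M * real n <= (\<Sum>i<n. - ln \<bar>x - rh i\<bar>)" by (simp add: sum_negf)
  also have "... <= (\<Sum>i<n. max 0 (- ln \<bar>x - rh i\<bar>))" by (rule sum_mono) simp
  finally have "ennreal (M * real n) <= ennreal (\<Sum>i<n. max 0 (- ln \<bar>x - rh i\<bar>))" by (rule ennreal_leI)
  also have "... = (\<Sum>i<n. ennreal (max 0 (- ln \<bar>x - rh i\<bar>)))" by (rule sum_ennreal[symmetric]) simp
  also have "... <= (\<Sum>i<n. \<Sum>k. g i k x)"
  proof (rule sum_mono)
  fix i assume "i : {..<n}"
  then have "ennreal (- ln \<bar>x - rh i\<bar>) <= (\<Sum>k. g i k x)" unfolding g_def using nz by (intro neg_ln_le_dyadic_count) auto
  then show "ennreal (max 0 (- ln \<bar>x - rh i\<bar>)) <= (\<Sum>k. g i k x)" by (simp add: max_def)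
  qed
  finally show ?thesis using True by simp
 qed simp
 have "ennreal (M * real n) * emeasure lborel A = (\<integral>\<^sup>+x. ennreal (M * real n) * indicator A x \<partial>lborel)"
 proof (rule nn_integral_cmult_indicator[symmetric])
  have "rh ` {..<n} : sets borel" by (intro borel_closed finite_imp_closed) simp
  then show "A : sets lborel" by (simp add: A_def)
 qed
 also have "... <= (\<integral>\<^sup>+x. (\<Sum>i<n. \<Sum>k. g i k x) \<partial>lborel)" by (rule nn_integral_mono) (rule pt)
 also have "... = (\<Sum>i<n. \<integral>\<^sup>+x. (\<Sum>k. g i k x) \<partial>lborel)"
  by (rule nn_integral_sum) (intro borel_measurable_suminf_order gm)
 also have "... = (\<Sum>i<n. ennreal 4)"
 proof (rule sum.cong[OF refl])
  fix i
  have "(\<integral>\<^sup>+x. (\<Sum>k. g i k x) \<partial>lborel) = (\<Sum>k. \<integral>\<^sup>+x. g i k x \<partial>lborel)" by (rule nn_integral_suminf) (rule gm)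
  also have "... = (\<Sum>k. ennreal (2 * (1/2) ^ k))"
  proof (rule suminf_cong)
  fix k
  have "(\<integral>\<^sup>+x. g i k x \<partial>lborel) = emeasure lborel (ball (rh i) ((1/2)^k))"
  unfolding g_def by (rule nn_integral_indicator) simp
  also have "ball (rh i) ((1/2)^k) = {rh i - (1/2)^k<..<rh i + (1/2)^k}" by (rule ball_eq_greaterThanLessThan)
  also have "emeasure lborel ... = ennreal ((rh i + (1/2)^k) - (rh i - (1/2)^k))"
  proof (rule emeasure_lborel_Ioo)
  have "0 <= (1/2::real)^k" by simp
  then show "rh i - (1/2)^k <= rh i + (1/2)^k" by linarith
  qed
  also have "(rh i + (1/2)^k) - (rh i - (1/2)^k) = 2 * (1/2) ^ k" by simp
  finally show "(\<integral>\<^sup>+x. g i k x \<partial>lborel) = ennreal (2 * (1/2) ^ k)" .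
  qed
  also have "... = ennreal (\<Sum>k. 2 * (1/2) ^ k)"
  by (rule suminf_ennreal2) (auto intro!: summable_mult summable_geometric)
  also have "(\<Sum>k. 2 * (1/2::real) ^ k) = 4"
  by (subst suminf_mult) (auto simp: suminf_geometric intro!: summable_geometric)
  finally show "(\<integral>\<^sup>+x. (\<Sum>k. g i k x) \<partial>lborel) = ennreal 4" .
 qed
 also have "... = ennreal (4 * real n)" by (subst sum_ennreal) (auto simp: mult.commute)
 also have "emeasure lborel A = emeasure lborel {s<..<t}"
  unfolding A_def by (rule emeasure_Diff_null_set) (auto intro!: finite_imp_null_set_lborel)
 also have "... = ennreal (t - s)" using st by simp
 also have "ennreal (M * real n) * ennreal (t - s) = ennreal (M * real n * (t - s))"
  by (rule ennreal_mult[symmetric]) (use st Mpos in auto)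
 also have "M * real n * (t - s) = 5 * real n" using st by (simp add: M_def)
 finally show False using nw(1) by (simp del: ennreal_mult)
qed

section \<open>Cauchy integrals over circles and the Laurent splitting\<close>

lemma Cauchy_circle_holomorphic:
 assumes r: "r > 0" and p: "continuous_on (sphere 0 r) p"
 shows "(%z. contour_integral (circlepath 0 r) (%w. p w / (w - z))) holomorphic_on - sphere 0 r"
 unfolding holomorphic_on_def
proof
 fix z assume z: "z : - sphere (0::complex) r"
 have pim: "path_image (circlepath 0 r) = sphere 0 r" using r by simp
 have "((%z. contour_integral (circlepath 0 r) (%w. p w / (w - z))) has_field_derivative
  (of_nat 1 * contour_integral (circlepath 0 r) (%u. p u / (u - z) ^ Suc 1))) (at z)"
 proof (rule Cauchy_next_derivative(2)[where k = 1 and S = UNIV and B = "2 * pi * r"])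
  show "continuous_on (path_image (circlepath 0 r)) p" unfolding pim by (rule p)
  show "norm (vector_derivative (circlepath 0 r) (at t)) <= 2 * pi * r" for t
  using r by (simp add: vector_derivative_circlepath norm_mult norm_exp_eq_Re)
  fix w assume w: "w : UNIV - path_image (circlepath 0 r)"
  have "(%u. p u / (u - w)) contour_integrable_on circlepath 0 r"
  using p w unfolding pim[symmetric]
  by (intro contour_integrable_continuous_circlepath continuous_intros) auto
  then show "((%u. p u / (u - w) ^ 1) has_contour_integral contour_integral (circlepath 0 r) (%u. p u / (u - w))) (circlepath 0 r)"
  by (simp add: has_contour_integral_integral)
 qed (use z r in auto)
 then show "(%z. contour_integral (circlepath 0 r) (%w. p w / (w - z))) field_differentiable at z within - sphere 0 r"
  using field_differentiable_at_within field_differentiable_def by blast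
qed

text \<open>The difference quotient \<open>g\<close> is holomorphic across \<open>z\<close>, so its
  integrals over the two homotopic circles agree; only the outer circle winds around
  \<open>z\<close>.\<close>

lemma Cauchy_annulus:
 assumes ab: "0 < a" "a < b" and A: "open A" "!!w. a <= cmod w ==> cmod w <= b ==> w : A" and p: "p holomorphic_on A"
  and z: "a < cmod z" "cmod z < b"
 shows "2 * of_real pi * \<i> * p z = contour_integral (circlepath 0 b) (%w. p w / (w - z)) - contour_integral (circlepath 0 a) (%w. p w / (w - z))"
proof -
 define g where "g w = (if w = z then deriv p z else (p w - p z) / (w - z))" for w
 define B where "B = {w. a / 2 < cmod w} Int A"
 have g: "g holomorphic_on A" unfolding g_def by (rule pole_lemma_open[OF p A(1)])
 have "contour_integral (circlepath 0 a) g = contour_integral (circlepath 0 b) g"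
 proof (rule Cauchy_theorem_homotopic_loops[OF _ A(1) g])
  show "homotopic_loops A (circlepath 0 a) (circlepath 0 b)"
  proof (rule homotopic_loops_linear)
  fix t x :: real assume "t : {0..1}"
  show "closed_segment (circlepath 0 a t) (circlepath 0 b t) <= A"
  proof
  fix w assume "w : closed_segment (circlepath 0 a t) (circlepath 0 b t)"
  then obtain l where l: "0 <= l" "l <= 1" "w = (1 - l) *\<^sub>R circlepath 0 a t + l *\<^sub>R circlepath 0 b t"
  by (auto simp: in_segment)
  have "w = of_real ((1 - l) * a + l * b) * exp (2 * of_real pi * \<i> * of_real t)"
  unfolding l(3) circlepath by (simp add: scaleR_conv_of_real algebra_simps)
  then have cw: "cmod w = \<bar>(1 - l) * a + l * b\<bar>" by (simp add: norm_mult norm_exp_eq_Re del: of_real_add of_real_mult)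
  have eq: "(1 - l) * a + l * b = a + l * (b - a)" by (simp add: algebra_simps)
  define v where "v = l * (b - a)"
  have 1: "0 <= v" using l ab by (simp add: v_def)
  have 2: "v <= b - a" using mult_right_mono[of l 1 "b - a"] l ab by (simp add: v_def)
  have "cmod w = a + v" unfolding cw eq v_def[symmetric] using 1 ab(1) by (intro abs_of_nonneg) linarith
  then have "a <= cmod w" "cmod w <= b" using 1 2 by simp_all
  then show "w : A" by (rule A(2))
  qed
  qed simp_all
 qed simp_all
 moreover have "contour_integral (circlepath 0 r) g = contour_integral (circlepath 0 r) (%w. p w / (w - z))
  - p z * contour_integral (circlepath 0 r) (%w. 1 / (w - z))" if r: "r : {a, b}" for r
 proof -
  have pim: "path_image (circlepath 0 r) = sphere 0 r" using r ab by auto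
  have sub: "sphere 0 r <= A" using A(2) r ab by auto
  have nz: "w - z ~= 0" if "w : sphere 0 r" for w using that r z by auto
  have cp: "continuous_on (sphere 0 r) p" using hol_cont[OF p] sub by (rule continuous_on_subset)
  have i1: "(%w. p w / (w - z)) contour_integrable_on circlepath 0 r"
  by (rule contour_integrable_continuous_circlepath) (unfold pim, intro continuous_intros cp, use nz in auto)
  have i2: "(%w. 1 / (w - z)) contour_integrable_on circlepath 0 r"
  by (rule contour_integrable_continuous_circlepath) (unfold pim, intro continuous_intros, use nz in auto)
  have "contour_integral (circlepath 0 r) g = contour_integral (circlepath 0 r) (%w. p w / (w - z) - p z * (1 / (w - z)))"
  proof (rule contour_integral_eq)
  fix w assume "w : path_image (circlepath 0 r)"
  then have "w ~= z" using nz[of w] unfolding pim by auto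
  then show "g w = p w / (w - z) - p z * (1 / (w - z))" by (simp add: g_def diff_divide_distrib)
  qed
  also have "... = contour_integral (circlepath 0 r) (%w. p w / (w - z)) - contour_integral (circlepath 0 r) (%w. p z * (1 / (w - z)))"
  by (rule contour_integral_diff[OF i1 contour_integrable_lmul[OF i2]])
  also have "contour_integral (circlepath 0 r) (%w. p z * (1 / (w - z))) = p z * contour_integral (circlepath 0 r) (%w. 1 / (w - z))"
  by (rule contour_integral_lmul[OF i2])
  finally show ?thesis .
 qed
 moreover have "contour_integral (circlepath 0 b) (%w. 1 / (w - z)) = 2 * of_real pi * \<i>"
  using contour_integral_unique[OF Cauchy_integral_circlepath_simple[of "%_. 1" 0 b z]] z by simp
 moreover have "contour_integral (circlepath 0 a) (%w. 1 / (w - z)) = 0"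
 proof (rule contour_integral_unique, rule Cauchy_theorem_disc_simple[of _ 0 "cmod z"])
  show "(%w. 1 / (w - z)) holomorphic_on ball 0 (cmod z)" by (intro holomorphic_intros) auto
  show "path_image (circlepath 0 a) <= ball 0 (cmod z)" using ab z by (auto simp: path_image_circlepath)
 qed auto
 ultimately have "- contour_integral (circlepath 0 a) (%w. p w / (w - z)) = p z * (2 * of_real pi * \<i>) - contour_integral (circlepath 0 b) (%w. p w / (w - z))"
  by (simp add: algebra_simps)
 then show ?thesis by (simp add: algebra_simps)
qed

text \<open>The factor F' absorbs the Jacobian, so that the two square integrals coincide.\<close>

lemma A2_pullback:
 assumes S: "open S" and F: "F holomorphic_on S" and inj: "inj_on F S" and G: "G holomorphic_on F ` S"
 shows "(%z. deriv F z * G (F z)) : A2 S \<longleftrightarrow> G : A2 (F ` S)"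
proof -
 have oF: "open (F ` S)" using open_mapping_thm3[OF F S inj] .
 have h: "(%z. deriv F z * G (F z)) holomorphic_on S"
  using hol_compose[OF F G] holomorphic_deriv[OF F S]
  by (intro holomorphic_on_mult) (auto simp: o_def)
 have "smeas (F ` S) (%w. (cmod (G w))\<^sup>2)"
  using G oF by (intro meas_cont continuous_intros hol_cont) auto
 from holomorphic_change_of_variables_integrable[OF S F inj this] show ?thesis
  using G h by (simp add: A2_def norm_mult power_mult_distrib)
qed

lemma A2_integrable:
 assumes S: "open S" "emeasure lborel S < \<infinity>" and f: "f : A2 S"
 shows "intg S f"
proof (rule set_integrable_bound)
 have Sm: "S : sets borel" using S by simp
 have "intg S (%_. 1::real)" using S by (simp add: set_integrable_def)
 then show "intg S (%z. 1 + (cmod (f z))\<^sup>2)" by (rule set_integral_add(1)) (rule A2D(2)[OF f])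
 show "smeas S f"
  using f Sm by (intro meas_cont hol_cont) (auto simp: A2_def)
 have "x <= 1 + x\<^sup>2" if "x >= 0" for x :: real
  using zero_le_power2[of "x - 1"] that by (simp add: p2eq algebra_simps)
 then show "AE z in lborel. z : S --> norm (f z) <= norm (1 + (cmod (f z))\<^sup>2)" by (auto intro!: AE_I2 simp: abs_of_nonneg)
qed

context hyperbolic_kernel
begin

text \<open>On a circle avoiding the exceptional set, \<open>p\<close> splits into a part holomorphic inside and a
  part holomorphic outside; the latter lies in the Bergman space of the whole image, hence extends
  to an entire function vanishing at infinity.\<close>

lemma sublevel_extension:
 assumes r: "r <= 1" and s: "0 < s" "s < r" and p: "p : A2 (f ` D Int ball 0 r)"
 shows "EX Q. Q holomorphic_on ball 0 s & (ALL w:f ` D Int ball 0 s. p w = Q w)"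
proof -
 let ?Om = "f ` D"
 define t where "t = (s + r) / 2"
 have t: "s < t" "t < r" using s by (auto simp: t_def)
 define E where "E = cball 0 t - ?Om"
 have E: "compact E" "E <= ball 0 1 - ?Om" unfolding E_def using open_image t r by (auto intro!: compact_diff)
 \<comment> \<open>The part of the complement of f(D) in a compact disc has capacity zero, so some
   circle of radius \<open>x\<close> between \<open>s\<close> and \<open>t\<close> misses it; by
   compactness so does an annulus a <= |w| <= b around the circle.\<close>
 have "EX x. s < x & x < t & (ALL z:E. cmod z ~= x)"
 proof (cases "E = {}")
  case True then show ?thesis using t(1) dense by auto
 next
  case False show ?thesis by (rule cap0_circle_avoiding[OF complement_cap0[OF E False] t(1)])
 qed
 then obtain x where x: "s < x" "x < t" "ALL z:E. cmod z ~= x" by blast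
 have sph: "sphere 0 x <= ?Om" using x t by (auto simp: E_def)
 obtain e where e: "e > 0" "(\<Union>y\<in>sphere 0 x. ball y e) <= ?Om"
  using compact_subset_open_imp_ball_epsilon_subset[OF compact_sphere open_image sph] by blast
 define d where "d = min e (min (x - s) (t - x)) / 2"
 have d: "0 < d" "d < e" "d < x - s" "d < t - x" using e x by (auto simp: d_def)
 define a b where "a = x - d" and "b = x + d"
 have ab: "0 < a" "s < a" "a < x" "x < b" "b < t" "a < b" using d s x by (auto simp: a_def b_def)
 have ann: "w : ?Om Int ball 0 r" if w: "a <= cmod w" "cmod w <= b" for w
 proof -
  have w0: "cmod w > 0" using w ab by linarith
  define y where "y = of_real (x / cmod w) * w"
  have "cmod y = x" using w0 x s by (simp add: y_def norm_mult norm_divide)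
  moreover have "dist y w = \<bar>x - cmod w\<bar>"
  proof -
  have "y - w = of_real (x / cmod w - 1) * w" by (simp add: y_def algebra_simps)
  then have "cmod (y - w) = \<bar>x / cmod w - 1\<bar> * cmod w" by (simp add: norm_mult del: of_real_diff of_real_divide)
  also have "... = \<bar>(x / cmod w - 1) * cmod w\<bar>" by (simp add: abs_mult)
  also have "(x / cmod w - 1) * cmod w = x - cmod w" using w0 by (simp add: field_simps)
  finally show ?thesis by (simp add: dist_norm)
  qed
  ultimately have "w : ball y e" "y : sphere 0 x" using w d by (auto simp: a_def b_def)
  then have "w : ?Om" using e(2) by blast
  then show ?thesis using w ab t by auto
 qed
 have oA: "open (?Om Int ball 0 r)" using open_image by (intro open_Int) auto
 have ph: "p holomorphic_on ?Om Int ball 0 r" using p by (simp add: A2_def)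
 have pc: "continuous_on (sphere 0 rh) p" if "a <= rh" "rh <= b" for rh
  by (rule continuous_on_subset[OF hol_cont[OF ph]]) (use ann that in auto)
 define q where "q z = contour_integral (circlepath 0 b) (%w. p w / (w - z)) / (2 * of_real pi * \<i>)" for z
 define I where "I z = - contour_integral (circlepath 0 a) (%w. p w / (w - z)) / (2 * of_real pi * \<i>)" for z
 have qh: "q holomorphic_on ball 0 b"
  unfolding q_def using ab
  by (intro holomorphic_on_divide holomorphic_on_const hol_subset[OF Cauchy_circle_holomorphic] pc) auto
 have Ih: "I holomorphic_on - cball 0 a"
  unfolding I_def using ab
  by (intro holomorphic_on_divide holomorphic_on_minus holomorphic_on_const hol_subset[OF Cauchy_circle_holomorphic] pc) auto
 have split: "p z = q z + I z" if z: "a < cmod z" "cmod z < b" for z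
 proof -
  have "2 * of_real pi * \<i> * p z = contour_integral (circlepath 0 b) (%w. p w / (w - z)) - contour_integral (circlepath 0 a) (%w. p w / (w - z))"
  by (rule Cauchy_annulus[OF ab(1,6) oA ann ph z])
  then show ?thesis by (simp add: q_def I_def field_simps)
 qed
 \<comment> \<open>The outer Laurent part of \<open>p\<close>: p - q inside, the Cauchy integral
   \<open>I\<close> outside, in agreement on the annulus.\<close>
 define G where "G z = (if cmod z < b then p z - q z else I z)" for z
 have GI: "G z = I z" if "cmod z > a" for z using split[of z] that by (auto simp: G_def)
 have G1: "G holomorphic_on ?Om Int ball 0 b"
 proof (rule holomorphic_transform[of "%z. p z - q z"])
  show "(%z. p z - q z) holomorphic_on ?Om Int ball 0 b"
  using ab t by (intro holomorphic_on_diff hol_subset[OF ph] hol_subset[OF qh]) auto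
 qed (simp add: G_def)
 have G2: "G holomorphic_on - cball 0 a" by (rule holomorphic_transform[OF Ih]) (auto simp: GI)
 have "G holomorphic_on (?Om Int ball 0 b) \<union> - cball 0 a"
  by (rule holomorphic_on_Un[OF G1 G2]) (use open_image in \<open>auto intro!: open_Int\<close>)
 then have Gh: "G holomorphic_on ?Om" by (rule hol_subset) (use ab in auto)
 have Gb: "G : A2 ?Om"
 proof -
  have i1: "intg (?Om Int ball 0 x) (%z. (cmod (G z))\<^sup>2)"
  proof -
  have o: "open (?Om Int ball 0 x)" using open_image by (intro open_Int) auto
  have pb: "p : A2 (?Om Int ball 0 x)" by (rule A2_subset[OF p _ o]) (use x t in auto)
  have "compact (q ` cball 0 x)"
  by (rule compact_continuous_image[OF continuous_on_subset[OF hol_cont[OF qh]]]) (use ab in auto)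
  then have "bounded (q ` cball 0 x)" by (rule compact_imp_bounded)
  then obtain C where "ALL y:q ` cball 0 x. cmod y <= C" unfolding bounded_iff by (elim exE)
  then have C: "!!z. z : cball 0 x ==> cmod (q z) <= C" by simp
  have "(%z. q z * 1) : A2 (?Om Int ball 0 x)"
  proof (rule A2_mult_bounded[OF o])
  show "(%_. 1) : A2 (?Om Int ball 0 x)"
  using o emeasure_bounded_finite[of "?Om Int ball 0 x"] by (simp add: A2_def set_integrable_def bounded_Int)
  show "q holomorphic_on ?Om Int ball 0 x" by (rule hol_subset[OF qh]) (use ab in auto)
  show "!!z. z : ?Om Int ball 0 x ==> cmod (q z) <= C" using C by auto
  qed
  then have "(%z. p z - q z * 1) : A2 (?Om Int ball 0 x)" by (rule A2_diff[OF o pb])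
  then have "G : A2 (?Om Int ball 0 x)" by (rule A2_cong) (use ab in \<open>auto simp: G_def\<close>)
  then show ?thesis by (simp add: A2_def)
  qed
  have i2: "intg (?Om - ball 0 x) (%z. (cmod (G z))\<^sup>2)"
  proof -
  have "continuous_on (cball 0 1 - ball 0 x) I"
  by (rule continuous_on_subset[OF hol_cont[OF Ih]]) (use ab in auto)
  moreover have "compact (cball (0::complex) 1 - ball 0 x)" by (intro compact_diff) auto
  ultimately have "bounded (I ` (cball 0 1 - ball 0 x))" by (intro compact_imp_bounded compact_continuous_image)
  then obtain C where "ALL y:I ` (cball 0 1 - ball 0 x). cmod y <= C" unfolding bounded_iff by (elim exE)
  then have C: "!!z. z : cball 0 1 - ball 0 x ==> cmod (I z) <= C" by simp
  have Cn: "norm ((cmod (G z))\<^sup>2) <= C\<^sup>2" if "z : ?Om - ball 0 x" for z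
  proof -
  have "cmod (G z) <= C" using that ab fD C[of z] GI[of z] by auto
  then show ?thesis by (simp add: power_mono)
  qed
  have m: "?Om - ball 0 x : sets borel" using open_image by auto
  have fin: "emeasure lborel (?Om - ball 0 x) < \<infinity>"
  by (rule emeasure_bounded_finite) (rule bounded_subset[OF bounded_ball[of 0 1]], use fD in auto)
  show ?thesis
  by (rule set_integrable_bounded[OF m fin _ Cn], rule meas_cont[OF m])
  (intro continuous_intros continuous_on_subset[OF hol_cont[OF Gh]], auto)
  qed
  have "intg ((?Om Int ball 0 x) \<union> (?Om - ball 0 x)) (%z. (cmod (G z))\<^sup>2)"
  by (rule set_integrable_Un[OF i1 i2]) (use open_image in auto)
  moreover have "(?Om Int ball 0 x) \<union> (?Om - ball 0 x) = ?Om" by auto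
  ultimately show ?thesis using Gh by (simp add: A2_def)
 qed
 have "(%z. deriv f z * G (f z)) : A2 D"
  using A2_pullback[OF D(1) f f_inj Gh] Gb by simp
 then obtain U where U: "U holomorphic_on ball 0 1" "ALL z:D. deriv f z * G (f z) = deriv f z * U (f z)"
  using bergman_factor by blast
 have UG: "U w = G w" if "w : ?Om" for w using U(2) that deriv_f_nonzero by auto
 \<comment> \<open>The extension of \<open>G\<close> to the disc from \<open>bergman_factor\<close>,
   glued with \<open>I\<close> outside. It is entire and vanishes at infinity, so \<open>G\<close>
   is 0 and \<open>p\<close> equals \<open>q\<close> on the smaller disc.\<close>
 define H where "H w = (if cmod w < b then U w else I w)" for w
 have b1: "b < 1" using ab t r by linarith
 have H1: "H holomorphic_on ball 0 b"
  by (rule holomorphic_transform[OF hol_subset[OF U(1)]]) (use b1 in \<open>auto simp: H_def\<close>)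
 have HI: "H w = I w" if "cmod w > a" for w
  using UG[of w] GI[of w] ann[of w] that by (auto simp: H_def)
 have H2: "H holomorphic_on - cball 0 a" by (rule holomorphic_transform[OF Ih]) (auto simp: HI)
 have "H holomorphic_on ball 0 b \<union> - cball 0 a" by (rule holomorphic_on_Un[OF H1 H2]) auto
 moreover have "ball 0 b \<union> - cball (0::complex) a = UNIV" using ab by auto
 ultimately have HU: "H holomorphic_on UNIV" by simp
 obtain B where B: "B >= 0" "!!w. w : sphere 0 a ==> cmod (p w) <= B"
 proof -
  have "bounded (p ` sphere 0 a)" using pc[of a] ab by (intro compact_imp_bounded compact_continuous_image) auto
  then obtain B where "ALL w:sphere 0 a. cmod (p w) <= B" unfolding bounded_iff by auto
  then show ?thesis using that[of "max B 0"] by fastforce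
 qed
 have Ib: "cmod (I z) <= B * a * 2 / cmod z" if z: "cmod z >= 2 * a" for z
 proof -
  have zpos: "cmod z > 0" using z ab by linarith
  have dz: "cmod z / 2 <= cmod (w - z)" if "w : sphere 0 a" for w
  using norm_triangle_ineq2[of z w] that z by (simp add: norm_minus_commute)
  have "(%w. p w / (w - z)) contour_integrable_on circlepath 0 a"
  proof (rule contour_integrable_continuous_circlepath)
  have "w - z ~= 0" if "w : sphere 0 a" for w using dz[OF that] zpos by auto
  then show "continuous_on (path_image (circlepath 0 a)) (%w. p w / (w - z))"
  using ab pc[of a] by (intro continuous_intros) auto
  qed
  then have "cmod (contour_integral (circlepath 0 a) (%w. p w / (w - z))) <= (B / (cmod z / 2)) * (2 * pi * a)"
  proof (rule has_contour_integral_bound_circlepath[OF has_contour_integral_integral])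
  fix w assume "cmod (w - 0) = a"
  then have w: "w : sphere 0 a" by simp
  show "cmod (p w / (w - z)) <= B / (cmod z / 2)"
  unfolding norm_divide using B(2)[OF w] dz[OF w] zpos B(1) by (intro frac_le) auto
  qed (use B zpos ab in auto)
  then show ?thesis unfolding I_def norm_divide norm_minus_cancel norm_mult
  using zpos by (simp add: field_simps)
 qed
 have "(H \<longlongrightarrow> 0) at_infinity"
 proof (rule Lim_null_comparison)
  show "eventually (%z. norm (H z) <= B * a * 2 * norm (1 / z)) at_infinity"
  unfolding eventually_at_infinity
  proof (intro exI[of _ "2 * a"] allI impI)
  fix z :: complex assume z: "2 * a <= norm z"
  then have "H z = I z" using ab by (intro HI) linarith
  then show "norm (H z) <= B * a * 2 * norm (1 / z)" using Ib[OF z] by (simp add: norm_divide)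
  qed
  have "((%z::complex. B * a * 2 * norm (1 / z)) \<longlongrightarrow> B * a * 2 * norm (0::complex)) at_infinity"
  by (intro tendsto_intros tendsto_divide_0[OF tendsto_const] filterlim_ident)
  then show "((%z::complex. B * a * 2 * norm (1 / z)) \<longlongrightarrow> 0) at_infinity" by simp
 qed
 then have H0: "H w = 0" for w by (rule Liouville_weak_0[OF HU])
 show ?thesis
 proof (intro exI conjI ballI)
  show "q holomorphic_on ball 0 s" by (rule hol_subset[OF qh]) (use ab in auto)
  fix w assume w: "w : ?Om Int ball 0 s"
  then have "cmod w < b" using ab by auto
  then have "G w = 0" using UG[of w] w H0[of w] by (simp add: H_def)
  then show "p w = q w" using \<open>cmod w < b\<close> by (simp add: G_def)
 qed
qed

section \<open>Mean values and Bergman kernels of the sublevel sets\<close>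

lemma zero_in_image: "0 : f ` D" using z0 f0 by force

text \<open>Up to a null set the integral is that of a holomorphic extension over a full disc, where
  the mean value property holds. The extension is known only on smaller discs, so the radius is
  exhausted by \<open>s n\<close>.\<close>

lemma sublevel_integral:
 assumes r: "0 < r" "r <= 1" and p: "p : A2 (f ` D Int ball 0 r)"
 shows "(LINT w:f ` D Int ball 0 r|lborel. p w) = of_real (pi * r\<^sup>2) * p 0"
proof -
 let ?Om = "f ` D"
 have o: "open (?Om Int ball 0 rh)" for rh using open_image by (intro open_Int) auto
 have pint: "intg (?Om Int ball 0 r) p"
  by (rule A2_integrable[OF o _ p], rule emeasure_bounded_finite) (simp add: bounded_Int)
 have part: "(LINT w:?Om Int ball 0 s|lborel. p w) = of_real (pi * s\<^sup>2) * p 0" if s: "0 < s" "s < r" for s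
 proof -
  obtain Q where Q: "Q holomorphic_on ball 0 s" "ALL w:?Om Int ball 0 s. p w = Q w"
  using sublevel_extension[OF r(2) s p] by blast
  have null: "AE w in lborel. w ~: ball 0 1 - ?Om"
  using kernel_measure(2) open_image by (intro AE_not_in) (auto simp: null_sets_def)
  have ae: "AE w in lborel. indicat_real (?Om Int ball 0 s) w *\<^sub>R p w = indicat_real (ball 0 s) w *\<^sub>R Q w"
  using null
  proof (rule AE_mp, intro AE_I2 impI)
  fix w assume "w ~: ball 0 1 - ?Om"
  then show "indicat_real (?Om Int ball 0 s) w *\<^sub>R p w = indicat_real (ball 0 s) w *\<^sub>R Q w"
  using Q(2) s r by (cases "w : ball 0 s") auto
  qed
  have pi: "intg (?Om Int ball 0 s) p"
  by (rule set_integrable_subset[OF pint]) (use s o in auto)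
  have m2: "smeas (ball 0 s) Q"
  using Q(1) by (intro meas_cont hol_cont) auto
  have Qi: "intg (ball 0 s) Q"
  using pi ae m2 unfolding set_integrable_def set_borel_measurable_def
  by (subst integrable_cong_AE[symmetric, OF _ _ ae]) auto
  have "(LINT w:?Om Int ball 0 s|lborel. p w) = (LINT w:ball 0 s|lborel. Q w)"
  unfolding set_lebesgue_integral_def
  by (rule integral_cong_AE[OF _ _ ae]) (use pi m2 in \<open>auto simp: set_integrable_def set_borel_measurable_def\<close>)
  also have "... = of_real (pi * s\<^sup>2) * Q 0" by (rule mean_value_ball[OF Q(1) Qi s(1)])
  also have "Q 0 = p 0" using Q(2) zero_in_image s by auto
  finally show ?thesis .
 qed
 define s where "s n = r - r / real (n + 2)" for n
 have s: "0 < s n" "s n < r" for n using r by (auto simp: s_def field_simps intro!: add_pos_nonneg)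
 have sm: "s m <= s n" if "m <= n" for m n using that r unfolding s_def by (intro diff_left_mono divide_left_mono) auto
 have sl: "s \<longlonglongrightarrow> r"
 proof -
  have "(%n. r / real (n + 2)) \<longlonglongrightarrow> 0"
  using LIMSEQ_ignore_initial_segment[OF lim_const_over_n[of r], of 2] by simp
  from tendsto_diff[OF tendsto_const[of r] this] show ?thesis unfolding s_def by simp
 qed
 have un: "(\<Union>n. ?Om Int ball 0 (s n)) = ?Om Int ball 0 r"
 proof (intro set_eqI iffI)
  fix w assume w: "w : ?Om Int ball 0 r"
  then have "eventually (%n. cmod w < s n) sequentially" using order_tendstoD(1)[OF sl, of "cmod w"] by auto
  then obtain n where "cmod w < s n" by (auto simp: eventually_sequentially)
  then show "w : (\<Union>n. ?Om Int ball 0 (s n))" using w by auto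
 next
  fix w assume "w : (\<Union>n. ?Om Int ball 0 (s n))"
  then obtain n where n: "w : ?Om" "cmod w < s n" by auto
  then show "w : ?Om Int ball 0 r" using s(2)[of n] by auto
 qed
 have "(%n. LINT w:?Om Int ball 0 (s n)|lborel. p w) \<longlonglongrightarrow> (LINT w:(\<Union>n. ?Om Int ball 0 (s n))|lborel. p w)"
 proof (rule set_integral_cont_up)
  show "!!n. ?Om Int ball 0 (s n) : sets lborel" using o by simp
  show "incseq (%n. ?Om Int ball 0 (s n))"
  proof (rule incseq_SucI, rule subsetI)
  fix n w assume "w : ?Om Int ball 0 (s n)"
  then show "w : ?Om Int ball 0 (s (Suc n))" using sm[of n "Suc n"] by auto
  qed
  show "intg (\<Union>n. ?Om Int ball 0 (s n)) p" unfolding un by (rule pint)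
 qed
 then have "(%n. of_real (pi * (s n)\<^sup>2) * p 0) \<longlonglongrightarrow> (LINT w:?Om Int ball 0 r|lborel. p w)" unfolding un part[OF s] .
 moreover have "(%n. of_real (pi * (s n)\<^sup>2) * p 0) \<longlonglongrightarrow> of_real (pi * r\<^sup>2) * p 0" by (intro tendsto_intros sl)
 ultimately show ?thesis by (rule LIMSEQ_unique)
qed

text \<open>Writing q = f' G(f), evaluation of \<open>q\<close> at \<open>z0\<close> becomes
  evaluation of \<open>G\<close> at 0, which is a mean value by \<open>sublevel_integral\<close>. So
  a multiple of f', the pullback of a constant, represents it.\<close>

lemma sublevel_kernel:
 assumes r: "0 < r" "r <= 1"
 shows "bergman_kernel {z\<in>D. cmod (f z) < r} z0 = (cmod (deriv f z0))\<^sup>2 / (pi * r\<^sup>2)"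
proof -
 define S where "S = {z\<in>D. cmod (f z) < r}"
 have SD: "S <= D" by (auto simp: S_def)
 have "S = D Int f -` ball 0 r" by (auto simp: S_def)
 then have oS: "open S" using continuous_open_preimage[OF hol_cont[OF f] D(1) open_ball] by simp
 have fS: "f holomorphic_on S" "inj_on f S" using f f_inj SD by (auto intro: hol_subset inj_on_subset)
 have img: "f ` S = f ` D Int ball 0 r" by (auto simp: S_def)
 have zS: "z0 : S" using z0 f0 r by (simp add: S_def)
 have oI: "open (f ` S)" using open_mapping_thm3[OF fS(1) oS fS(2)] .
 \<comment> \<open>The area pi r^2 normalizes the mean value, and cnj f'(z0) restores q(z0) = f'(z0)
   G(0).\<close>
 define c where "c = cnj (deriv f z0) / of_real (pi * r\<^sup>2)"
 define kk where "kk z = c * (deriv f z * 1)" for z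
 have one: "(%_. 1) : A2 (f ` S)"
  using oI emeasure_bounded_finite[of "f ` S"] unfolding img by (simp add: A2_def set_integrable_def bounded_Int)
 have kk: "kk : A2 S"
  unfolding kk_def using A2_pullback[OF oS fS, of "%_. 1"] one oS by (intro A2_scale) auto
 have int: "(LINT z:S|lborel. (cmod (deriv f z))\<^sup>2 *\<^sub>R G (f z)) = of_real (pi * r\<^sup>2) * G 0" if G: "G : A2 (f ` S)" for G
 proof -
  have "smeas (f ` S) G"
  using G oI by (intro meas_cont hol_cont) (auto simp: A2_def)
  from holomorphic_change_of_variables[OF oS fS this] sublevel_integral[OF r G[unfolded img]]
  show ?thesis by (simp add: img)
 qed
 have pr: "cor (pi * r\<^sup>2) ~= 0" using r by simp
 have "bergman_kernel S z0 = nsq S kk"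
 proof (rule bergman_kernel_eqI[OF oS kk])
  fix q assume q: "q : A2 S"
  obtain g where g: "g holomorphic_on f ` S" "!!z. z : S ==> g (f z) = z" "!!w. w : f ` S ==> g w : S & f (g w) = w"
  by (rule inj_holomorphic_inverse[OF oS fS]) (rule that)
  define G where "G w = q (g w) / deriv f (g w)" for w
  have dn: "deriv f z ~= 0" if "z : S" for z using that SD deriv_f_nonzero by auto
  have qh: "q holomorphic_on S" using q by (simp add: A2_def)
  have gi: "g ` f ` S <= S" using g(3) by auto
  have Gh: "G holomorphic_on f ` S"
  unfolding G_def
  using hol_compose[OF g(1) qh gi] hol_compose[OF g(1) holomorphic_deriv[OF fS(1) oS] gi] g(3) dn
  by (intro holomorphic_on_divide) (auto simp: o_def)
  have qG: "q z = deriv f z * G (f z)" if "z : S" for z using g(2)[OF that] dn[OF that] by (simp add: G_def)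
  have "G : A2 (f ` S)"
  using A2_pullback[OF oS fS Gh] A2_cong[OF q qG] by simp
  note I = int[OF this]
  have "L2_inner S q kk = (LINT z:S|lborel. cnj c * ((cmod (deriv f z))\<^sup>2 *\<^sub>R G (f z)))"
  unfolding L2_inner_def
  proof (rule set_lebesgue_integral_cong)
  show "ALL z. z : S --> q z * cnj (kk z) = cnj c * ((cmod (deriv f z))\<^sup>2 *\<^sub>R G (f z))"
  using complex_norm_square by (auto simp: qG kk_def scaleR_conv_of_real mult_ac simp del: of_real_power)
  qed (use oS in simp)
  also have "... = cnj c * (of_real (pi * r\<^sup>2) * G 0)" unfolding I[symmetric] by (rule set_integral_mult_right)
  also have "... = deriv f z0 * G 0" using pr by (simp add: c_def)
  also have "... = q z0" using qG[OF zS] f0 by simp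
  finally show "q z0 = L2_inner S q kk" by simp
 qed
 also have "nsq S kk = (LINT z:S|lborel. (cmod c)\<^sup>2 * (cmod (deriv f z))\<^sup>2)"
  by (rule set_lebesgue_integral_cong) (use oS in \<open>auto simp: kk_def norm_mult power_mult_distrib\<close>)
 also have "... = (cmod c)\<^sup>2 * (LINT z:S|lborel. (cmod (deriv f z))\<^sup>2)" by (rule set_integral_mult_right)
 also have "(LINT z:S|lborel. (cmod (deriv f z))\<^sup>2) = pi * r\<^sup>2"
 proof -
  have "cor (LINT z:S|lborel. (cmod (deriv f z))\<^sup>2) = (LINT z:S|lborel. cor ((cmod (deriv f z))\<^sup>2))"
  by (simp only: set_integral_complex_of_real)
  also have "... = of_real (pi * r\<^sup>2)" using int[OF one] by (simp add: scaleR_conv_of_real)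
  finally show ?thesis using of_real_eq_iff by blast
 qed
 also have "(cmod c)\<^sup>2 * (pi * r\<^sup>2) = (cmod (deriv f z0))\<^sup>2 / (pi * r\<^sup>2)"
  using r by (simp add: c_def norm_divide norm_mult norm_power power_divide power_mult_distrib) (simp add: p2eq power4_eq_xxxx field_simps)
 finally show ?thesis by (simp add: S_def)
qed

end

section \<open>Green's function\<close>

lemma harmonic_on_continuous: assumes "open S" "harmonic_on u S" shows "continuous_on S u"
proof (rule continuous_at_imp_continuous_on, rule ballI)
 fix z assume z: "z : S"
 have "pd u (partial 1 u z) (partial \<i> u z) z" using hdataI[OF assms] z unfolding hdata_def by simp
 then show "isCont u z" by (rule pd_isCont)
qed

text \<open>Both directions use log |F| for a map into the disc with a single simple zero at
  \<open>z0\<close>: the developing map, and a biholomorphic map followed by a Moebius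
  transformation.\<close>

locale disc_map =
 fixes D :: "complex set" and z0 :: complex and F :: "complex => complex"
 assumes oD: "open D" and z0D: "z0 : D" and Fh: "F holomorphic_on D" and Fd: "F ` D <= ball 0 1"
  and F0: "F z0 = 0" and F_zero: "!!z. z : D ==> F z = 0 ==> z = z0" and dF: "deriv F z0 ~= 0"
begin

text \<open>F(z) / (z - z0) with the singularity filled in. It has no zeros in \<open>D\<close>, so
  log |F1| is harmonic across \<open>z0\<close> and is the regular part of log |F|.\<close>

definition "F1 z = (if z = z0 then deriv F z0 else (F z - F z0) / (z - z0))"

lemma F1: "F1 holomorphic_on D" "F z = (z - z0) * F1 z" "F1 z0 = deriv F z0"
 using pole_lemma_open[OF Fh oD, of z0] F0 by (auto simp: F1_def[abs_def])

lemma F_nz: "z : D ==> z ~= z0 ==> F z ~= 0" using F_zero by blast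

lemma F1_nonzero: "z : D ==> F1 z ~= 0"
 using F_nz[of z] dF F0 by (auto simp: F1_def)

lemma F_lt: "z : D ==> cmod (F z) < 1" using Fd by auto

lemma ln_F: "z : D ==> z ~= z0 ==> lnE (cmod (F z)) = ereal (ln (cmod (z - z0)) + ln (cmod (F1 z)))"
 using F1_nonzero[of z] by (simp add: F1(2) lnE_def norm_mult ln_mult)

lemma harmonic_ln_F1: "harmonic_on (%z. ln (cmod (F1 z))) D"
 by (rule harmonic_on_ln_holomorphic[OF oD F1(1) F1_nonzero])

lemma neg_subharmonic_ln_F: "neg_subharmonic_with_pole D z0 (%z. lnE (cmod (F z)))"
 unfolding neg_subharmonic_with_pole_def
proof (intro conjI ballI)
 show "subharmonic_on (%z. lnE (cmod (F z))) D"
 proof (rule subharmonic_on_lnE[OF oD])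
  show "continuous_on D (%z. cmod (F z))" by (intro continuous_intros hol_cont Fh)
  have "{z\<in>D. cmod (F z) ~= 0} = D - {z0}" using F_nz F0 by auto
  then show "harmonic_on (%z. ln (cmod (F z))) {z\<in>D. cmod (F z) ~= 0}"
  using oD F_nz by (auto intro!: harmonic_on_ln_holomorphic open_delete hol_subset[OF Fh])
 qed simp
 show "lnE (cmod (F z)) < 0" if "z : D" for z
  using lnE_less[of "cmod (F z)" 0] F_lt[OF that] by (simp add: zero_ereal_def)
 obtain r where r: "r > 0" "ball z0 r <= D" using oD z0D by (rule openE)
 show "has_log_pole (%z. lnE (cmod (F z))) z0"
  unfolding has_log_pole_def
 proof (intro conjI exI ballI)
  show "lnE (cmod (F z0)) = -\<infinity>" by (simp add: F0 lnE_def)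
  show "r > 0" by (rule r)
  show "harmonic_on (%z. ln (cmod (F1 z))) (ball z0 r)" by (rule harmonic_on_subset[OF harmonic_ln_F1 oD r(2)]) simp
  show "lnE (cmod (F z)) = ereal (ln (cmod (z - z0)) + ln (cmod (F1 z)))" if "z : ball z0 r - {z0}" for z
  using ln_F that r by auto
 qed
qed

lemma is_green_lnE:
 assumes mx: "!!u z. neg_subharmonic_with_pole D z0 u ==> z : D ==> u z <= lnE (cmod (F z))"
 shows "is_green D z0 (%z. lnE (cmod (F z)))"
 unfolding is_green_def
proof (intro conjI allI impI ballI neg_subharmonic_ln_F mx)
 show "\<bar>lnE (cmod (F z))\<bar> ~= \<infinity>" if "z : D - {z0}" for z using that F_nz by (auto simp: lnE_def)
 have o: "open (D - {z0})" using oD by (rule open_delete)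
 show "harmonic_on (%z. real_of_ereal (lnE (cmod (F z)))) (D - {z0})"
 proof (rule harmonic_on_cong[OF o])
  show "harmonic_on (%z. ln (cmod (F z))) (D - {z0})"
  using F_nz by (intro harmonic_on_ln_holomorphic o hol_subset[OF Fh]) auto
  show "real_of_ereal (lnE (cmod (F z))) = ln (cmod (F z))" if "z : D - {z0}" for z using that F_nz by (auto simp: lnE_def)
 qed
qed

text \<open>Maximality makes all Green's functions agree on \<open>D\<close>, so
  \<open>green\<close> can be computed from any of them; the value at \<open>z0\<close> is forced by
  the pole. The capacity is the exponential of the regular part log |F1| at \<open>z0\<close>, where
  F1 = F'.\<close>

lemma green_eq:
 assumes G: "is_green D z0 G" and eq: "!!z. z : D ==> z ~= z0 ==> G z = lnE (cmod (F z))"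
 shows "!!z. z : D ==> green D z0 z = lnE (cmod (F z))" and "log_capacity D z0 = cmod (deriv F z0)"
proof -
 have g: "is_green D z0 (green D z0)" unfolding green_def by (rule someI[where P = "is_green D z0", OF G])
 have gG: "green D z0 z = G z" if "z : D" for z
  using g G that unfolding is_green_def by (intro antisym) blast+
 have "has_log_pole (green D z0) z0" using g unfolding is_green_def neg_subharmonic_with_pole_def by blast
 then have gz: "green D z0 z0 = -\<infinity>" unfolding has_log_pole_def by blast
 show ge: "green D z0 z = lnE (cmod (F z))" if "z : D" for z
  using gG[OF that] eq[OF that] gz by (cases "z = z0") (auto simp: F0 lnE_def)
 have c: "isCont (%z. ln (cmod (F1 z))) z0"
  using harmonic_on_continuous[OF oD harmonic_ln_F1] oD z0D by (simp add: continuous_on_eq_continuous_at)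
 have "((%z. real_of_ereal (green D z0 z) - ln (cmod (z - z0))) \<longlongrightarrow> ln (cmod (F1 z0))) (at z0)"
 proof (rule Lim_transform_within_open[OF isContD[OF c] oD z0D])
  show "ln (cmod (F1 z)) = real_of_ereal (green D z0 z) - ln (cmod (z - z0))" if "z : D" "z ~= z0" for z
  using ge[OF that(1)] ln_F[OF that] by simp
 qed
 then have "Lim (at z0) (%z. real_of_ereal (green D z0 z) - ln (cmod (z - z0))) = ln (cmod (F1 z0))"
  by (intro tendsto_Lim) auto
 then show "log_capacity D z0 = cmod (deriv F z0)" using dF by (simp add: log_capacity_def F1(3))
qed

text \<open>The regular parts of \<open>u\<close> and of log |F| are continuous; on a compact disc
  inside both domains their difference attains a maximum, the constant \<open>B\<close>.\<close>

lemma pole_bound: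
 assumes u: "neg_subharmonic_with_pole D z0 u"
 obtains r B where "r > 0" "ball z0 r <= D" "ALL z:ball z0 r - {z0}. u z <= ereal (ln (cmod (F z)) + B)"
proof -
 have "has_log_pole u z0" using u by (simp add: neg_subharmonic_with_pole_def)
 then obtain r h where r: "r > 0" "harmonic_on h (ball z0 r)" "ALL z:ball z0 r - {z0}. u z = ereal (ln (cmod (z - z0)) + h z)"
  unfolding has_log_pole_def by (elim exE conjE)
 obtain R where R: "R > 0" "ball z0 R <= D" using oD z0D by (rule openE)
 define s where "s = min r R / 2"
 have s: "s > 0" "s < r" "s < R" using r R by (auto simp: s_def)
 have sub: "cball z0 s <= ball z0 r" "cball z0 s <= D" using s R by auto
 have "continuous_on (cball z0 s) (%z. h z - ln (cmod (F1 z)))"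
  using harmonic_on_continuous[OF open_ball r(2)] harmonic_on_continuous[OF oD harmonic_ln_F1] sub
  by (intro continuous_on_diff) (auto intro: continuous_on_subset)
 then have "EX x:cball z0 s. ALL y:cball z0 s. h y - ln (cmod (F1 y)) <= h x - ln (cmod (F1 x))"
  using s by (intro continuous_attains_sup) auto
 then obtain x where x: "ALL y:cball z0 s. h y - ln (cmod (F1 y)) <= h x - ln (cmod (F1 x))" by (elim bexE)
 define B where "B = h x - ln (cmod (F1 x))"
 have B: "h z - ln (cmod (F1 z)) <= B" if "z : cball z0 s" for z using x that by (simp add: B_def)
 show thesis
 proof (rule that[OF s(1), of B])
  show "ball z0 s <= D" using sub ball_subset_cball by blast
  show "ALL z:ball z0 s - {z0}. u z <= ereal (ln (cmod (F z)) + B)"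
  proof
  fix z assume z: "z : ball z0 s - {z0}"
  then have zs: "z : cball z0 s" "z : ball z0 r - {z0}" "z : D" using sub s(2) by auto
  have "ln (cmod (F z)) = ln (cmod (z - z0)) + ln (cmod (F1 z))"
  using F1_nonzero[OF zs(3)] z by (simp add: F1(2) norm_mult ln_mult)
  then show "u z <= ereal (ln (cmod (F z)) + B)" using r(3) zs(2) B[OF zs(1)] by auto
  qed
 qed
qed

end

context hyperbolic_kernel
begin

sublocale disc_map D z0 f
proof
 show "z = z0" if "z : D" "f z = 0" for z using inj_onD[OF f_inj, of z z0] that z0 f0 by simp
qed (use D z0 f fD f0 deriv_f_nonzero in auto)

text \<open>A small multiple of the logarithmic potential of the exceptional set, which is very negative
  there, is subtracted from the comparison function.\<close>

lemma green_maximal_aux: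
 assumes u: "neg_subharmonic_with_pole D z0 u" and z: "z : D" "z ~= z0"
  and et: "0 < et" "et < 1" and rh: "cmod (f z) < rh" "rh < 1" and e: "e > 0"
 shows "u z <= ereal ((1 - et) * (ln (cmod (f z)) - ln rh) + e)"
proof -
 define E where "E = cball 0 rh - f ` D"
 have E: "compact E" "E <= ball 0 1 - f ` D" unfolding E_def using open_image rh by (auto intro!: compact_diff)
 have fz: "cmod (f z) > 0" using F_nz[OF z] by simp
 have "f z ~: E" using z by (auto simp: E_def)
 then obtain d0 where d0: "d0 > 0" "ALL y:E. d0 <= dist (f z) y"
  using separate_point_closed[OF compact_imp_closed[OF E(1)]] by blast
 define d where "d = min d0 1"
 have d: "0 < d" "d <= 1" "ALL y:E. d <= cmod (f z - y)" using d0 by (auto simp: d_def dist_norm)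
 have ln3: "ln 3 > (0::real)" by simp
 have lnd: "ln d <= 0" using d by simp
 define ep where "ep = e / (ln 3 - ln d)"
 have den: "ln 3 - ln d > 0" using ln3 lnd by linarith
 have ep: "ep > 0" "ep * (ln 3 - ln d) = e" using e den by (auto simp: ep_def)
 obtain r B where rB: "r > 0" "ball z0 r <= D" "ALL z:ball z0 r - {z0}. u z <= ereal (ln (cmod (f z)) + B)"
  by (rule pole_bound[OF u]) (rule that)
 have "open (f ` ball z0 r)"
  using open_mapping_thm3[OF hol_subset[OF f rB(2)] open_ball inj_on_subset[OF f_inj rB(2)]] .
 moreover have "0 : f ` ball z0 r" using f0 rB(1) by force
 ultimately obtain dl1 where dl1: "dl1 > 0" "ball 0 dl1 <= f ` ball z0 r" by (rule openE)
 \<comment> \<open>Radius of the disc removed around the pole, at most |f z| so that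
   \<open>z\<close> stays. The last entry gives et ln dl <= - |B|, so that the factor 1 - et absorbs
   the constant \<open>B\<close> on this circle.\<close>
 define dl where "dl = min (dl1 / 2) (min (cmod (f z)) (exp (- \<bar>B\<bar> / et)))"
 have dl: "0 < dl" "dl < dl1" "dl <= cmod (f z)" "dl < 1" "dl <= exp (- \<bar>B\<bar> / et)"
  using dl1 fz rh by (auto simp: dl_def)
 have lndl: "ln dl < 0" using dl by simp
 have "ln dl <= ln (exp (- \<bar>B\<bar> / et))" using dl by (subst ln_le_cancel_iff) auto
 then have "et * ln dl <= et * (- \<bar>B\<bar> / et)" using et by (intro mult_left_mono) auto
 then have etdl: "et * ln dl <= - \<bar>B\<bar>" using et by simp
 have rh0: "rh > 0" using fz rh by linarith
 have lnrh: "ln rh < 0" using rh0 rh by simp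
 \<comment> \<open>The first entry makes ep M at least - ln dl, so that the potential outweighs the
   logarithm where the product is small; the second keeps the product at f(z), which is at least
   d^n, above the threshold exp(-M n).\<close>
 define M where "M = max (- ln dl / ep) (- ln d)"
 have "ep * (- ln dl / ep) <= ep * M" using ep by (intro mult_left_mono) (auto simp: M_def)
 then have Mdl: "- ln dl <= ep * M" using ep by simp
 have Md: "exp (- M) <= d"
 proof -
  have "exp (- M) <= exp (ln d)" by (subst exp_le_cancel_iff) (simp add: M_def)
  then show ?thesis using d by simp
 qed
 have "EX n>0. EX w::nat => complex. (ALL y:E. (\<Prod>i<n. cmod (y - w i)) <= exp (- (M + 1) * real n)) &
  (ALL y:ball 0 1. (\<Prod>i<n. cmod (y - w i)) <= 3 ^ n) & d ^ n <= (\<Prod>i<n. cmod (f z - w i))"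
 proof (cases "E = {}")
  \<comment> \<open>Without exceptional points a single factor with its zero outside the disc will
    do; the zero 2 respects the bounds 3 and \<open>d\<close>.\<close>
  case True
  have "cmod (y - 2) <= 3" if "y : ball 0 1" for y :: complex using that norm_triangle_ineq4[of y 2] by simp
  moreover have "d <= cmod (f z - 2)" using norm_triangle_ineq3[of 2 "f z"] F_lt[OF z(1)] d(2) by (simp add: norm_minus_commute)
  ultimately show ?thesis using True by (intro exI[of _ 1] conjI exI[of _ "%_. 2"]) auto
 next
  case False
  have "EX n>0. EX w::nat => complex. (ALL i<n. w i : E) & (ALL y:E. (\<Prod>i<n. cmod (y - w i)) <= exp (- (M + 1) * real n))"
  using complement_cap0[OF E False] unfolding cap0_def by (rule spec)
  then obtain n and w :: "nat => complex" where nw: "n > 0" "ALL i<n. w i : E" "ALL y:E. (\<Prod>i<n. cmod (y - w i)) <= exp (- (M + 1) * real n)"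
  by (elim exE conjE)
  have "(\<Prod>i<n. cmod (y - w i)) <= (\<Prod>i<n. 3)" if y: "y : ball 0 1" for y
  proof (rule prod_mono, intro conjI)
  fix i assume "i : {..<n}"
  then have "w i : E" using nw(2) by simp
  then have "cmod (w i) < 1" using E(2) by auto
  then show "cmod (y - w i) <= 3" using y norm_triangle_ineq4[of y "w i"] by simp
  qed simp
  moreover have "(\<Prod>i<n. d) <= (\<Prod>i<n. cmod (f z - w i))" by (rule prod_mono) (use d nw(2) in auto)
  ultimately show ?thesis using nw by (intro exI[of _ n] conjI exI[of _ w]) auto
 qed
 then obtain n and w :: "nat => complex" where n: "n > 0" and w: "ALL y:E. (\<Prod>i<n. cmod (y - w i)) <= exp (- (M + 1) * real n)"
  "ALL y:ball 0 1. (\<Prod>i<n. cmod (y - w i)) <= 3 ^ n" "d ^ n <= (\<Prod>i<n. cmod (f z - w i))" by (elim exE conjE)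
 define P where "P y = (\<Prod>i<n. cmod (y - w i))" for y
 have Pc: "continuous_on UNIV P" unfolding P_def by (intro continuous_intros)
 \<comment> \<open>The annulus between the radii \<open>dl\<close> and \<open>rh\<close>, without
   the region where the product is small. It misses the exceptional set, where the product is at
   most exp(-(M + 1) n), strictly below the threshold.\<close>
 define L where "L = cball 0 rh Int {y. dl <= cmod y} Int {y. exp (- M * real n) <= P y}"
 have L: "compact L"
  unfolding L_def by (intro compact_Int_closed compact_cball closed_Collect_le continuous_intros Pc)
 have LD: "L <= f ` D"
 proof
  fix y assume y: "y : L"
  show "y : f ` D"
  proof (rule ccontr)
  assume "y ~: f ` D"
  then have "y : E" using y by (auto simp: L_def E_def)
  then have "P y <= exp (- (M + 1) * real n)" using w(1) by (simp add: P_def)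
  also have "... < exp (- M * real n)" using n by (simp add: algebra_simps)
  finally show False using y by (simp add: L_def)
  qed
 qed
 obtain g where g: "g holomorphic_on f ` D" "!!z. z : D ==> g (f z) = z" "!!w. w : f ` D ==> g w : D & f (g w) = w"
  by (rule inj_holomorphic_inverse[OF D(1) f f_inj]) (rule that)
 define K where "K = g ` L"
 have K: "compact K"
  unfolding K_def by (rule compact_continuous_image[OF continuous_on_subset[OF hol_cont[OF g(1)] LD] L])
 have KL: "x : D & f x : L" if "x : K" for x using that g(3) LD unfolding K_def by force
 have LK: "x : K" if "x : D" "f x : L" for x unfolding K_def using g(2)[OF that(1)] that(2) by force
 have KD: "K <= D" using KL by auto
 have Ppos: "P (f x) > 0" if "x : K" for x
  using KL[OF that] exp_gt_zero[of "- M * real n"] unfolding L_def by (auto simp del: exp_gt_zero intro: less_le_trans)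
 have wnz: "f x - w i ~= 0" if "x : K" "i < n" for x i
 proof
  assume "f x - w i = 0"
  then have "P (f x) = 0" unfolding P_def using that(2) by (intro prod_zero) auto
  then show False using Ppos[OF that(1)] by simp
 qed
 have fnz: "f x ~= 0" if "x : K" for x using KL[OF that] dl(1) unfolding L_def by auto
 \<comment> \<open>(1 - et) log |f / rh| plus a small multiple of the potential; the term ep ln 3
   makes the second part nonnegative, as the product is at most 3^n.\<close>
 define H where "H x = (1 - et) * (ln (cmod (f x)) - ln rh) + ((- (ep / real n)) * (\<Sum>i<n. ln (cmod (f x - w i))) + ep * ln 3)" for x
 have HP: "H x = (1 - et) * (ln (cmod (f x)) - ln rh) + (- (ep / real n) * ln (P (f x)) + ep * ln 3)" if "x : K" for x
 proof -
  have "ln (P (f x)) = (\<Sum>i<n. ln (cmod (f x - w i)))" unfolding P_def by (rule ln_prod) (use wnz[OF that] in auto)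
  then show ?thesis by (simp add: H_def)
 qed
 have Hlow: "(1 - et) * (ln (cmod (f x)) - ln rh) <= H x" if x: "x : K" for x
 proof -
  have "f x : ball 0 1" using KL[OF x] fD by auto
  then have "P (f x) <= 3 ^ n" using w(2) by (simp add: P_def)
  then have "ln (P (f x)) <= ln (3 ^ n)" using Ppos[OF x] by (subst ln_le_cancel_iff) auto
  also have "... = real n * ln 3" by (simp add: ln_realpow)
  finally have "(ep / real n) * ln (P (f x)) <= (ep / real n) * (real n * ln 3)" using ep by (intro mult_left_mono) auto
  also have "... = ep * ln 3" using n by simp
  finally show ?thesis unfolding HP[OF x] by simp
 qed
 have zK: "z : K"
 proof (rule LK[OF z(1)])
  have "exp (- M * real n) = exp (- M) ^ n" by (metis exp_of_nat_mult mult.commute)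
  also have "... <= d ^ n" using Md by (intro power_mono) auto
  also have "... <= P (f z)" using w(3) by (simp add: P_def)
  finally show "f z : L" using rh dl by (simp add: L_def)
 qed
 have "u z <= ereal (H z)"
 proof (rule subharmonic_onD[OF _ K KD _ _ _ zK])
  show "subharmonic_on u D" using u by (simp add: neg_subharmonic_with_pole_def)
  have fK: "f holomorphic_on K" by (rule hol_subset[OF f KD])
  show "continuous_on K H"
  unfolding H_def using fnz wnz by (intro continuous_intros hol_cont fK) auto
  have ih: "f holomorphic_on interior K" by (rule hol_subset[OF fK interior_subset])
  show "harmonic_on H (interior K)"
  unfolding H_def using fnz wnz interior_subset[of K]
  by (intro harmonic_on_add harmonic_on_cmult harmonic_on_diff harmonic_on_const harmonic_on_sum harmonic_on_ln_holomorphic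
  holomorphic_intros ih open_interior) auto
  fix x assume x: "x : frontier K"
  have xK: "x : K" using x compact_imp_closed[OF K] by (simp add: frontier_def)
  have xD: "x : D" "f x : L" using KL[OF xK] by auto
  have un: "u x < 0" using u xD(1) by (simp add: neg_subharmonic_with_pole_def)
  \<comment> \<open>On the circle around the pole the singularity of \<open>u\<close> is compared;
    on the outer circle and on the level set of the product, H >= 0 > u.\<close>
  consider "cmod (f x) = dl" | "cmod (f x) = rh" | "P (f x) = exp (- M * real n)"
  proof (rule ccontr)
  assume "~ thesis"
  then have ne: "cmod (f x) ~= dl" "cmod (f x) ~= rh" "P (f x) ~= exp (- M * real n)" using that by auto
  define W where "W = {y. cmod y < rh} Int {y. dl < cmod y} Int {y. exp (- M * real n) < P y}"
  have "open W" unfolding W_def by (intro open_Int open_Collect_less continuous_intros Pc)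
  then have "open (D Int f -` W)" by (rule continuous_open_preimage[OF hol_cont[OF f] D(1)])
  moreover have "x : D Int f -` W" using xD ne by (auto simp: L_def W_def)
  moreover have "D Int f -` W <= K" by (auto intro!: LK simp: L_def W_def)
  ultimately have "x : interior K" by (rule interiorI)
  then show False using x by (simp add: frontier_def)
  qed
  then show "u x <= ereal (H x)"
  proof cases
  case 1
  then have "f x : f ` ball z0 r" using dl dl1 by auto
  then obtain y where y: "y : ball z0 r" "f y = f x" by auto
  then have "y = x" using f_inj xD rB(2) by (auto simp: inj_on_def)
  moreover have "x ~= z0" using fnz[OF xK] f0 by auto
  ultimately have "u x <= ereal (ln dl + B)" using rB(3) y 1 by auto
  also have "ln dl + B <= (1 - et) * (ln dl - ln rh)"
  proof -
  have "(1 - et) * ln rh <= 0" using et lnrh by (intro mult_nonneg_nonpos) auto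
  moreover have "(1 - et) * (ln dl - ln rh) = ln dl - et * ln dl - (1 - et) * ln rh" by (simp add: algebra_simps)
  ultimately show ?thesis using etdl by linarith
  qed
  also have "... <= H x" using Hlow[OF xK] 1 by simp
  finally show ?thesis by simp
  next
  case 2
  then have "0 <= H x" using Hlow[OF xK] by simp
  then have "(0::ereal) <= ereal (H x)" by simp
  then show ?thesis using un by (meson less_imp_le order_trans)
  next
  case 3
  have Hx: "H x = (1 - et) * (ln (cmod (f x)) - ln rh) + ep * M + ep * ln 3" unfolding HP[OF xK] 3 using n by simp
  have "ln dl <= ln (cmod (f x))" using xD dl by (subst ln_le_cancel_iff) (auto simp: L_def)
  then have "(1 - et) * ln dl <= (1 - et) * (ln (cmod (f x)) - ln rh)" using et lnrh by (intro mult_left_mono) auto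
  moreover have "ln dl <= (1 - et) * ln dl"
  proof -
  have "et * ln dl <= 0" using et lndl by (intro mult_nonneg_nonpos) auto
  then show ?thesis by (simp add: algebra_simps)
  qed
  moreover have "0 <= ep * ln 3" using ep by simp
  ultimately have "0 <= H x" unfolding Hx using Mdl by linarith
  then have "(0::ereal) <= ereal (H x)" by simp
  then show ?thesis using un by (meson less_imp_le order_trans)
  qed
 qed
 also have "H z <= (1 - et) * (ln (cmod (f z)) - ln rh) + e"
 proof -
  have "ln (d ^ n) <= ln (P (f z))" using w(3) d Ppos[OF zK] by (subst ln_le_cancel_iff) (auto simp: P_def)
  then have "real n * ln d <= ln (P (f z))" using d by (simp add: ln_realpow)
  then have "(ep / real n) * (real n * ln d) <= (ep / real n) * ln (P (f z))" using ep by (intro mult_left_mono) auto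
  then have "ep * ln d <= (ep / real n) * ln (P (f z))" using n by simp
  moreover have "e = ep * ln 3 - ep * ln d" using ep(2) by (simp add: algebra_simps)
  ultimately show ?thesis unfolding HP[OF zK] by simp
 qed
 finally show ?thesis by simp
qed

text \<open>Limit of \<open>green_maximal_aux\<close> for \<open>et\<close> towards 0 and
  \<open>rh\<close> towards 1; each of the three errors is kept below e / 3.\<close>

lemma green_maximal:
 assumes u: "neg_subharmonic_with_pole D z0 u" and z: "z : D"
 shows "u z <= lnE (cmod (f z))"
proof (cases "z = z0")
 case True
 have "has_log_pole u z0" using u by (simp add: neg_subharmonic_with_pole_def)
 then show ?thesis using True by (simp add: has_log_pole_def)
next
 case False
 define L where "L = ln (cmod (f z))"
 have fz: "0 < cmod (f z)" "cmod (f z) < 1" using F_nz[OF z False] F_lt[OF z] by simp_all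
 have "u z <= ereal L + ereal e" if e: "e > 0" for e
 proof -
  define et where "et = min (1/2) (e / (3 * (\<bar>L\<bar> + 1)))"
  have et: "0 < et" "et < 1" using e by (auto simp: et_def add_nonneg_pos)
  define rh where "rh = max (exp (- e / 3)) ((1 + cmod (f z)) / 2)"
  have rh: "cmod (f z) < rh" "rh < 1" using fz e by (auto simp: rh_def less_max_iff_disj)
  have "ln (exp (- e / 3)) <= ln rh" using fz by (subst ln_le_cancel_iff) (auto simp: rh_def less_max_iff_disj)
  then have l1: "- ln rh <= e / 3" by simp
  have "rh > 0" using rh(1) fz(1) by (rule less_trans[rotated])
  then have l0: "ln rh <= 0" using rh(2) by simp
  have "et * \<bar>L\<bar> <= e / (3 * (\<bar>L\<bar> + 1)) * (\<bar>L\<bar> + 1)" using e by (intro mult_mono) (auto simp: et_def)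
  also have "... = e / 3"
  proof -
  have "\<bar>L\<bar> + 1 ~= 0" by linarith
  then show ?thesis by (simp add: field_simps)
  qed
  finally have l2: "et * \<bar>L\<bar> <= e / 3" .
  have l3: "- (et * L) <= et * \<bar>L\<bar>" using et by (simp add: abs_if mult_le_cancel_left)
  have l4: "0 <= et * (- ln rh)" using et l0 by (intro mult_nonneg_nonneg) auto
  have "(1 - et) * (L - ln rh) + e / 3 = L - et * L - ln rh - et * (- ln rh) + e / 3" by (simp add: algebra_simps)
  also have "... <= L + e" using l1 l2 l3 l4 by linarith
  finally have "ereal ((1 - et) * (L - ln rh) + e / 3) <= ereal L + ereal e" by simp
  moreover have "u z <= ereal ((1 - et) * (L - ln rh) + e / 3)"
  unfolding L_def by (rule green_maximal_aux[OF u z False et rh]) (use e in simp)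
  ultimately show ?thesis by (rule order_trans[rotated])
 qed
 then have "u z <= ereal L" by (rule ereal_le_epsilon2)
 then show ?thesis using fz by (simp add: L_def lnE_def)
qed

lemma is_green_ln_f: "is_green D z0 (%z. lnE (cmod (f z)))"
 by (rule is_green_lnE) (rule green_maximal)

text \<open>For each \<open>k\<close> choose points whose product \<open>p k\<close> is at most
  exp(- k 2^k n k) on the exceptional set, and add the potentials with weights 1 / (2^k n k). On the
  set the k-th summand is at most -k, so the sum is -\<infinity>; at a point at distance at least d
  <= 1 from it the sum is at least 2 log d. The sum is handled as the decreasing product
  \<open>Fj\<close> of powers.\<close>

lemma complement_polar: "polar (ball 0 1 - f ` D)"
 unfolding polar_def
proof
 fix a assume a: "a : ball 0 1 - f ` D"
 \<comment> \<open>At most 1 / 2, so that points of the disc of radius \<open>rh\<close> are within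
   1 of each other and every factor of the products is at most 1.\<close>
 define rh where "rh = (1 - cmod a) / 2"
 have rh: "rh > 0" "rh <= 1/2" using a by (auto simp: rh_def)
 have sub: "cball a rh <= ball 0 1"
 proof
  fix y assume "y : cball a rh"
  then have "cmod y <= cmod a + rh" using norm_triangle_ineq2[of y a] by (simp add: dist_norm norm_minus_commute)
  moreover have "cmod a < 1" using a by simp
  ultimately have "cmod y < 1" unfolding rh_def by (simp add: field_simps)
  then show "y : ball 0 1" by simp
 qed
 define E where "E = cball a rh - f ` D"
 have E: "compact E" "E <= ball 0 1 - f ` D" unfolding E_def using open_image sub by (auto intro!: compact_diff)
 have "a : E" using a rh by (simp add: E_def)
 then have Ene: "E ~= {}" by blast
 have ex: "EX n>0. EX w::nat => complex. (ALL i<n. w i : E) & (ALL y:E. (\<Prod>i<n. cmod (y - w i)) <= exp (- M * real n))" for M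
  using complement_cap0[OF E Ene] unfolding cap0_def by (rule spec)
 have "ALL k. EX nw. fst nw > 0 & (ALL i<fst nw. snd nw i : E) & (ALL y:E. (\<Prod>i<fst nw. cmod (y - snd nw i)) <= exp (- (real k * 2 ^ k) * real (fst nw)))"
 proof
  fix k
  obtain n and w :: "nat => complex" where "n > 0" "ALL i<n. w i : E" "ALL y:E. (\<Prod>i<n. cmod (y - w i)) <= exp (- (real k * 2 ^ k) * real n)"
  using ex[of "real k * 2 ^ k"] by (elim exE conjE)
  then show "EX nw. fst nw > 0 & (ALL i<fst nw. snd nw i : E) & (ALL y:E. (\<Prod>i<fst nw. cmod (y - snd nw i)) <= exp (- (real k * 2 ^ k) * real (fst nw)))"
  by (intro exI[of _ "(n, w)"]) simp
 qed
 from choice[OF this] obtain nw where nw': "ALL k. fst (nw k) > 0 & (ALL i<fst (nw k). snd (nw k) i : E) &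
  (ALL y:E. (\<Prod>i<fst (nw k). cmod (y - snd (nw k) i)) <= exp (- (real k * 2 ^ k) * real (fst (nw k))))" by (elim exE)
 have nw: "fst (nw k) > 0" "i < fst (nw k) ==> snd (nw k) i : E"
  "y : E ==> (\<Prod>i<fst (nw k). cmod (y - snd (nw k) i)) <= exp (- (real k * 2 ^ k) * real (fst (nw k)))" for k i y
  using nw'[rule_format, of k] by simp_all
 define n w where "n k = fst (nw k)" and "w k i = snd (nw k) i" for k i
 have n: "n k > 0" and wE: "i < n k ==> w k i : E" for k i using nw by (auto simp: n_def w_def)
 define p where "p k y = (\<Prod>i<n k. cmod (y - w k i))" for k y
 define c where "c k = 1 / (2 ^ k * real (n k))" for k
 define Fj where "Fj m y = (\<Prod>k<m. p k y powr c k)" for m y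
 have cpos: "c k > 0" for k using n by (simp add: c_def)
 have p0: "p k y >= 0" for k y unfolding p_def by (rule prod_nonneg) auto
 let ?U = "ball a rh"
 have p1: "p k y <= 1" if y: "y : ?U" for k y
 proof -
  have "p k y <= (\<Prod>i<n k. 1)"
  unfolding p_def
  proof (rule prod_mono, intro conjI)
  fix i assume "i : {..<n k}"
  then have "w k i : cball a rh" using wE[of i k] by (simp add: E_def)
  then have "dist y (w k i) <= rh + rh" using y dist_triangle[of y "w k i" a] by (simp add: dist_commute)
  then show "cmod (y - w k i) <= 1" using rh by (simp add: dist_norm)
  qed simp
  then show ?thesis by simp
 qed
 have Fj0: "Fj m y >= 0" for m y unfolding Fj_def by (rule prod_nonneg) auto
 have fi1: "p k y powr c k <= 1" if "y : ?U" for k y using powr_le_one_le p1[OF that] p0 cpos[of k]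
  by (metis less_imp_le powr_mono2 powr_one_eq_one)
 have dec: "Fj (Suc m) y <= Fj m y" if "y : ?U" for m y
  using mult_left_mono[OF fi1[OF that, of m] Fj0[of m y]] by (simp add: Fj_def)
 define Ps where "Ps y = lim (%m. Fj m y)" for y
 have lim: "(%m. Fj m y) \<longlonglongrightarrow> Ps y" if y: "y : ?U" for y
 proof -
  have "decseq (%m. Fj m y)" using dec[OF y] by (rule decseq_SucI)
  then obtain l where "(%m. Fj m y) \<longlonglongrightarrow> l" using decseq_convergent[of "%m. Fj m y" 0] Fj0 by blast
  then show ?thesis unfolding Ps_def by (simp add: limI)
 qed
 have subPs: "subharmonic_on (%y. lnE (Ps y)) ?U"
 proof (rule subharmonic_on_lnE_limit[where Fj = Fj])
  show "continuous_on ?U (Fj m)" for m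
  unfolding Fj_def
  proof (intro continuous_on_prod continuous_on_powr')
  show "continuous_on ?U (p k)" for k unfolding p_def by (intro continuous_intros)
  show "ALL x:?U. 0 <= p k x & (p k x = 0 --> 0 < c k)" for k using p0 cpos by auto
  qed auto
  fix m
  have eq: "{y\<in>?U. Fj m y ~= 0} = ?U Int (\<Inter>k\<in>{..<m}. {y. p k y ~= 0})" by (auto simp: Fj_def)
  have "open {y. p k y ~= 0}" for k unfolding p_def by (intro open_Collect_neq continuous_intros)
  then have o: "open {y\<in>?U. Fj m y ~= 0}" unfolding eq by (intro open_Int open_ball open_INT) auto
  have nz: "y - w k i ~= 0" if "y : {y\<in>?U. Fj m y ~= 0}" "k < m" "i < n k" for y k i
  proof -
  have "p k y ~= 0" using that(1,2) unfolding eq by auto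
  then show ?thesis using that(3) unfolding p_def by (auto simp: prod_zero_iff)
  qed
  show "harmonic_on (%y. ln (Fj m y)) {y\<in>?U. Fj m y ~= 0}"
  proof (rule harmonic_on_cong[OF o, of "%y. \<Sum>k<m. c k * (\<Sum>i<n k. ln (cmod (y - w k i)))"])
  show "harmonic_on (%y. \<Sum>k<m. c k * (\<Sum>i<n k. ln (cmod (y - w k i)))) {y\<in>?U. Fj m y ~= 0}"
  using nz by (intro harmonic_on_sum harmonic_on_cmult harmonic_on_ln_holomorphic holomorphic_intros o) auto
  fix y assume y: "y : {y\<in>?U. Fj m y ~= 0}"
  have pk: "p k y > 0" if "k < m" for k using y that p0[of k y] unfolding eq by (auto simp: less_le)
  have "ln (Fj m y) = (\<Sum>k<m. ln (p k y powr c k))" unfolding Fj_def by (rule ln_prod) (auto dest: pk)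
  also have "... = (\<Sum>k<m. c k * (\<Sum>i<n k. ln (cmod (y - w k i))))"
  proof (rule sum.cong[OF refl])
  fix k assume k: "k : {..<m}"
  have "ln (p k y) = (\<Sum>i<n k. ln (cmod (y - w k i)))"
  unfolding p_def by (rule ln_prod) (use nz[OF y, of k] k in auto)
  then show "ln (p k y powr c k) = c k * (\<Sum>i<n k. ln (cmod (y - w k i)))" using pk[of k] k by (simp add: ln_powr)
  qed
  finally show "ln (Fj m y) = (\<Sum>k<m. c k * (\<Sum>i<n k. ln (cmod (y - w k i))))" .
  qed
 qed (use Fj0 dec lim in auto)
 have zero: "Ps y = 0" if y: "y : ?U" "y : E" for y
 proof (rule LIMSEQ_unique[OF LIMSEQ_Suc[OF lim[OF y(1)]]])
  have "Fj (Suc m) y <= exp (- 1) ^ m" for m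
  proof -
  have "Fj m y <= 1" unfolding Fj_def by (rule prod_le_1) (use fi1[OF y(1)] in auto)
  then have "Fj (Suc m) y <= 1 * p m y powr c m" using mult_right_mono[of "Fj m y" 1 "p m y powr c m"] by (simp add: Fj_def)
  also have "... <= exp (- (real m * 2 ^ m) * real (n m)) powr c m"
  using nw(3)[OF y(2), of m] p0 cpos[of m] unfolding mult_1 by (intro powr_mono2) (auto simp: p_def n_def w_def)
  also have "... = exp (real m * (-1))" using n[of m] by (simp add: powr_def c_def)
  also have "... = exp (-1) ^ m" by (rule exp_of_nat_mult)
  finally show ?thesis .
  qed
  moreover have "(%m. exp (- 1 :: real) ^ m) \<longlonglongrightarrow> 0" by (rule LIMSEQ_realpow_zero) auto
  ultimately show "(%m. Fj (Suc m) y) \<longlonglongrightarrow> 0"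
  using tendsto_sandwich[of "%_. 0" "%m. Fj (Suc m) y" sequentially "%m. exp (- 1) ^ m" 0] Fj0
  by (simp add: eventually_sequentially)
 qed
 have "~ ?U <= E"
 proof
  assume "?U <= E"
  then have "?U <= ball 0 1 - f ` D" using E(2) by (rule order_trans)
  moreover have "ball 0 1 - f ` D : sets lborel" using open_image by simp
  moreover have "?U ~= {}" using rh(1) by simp
  ultimately show False using null_complement_dense[OF open_ball _ kernel_measure(2)] by simp
 qed
 then obtain z1 where z1: "z1 : ?U" "z1 ~: E" by blast
 obtain d0 where d0: "d0 > 0" "ALL y:E. d0 <= dist z1 y"
  using separate_point_closed[OF compact_imp_closed[OF E(1)] z1(2)] by blast
 define d where "d = min d0 1"
 have d: "0 < d" "d <= 1" "ALL y:E. d <= cmod (z1 - y)" using d0 by (auto simp: d_def dist_norm)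
 have "Ps z1 > 0"
 proof -
  have "d powr 2 <= Fj m z1" for m
  proof -
  have "d powr 2 <= d powr (\<Sum>k<m. (1/2) ^ k)"
  proof (rule powr_mono')
  have "(\<Sum>k<m. (1/2) ^ k) = (1 - (1/2::real) ^ m) / (1 - 1/2)" by (rule sum_gp_strict[THEN trans]) simp
  then show "(\<Sum>k<m. (1/2) ^ k) <= (2::real)" by simp
  qed (use d in auto)
  also have "... = (\<Prod>k<m. d powr ((1/2) ^ k))" using d by (simp add: powr_sum)
  also have "... <= Fj m z1"
  unfolding Fj_def
  proof (rule prod_mono, intro conjI)
  fix k
  have "(\<Prod>i<n k. d) <= p k z1" unfolding p_def by (rule prod_mono) (use d wE in auto)
  then have "d ^ n k <= p k z1" by simp
  then have "(d ^ n k) powr c k <= p k z1 powr c k" using d cpos[of k] by (intro powr_mono2) auto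
  moreover have "(d ^ n k) powr c k = d powr ((1/2) ^ k)"
  using d n[of k] by (simp add: powr_realpow[symmetric] powr_powr c_def power_one_over)
  ultimately show "d powr ((1/2) ^ k) <= p k z1 powr c k" by simp
  qed simp
  finally show ?thesis .
  qed
  then have "d powr 2 <= Ps z1" by (intro LIMSEQ_le_const[OF lim[OF z1(1)]]) auto
  moreover have "d powr 2 > 0" using d by simp
  ultimately show ?thesis by linarith
 qed
 then have nt: "EX y:?U. lnE (Ps y) ~= -\<infinity>" using z1(1) by (intro bexI[of _ z1]) (auto simp: lnE_def)
 have "(ball 0 1 - f ` D) Int ?U <= {y\<in>?U. lnE (Ps y) = -\<infinity>}" using zero by (auto simp: lnE_def E_def)
 then show "EX U u. open U & connected U & a : U & subharmonic_on u U & (EX z:U. u z ~= -\<infinity>) & (ball 0 1 - f ` D) Int U <= {z\<in>U. u z = -\<infinity>}"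
  using subPs nt rh(1) by (intro exI[of _ ?U] exI[of _ "%y. lnE (Ps y)"] conjI) auto
qed

end

section \<open>Removing polar sets\<close>

text \<open>A multiple of the subharmonic \<open>v\<close> pays for the unknown behaviour of
  \<open>H\<close> near \<open>P\<close>. The harmonic function (h - H) / ep + C majorizes
  \<open>v\<close> on the disc minus a neighbourhood of \<open>P\<close> where \<open>v\<close> is
  very negative. Letting \<open>ep\<close> tend to 0 gives the bound where \<open>v\<close> is
  finite; that set is dense, and continuity gives the rest.\<close>

lemma harmonic_majorant_off_polar:
 assumes U: "open U" "connected U" and v: "subharmonic_on v U" "z1 : U" "v z1 ~= -\<infinity>"
  and Om: "open Om" "U Int W - P <= Om" and P: "P Int U <= {z\<in>U. v z = -\<infinity>}" "!!C. compact C ==> C <= W ==> compact (P Int C)"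
  and a: "cball a R <= U Int W"
  and H: "harmonic_on H Om" "!!w. w : Om ==> H w <= B" and OmP: "Om Int P = {}"
  and h: "continuous_on (cball a R) h" "harmonic_on h (ball a R)"
  and le: "!!w. w : sphere a R ==> w : Om ==> H w <= h w" and w: "w : ball a R" "w : Om"
 shows "H w <= h w"
proof -
 obtain C where C: "!!x. x : cball a R ==> v x <= ereal C"
  using subharmonic_on_bounded_above[OF v(1) U(1) compact_cball, of a R] a by blast
 have R: "R > 0" using w(1) le_less_trans[OF zero_le_dist] by auto
 have "EX x:cball a R. ALL y:cball a R. h x <= h y"
  by (rule continuous_attains_inf[OF compact_cball _ h(1)]) (use R in auto)
 then obtain x0 where x0: "ALL y:cball a R. h x0 <= h y" by (elim bexE)
 have finite_case: "H w <= h w" if w: "w : ball a R" "w : Om" and fin: "v w ~= -\<infinity>" for w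
 proof -
  have vw: "v w <= ereal C" using C w by auto
  then obtain y where y: "v w = ereal y" using fin by (cases "v w") auto
  have key: "H w <= h w + ep * (C - y)" if ep: "ep > 0" for ep
  proof -
  \<comment> \<open>The second entry makes -T a lower bound for the majorant, so that v < -T near
    \<open>P\<close> suffices there; the first keeps \<open>w\<close>, where v = y, out of that
    neighbourhood.\<close>
  define T where "T = max (1 - y) ((B - h x0) / ep - C)"
  define N where "N = {z\<in>U. v z < ereal (- T)}"
  have N: "open N" unfolding N_def by (rule subharmonic_on_open[OF v(1) U(1)])
  have cP: "compact (P Int cball a R)" by (rule P(2)) (use a in auto)
  have "P Int cball a R <= N" using P(1) a unfolding N_def by force
  then obtain e where e: "e > 0" "(\<Union>x\<in>P Int cball a R. ball x e) <= N"
  using compact_subset_open_imp_ball_epsilon_subset[OF cP N] by blast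
  define N' where "N' = (\<Union>x\<in>P Int cball a R. ball x (e/2))"
  have oN': "open N'" unfolding N'_def by auto
  have cN': "closure N' <= N"
  proof
  fix x assume "x : closure N'"
  then obtain x' where x': "x' : N'" "dist x' x < e/2" using e(1) closure_approachable[of x N'] by (meson half_gt_zero)
  then obtain p where p: "p : P Int cball a R" "dist p x' < e/2" unfolding N'_def by auto
  have "dist p x < e" using dist_triangle[of p x x'] x'(2) p(2) by linarith
  then have "x : ball p e" by simp
  then show "x : N" using e(2) p(1) by blast
  qed
  define K where "K = cball a R - N'"
  have K: "compact K" unfolding K_def by (rule compact_diff[OF compact_cball oN'])
  have PN': "P Int cball a R <= N'" unfolding N'_def using e(1) by auto
  have KOm: "K <= Om" using PN' a Om(2) unfolding K_def by auto
  have KU: "K <= U" using a unfolding K_def by auto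
  have "ereal (- T) < v w" unfolding y by (simp add: T_def)
  then have "w ~: N" unfolding N_def by auto
  then have wK: "w : K" using w closure_subset[of N'] cN' unfolding K_def by auto
  define k where "k x = (1 / ep) * (h x - H x) + C" for x
  have iK: "interior K <= ball a R" using interior_mono[of K "cball a R"] by (auto simp: K_def)
  have "v w <= ereal (k w)"
  proof (rule subharmonic_onD[OF v(1) K KU _ _ _ wK])
  show "continuous_on K k"
  unfolding k_def using continuous_on_subset[OF h(1), of K] continuous_on_subset[OF harmonic_on_continuous[OF Om(1) H(1)] KOm]
  by (intro continuous_intros) (auto simp: K_def)
  show "harmonic_on k (interior K)"
  unfolding k_def
  by (intro harmonic_on_add harmonic_on_cmult harmonic_on_diff harmonic_on_const open_interior
  harmonic_on_subset[OF h(2) open_ball iK] harmonic_on_subset[OF H(1) Om(1) order_trans[OF interior_subset KOm]])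
  fix x assume x: "x : frontier K"
  have xK: "x : K" using x compact_imp_closed[OF K] by (simp add: frontier_def)
  show "v x <= ereal (k x)"
  proof (cases "x : N")
  case True
  have "h x0 <= h x" "H x <= B" using x0 xK H(2) KOm by (auto simp: K_def)
  then have "(h x0 - B) / ep <= (h x - H x) / ep" using ep by (intro divide_right_mono) auto
  moreover have "- T <= (h x0 - B) / ep + C"
  proof -
  have "(B - h x0) / ep - C <= T" by (simp add: T_def)
  moreover have "(h x0 - B) / ep = - ((B - h x0) / ep)" by (simp add: diff_divide_distrib)
  ultimately show ?thesis by linarith
  qed
  ultimately have "- T <= k x" by (simp add: k_def)
  then have "ereal (- T) <= ereal (k x)" by simp
  moreover have "v x <= ereal (- T)" using True unfolding N_def mem_Collect_eq by (elim conjE less_imp_le)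
  ultimately show ?thesis by (rule order_trans[rotated])
  next
  case False
  have "x : sphere a R"
  proof (rule ccontr)
  assume "x ~: sphere a R"
  then have "x : ball a R - closure N'" using xK False cN' by (auto simp: K_def)
  moreover have "open (ball a R - closure N')" by (intro open_Diff) auto
  moreover have "ball a R - closure N' <= K" using closure_subset[of N'] by (auto simp: K_def)
  ultimately have "x : interior K" by (intro interiorI)
  then show False using x by (simp add: frontier_def)
  qed
  then have "H x <= h x" using le xK KOm by auto
  then have "ereal C <= ereal (k x)" using ep by (simp add: k_def)
  moreover have "v x <= ereal C" using C xK by (auto simp: K_def)
  ultimately show ?thesis by (rule order_trans[rotated])
  qed
  qed
  then have "y <= (h w - H w) / ep + C" by (simp add: y k_def)
  then have "(y - C) * ep <= h w - H w" using ep by (simp add: field_simps)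
  then show ?thesis by (simp add: algebra_simps)
  qed
  show ?thesis
  proof (rule field_le_epsilon)
  fix e :: real assume e: "e > 0"
  have "H w <= h w + e / (\<bar>C - y\<bar> + 1) * (C - y)" by (rule key) (use e in \<open>simp add: add_nonneg_pos\<close>)
  also have "e / (\<bar>C - y\<bar> + 1) * (C - y) <= e / (\<bar>C - y\<bar> + 1) * (\<bar>C - y\<bar> + 1)"
  using e by (intro mult_left_mono) auto
  also have "... = e"
  proof -
  have "\<bar>C - y\<bar> + 1 ~= 0" by linarith
  then show ?thesis by simp
  qed
  finally show "H w <= h w + e" by simp
  qed
 qed
 show ?thesis
 proof (rule ccontr)
  assume n: "~ H w <= h w"
  \<comment> \<open>A violation would persist on an open set, where v = -\<infinity> by the finite
    case; such a set is empty.\<close>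
  define G where "G = (ball a R Int Om) Int (%x. H x - h x) -` {0<..}"
  have "continuous_on (ball a R Int Om) (%x. H x - h x)"
  by (intro continuous_on_diff continuous_on_subset[OF harmonic_on_continuous[OF Om(1) H(1)]] continuous_on_subset[OF h(1)]) auto
  then have "open G" unfolding G_def using Om(1) by (intro continuous_open_preimage open_Int) auto
  moreover have "G <= {z\<in>U. v z = -\<infinity>}"
  proof
  fix x assume x: "x : G"
  then have "v x = -\<infinity>" using finite_case[of x] by (auto simp: G_def)
  then show "x : {z\<in>U. v z = -\<infinity>}" using x a by (auto simp: G_def)
  qed
  ultimately have "G <= interior {z\<in>U. v z = -\<infinity>}" by (rule interior_maximal[rotated])
  moreover have "w : G" using n w by (simp add: G_def)
  ultimately show False using subharmonic_on_minus_infinity_interior[OF v(1) U v(2,3)] by blast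
 qed
qed

text \<open>The Poisson kernel with its pole slightly outside the circle.\<close>

lemma poisson_barrier:
 fixes ta :: real
 assumes ta: "ta > 0"
 obtains ka where "0 < ka" "ka <= 1" "!!ze. cmod ze = 1 ==> Re ((of_real (1 + ka) + ze) / (of_real (1 + ka) - ze)) <= 3 / ka"
  "!!ze. cmod ze = 1 ==> ta <= cmod (ze - 1) ==> Re ((of_real (1 + ka) + ze) / (of_real (1 + ka) - ze)) <= 1 / 2"
proof -
 \<comment> \<open>On the unit circle the kernel is (2 ka + ka^2) / |1 + ka - ze|^2, with numerator
   at most 3 ka. The bound ta^2 / 24 makes it at most 1 / 2 at distance ta from 1, below the value 1
   at the centre; this gap drives the later comparison.\<close>
 define ka where "ka = min 1 (min (ta / 2) (ta\<^sup>2 / 24))"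
 have ka: "0 < ka" "ka <= 1" "ka <= ta / 2" "ka <= ta\<^sup>2 / 24" using ta by (auto simp: ka_def)
 have eq: "Re ((of_real (1 + ka) + ze) / (of_real (1 + ka) - ze)) = (2 * ka + ka\<^sup>2) / (cmod (of_real (1 + ka) - ze))\<^sup>2"
  if "cmod ze = 1" for ze
 proof -
  have n: "(Re ze)\<^sup>2 + (Im ze)\<^sup>2 = 1" using that by (simp add: cmod_def)
  have "(1 + ka + Re ze) * (1 + ka - Re ze) + Im ze * (- Im ze) = 1 + 2 * ka + ka\<^sup>2 - ((Re ze)\<^sup>2 + (Im ze)\<^sup>2)"
  by (simp add: p2eq algebra_simps)
  then have "(1 + ka + Re ze) * (1 + ka - Re ze) + Im ze * (- Im ze) = 2 * ka + ka\<^sup>2" unfolding n by simp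
  then show ?thesis by (simp add: Re_divide cmod_power2)
 qed
 have k3: "2 * ka + ka\<^sup>2 <= 3 * ka" using mult_left_mono[OF ka(2), of ka] ka(1) by (simp add: p2eq)
 show thesis
 proof (rule that[OF ka(1,2)])
  fix ze :: complex assume ze: "cmod ze = 1"
  have "ka <= cmod (of_real (1 + ka) - ze)"
  using norm_triangle_ineq2[of "of_real (1 + ka)" ze] ze ka(1) by (simp only: norm_of_real; simp)
  then have "ka\<^sup>2 <= (cmod (of_real (1 + ka) - ze))\<^sup>2" using ka(1) by (intro power_mono) auto
  then have "(2 * ka + ka\<^sup>2) / (cmod (of_real (1 + ka) - ze))\<^sup>2 <= (3 * ka) / ka\<^sup>2"
  using ka(1) k3 by (intro frac_le) auto
  also have "... = 3 / ka" using ka(1) by (simp add: p2eq)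
  finally show "Re ((of_real (1 + ka) + ze) / (of_real (1 + ka) - ze)) <= 3 / ka" unfolding eq[OF ze] .
  assume far: "ta <= cmod (ze - 1)"
  have "cmod (ze - 1) <= cmod (of_real (1 + ka) - ze) + cmod (of_real ka)"
  using norm_triangle_ineq4[of "of_real ka" "of_real (1 + ka) - ze"] by simp
  then have "ta / 2 <= cmod (of_real (1 + ka) - ze)" using far ka(1,3) by (simp only: norm_of_real; simp)
  then have "(ta / 2)\<^sup>2 <= (cmod (of_real (1 + ka) - ze))\<^sup>2" using ta by (intro power_mono) auto
  then have "(2 * ka + ka\<^sup>2) / (cmod (of_real (1 + ka) - ze))\<^sup>2 <= (3 * (ta\<^sup>2 / 24)) / (ta / 2)\<^sup>2"
  using ka k3 ta by (intro frac_le) auto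
  also have "... = 1 / 2" using ta by (simp add: p2eq field_simps)
  finally show "Re ((of_real (1 + ka) + ze) / (of_real (1 + ka) - ze)) <= 1 / 2" unfolding eq[OF ze] .
 qed
qed

text \<open>The points near which \<open>H\<close> stays below its supremum form a set that is open and, by comparison
  with a barrier, closed.\<close>

lemma harmonic_off_polar_nonpos:
 assumes P: "closedin (top_of_set (ball 0 1)) P" "polar P"
  and H: "harmonic_on H (ball 0 1 - P)" "!!w. w : ball 0 1 - P ==> H w <= B"
  and bd: "!!e. e > 0 ==> EX rh<1. ALL w:ball 0 1 - P. rh <= cmod w --> H w <= e"
  and w0: "w0 : ball 0 1 - P"
 shows "H w0 <= 0"
proof (rule ccontr)
 assume "~ H w0 <= 0"
 define Om where "Om = ball 0 1 - P"
 have P1: "P <= ball 0 1" using closedin_imp_subset[OF P(1)] .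
 obtain Q where Q: "closed Q" "P = ball 0 1 Int Q" using P(1) unfolding closedin_closed by auto
 have "Om = ball 0 1 - Q" unfolding Om_def Q(2) by auto
 then have oOm: "open Om" using Q(1) by (simp add: open_Diff)
 have Pc: "compact (P Int C)" if "compact C" "C <= ball 0 1" for C
 proof -
  have "P Int C = C Int Q" using that(2) Q(2) by auto
  then show ?thesis using compact_Int_closed[OF that(1) Q(1)] by simp
 qed
 define S where "S = (SUP w\<in>Om. H w)"
 have bdd: "bdd_above (H ` Om)" by (rule bdd_aboveI2[where M = B]) (simp add: H(2) Om_def)
 have HS: "H w <= S" if "w : Om" for w unfolding S_def by (rule cSUP_upper[OF that bdd])
 have S: "S > 0" using HS[of w0] w0 \<open>\<not> H w0 \<le> 0\<close> by (simp add: Om_def)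
 \<comment> \<open>Points near which \<open>H\<close> stays below its supremum, graded by the
   amount. Points of \<open>P\<close> may belong as well, since only values off \<open>P\<close> are
   restricted.\<close>
 define A where "A n = \<Union> {V. open V & (ALL w:V Int Om. H w <= S - 1 / real (Suc n))}" for n
 have oA: "open (A n)" for n unfolding A_def by auto
 have A: "H w <= S - 1 / real (Suc n)" if "w : A n" "w : Om" for w n using that unfolding A_def by blast
 have AI: "w : A n" if "open V" "w : V" "ALL w:V Int Om. H w <= S - 1 / real (Suc n)" for w V n using that unfolding A_def by blast
 have AI': "EX n. w : A n" if V: "open V" "w : V" "ALL w:V Int Om. H w <= S - dl" and d: "dl > 0" for w V dl
 proof -
  obtain n where "1 / real (Suc n) < dl" using d nat_approx_posE by blast
  then have "ALL w:V Int Om. H w <= S - 1 / real (Suc n)" using V(3) by force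
  then show ?thesis using AI[OF V(1,2)] by blast
 qed
 define N where "N = ball 0 1 Int (\<Union>n. A n)"
 obtain rh where rh: "rh < 1" "ALL w:Om. rh <= cmod w --> H w <= S / 2" using bd[of "S / 2"] S unfolding Om_def by auto
 have "N ~= {}"
 proof -
  define r where "r = (1 + max rh 0) / 2"
  have r: "rh < r" "0 < r" "r < 1" using rh(1) by (auto simp: r_def)
  have "open {w::complex. rh < cmod w}" by (intro open_Collect_less continuous_intros)
  moreover have "ALL w:{w. rh < cmod w} Int Om. H w <= S - S / 2" using rh(2) by auto
  ultimately have "EX n. of_real r : A n" using AI'[of "{w. rh < cmod w}" "of_real r" "S / 2"] r S by simp
  then have "cor r : N" using r by (auto simp: N_def)
  then show ?thesis by blast
 qed
 moreover have "openin (top_of_set (ball 0 1)) N" unfolding N_def by (intro open_subset open_Int open_UN ballI oA) auto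
 moreover have "closedin (top_of_set (ball 0 1)) N"
  unfolding closedin_limpt
 proof (intro conjI allI impI)
  show "N <= ball 0 1" by (auto simp: N_def)
  fix a assume a: "a islimpt N & a : ball 0 1"
  \<comment> \<open>At a point off \<open>P\<close> a constant plays the role of the potential, so
    that both kinds of points are treated alike.\<close>
  have "EX U v z1. open U & connected U & a : U & subharmonic_on v U & z1 : U & v z1 ~= -\<infinity> & P Int U <= {z\<in>U. v z = -\<infinity>}"
  proof (cases "a : P")
  case True
  then have "EX U u. open U & connected U & a : U & subharmonic_on u U & (EX z:U. u z ~= -\<infinity>) & P Int U <= {z\<in>U. u z = -\<infinity>}"
  using P(2) unfolding polar_def by (rule bspec[rotated])
  then show ?thesis by auto
  next
  case False
  then have "a : Om" using a by (simp add: Om_def)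
  then obtain r where r: "r > 0" "ball a r <= Om" by (rule openE[OF oOm])
  have "subharmonic_on (%z. lnE 1) (ball a r)"
  proof (rule subharmonic_on_lnE)
  have "{z\<in>ball a r. (1::real) ~= 0} = ball a r" by auto
  then show "harmonic_on (%z. ln 1) {z\<in>ball a r. (1::real) ~= 0}" using harmonic_on_const[OF open_ball] by simp
  qed simp_all
  moreover have "lnE 1 ~= -\<infinity>" by (simp add: lnE_def)
  moreover have "P Int ball a r = {}" using r(2) by (auto simp: Om_def)
  ultimately show ?thesis using r(1) by (intro exI[of _ "ball a r"] exI[of _ "%z. lnE 1"] exI[of _ a]) auto
  qed
  then obtain U v z1 where U: "open U" "connected U" "a : U" and v: "subharmonic_on v U" "z1 : U" "v z1 ~= -\<infinity>"
  and PU: "P Int U <= {z\<in>U. v z = -\<infinity>}" by (elim exE conjE)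
  have "open (U Int ball 0 1)" "a : U Int ball 0 1" using U a by auto
  then obtain r where r: "r > 0" "ball a r <= U Int ball 0 1" by (rule openE)
  obtain b where b: "b : N" "b ~= a" "dist b a < r" using a r(1) unfolding islimpt_approachable by blast
  \<comment> \<open>This puts \<open>b\<close> on the circle of radius \<open>R\<close> about
    \<open>a\<close>; near \<open>b\<close> the function \<open>H\<close> is at most S - dl.\<close>
  define R where "R = cmod (b - a)"
  have R: "R > 0" "R < r" using b by (auto simp: R_def dist_norm)
  have aR: "cball a R <= U Int ball 0 1" using r(2) R(2) by auto
  obtain n where "b : A n" using b(1) by (auto simp: N_def)
  then obtain t where t: "t > 0" "ball b t <= A n" by (rule openE[OF oA])
  define dl where "dl = 1 / real (Suc n)"
  have dl: "dl > 0" by (simp add: dl_def)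
  obtain ka where ka: "0 < ka" "ka <= 1" "!!ze. cmod ze = 1 ==> Re ((of_real (1 + ka) + ze) / (of_real (1 + ka) - ze)) <= 3 / ka"
  "!!ze. cmod ze = 1 ==> t / R <= cmod (ze - 1) ==> Re ((of_real (1 + ka) + ze) / (of_real (1 + ka) - ze)) <= 1 / 2"
  by (rule poisson_barrier[of "t / R"]) (use t R in simp, rule that)
  define ze where "ze w = (w - a) / (b - a)" for w
  define p where "p w = (of_real (1 + ka) + ze w) / (of_real (1 + ka) - ze w)" for w
  \<comment> \<open>Scaled so that the barrier loses at most \<open>dl\<close> near
    \<open>b\<close>. Elsewhere on the circle Re p <= 1 / 2 and so h >= S, while p = 1 at the centre
    puts h strictly below S.\<close>
  define h where "h w = S + (- (dl * ka / 3)) * (Re (p w) - 1 / 2)" for w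
  have zen: "cmod (ze w) = cmod (w - a) / R" for w by (simp add: ze_def R_def norm_divide)
  have pnz: "of_real (1 + ka) - ze w ~= 0" if "w : cball a R" for w
  proof
  assume "of_real (1 + ka) - ze w = 0"
  then have "cmod (ze w) = cmod (of_real (1 + ka))" by simp
  then have "cmod (ze w) = 1 + ka" using ka(1) by (simp only: norm_of_real)
  moreover have "cmod (ze w) <= 1" unfolding zen using that R by (simp add: dist_norm norm_minus_commute)
  ultimately show False using ka(1) by simp
  qed
  have ph: "p holomorphic_on ball a R" "continuous_on (cball a R) p"
  unfolding p_def ze_def using pnz b(2)
  by (auto intro!: holomorphic_intros continuous_intros simp: ze_def)
  have hc: "continuous_on (cball a R) h" unfolding h_def by (intro continuous_intros ph(2))
  have hh: "harmonic_on h (ball a R)"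
  unfolding h_def by (intro harmonic_on_add harmonic_on_cmult harmonic_on_diff harmonic_on_const harmonic_on_Re_holomorphic ph(1) open_ball)
  have dk: "dl * ka / 3 > 0" using dl ka by simp
  have main: "H w <= h w" if "w : ball a R" "w : Om" for w
  proof (rule harmonic_majorant_off_polar[OF U(1,2) v oOm _ PU Pc aR, of H B])
  show "U Int ball 0 1 - P <= Om" by (auto simp: Om_def)
  show "harmonic_on H Om" using H(1) by (simp add: Om_def)
  show "H w <= B" if "w : Om" for w using H(2) that by (simp add: Om_def)
  show "Om Int P = {}" by (auto simp: Om_def)
  show "H x <= h x" if x: "x : sphere a R" "x : Om" for x
  proof -
  define q where "q = (dl * ka / 3) * (Re (p x) - 1 / 2)"
  have hq: "h x = S - q" by (simp add: h_def q_def)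
  have z1: "cmod (ze x) = 1" unfolding zen using x R by (simp add: dist_norm norm_minus_commute)
  show ?thesis
  proof (cases "x : ball b t")
  case True
  have "H x <= S - dl" unfolding dl_def by (rule A[OF _ x(2)]) (use True t in auto)
  moreover have "q <= (dl * ka / 3) * (3 / ka)"
  using ka(3)[OF z1] dk unfolding q_def p_def by (intro mult_left_mono) auto
  moreover have "(dl * ka / 3) * (3 / ka) = dl" using ka by simp
  ultimately show ?thesis unfolding hq by linarith
  next
  case False
  have "ze x - 1 = (x - b) / (b - a)" using b(2) by (simp add: ze_def field_simps)
  then have "t / R <= cmod (ze x - 1)"
  using False R by (simp add: norm_divide R_def dist_norm norm_minus_commute divide_right_mono)
  then have "Re (p x) <= 1 / 2" using ka(4)[OF z1] by (simp add: p_def)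
  then have "q <= 0" unfolding q_def using dk by (intro mult_nonneg_nonpos) auto
  then show ?thesis using HS[OF x(2)] unfolding hq by linarith
  qed
  qed
  qed (use that hc hh in auto)
  have pa: "p a = 1" using ka(1) by (simp add: p_def ze_def) (metis add_pos_pos of_real_eq_0_iff of_real_1 of_real_add order_less_irrefl zero_less_one)
  define gq where "gq = dl * ka / 12"
  have gq: "gq > 0" using dk by (simp add: gq_def)
  have ha: "h a < S - gq" unfolding h_def pa gq_def using dk by simp
  have "continuous_on (ball a R) h" using hc ball_subset_cball by (rule continuous_on_subset)
  then have "open (ball a R Int h -` {..<S - gq})" by (rule continuous_open_preimage) auto
  moreover have "a : ball a R Int h -` {..<S - gq}" using ha R by simp
  moreover have "ALL w:(ball a R Int h -` {..<S - gq}) Int Om. H w <= S - gq"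
  proof
  fix w assume "w : (ball a R Int h -` {..<S - gq}) Int Om"
  then show "H w <= S - gq" using main[of w] by auto
  qed
  ultimately have "EX n. a : A n" using gq by (rule AI')
  then show "a : N" using a by (auto simp: N_def)
 qed
 \<comment> \<open>The disc is connected, so \<open>H\<close> is locally bounded away from
   \<open>S\<close> everywhere. Compactness of an inner disc and the bound near the circle then
   contradict that \<open>S\<close> is the supremum.\<close>
 ultimately have N: "N = ball 0 1" using connected_ball[of "0::complex" 1] unfolding connected_clopen by blast
 have "cball 0 rh <= (\<Union>n\<in>UNIV. A n)"
 proof
  fix x :: complex assume "x : cball 0 rh"
  then have "x : N" using rh(1) unfolding N by auto
  then show "x : (\<Union>n\<in>UNIV. A n)" by (simp add: N_def)
 qed
 then obtain I where I: "finite I" "cball 0 rh <= (\<Union>n\<in>I. A n)"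
  using compactE_image[OF compact_cball, of UNIV A 0 rh] oA by auto
 define m where "m = Max (insert 0 I)"
 have HA: "H w <= max (S / 2) (S - 1 / real (Suc m))" if w: "w : Om" for w
 proof (cases "rh <= cmod w")
  case True
  then show ?thesis using rh(2) w by force
 next
  case False
  then have "w : cball 0 rh" by simp
  then have "w : (\<Union>n\<in>I. A n)" using I(2) by blast
  then obtain n where n: "n : I" "w : A n" by auto
  have "n <= m" unfolding m_def using n I(1) by (intro Max_ge) auto
  then have "1 / real (Suc m) <= 1 / real (Suc n)" by (intro divide_left_mono) auto
  then have "H w <= S - 1 / real (Suc m)" using A[OF n(2) w] by linarith
  then show ?thesis by simp
 qed
 have "(SUP w\<in>Om. H w) <= max (S / 2) (S - 1 / real (Suc m))"
  by (rule cSUP_least[OF _ HA]) (use w0 in \<open>auto simp: Om_def\<close>)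
 then have "S <= max (S / 2) (S - 1 / real (Suc m))" by (simp only: S_def)
 moreover have "1 / real (Suc m) > 0" by simp
 ultimately show False using S by (auto simp: max_def split: if_splits)
qed

text \<open>The polarized kernel is f'(a) g'(b) / (pi V^2), where V = 1 - f(a) g(b) and
  \<open>g\<close> is the conjugate reflection of \<open>f\<close>. Only V contributes to the mixed
  logarithmic derivative, which is 2 f' g' / V^2, that is 2 pi times the kernel. So the metric is 2
  pi K, and its logarithm has the same mixed derivative as log K, namely the metric itself.\<close>

lemma curvature_of_disc_kernel:
 assumes D: "open D" and f: "f holomorphic_on D" "f ` D <= ball 0 1" "!!z. z : D ==> deriv f z ~= 0"
  and K: "!!z. z : D ==> bergman_kernel D z = (cmod (deriv f z))\<^sup>2 / (pi * (1 - (cmod (f z))\<^sup>2)\<^sup>2)"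
 shows "bergman_metric_exists D & (ALL z:D. bergman_curvature D z = -2)"
proof -
 define B where "B = cnj ` D"
 have memB: "b : B \<longleftrightarrow> cnj b : D" for b unfolding B_def by (metis complex_cnj_cnj image_iff)
 have B: "open B"
 proof -
  have "B = cnj -` D" using memB by auto
  then show ?thesis using D open_vimage[OF D, of cnj] by (simp add: continuous_on_cnj)
 qed
 define g where "g b = cnj (f (cnj b))" for b
 define g' where "g' b = cnj (deriv f (cnj b))" for b
 have gd: "(g has_field_derivative g' b) (at b)" if "b : B" for b
  using has_field_derivative_cnj_cnj[of f "deriv f (cnj b)" b] holomorphic_derivI[OF f(1) D, of "cnj b"] that
  by (simp add: memB g_def[abs_def] g'_def o_def)
 have gh: "g holomorphic_on B" using gd B by (auto simp: holomorphic_on_open)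
 have dg: "deriv g b = g' b" if "b : B" for b using gd[OF that] by (rule DERIV_imp_deriv)
 have g'h: "g' holomorphic_on B" by (rule holomorphic_transform[OF holomorphic_deriv[OF gh B]]) (simp add: dg)
 have f'h: "deriv f holomorphic_on D" by (rule holomorphic_deriv[OF f(1) D])
 define V where "V a b = 1 - f a * g b" for a b
 have V: "hol2 V D B" unfolding V_def
  by (intro hol2_diff hol2_const hol2_mult hol2_left hol2_right f gh D B)
 have Vnz: "V a b ~= 0" if "a : D" "b : B" for a b
 proof
  assume "V a b = 0"
  then have "cmod (f a * g b) = 1" by (simp add: V_def)
  moreover have "cmod (f a) < 1" "cmod (g b) < 1" using f(2) that by (auto simp: memB g_def)
  ultimately show False by (metis mult_strict_mono' norm_ge_zero norm_mult order_less_irrefl mult_1)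
 qed
 define Fj where "Fj a b = (deriv f a * (g' b / of_real pi)) / (V a b * V a b)" for a b
 have g'h2: "(%b. g' b / of_real pi) holomorphic_on B" by (intro holomorphic_intros g'h) auto
 have Fj: "hol2 Fj D B" unfolding Fj_def
  by (intro hol2_divide hol2_mult V hol2_left[OF f'h D B] hol2_right[OF g'h2 D B]) (simp add: Vnz)
 have Fjnz: "Fj a b ~= 0" if "a : D" "b : B" for a b
  using that Vnz[OF that] f(3) by (simp add: Fj_def g'_def memB)
 have wV: "wronsk V a b = - (deriv f a * g' b)" if ab: "a : D" "b : B" for a b
 proof -
  have d2: "D2 V x b = - f x * g' b" if "x : D" for x
  unfolding D2_def V_def by (rule DERIV_imp_deriv) (auto intro!: derivative_eq_intros gd ab)
  have d1: "D1 V a b = - deriv f a * g b"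
  unfolding D1_def V_def by (rule DERIV_imp_deriv) (auto intro!: derivative_eq_intros holomorphic_derivI[OF f(1) D ab(1)])
  have "D1 (D2 V) a b = D1 (%x y. - f x * g' b) a b" by (rule D1_cong[OF D ab(1)]) (rule d2)
  also have "... = - deriv f a * g' b"
  unfolding D1_def by (rule DERIV_imp_deriv) (auto intro!: derivative_eq_intros holomorphic_derivI[OF f(1) D ab(1)])
  finally show ?thesis unfolding wronsk_def d1 d2[OF ab(1)] by (simp add: V_def algebra_simps)
 qed
 have wFj: "wronsk Fj a b / (Fj a b)\<^sup>2 = 2 * of_real pi * Fj a b" if ab: "a : D" "b : B" for a b
 proof -
  have VV: "hol2 (%a b. V a b * V a b) D B" by (intro hol2_mult V)
  have "wronsk (%a b. Fj a b * (V a b * V a b)) a b = wronsk (%a b. deriv f a * (g' b / of_real pi)) a b"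
  by (rule wronsk_cong[OF D B ab]) (simp add: Fj_def Vnz)
  also have "... = 0"
  by (subst wronsk_mult[OF hol2_left[OF f'h D B] hol2_right[OF g'h2 D B] ab]) simp
  finally have 0: "wronsk Fj a b * (V a b * V a b)\<^sup>2 + (Fj a b)\<^sup>2 * (wronsk V a b * (V a b)\<^sup>2 + (V a b)\<^sup>2 * wronsk V a b) = 0"
  unfolding wronsk_mult[OF Fj VV ab] wronsk_mult[OF V V ab] .
  have "deriv f a * g' b = of_real pi * Fj a b * (V a b * V a b)" using Vnz[OF ab] by (simp add: Fj_def)
  then have "wronsk V a b = - (of_real pi * Fj a b * (V a b * V a b))" using wV[OF ab] by simp
  with 0 have "(wronsk Fj a b - 2 * of_real pi * Fj a b * (Fj a b)\<^sup>2) * (V a b * V a b)\<^sup>2 = 0"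
  by (simp add: algebra_simps p2eq)
  then have "wronsk Fj a b = 2 * of_real pi * Fj a b * (Fj a b)\<^sup>2" using Vnz[OF ab] by simp
  then show ?thesis using Fjnz[OF ab] by simp
 qed
 have Kpos: "bergman_kernel D z > 0" if "z : D" for z
 proof -
  have "cmod (f z) < 1" using f(2) that by auto
  then have "(cmod (f z))\<^sup>2 < 1" by (simp add: abs_square_less_1)
  then show ?thesis using f(3)[OF that] by (simp add: K[OF that])
 qed
 have diag: "Fj w (cnj w) = of_real (bergman_kernel D w)" if "w : D" for w
 proof -
  have "V w (cnj w) = of_real (1 - (cmod (f w))\<^sup>2)" by (simp add: V_def g_def complex_norm_square[symmetric])
  moreover have "deriv f w * g' (cnj w) = of_real ((cmod (deriv f w))\<^sup>2)" by (simp add: g'_def complex_norm_square[symmetric])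
  ultimately show ?thesis unfolding Fj_def K[OF that] by (simp add: p2eq del: of_real_diff; simp add: field_simps)
 qed
 have UB: "!!w. w : D ==> w : D & cnj w : B" by (simp add: memB)
 have metric: "bergman_metric D z = 2 * pi * bergman_kernel D z" if z: "z : D" for z
 proof -
  have "bergman_metric D z = Re (wronsk Fj z (cnj z) / (Fj z (cnj z))\<^sup>2)"
  unfolding bergman_metric_def by (rule ddbar_ln_hol2[OF Fj z D UB diag Kpos])
  also have "... = 2 * pi * bergman_kernel D z" using wFj[of z "cnj z"] UB[OF z] diag[OF z] by simp
  finally show ?thesis .
 qed
 have mpos: "bergman_metric D z > 0" if "z : D" for z using metric[OF that] Kpos[OF that] by simp
 have curv: "bergman_curvature D z = -2" if z: "z : D" for z
 proof -
  define c where "c = cor (2 * pi)"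
  have c0: "c ~= 0" by (simp add: c_def)
  have h: "hol2 (%a b. c * Fj a b) D B" by (rule hol2_cmult[OF Fj])
  have "ddbar (%w. ln (bergman_metric D w)) z = Re (wronsk (%a b. c * Fj a b) z (cnj z) / (c * Fj z (cnj z))\<^sup>2)"
  by (rule ddbar_ln_hol2[OF h z D UB _ mpos]) (simp_all add: diag metric c_def)
  also have "wronsk (%a b. c * Fj a b) z (cnj z) = c\<^sup>2 * wronsk Fj z (cnj z)"
  using wronsk_mult[OF hol2_const[OF D B, of c] Fj z] UB[OF z] wronsk_left[of "%_. c"] by simp
  also have "c\<^sup>2 * wronsk Fj z (cnj z) / (c * Fj z (cnj z))\<^sup>2 = wronsk Fj z (cnj z) / (Fj z (cnj z))\<^sup>2"
  using c0 by (simp add: power_mult_distrib)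
  also have "Re ... = bergman_metric D z" using wFj[of z "cnj z"] UB[OF z] diag[OF z] metric[OF z] by simp
  finally show ?thesis unfolding bergman_curvature_def using mpos[OF z] by simp
 qed
 show ?thesis unfolding bergman_metric_exists_def using Kpos mpos curv by blast
qed

section \<open>Comparison with the Green function of the disc\<close>

text \<open>With the normalized map \<open>F\<close>, the difference of \<open>G\<close> and log |F|
  extends harmonically across \<open>z0\<close>. Away from the pole it is at most - log |F|, so it
  is bounded above and its upper limits at the unit circle are at most 0. Transported to the disc
  minus \<open>P\<close> it is nonpositive by \<open>harmonic_off_polar_nonpos\<close>; maximality
  of \<open>G\<close> gives the other inequality.\<close>

lemma log_capacity_disc_less_polar:
 assumes D: "open D" and z0: "z0 : D" and G: "is_green D z0 G"
  and P: "closedin (top_of_set (ball 0 1)) P" "polar P"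
  and f: "f holomorphic_on D" and g: "g holomorphic_on ball 0 1 - P"
  and fg: "!!z. z : D ==> f z : ball 0 1 - P & g (f z) = z" and gf: "!!w. w : ball 0 1 - P ==> g w : D & f (g w) = w"
 shows "log_capacity D z0 = cmod (deriv f z0) / (1 - (cmod (f z0))\<^sup>2)" and "deriv f z0 ~= 0"
proof -
 define Om where "Om = ball 0 1 - P"
 obtain Q where Q: "closed Q" "P = ball 0 1 Int Q" using P(1) unfolding closedin_closed by auto
 have "Om = ball 0 1 - Q" unfolding Om_def Q(2) by auto
 then have oOm: "open Om" using Q(1) by (simp add: open_Diff)
 define a where "a = f z0"
 have f1: "cmod (f z) < 1" if "z : D" for z using fg[OF that] by simp
 have a1: "cmod a < 1" unfolding a_def by (rule f1[OF z0])
 have inj: "inj_on f D" using fg by (metis inj_onI)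
 show df: "deriv f z0 ~= 0" by (rule holomorphic_injective_imp_regular[OF f D inj z0])
 define fi where "fi = Moebius_function 0 a"
 define ps where "ps = Moebius_function 0 (- a)"
 have fih: "fi holomorphic_on ball 0 1" unfolding fi_def by (rule Moebius_function_holomorphic[OF a1])
 have psh: "ps holomorphic_on ball 0 1" unfolding ps_def by (rule Moebius_function_holomorphic) (simp add: a1)
 have fi1: "cmod (fi w) < 1" if "cmod w < 1" for w unfolding fi_def by (rule Moebius_function_norm_lt_1[OF a1 that])
 have ps1: "cmod (ps w) < 1" if "cmod w < 1" for w
  unfolding ps_def by (rule Moebius_function_norm_lt_1[OF _ that]) (simp add: a1)
 have psfi: "ps (fi w) = w" if "cmod w < 1" for w
  unfolding ps_def fi_def by (rule Moebius_function_compose) (use a1 that in auto)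
 have ps0: "ps 0 = a" by (simp add: ps_def Moebius_function_of_zero)
 define F where "F z = fi (f z)" for z
 have fd: "f ` D <= ball 0 1" using f1 by auto
 have psF: "ps (F z) = f z" if "z : D" for z unfolding F_def by (rule psfi[OF f1[OF that]])
 have na: "1 - cnj a * a = cor (1 - (cmod a)\<^sup>2)" by (simp add: complex_norm_square[symmetric] mult.commute)
 have "(cmod a)\<^sup>2 < 1" using a1 by (simp add: abs_square_less_1)
 then have na0: "1 - cnj a * a ~= 0" unfolding na of_real_eq_0_iff by simp
 \<comment> \<open>The derivative of the Moebius map at \<open>a\<close> is 1 / (1 - |a|^2), the
   source of the denominator in the capacity.\<close>
 have "((%z. (f z - a) / (1 - cnj a * f z)) has_field_derivative deriv f z0 / (1 - cnj a * a)) (at z0)"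
  using na0 by (auto intro!: derivative_eq_intros holomorphic_derivI[OF f D z0] simp: a_def[symmetric] p2eq)
 moreover have "F = (%z. (f z - a) / (1 - cnj a * f z))" by (simp add: F_def[abs_def] fi_def Moebius_function_simple)
 ultimately have dFe: "deriv F z0 = deriv f z0 / (1 - cnj a * a)" by (simp add: DERIV_imp_deriv)
 interpret disc_map D z0 F
 proof
  show "F holomorphic_on D" using hol_compose[OF f fih fd] by (simp add: F_def[abs_def] o_def)
  show "F ` D <= ball 0 1" using fi1 f1 by (auto simp: F_def)
  show "F z0 = 0" by (simp add: F_def fi_def a_def Moebius_function_eq_zero)
  show "z = z0" if "z : D" "F z = 0" for z
  proof -
  have "f z = f z0" using psF[OF that(1)] that(2) ps0 by (simp add: a_def)
  then show ?thesis using inj that(1) z0 by (simp add: inj_on_def)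
  qed
  show "deriv F z0 ~= 0" unfolding dFe using df na0 by simp
 qed (use D z0 in auto)
 have Finj: "inj_on F D" using psF inj by (metis inj_on_def)
 note G' = G[unfolded is_green_def]
 have Gs: "neg_subharmonic_with_pole D z0 G" using G' by (elim conjE)
 have Gf: "\<bar>G z\<bar> ~= \<infinity>" if "z : D - {z0}" for z using G'[THEN conjunct2, THEN conjunct1] that by (rule bspec)
 have Gh: "harmonic_on (%z. real_of_ereal (G z)) (D - {z0})" using G' by (elim conjE)
 have Gm: "u z <= G z" if "neg_subharmonic_with_pole D z0 u" "z : D" for u z
  using G'[THEN conjunct2, THEN conjunct2, THEN conjunct2] that by simp
 have Gneg: "real_of_ereal (G z) < 0" if "z : D" "z ~= z0" for z
 proof -
  have "G z < 0" using Gs that(1) by (simp add: neg_subharmonic_with_pole_def)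
  then show ?thesis using Gf[of z] that by (cases "G z") auto
 qed
 have "has_log_pole G z0" using Gs by (simp add: neg_subharmonic_with_pole_def)
 then obtain r0 h0 where r0: "r0 > 0" "harmonic_on h0 (ball z0 r0)" "ALL z:ball z0 r0 - {z0}. G z = ereal (ln (cmod (z - z0)) + h0 z)"
  unfolding has_log_pole_def by (elim exE conjE)
 obtain R where R: "R > 0" "ball z0 R <= D" using D z0 by (rule openE)
 define r where "r = min r0 R"
 have r: "r > 0" "ball z0 r <= ball z0 r0" "ball z0 r <= D" using r0(1) R by (auto simp: r_def)
 \<comment> \<open>At \<open>z0\<close>, where both logarithms are singular, the value is the
   difference of their regular parts.\<close>
 define Hd where "Hd z = (if z = z0 then h0 z0 - ln (cmod (F1 z0)) else real_of_ereal (G z) - ln (cmod (F z)))" for z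
 have Hdh: "harmonic_on Hd D"
 proof (rule harmonic_on_local[OF D])
  fix z assume z: "z : D"
  show "EX T. open T & z : T & harmonic_on Hd T"
  proof (cases "z = z0")
  case True
  have "harmonic_on Hd (ball z0 r)"
  proof (rule harmonic_on_cong[OF open_ball])
  show "harmonic_on (%z. h0 z - ln (cmod (F1 z))) (ball z0 r)"
  by (intro harmonic_on_diff open_ball harmonic_on_subset[OF r0(2) open_ball r(2)] harmonic_on_subset[OF harmonic_ln_F1 D r(3)])
  fix w assume w: "w : ball z0 r"
  show "Hd w = h0 w - ln (cmod (F1 w))"
  proof (cases "w = z0")
  case False
  have wD: "w : D" using w r(3) by auto
  have "real_of_ereal (G w) = ln (cmod (w - z0)) + h0 w" using r0(3) w r(2) False by auto
  moreover have "ln (cmod (F w)) = ln (cmod (w - z0)) + ln (cmod (F1 w))"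
  using F1_nonzero[OF wD] False by (simp add: F1(2)[of w] norm_mult ln_mult)
  ultimately show ?thesis using False by (simp add: Hd_def)
  qed (simp add: Hd_def)
  qed
  then show ?thesis using True r(1) by (intro exI[of _ "ball z0 r"]) auto
  next
  case False
  have o: "open (D - {z0})" using D by (rule open_delete)
  have "harmonic_on Hd (D - {z0})"
  proof (rule harmonic_on_cong[OF o])
  show "harmonic_on (%z. real_of_ereal (G z) - ln (cmod (F z))) (D - {z0})"
  using F_nz by (intro harmonic_on_diff o Gh harmonic_on_ln_holomorphic hol_subset[OF Fh]) auto
  qed (simp add: Hd_def)
  then show ?thesis using o z False by (intro exI[of _ "D - {z0}"]) auto
  qed
 qed
 have Hdle: "Hd z <= - ln (cmod (F z))" if "z : D" "z ~= z0" for z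
 proof -
  have "Hd z = real_of_ereal (G z) - ln (cmod (F z))" using that(2) by (simp add: Hd_def)
  then show ?thesis using Gneg[OF that] by linarith
 qed
 obtain s B where sB: "s > 0" "ball z0 s <= D" "ALL z:ball z0 s - {z0}. G z <= ereal (ln (cmod (F z)) + B)"
  by (rule pole_bound[OF Gs]) (rule that)
 have "open (F ` ball z0 s)"
  using open_mapping_thm3[OF hol_subset[OF Fh sB(2)] open_ball inj_on_subset[OF Finj sB(2)]] .
 moreover have "0 : F ` ball z0 s" using F0 sB(1) by force
 ultimately obtain dl where dl: "dl > 0" "ball 0 dl <= F ` ball z0 s" by (rule openE)
 have Hbd: "Hd z <= max (max B (Hd z0)) (- ln dl)" if z: "z : D" for z
 proof (cases "z : ball z0 s")
  case True
  show ?thesis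
  proof (cases "z = z0")
  case False
  then have le: "G z <= ereal (ln (cmod (F z)) + B)" using sB(3) True by auto
  obtain x where "G z = ereal x" using Gf[of z] z False by (cases "G z") auto
  then have "Hd z <= B" using le False by (simp add: Hd_def)
  then show ?thesis by simp
  qed simp
 next
  case False
  then have zz: "z ~= z0" using sB(1) by auto
  have "F z ~: ball 0 dl"
  proof
  assume "F z : ball 0 dl"
  then obtain y where y: "y : ball z0 s" "F z = F y" using dl(2) by blast
  then have "z = y" using inj_onD[OF Finj, of z y] z sB(2) by auto
  then show False using False y by simp
  qed
  then have "ln dl <= ln (cmod (F z))" using dl(1) by (subst ln_le_cancel_iff) auto
  then show ?thesis using Hdle[OF z zz] by simp
 qed
 \<comment> \<open>The closed disc of radius exp(-e) in the coordinate \<open>F\<close> is compact,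
   so it corresponds to values of \<open>f\<close> of modulus at most some number below 1. Past the
   midpoint between that number and 1, - log |F| is below e.\<close>
 have bdry: "EX rh<1. ALL w:ball 0 1 - P. rh <= cmod w --> Hd (g w) <= e" if e: "e > 0" for e
 proof -
  have sub: "cball 0 (exp (- e)) <= ball (0::complex) 1"
  proof
  fix x :: complex assume "x : cball 0 (exp (- e))"
  then have "cmod x <= exp (- e)" by simp
  also have "... < 1" using e by simp
  finally show "x : ball 0 1" by simp
  qed
  have "continuous_on (cball 0 (exp (- e))) (%w. cmod (ps w))"
  by (intro continuous_intros continuous_on_subset[OF hol_cont[OF psh] sub])
  then have "EX x:cball 0 (exp (- e)). ALL y:cball 0 (exp (- e)). cmod (ps y) <= cmod (ps x)"
  by (intro continuous_attains_sup) auto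
  then obtain x where x: "x : cball 0 (exp (- e))" "ALL y:cball 0 (exp (- e)). cmod (ps y) <= cmod (ps x)" by (elim bexE)
  have x1: "cmod (ps x) < 1" by (rule ps1) (use x(1) sub in auto)
  show ?thesis
  proof (intro exI[of _ "(1 + cmod (ps x)) / 2"] conjI ballI impI)
  show "(1 + cmod (ps x)) / 2 < 1" using x1 by simp
  fix w assume w: "w : ball 0 1 - P" "(1 + cmod (ps x)) / 2 <= cmod w"
  define z where "z = g w"
  have z: "z : D" "f z = w" using gf[OF w(1)] by (auto simp: z_def)
  have "F z ~: cball 0 (exp (- e))"
  proof
  assume "F z : cball 0 (exp (- e))"
  then have "cmod (ps (F z)) <= cmod (ps x)" using x(2) by blast
  then show False using w(2) x1 unfolding psF[OF z(1)] z(2) by simp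
  qed
  then have big: "exp (- e) < cmod (F z)" by simp
  then have "z ~= z0" using F0 exp_gt_zero[of "- e"] by (metis norm_zero order_less_asym)
  have "ln (exp (- e)) <= ln (cmod (F z))" using big exp_gt_zero[of "- e"] by (subst ln_le_cancel_iff) linarith+
  then show "Hd (g w) <= e" using Hdle[OF z(1) \<open>z \<noteq> z0\<close>] by (simp add: z_def)
  qed
 qed
 have Hh: "harmonic_on (%w. Hd (g w)) (ball 0 1 - P)"
  by (rule harmonic_on_compose[OF oOm[unfolded Om_def] D Hdh g]) (use gf in auto)
 have Hd0: "Hd z <= 0" if z: "z : D" for z
 proof -
  have "Hd (g (f z)) <= 0"
  by (rule harmonic_off_polar_nonpos[OF P Hh _ bdry]) (use gf Hbd fg[OF z] in auto)
  then show ?thesis using fg[OF z] by simp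
 qed
 have eq: "G z = lnE (cmod (F z))" if z: "z : D" "z ~= z0" for z
 proof (rule antisym)
  show "lnE (cmod (F z)) <= G z" by (rule Gm[OF neg_subharmonic_ln_F z(1)])
  obtain x where x: "G z = ereal x" using Gf[of z] z by (cases "G z") auto
  then have "x <= ln (cmod (F z))" using Hd0[OF z(1)] z(2) by (simp add: Hd_def)
  then show "G z <= lnE (cmod (F z))" using F_nz[OF z] by (simp add: x lnE_def)
 qed
 have "log_capacity D z0 = cmod (deriv F z0)" by (rule green_eq(2)[OF G eq])
 also have "... = cmod (deriv f z0) / cmod (1 - cnj a * a)" by (simp add: dFe norm_divide)
 also have "cmod (1 - cnj a * a) = 1 - (cmod a)\<^sup>2" unfolding na norm_of_real using \<open>(cmod a)\<^sup>2 < 1\<close> by simp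
 finally show "log_capacity D z0 = cmod (deriv f z0) / (1 - (cmod (f z0))\<^sup>2)" by (simp add: a_def)
qed

text \<open>The extremal form is the multiple c / K of K(.,z0); its norm c / sqrt K equals sqrt pi
  by \<open>i\<close>, and Cauchy-Schwarz against K(.,z0) shows that no competitor is
  smaller.\<close>

lemma minimal_form:
 assumes D: "open D" and z0: "z0 : D" and c: "log_capacity D z0 > 0" and i: "pi * bergman_kernel D z0 = (log_capacity D z0)\<^sup>2"
 shows "EX F. is_arg_min (L2_norm D) (admissible_form D z0) F & L2_norm D F = sqrt pi"
proof -
 define c K k where "c = log_capacity D z0" and "K = bergman_kernel D z0" and "k = brep D z0"
 have c0: "c > 0" and Kc: "pi * K = c\<^sup>2" using c i by (auto simp: c_def K_def)
 have K0: "K > 0"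
 proof -
  have "pi * K > 0" unfolding Kc using c0 by simp
  then show ?thesis by (simp add: zero_less_mult_iff)
 qed
 have k: "k : A2 D" unfolding k_def by (rule brep(1)[OF D z0])
 have kz: "k z0 = of_real K" unfolding k_def K_def by (rule bergman_kernel_rep(1)[OF D z0])
 have nk: "nsq D k = K" unfolding k_def K_def by (rule bergman_kernel_rep(2)[OF D z0, symmetric])
 define F where "F z = of_real (c / K) * k z" for z
 have F: "F : A2 D" unfolding F_def using k D by (intro A2_scale) auto
 have "nsq D F = (LINT z:D|lborel. (c / K)\<^sup>2 * (cmod (k z))\<^sup>2)"
  by (rule set_lebesgue_integral_cong) (use D in \<open>auto simp: F_def norm_mult norm_divide power_mult_distrib power_divide\<close>)
 also have "... = (c / K)\<^sup>2 * K" unfolding nk[symmetric] by (rule set_integral_mult_right)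
 also have "... = c\<^sup>2 / K" using K0 by (simp add: p2eq)
 also have "... = pi" using Kc K0 by (simp add: field_simps)
 finally have nF: "L2_norm D F = sqrt pi" by (simp add: L2_norm_def)
 have adm: "admissible_form D z0 F"
  unfolding admissible_form_def using F nF kz K0 by (simp add: F_def c_def)
 have "~ L2_norm D h < L2_norm D F" if h: "admissible_form D z0 h" for h
 proof -
  have hb: "h : A2 D" and hz: "h z0 = of_real c" using h by (auto simp: admissible_form_def c_def)
  have "(cmod (L2_inner D h k))\<^sup>2 <= nsq D h * nsq D k" by (rule Cauchy_Schwarz_L2[OF D hb k])
  moreover have "L2_inner D h k = of_real c" using brep(2)[OF D z0 hb] hz by (simp add: k_def)
  ultimately have "pi * K <= nsq D h * K" using Kc nk by simp
  then have "pi <= nsq D h" using K0 by simp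
  then show ?thesis unfolding nF by (simp add: L2_norm_def)
 qed
 then have "is_arg_min (L2_norm D) (admissible_form D z0) F" using adm by (auto simp: is_arg_min_def)
 then show ?thesis using nF by blast
qed

section \<open>The four conditions on a domain of curvature -2\<close>

context hyperbolic_kernel
begin

lemma log_capacity_deriv: "log_capacity D z0 = cmod (deriv f z0)"
 by (rule green_eq(2)[OF is_green_ln_f]) simp

lemma kernel_deriv: "bergman_kernel D z0 = (cmod (deriv f z0))\<^sup>2 / pi"
proof -
 have "{z\<in>D. cmod (f z) < 1} = D" using F_lt by auto
 then show ?thesis using sublevel_kernel[of 1] by simp
qed

text \<open>The sublevel set of Green's function is |f| < exp(Re ta), and its kernel carries the
  inverse area of the disc of that radius; hence the slope -2.\<close>

lemma log_kernel_sublevel_linear: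
 assumes ta: "Re ta <= 0"
 shows "log_kernel_sublevel D z0 ta = (-2) * Re ta + ln ((cmod (deriv f z0))\<^sup>2 / pi)"
proof -
 have "green D z0 z = lnE (cmod (f z))" if "z : D" for z using green_eq(1)[OF is_green_ln_f _ that] by simp
 then have "green_sublevel D z0 ta = {z\<in>D. cmod (f z) < exp (Re ta)}"
  by (auto simp: green_sublevel_def lnE_less)
 then have "bergman_kernel (green_sublevel D z0 ta) z0 = (cmod (deriv f z0))\<^sup>2 / (pi * (exp (Re ta))\<^sup>2)"
  using sublevel_kernel[of "exp (Re ta)"] ta by simp
 also have "... = exp ((-2) * Re ta) * ((cmod (deriv f z0))\<^sup>2 / pi)"
 proof -
  have "exp ((-2) * Re ta) * (exp (Re ta))\<^sup>2 = 1" by (simp add: p2eq mult_exp_exp)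
  then have E: "exp ((-2) * Re ta) = 1 / (exp (Re ta))\<^sup>2" by (simp add: eq_divide_eq)
  show ?thesis unfolding E by simp
 qed
 finally have "log_kernel_sublevel D z0 ta = ln (exp ((-2) * Re ta) * ((cmod (deriv f z0))\<^sup>2 / pi))"
  unfolding log_kernel_sublevel_def by (rule arg_cong)
 also have "... = ln (exp ((-2) * Re ta)) + ln ((cmod (deriv f z0))\<^sup>2 / pi)"
  by (rule ln_mult_pos) (use dF in simp_all)
 finally show ?thesis by (simp only: ln_exp)
qed

lemma biholomorphic_image: "biholomorphic_to_disc_less_polar D"
 unfolding biholomorphic_to_disc_less_polar_def
proof (intro exI[of _ "ball 0 1 - f ` D"] conjI complement_polar)
 show "closedin (top_of_set (ball 0 1)) (ball 0 1 - f ` D)"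
  using open_image fD by (intro closedin_diff closedin_subtopology_refl[THEN iffD2] open_subset) auto
 obtain g where g: "g holomorphic_on f ` D" "!!z. z : D ==> g (f z) = z" "!!w. w : f ` D ==> g w : D & f (g w) = w"
  by (rule inj_holomorphic_inverse[OF D(1) f f_inj]) (rule that)
 have "ball 0 1 - (ball 0 1 - f ` D) = f ` D" using fD by auto
 then show "biholomorphic D (ball 0 1 - (ball 0 1 - f ` D))"
  unfolding biholomorphic_def using f g by (intro exI[of _ f] exI[of _ g]) auto
qed

end

theorem theorem1p7:
  fixes D :: "complex set"
  assumes "open D" and "connected D" and "D \<noteq> {}"
    and "\<not> (\<exists>q\<in>frontier D.
            Limsup (at q within D) (\<lambda>z. ereal (bergman_kernel D z)) = \<infinity> \<and>
            Liminf (at q within D) (\<lambda>z. ereal (bergman_kernel D z)) < \<infinity>)"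
  shows "(bergman_metric_exists D \<and> (\<forall>z\<in>D. bergman_curvature D z = -2)) \<longleftrightarrow>
    (admits_green D \<and>
     (\<forall>z0\<in>D. pi * bergman_kernel D z0 = (log_capacity D z0)\<^sup>2) \<and>
     biholomorphic_to_disc_less_polar D \<and>
     (\<forall>z0\<in>D. \<exists>F. is_arg_min (L2_norm D) (admissible_form D z0) F \<and> L2_norm D F = sqrt pi) \<and>
     (\<forall>z0\<in>D.
        harmonic_on (log_kernel_sublevel D z0) {\<tau>. Re \<tau> < 0} \<and>
        (\<exists>C b. \<forall>\<tau>. Re \<tau> \<le> 0 \<longrightarrow> log_kernel_sublevel D z0 \<tau> = C * Re \<tau> + b)))"
    (is "?L \<longleftrightarrow> ?R")
proof
 assume L: ?L
 \<comment> \<open>A separate developing map for each base point; the conditions are then read off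
   at that point.\<close>
 have ex: "EX f. hyperbolic_kernel D z0 f" if z0: "z0 : D" for z0
 proof -
  obtain f where f: "f holomorphic_on D" "f ` D <= ball 0 1" "f z0 = 0" "~ (ALL z:D. f z = 0)"
  "!!z. z : D ==> brep D z0 z ~= 0"
  "!!z w. z : D ==> w : D ==> brep D w z * of_real (bergman_kernel D z0) * (1 - f z * cnj (f w))\<^sup>2
  = brep D z0 z * cnj (brep D z0 w)"
  by (rule curvature_developing_map[OF assms(1,2) conjunct1[OF L] conjunct2[OF L] z0]) (rule that)
  have "hyperbolic_kernel D z0 f" by unfold_locales (use assms(1,2) z0 f in auto)
  then show ?thesis by blast
 qed
 have all: "(EX G. is_green D z0 G) & pi * bergman_kernel D z0 = (log_capacity D z0)\<^sup>2 & biholomorphic_to_disc_less_polar D &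
  (EX F. is_arg_min (L2_norm D) (admissible_form D z0) F & L2_norm D F = sqrt pi) &
  harmonic_on (log_kernel_sublevel D z0) {ta. Re ta < 0} &
  (EX C b. ALL ta. Re ta <= 0 --> log_kernel_sublevel D z0 ta = C * Re ta + b)" if z0: "z0 : D" for z0
 proof -
  obtain f where "hyperbolic_kernel D z0 f" using ex[OF z0] by blast
  then interpret hyperbolic_kernel D z0 f .
  have i: "pi * bergman_kernel D z0 = (log_capacity D z0)\<^sup>2" by (simp add: log_capacity_deriv kernel_deriv)
  have c: "log_capacity D z0 > 0" using dF by (simp add: log_capacity_deriv)
  have o: "open {ta. Re ta < 0}" by (rule open_halfspace_Re_lt)
  have "harmonic_on (log_kernel_sublevel D z0) {ta. Re ta < 0}"
  proof (rule harmonic_on_cong[OF o])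
  show "harmonic_on (%ta. (-2) * Re ta + ln ((cmod (deriv f z0))\<^sup>2 / pi)) {ta. Re ta < 0}"
  by (intro harmonic_on_add harmonic_on_cmult harmonic_on_const harmonic_on_Re_holomorphic holomorphic_intros o)
  qed (simp add: log_kernel_sublevel_linear)
  then show ?thesis using is_green_ln_f i minimal_form[OF assms(1) z0 c i] biholomorphic_image log_kernel_sublevel_linear by blast
 qed
 obtain z1 where "z1 : D" using assms(3) by blast
 then show ?R using all unfolding admits_green_def by blast
next
 assume R: ?R
 then obtain P f g where P: "closedin (top_of_set (ball 0 1)) P" "polar P"
  and fg: "f holomorphic_on D" "g holomorphic_on ball 0 1 - P"
  "!!z. z : D ==> f z : ball 0 1 - P & g (f z) = z" "!!w. w : ball 0 1 - P ==> g w : D & f (g w) = w"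
  unfolding biholomorphic_to_disc_less_polar_def biholomorphic_def by blast
 \<comment> \<open>One map \<open>f\<close> serves all base points; the Moebius normalization that
   depends on the point is hidden in \<open>log_capacity_disc_less_polar\<close>.\<close>
 have cap: "log_capacity D z0 = cmod (deriv f z0) / (1 - (cmod (f z0))\<^sup>2)" "deriv f z0 ~= 0" if z0: "z0 : D" for z0
 proof -
  obtain G where G: "is_green D z0 G" using R z0 unfolding admits_green_def by blast
  show "log_capacity D z0 = cmod (deriv f z0) / (1 - (cmod (f z0))\<^sup>2)" "deriv f z0 ~= 0"
  using log_capacity_disc_less_polar[OF assms(1) z0 G P fg] by auto
 qed
 have "bergman_kernel D z = (cmod (deriv f z))\<^sup>2 / (pi * (1 - (cmod (f z))\<^sup>2)\<^sup>2)" if z: "z : D" for z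
 proof -
  have "pi * bergman_kernel D z = (log_capacity D z)\<^sup>2" using R z by blast
  then have "bergman_kernel D z = (log_capacity D z)\<^sup>2 / pi" by (simp add: field_simps)
  then show ?thesis by (simp add: cap[OF z] power_divide)
 qed
 then show ?L using curvature_of_disc_kernel[OF assms(1) fg(1) _ cap(2)] fg(3) by blast
qed

end
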